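(* Let $\mathcal{X}$ be an algebraic stack with a flat sheaf of (commutative) rings $\mathcal{A}$. Then the category $\mathfrak{Qcoh}(\mathcal{X})$ of quasi-coherent sheaves (of $\mathcal{A}$-modules) on $\mathcal{X}$ is a Grothendieck category. In particular it is locally presentable and has arbitrary products.
   Context: Let $\mathcal{C}$ be (a small skeleton of) the category of affine schemes smooth over $\mathcal{X}$; $\mathcal{A}$ is regarded as a presheaf of commutative rings on $\mathcal{C}$. The sheaf $\mathcal{A}$ is flat if for every morphism $U\to W$ in $\mathcal{C}$ the ring $\mathcal{A}(U)$ is a flat $\mathcal{A}(W)$-module. Quasi-coherent sheaves on $\mathcal{X}$ are understood (with respect to $\mathcal{A}$) as cartesian $\mathcal{A}$-modules on $\mathcal{C}$: contravariant functors $M$ assigning to each object $U$ of $\mathcal{C}$ an $\mathcal{A}(U)$-module $M(U)$ and to each morphism $U\to W$ an $\mathcal{A}(W)$-linear map $M(W)\to M(U)$ such that the induced map $\mathcal{A}(U)\otimes_{\mathcal{A}(W)}M(W)\to M(U)$ is an isomorphism of $\mathcal{A}(U)$-modules; morphisms are natural transformations that are $\mathcal{A}(U)$-linear at each $U$. A Grothendieck category is an abelian category with coproducts, exact direct limits and a generator. *)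

theory Defs
  imports "HOL-Algebra.Algebra"
begin

unbundle cardinal_syntax

section \<open>Size\<close>

text \<open>
  The type \<open>'u\<close> plays the part of a Grothendieck universe: its cardinality is strongly
  inaccessible, and a set (of any type) is small when its cardinality is strictly less.
  Rings and modules have small carriers inside \<open>'u\<close>; coproducts, products and colimits are
  indexed by small sets and small categories.  The type of all ZFC sets is the standard example of
  such a type in extensions of HOL by set theory.
\<close>

definition small :: "'u itself \<Rightarrow> 'b set \<Rightarrow> bool" where
  "small u B \<longleftrightarrow> |B| <o |UNIV :: 'u set|"

definition universe :: "'u itself \<Rightarrow> bool" where
  "universe u \<longleftrightarrow>
     natLeq <o |UNIV :: 'u set| \<and>
     regularCard |UNIV :: 'u set| \<and>
     (\<forall>B :: 'u set. small u B \<longrightarrow> small u (Pow B))"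


section \<open>Categories\<close>

record ('o, 'a) category =
  Ob  :: "'o set"
  Ar  :: "'a set"
  src :: "'a \<Rightarrow> 'o"
  tgt :: "'a \<Rightarrow> 'o"
  ide :: "'o \<Rightarrow> 'a"
  cmp :: "'a \<Rightarrow> 'a \<Rightarrow> 'a"  (infixr \<open>\<bullet>\<index>\<close> 70)

definition Hom :: "('o, 'a) category \<Rightarrow> 'o \<Rightarrow> 'o \<Rightarrow> 'a set" where
  "Hom C x y = {f \<in> Ar C. src C f = x \<and> tgt C f = y}"

definition category :: "('o, 'a) category \<Rightarrow> bool" where
  "category C \<longleftrightarrow>
     (\<forall>f \<in> Ar C. src C f \<in> Ob C \<and> tgt C f \<in> Ob C) \<and>
     (\<forall>x \<in> Ob C. ide C x \<in> Hom C x x) \<and>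
     (\<forall>f \<in> Ar C. \<forall>g \<in> Ar C. tgt C f = src C g \<longrightarrow> g \<bullet>\<^bsub>C\<^esub> f \<in> Hom C (src C f) (tgt C g)) \<and>
     (\<forall>f \<in> Ar C. f \<bullet>\<^bsub>C\<^esub> ide C (src C f) = f \<and> ide C (tgt C f) \<bullet>\<^bsub>C\<^esub> f = f) \<and>
     (\<forall>f \<in> Ar C. \<forall>g \<in> Ar C. \<forall>h \<in> Ar C. tgt C f = src C g \<and> tgt C g = src C h \<longrightarrow>
        h \<bullet>\<^bsub>C\<^esub> (g \<bullet>\<^bsub>C\<^esub> f) = (h \<bullet>\<^bsub>C\<^esub> g) \<bullet>\<^bsub>C\<^esub> f)"

definition locally_small :: "'u itself \<Rightarrow> ('o, 'a) category \<Rightarrow> bool" where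
  "locally_small u C \<longleftrightarrow> (\<forall>x \<in> Ob C. \<forall>y \<in> Ob C. small u (Hom C x y))"

definition full_subcategory :: "('o, 'a) category \<Rightarrow> 'o set \<Rightarrow> ('o, 'a) category" where
  "full_subcategory C S = C\<lparr>Ob := S, Ar := {f \<in> Ar C. src C f \<in> S \<and> tgt C f \<in> S}\<rparr>"

definition isomorphic :: "('o, 'a) category \<Rightarrow> 'o \<Rightarrow> 'o \<Rightarrow> bool" where
  "isomorphic C x y \<longleftrightarrow>
     (\<exists>f \<in> Hom C x y. \<exists>g \<in> Hom C y x. g \<bullet>\<^bsub>C\<^esub> f = ide C x \<and> f \<bullet>\<^bsub>C\<^esub> g = ide C y)"

definition small_skeleton :: "'u itself \<Rightarrow> ('o, 'a) category \<Rightarrow> ('o, 'a) category \<Rightarrow> bool" where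
  "small_skeleton u C D \<longleftrightarrow>
     (\<exists>S \<subseteq> Ob D. C = full_subcategory D S \<and> (\<forall>x \<in> Ob D. \<exists>!s. s \<in> S \<and> isomorphic D x s)) \<and>
     small u (Ob C) \<and> small u (Ar C)"

definition is_functor ::
  "('i, 'k) category \<Rightarrow> ('o, 'a) category \<Rightarrow> ('i \<Rightarrow> 'o) \<Rightarrow> ('k \<Rightarrow> 'a) \<Rightarrow> bool" where
  "is_functor J C F F' \<longleftrightarrow>
     (\<forall>i \<in> Ob J. F i \<in> Ob C \<and> F' (ide J i) = ide C (F i)) \<and>
     (\<forall>f \<in> Ar J. F' f \<in> Hom C (F (src J f)) (F (tgt J f))) \<and>
     (\<forall>f \<in> Ar J. \<forall>g \<in> Ar J. tgt J f = src J g \<longrightarrow> F' (g \<bullet>\<^bsub>J\<^esub> f) = F' g \<bullet>\<^bsub>C\<^esub> F' f)"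

definition natural_transf ::
  "('i, 'k) category \<Rightarrow> ('o, 'a) category \<Rightarrow> ('i \<Rightarrow> 'o) \<Rightarrow> ('k \<Rightarrow> 'a) \<Rightarrow> ('i \<Rightarrow> 'o) \<Rightarrow> ('k \<Rightarrow> 'a)
     \<Rightarrow> ('i \<Rightarrow> 'a) \<Rightarrow> bool" where
  "natural_transf J C F F' G G' \<alpha> \<longleftrightarrow>
     (\<forall>i \<in> Ob J. \<alpha> i \<in> Hom C (F i) (G i)) \<and>
     (\<forall>f \<in> Ar J. G' f \<bullet>\<^bsub>C\<^esub> \<alpha> (src J f) = \<alpha> (tgt J f) \<bullet>\<^bsub>C\<^esub> F' f)"

definition cocone ::
  "('i, 'k) category \<Rightarrow> ('o, 'a) category \<Rightarrow> ('i \<Rightarrow> 'o) \<Rightarrow> ('k \<Rightarrow> 'a) \<Rightarrow> 'o \<Rightarrow> ('i \<Rightarrow> 'a) \<Rightarrow> bool" where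
  "cocone J C F F' L \<iota> \<longleftrightarrow>
     L \<in> Ob C \<and> (\<forall>i \<in> Ob J. \<iota> i \<in> Hom C (F i) L) \<and>
     (\<forall>f \<in> Ar J. \<iota> (tgt J f) \<bullet>\<^bsub>C\<^esub> F' f = \<iota> (src J f))"

definition is_colimit ::
  "('i, 'k) category \<Rightarrow> ('o, 'a) category \<Rightarrow> ('i \<Rightarrow> 'o) \<Rightarrow> ('k \<Rightarrow> 'a) \<Rightarrow> 'o \<Rightarrow> ('i \<Rightarrow> 'a) \<Rightarrow> bool" where
  "is_colimit J C F F' L \<iota> \<longleftrightarrow>
     cocone J C F F' L \<iota> \<and>
     (\<forall>K \<kappa>. cocone J C F F' K \<kappa> \<longrightarrow>
        (\<exists>!u. u \<in> Hom C L K \<and> (\<forall>i \<in> Ob J. u \<bullet>\<^bsub>C\<^esub> \<iota> i = \<kappa> i)))"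

definition cocomplete :: "'u itself \<Rightarrow> ('o, 'a) category \<Rightarrow> bool" where
  "cocomplete u C \<longleftrightarrow>
     (\<forall>(J :: ('u, 'u) category) F F'.
        category J \<and> small u (Ob J) \<and> small u (Ar J) \<and> is_functor J C F F' \<longrightarrow>
        (\<exists>L \<iota>. is_colimit J C F F' L \<iota>))"

definition is_product ::
  "('o, 'a) category \<Rightarrow> 'i set \<Rightarrow> ('i \<Rightarrow> 'o) \<Rightarrow> 'o \<Rightarrow> ('i \<Rightarrow> 'a) \<Rightarrow> bool" where
  "is_product C I F P \<pi> \<longleftrightarrow>
     P \<in> Ob C \<and> (\<forall>i \<in> I. \<pi> i \<in> Hom C P (F i)) \<and>
     (\<forall>K \<in> Ob C. \<forall>\<kappa>. (\<forall>i \<in> I. \<kappa> i \<in> Hom C K (F i)) \<longrightarrow>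
        (\<exists>!u. u \<in> Hom C K P \<and> (\<forall>i \<in> I. \<pi> i \<bullet>\<^bsub>C\<^esub> u = \<kappa> i)))"

definition is_coproduct ::
  "('o, 'a) category \<Rightarrow> 'i set \<Rightarrow> ('i \<Rightarrow> 'o) \<Rightarrow> 'o \<Rightarrow> ('i \<Rightarrow> 'a) \<Rightarrow> bool" where
  "is_coproduct C I F P \<iota> \<longleftrightarrow>
     P \<in> Ob C \<and> (\<forall>i \<in> I. \<iota> i \<in> Hom C (F i) P) \<and>
     (\<forall>K \<in> Ob C. \<forall>\<kappa>. (\<forall>i \<in> I. \<kappa> i \<in> Hom C (F i) K) \<longrightarrow>
        (\<exists>!u. u \<in> Hom C P K \<and> (\<forall>i \<in> I. u \<bullet>\<^bsub>C\<^esub> \<iota> i = \<kappa> i)))"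

definition has_products :: "'u itself \<Rightarrow> ('o, 'a) category \<Rightarrow> bool" where
  "has_products u C \<longleftrightarrow>
     (\<forall>(I :: 'u set) F. small u I \<and> F ` I \<subseteq> Ob C \<longrightarrow> (\<exists>P \<pi>. is_product C I F P \<pi>))"

definition has_coproducts :: "'u itself \<Rightarrow> ('o, 'a) category \<Rightarrow> bool" where
  "has_coproducts u C \<longleftrightarrow>
     (\<forall>(I :: 'u set) F. small u I \<and> F ` I \<subseteq> Ob C \<longrightarrow> (\<exists>P \<iota>. is_coproduct C I F P \<iota>))"

text \<open>A partial order \<open>r\<close> on \<open>I\<close> as a category: the pair \<open>(i, j) \<in> r\<close> is the arrow from \<open>i\<close> to \<open>j\<close>.\<close>

definition poset_category :: "'i set \<Rightarrow> 'i rel \<Rightarrow> ('i, 'i \<times> 'i) category" where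
  "poset_category I r =
     \<lparr>Ob = I, Ar = r, src = fst, tgt = snd, ide = (\<lambda>i. (i, i)), cmp = (\<lambda>g f. (fst f, snd g))\<rparr>"

definition directed_poset :: "'i set \<Rightarrow> 'i rel \<Rightarrow> bool" where
  "directed_poset I r \<longleftrightarrow>
     partial_order_on I r \<and> (\<forall>K \<subseteq> I. finite K \<longrightarrow> (\<exists>u \<in> I. \<forall>k \<in> K. (k, u) \<in> r))"

definition card_directed_poset :: "'k rel \<Rightarrow> 'i set \<Rightarrow> 'i rel \<Rightarrow> bool" where
  "card_directed_poset l I r \<longleftrightarrow>
     partial_order_on I r \<and> (\<forall>K \<subseteq> I. |K| <o l \<longrightarrow> (\<exists>u \<in> I. \<forall>k \<in> K. (k, u) \<in> r))"


section \<open>Abelian, Grothendieck and locally presentable categories\<close>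

definition zero_object :: "('o, 'a) category \<Rightarrow> 'o \<Rightarrow> bool" where
  "zero_object C z \<longleftrightarrow>
     z \<in> Ob C \<and> (\<forall>x \<in> Ob C. (\<exists>!f. f \<in> Hom C x z) \<and> (\<exists>!f. f \<in> Hom C z x))"

definition zero_arrow :: "('o, 'a) category \<Rightarrow> 'a \<Rightarrow> bool" where
  "zero_arrow C f \<longleftrightarrow>
     (\<exists>z. zero_object C z \<and> (\<exists>g \<in> Hom C (src C f) z. \<exists>h \<in> Hom C z (tgt C f). f = h \<bullet>\<^bsub>C\<^esub> g))"

definition monic :: "('o, 'a) category \<Rightarrow> 'a \<Rightarrow> bool" where
  "monic C f \<longleftrightarrow> f \<in> Ar C \<and>
     (\<forall>g \<in> Ar C. \<forall>h \<in> Ar C. src C g = src C h \<and> tgt C g = src C f \<and> tgt C h = src C f \<and>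
        f \<bullet>\<^bsub>C\<^esub> g = f \<bullet>\<^bsub>C\<^esub> h \<longrightarrow> g = h)"

definition epic :: "('o, 'a) category \<Rightarrow> 'a \<Rightarrow> bool" where
  "epic C f \<longleftrightarrow> f \<in> Ar C \<and>
     (\<forall>g \<in> Ar C. \<forall>h \<in> Ar C. tgt C g = tgt C h \<and> src C g = tgt C f \<and> src C h = tgt C f \<and>
        g \<bullet>\<^bsub>C\<^esub> f = h \<bullet>\<^bsub>C\<^esub> f \<longrightarrow> g = h)"

definition is_kernel :: "('o, 'a) category \<Rightarrow> 'a \<Rightarrow> 'a \<Rightarrow> bool" where
  "is_kernel C f k \<longleftrightarrow>
     f \<in> Ar C \<and> k \<in> Ar C \<and> tgt C k = src C f \<and> zero_arrow C (f \<bullet>\<^bsub>C\<^esub> k) \<and>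
     (\<forall>h \<in> Ar C. tgt C h = src C f \<and> zero_arrow C (f \<bullet>\<^bsub>C\<^esub> h) \<longrightarrow>
        (\<exists>!u. u \<in> Hom C (src C h) (src C k) \<and> k \<bullet>\<^bsub>C\<^esub> u = h))"

definition is_cokernel :: "('o, 'a) category \<Rightarrow> 'a \<Rightarrow> 'a \<Rightarrow> bool" where
  "is_cokernel C f c \<longleftrightarrow>
     f \<in> Ar C \<and> c \<in> Ar C \<and> src C c = tgt C f \<and> zero_arrow C (c \<bullet>\<^bsub>C\<^esub> f) \<and>
     (\<forall>h \<in> Ar C. src C h = tgt C f \<and> zero_arrow C (h \<bullet>\<^bsub>C\<^esub> f) \<longrightarrow>
        (\<exists>!u. u \<in> Hom C (tgt C c) (tgt C h) \<and> u \<bullet>\<^bsub>C\<^esub> c = h))"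

definition preadditive :: "('o, 'a) category \<Rightarrow> bool" where
  "preadditive C \<longleftrightarrow>
     (\<exists>(plus :: 'a \<Rightarrow> 'a \<Rightarrow> 'a) zero.
        (\<forall>x \<in> Ob C. \<forall>y \<in> Ob C.
           comm_group \<lparr>carrier = Hom C x y, monoid.mult = plus, one = zero x y\<rparr>) \<and>
        (\<forall>x \<in> Ob C. \<forall>y \<in> Ob C. \<forall>z \<in> Ob C.
           \<forall>f \<in> Hom C x y. \<forall>f' \<in> Hom C x y. \<forall>g \<in> Hom C y z. \<forall>g' \<in> Hom C y z.
             g \<bullet>\<^bsub>C\<^esub> plus f f' = plus (g \<bullet>\<^bsub>C\<^esub> f) (g \<bullet>\<^bsub>C\<^esub> f') \<and>
             plus g g' \<bullet>\<^bsub>C\<^esub> f = plus (g \<bullet>\<^bsub>C\<^esub> f) (g' \<bullet>\<^bsub>C\<^esub> f)))"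

definition abelian_category :: "('o, 'a) category \<Rightarrow> bool" where
  "abelian_category C \<longleftrightarrow>
     category C \<and> preadditive C \<and>
     (\<exists>z. zero_object C z) \<and>
     (\<forall>F. F ` (UNIV :: bool set) \<subseteq> Ob C \<longrightarrow>
        (\<exists>P \<pi>. is_product C UNIV F P \<pi>) \<and> (\<exists>P \<iota>. is_coproduct C UNIV F P \<iota>)) \<and>
     (\<forall>f \<in> Ar C. (\<exists>k. is_kernel C f k) \<and> (\<exists>c. is_cokernel C f c)) \<and>
     (\<forall>f. monic C f \<longrightarrow> (\<exists>g. is_kernel C g f)) \<and>
     (\<forall>f. epic C f \<longrightarrow> (\<exists>g. is_cokernel C g f))"

definition short_exact :: "('o, 'a) category \<Rightarrow> 'a \<Rightarrow> 'a \<Rightarrow> bool" where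
  "short_exact C f g \<longleftrightarrow> is_kernel C g f \<and> is_cokernel C f g"

definition has_exact_direct_limits :: "'u itself \<Rightarrow> ('o, 'a) category \<Rightarrow> bool" where
  "has_exact_direct_limits u C \<longleftrightarrow>
     (\<forall>(I :: 'u set) r. small u I \<and> directed_poset I r \<longrightarrow>
        (let J = poset_category I r in
          (\<forall>F F'. is_functor J C F F' \<longrightarrow> (\<exists>L \<iota>. is_colimit J C F F' L \<iota>)) \<and>
          (\<forall>F F' G G' H H' \<alpha> \<beta> L \<iota> M \<mu> N \<nu> a b.
             is_functor J C F F' \<and> is_functor J C G G' \<and> is_functor J C H H' \<and>
             natural_transf J C F F' G G' \<alpha> \<and> natural_transf J C G G' H H' \<beta> \<and>
             (\<forall>i \<in> I. short_exact C (\<alpha> i) (\<beta> i)) \<and>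
             is_colimit J C F F' L \<iota> \<and> is_colimit J C G G' M \<mu> \<and> is_colimit J C H H' N \<nu> \<and>
             a \<in> Hom C L M \<and> (\<forall>i \<in> I. a \<bullet>\<^bsub>C\<^esub> \<iota> i = \<mu> i \<bullet>\<^bsub>C\<^esub> \<alpha> i) \<and>
             b \<in> Hom C M N \<and> (\<forall>i \<in> I. b \<bullet>\<^bsub>C\<^esub> \<mu> i = \<nu> i \<bullet>\<^bsub>C\<^esub> \<beta> i) \<longrightarrow>
             short_exact C a b)))"

definition generator :: "('o, 'a) category \<Rightarrow> 'o \<Rightarrow> bool" where
  "generator C G \<longleftrightarrow>
     G \<in> Ob C \<and>
     (\<forall>f \<in> Ar C. \<forall>g \<in> Ar C. src C f = src C g \<and> tgt C f = tgt C g \<and> f \<noteq> g \<longrightarrow>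
        (\<exists>h \<in> Hom C G (src C f). f \<bullet>\<^bsub>C\<^esub> h \<noteq> g \<bullet>\<^bsub>C\<^esub> h))"

definition grothendieck_category :: "'u itself \<Rightarrow> ('o, 'a) category \<Rightarrow> bool" where
  "grothendieck_category u C \<longleftrightarrow>
     abelian_category C \<and> locally_small u C \<and>
     has_coproducts u C \<and> has_exact_direct_limits u C \<and> (\<exists>G. generator C G)"

text \<open>
  \<open>Hom(K, -)\<close> preserves small \<open>\<lambda>\<close>-directed colimits; the two clauses say that the canonical map
  from the colimit of the sets \<open>Hom(K, F i)\<close> to \<open>Hom(K, colim F)\<close> is surjective and injective.
\<close>

definition presentable_object :: "'u itself \<Rightarrow> 'u rel \<Rightarrow> ('o, 'a) category \<Rightarrow> 'o \<Rightarrow> bool" where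
  "presentable_object u l C K \<longleftrightarrow>
     K \<in> Ob C \<and>
     (\<forall>(I :: 'u set) r F F' L \<iota>.
        small u I \<and> card_directed_poset l I r \<and> is_functor (poset_category I r) C F F' \<and>
        is_colimit (poset_category I r) C F F' L \<iota> \<longrightarrow>
        (\<forall>f \<in> Hom C K L. \<exists>i \<in> I. \<exists>g \<in> Hom C K (F i). f = \<iota> i \<bullet>\<^bsub>C\<^esub> g) \<and>
        (\<forall>i \<in> I. \<forall>g \<in> Hom C K (F i). \<forall>j \<in> I. \<forall>h \<in> Hom C K (F j).
           \<iota> i \<bullet>\<^bsub>C\<^esub> g = \<iota> j \<bullet>\<^bsub>C\<^esub> h \<longrightarrow>
           (\<exists>k \<in> I. (i, k) \<in> r \<and> (j, k) \<in> r \<and> F' (i, k) \<bullet>\<^bsub>C\<^esub> g = F' (j, k) \<bullet>\<^bsub>C\<^esub> h)))"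

definition locally_presentable :: "'u itself \<Rightarrow> ('o, 'a) category \<Rightarrow> bool" where
  "locally_presentable u C \<longleftrightarrow>
     category C \<and> locally_small u C \<and> cocomplete u C \<and>
     (\<exists>l :: 'u rel. Cinfinite l \<and> regularCard l \<and> l <o |UNIV :: 'u set| \<and>
        (\<exists>S \<subseteq> Ob C. small u S \<and> (\<forall>K \<in> S. presentable_object u l C K) \<and>
           (\<forall>x \<in> Ob C. \<exists>(I :: 'u set) r F F' \<iota>.
              small u I \<and> card_directed_poset l I r \<and> F ` I \<subseteq> S \<and>
              is_functor (poset_category I r) C F F' \<and>
              is_colimit (poset_category I r) C F F' x \<iota>)))"


section \<open>Commutative algebra\<close>

definition small_cring :: "'u ring \<Rightarrow> bool" where
  "small_cring R \<longleftrightarrow> cring R \<and> small TYPE('u) (carrier R)"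

text \<open>
  Ring homomorphisms are taken extensional on the carrier, so that equality of homomorphisms is
  equality of functions.  The category of affine schemes is the opposite of the category of small
  commutative rings; a homomorphism \<open>R \<rightarrow> S\<close> is a morphism \<open>Spec S \<rightarrow> Spec R\<close>.
\<close>

definition rhom :: "'u ring \<Rightarrow> 'u ring \<Rightarrow> ('u \<Rightarrow> 'u) set" where
  "rhom R S = ring_hom R S \<inter> extensional (carrier R)"

definition rid :: "'u ring \<Rightarrow> 'u \<Rightarrow> 'u" where
  "rid R = restrict id (carrier R)"

definition rcomp :: "'u ring \<Rightarrow> ('u \<Rightarrow> 'u) \<Rightarrow> ('u \<Rightarrow> 'u) \<Rightarrow> 'u \<Rightarrow> 'u" where
  "rcomp R \<psi> \<phi> = compose (carrier R) \<psi> \<phi>"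

text \<open>\<open>P\<close> is the polynomial ring over \<open>R\<close> in the variables \<open>xs\<close>, given by its universal property.\<close>

definition polynomial_ring :: "'u ring \<Rightarrow> 'u ring \<Rightarrow> ('u \<Rightarrow> 'u) \<Rightarrow> 'u list \<Rightarrow> bool" where
  "polynomial_ring R P \<iota> xs \<longleftrightarrow>
     small_cring P \<and> \<iota> \<in> rhom R P \<and> set xs \<subseteq> carrier P \<and>
     (\<forall>T \<rho> ts. small_cring T \<and> \<rho> \<in> rhom R T \<and> set ts \<subseteq> carrier T \<and> length ts = length xs \<longrightarrow>
        (\<exists>!\<tau>. \<tau> \<in> rhom P T \<and> rcomp R \<tau> \<iota> = \<rho> \<and> map \<tau> xs = ts))"

definition finitely_presented :: "'u ring \<Rightarrow> 'u ring \<Rightarrow> ('u \<Rightarrow> 'u) \<Rightarrow> bool" where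
  "finitely_presented R S \<phi> \<longleftrightarrow>
     (\<exists>P \<iota> xs \<pi> F. polynomial_ring R P \<iota> xs \<and> \<pi> \<in> rhom P S \<and> \<pi> ` carrier P = carrier S \<and>
        rcomp R \<pi> \<iota> = \<phi> \<and> finite F \<and> F \<subseteq> carrier P \<and> a_kernel P S \<pi> = genideal P F)"

text \<open>\<open>\<pi> : T \<rightarrow> T'\<close> is, up to isomorphism, the quotient by an ideal of square zero.\<close>

definition square_zero_extension :: "'u ring \<Rightarrow> 'u ring \<Rightarrow> ('u \<Rightarrow> 'u) \<Rightarrow> bool" where
  "square_zero_extension T T' \<pi> \<longleftrightarrow>
     small_cring T \<and> small_cring T' \<and> \<pi> \<in> rhom T T' \<and> \<pi> ` carrier T = carrier T' \<and>
     (\<forall>a \<in> a_kernel T T' \<pi>. \<forall>b \<in> a_kernel T T' \<pi>. a \<otimes>\<^bsub>T\<^esub> b = \<zero>\<^bsub>T\<^esub>)"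

definition lifts ::
  "'u ring \<Rightarrow> 'u ring \<Rightarrow> ('u \<Rightarrow> 'u) \<Rightarrow> 'u ring \<Rightarrow> ('u \<Rightarrow> 'u) \<Rightarrow> ('u \<Rightarrow> 'u) \<Rightarrow> ('u \<Rightarrow> 'u) \<Rightarrow> ('u \<Rightarrow> 'u) set" where
  "lifts R S \<phi> T \<pi> \<rho> \<sigma> = {\<tau> \<in> rhom S T. rcomp R \<tau> \<phi> = \<rho> \<and> rcomp S \<pi> \<tau> = \<sigma>}"

definition formally_smooth :: "'u ring \<Rightarrow> 'u ring \<Rightarrow> ('u \<Rightarrow> 'u) \<Rightarrow> bool" where
  "formally_smooth R S \<phi> \<longleftrightarrow>
     (\<forall>T T' \<pi>. square_zero_extension T T' \<pi> \<longrightarrow>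
        (\<forall>\<rho> \<in> rhom R T. \<forall>\<sigma> \<in> rhom S T'. rcomp R \<pi> \<rho> = rcomp R \<sigma> \<phi> \<longrightarrow>
           (\<exists>\<tau>. \<tau> \<in> lifts R S \<phi> T \<pi> \<rho> \<sigma>)))"

definition formally_etale :: "'u ring \<Rightarrow> 'u ring \<Rightarrow> ('u \<Rightarrow> 'u) \<Rightarrow> bool" where
  "formally_etale R S \<phi> \<longleftrightarrow>
     (\<forall>T T' \<pi>. square_zero_extension T T' \<pi> \<longrightarrow>
        (\<forall>\<rho> \<in> rhom R T. \<forall>\<sigma> \<in> rhom S T'. rcomp R \<pi> \<rho> = rcomp R \<sigma> \<phi> \<longrightarrow>
           (\<exists>!\<tau>. \<tau> \<in> lifts R S \<phi> T \<pi> \<rho> \<sigma>)))"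

definition smooth_hom :: "'u ring \<Rightarrow> 'u ring \<Rightarrow> ('u \<Rightarrow> 'u) \<Rightarrow> bool" where
  "smooth_hom R S \<phi> \<longleftrightarrow>
     small_cring R \<and> small_cring S \<and> \<phi> \<in> rhom R S \<and> finitely_presented R S \<phi> \<and> formally_smooth R S \<phi>"

definition etale_hom :: "'u ring \<Rightarrow> 'u ring \<Rightarrow> ('u \<Rightarrow> 'u) \<Rightarrow> bool" where
  "etale_hom R S \<phi> \<longleftrightarrow>
     small_cring R \<and> small_cring S \<and> \<phi> \<in> rhom R S \<and> finitely_presented R S \<phi> \<and> formally_etale R S \<phi>"

definition localization_at :: "'u ring \<Rightarrow> 'u \<Rightarrow> 'u ring \<Rightarrow> ('u \<Rightarrow> 'u) \<Rightarrow> bool" where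
  "localization_at R f S \<phi> \<longleftrightarrow>
     f \<in> carrier R \<and> small_cring S \<and> \<phi> \<in> rhom R S \<and> \<phi> f \<in> Units S \<and>
     (\<forall>T. small_cring T \<longrightarrow> (\<forall>\<rho> \<in> rhom R T. \<rho> f \<in> Units T \<longrightarrow>
        (\<exists>!\<tau>. \<tau> \<in> rhom S T \<and> rcomp R \<tau> \<phi> = \<rho>)))"

text \<open>A family of affine schemes over \<open>Spec R\<close> is a set of pairs \<open>(S, \<phi>)\<close> with \<open>\<phi> : R \<rightarrow> S\<close>.\<close>

definition jointly_surjective :: "'u ring \<Rightarrow> ('u ring \<times> ('u \<Rightarrow> 'u)) set \<Rightarrow> bool" where
  "jointly_surjective R \<Phi> \<longleftrightarrow>
     (\<forall>p. primeideal p R \<longrightarrow>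
        (\<exists>(S, \<phi>) \<in> \<Phi>. \<exists>q. primeideal q S \<and> p = {r \<in> carrier R. \<phi> r \<in> q}))"

definition etale_cover :: "'u ring \<Rightarrow> ('u ring \<times> ('u \<Rightarrow> 'u)) set \<Rightarrow> bool" where
  "etale_cover R \<Phi> \<longleftrightarrow>
     finite \<Phi> \<and> (\<forall>(S, \<phi>) \<in> \<Phi>. etale_hom R S \<phi>) \<and> jointly_surjective R \<Phi>"

definition zariski_cover :: "'u ring \<Rightarrow> ('u ring \<times> ('u \<Rightarrow> 'u)) set \<Rightarrow> bool" where
  "zariski_cover R \<Phi> \<longleftrightarrow>
     finite \<Phi> \<and> (\<forall>(S, \<phi>) \<in> \<Phi>. \<exists>f. localization_at R f S \<phi>) \<and> jointly_surjective R \<Phi>"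


section \<open>Modules and tensor products\<close>

definition linear_maps :: "'r ring \<Rightarrow> ('r, 'm) module \<Rightarrow> ('r, 'n) module \<Rightarrow> ('m \<Rightarrow> 'n) set" where
  "linear_maps R M N =
     {f \<in> carrier M \<rightarrow> carrier N.
        (\<forall>x \<in> carrier M. \<forall>y \<in> carrier M. f (x \<oplus>\<^bsub>M\<^esub> y) = f x \<oplus>\<^bsub>N\<^esub> f y) \<and>
        (\<forall>a \<in> carrier R. \<forall>x \<in> carrier M. f (a \<odot>\<^bsub>M\<^esub> x) = a \<odot>\<^bsub>N\<^esub> f x)}"

definition restrict_scalars :: "('r \<Rightarrow> 'b) \<Rightarrow> 'b ring \<Rightarrow> ('r, 'b) module" where
  "restrict_scalars \<phi> B =
     \<lparr>carrier = carrier B, monoid.mult = monoid.mult B, one = \<one>\<^bsub>B\<^esub>, ring.zero = \<zero>\<^bsub>B\<^esub>, ring.add = ring.add B,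
      smult = (\<lambda>r b. \<phi> r \<otimes>\<^bsub>B\<^esub> b)\<rparr>"

definition tensor_relators ::
  "'r ring \<Rightarrow> ('r, 'm) module \<Rightarrow> ('r, 'n) module \<Rightarrow> ('m \<times> 'n \<Rightarrow>\<^sub>0 int) set" where
  "tensor_relators R M N =
     {frag_of (x \<oplus>\<^bsub>M\<^esub> x', y) - frag_of (x, y) - frag_of (x', y) |x x' y.
        x \<in> carrier M \<and> x' \<in> carrier M \<and> y \<in> carrier N} \<union>
     {frag_of (x, y \<oplus>\<^bsub>N\<^esub> y') - frag_of (x, y) - frag_of (x, y') |x y y'.
        x \<in> carrier M \<and> y \<in> carrier N \<and> y' \<in> carrier N} \<union>
     {frag_of (a \<odot>\<^bsub>M\<^esub> x, y) - frag_of (x, a \<odot>\<^bsub>N\<^esub> y) |a x y.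
        a \<in> carrier R \<and> x \<in> carrier M \<and> y \<in> carrier N}"

definition tensor_kernel ::
  "'r ring \<Rightarrow> ('r, 'm) module \<Rightarrow> ('r, 'n) module \<Rightarrow> ('m \<times> 'n \<Rightarrow>\<^sub>0 int) set" where
  "tensor_kernel R M N =
     generate (free_Abelian_group (carrier M \<times> carrier N)) (tensor_relators R M N)"

text \<open>
  The abelian group \<open>M \<otimes>\<^sub>R N\<close>.  It is a record of type \<open>ring\<close> only in order to be written
  additively: the fields \<open>mult\<close> and \<open>one\<close> carry no meaning, as in the library's type of modules.
\<close>

definition tensor ::
  "'r ring \<Rightarrow> ('r, 'm) module \<Rightarrow> ('r, 'n) module \<Rightarrow> ('m \<times> 'n \<Rightarrow>\<^sub>0 int) set ring" where
  "tensor R M N =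
     (let Q = free_Abelian_group (carrier M \<times> carrier N) Mod tensor_kernel R M N
      in \<lparr>carrier = carrier Q, monoid.mult = undefined, one = undefined,
          ring.zero = \<one>\<^bsub>Q\<^esub>, ring.add = monoid.mult Q\<rparr>)"

definition pure_tensor ::
  "'r ring \<Rightarrow> ('r, 'm) module \<Rightarrow> ('r, 'n) module \<Rightarrow> 'm \<Rightarrow> 'n \<Rightarrow> ('m \<times> 'n \<Rightarrow>\<^sub>0 int) set" where
  "pure_tensor R M N x y =
     tensor_kernel R M N #>\<^bsub>free_Abelian_group (carrier M \<times> carrier N)\<^esub> frag_of (x, y)"

text \<open>
  The additive map on a tensor product which sends the pure tensor of \<open>x\<close> and \<open>y\<close> to \<open>\<beta> (x, y)\<close>.
  If \<open>\<beta>\<close> is biadditive and balanced, all elements of a coset have the same image.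
\<close>

definition tensor_lift ::
  "('p, 'z) ring_scheme \<Rightarrow> ('m \<times> 'n \<Rightarrow> 'p) \<Rightarrow> ('m \<times> 'n \<Rightarrow>\<^sub>0 int) set \<Rightarrow> 'p" where
  "tensor_lift P \<beta> t =
     the_elem ((\<lambda>c. \<Oplus>\<^bsub>P\<^esub> k \<in> Poly_Mapping.keys c. [Poly_Mapping.lookup c k] \<cdot>\<^bsub>P\<^esub> \<beta> k) ` t)"

definition flat_module :: "'u ring \<Rightarrow> ('u, 'u) module \<Rightarrow> bool" where
  "flat_module R M \<longleftrightarrow>
     module R M \<and>
     (\<forall>(N :: ('u, 'u) module) (N' :: ('u, 'u) module).
        module R N \<and> module R N' \<and> small TYPE('u) (carrier N) \<and> small TYPE('u) (carrier N') \<longrightarrow>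
        (\<forall>f \<in> linear_maps R N N'. inj_on f (carrier N) \<longrightarrow>
           inj_on (tensor_lift (tensor R M N') (\<lambda>(x, y). pure_tensor R M N' x (f y)))
                  (carrier (tensor R M N))))"

definition base_change ::
  "'u ring \<Rightarrow> 'u ring \<Rightarrow> ('u \<Rightarrow> 'u) \<Rightarrow> ('u, 'u) module \<Rightarrow> ('u, ('u \<times> 'u \<Rightarrow>\<^sub>0 int) set) module" where
  "base_change R B \<phi> M =
     (let B' = restrict_scalars \<phi> B; T = tensor R B' M
      in \<lparr>carrier = carrier T, monoid.mult = undefined, one = undefined,
          ring.zero = \<zero>\<^bsub>T\<^esub>, ring.add = ring.add T,
          smult = (\<lambda>b. tensor_lift T (\<lambda>(b', x). pure_tensor R B' M (b \<otimes>\<^bsub>B\<^esub> b') x))\<rparr>)"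


section \<open>Presheaves of rings and categories fibred over affine schemes\<close>

record ('o, 'a, 'u) presheaf =
  sec :: "'o \<Rightarrow> 'u ring"
  res :: "'a \<Rightarrow> 'u \<Rightarrow> 'u"

definition ring_presheaf :: "('o, 'a) category \<Rightarrow> ('o, 'a, 'u) presheaf \<Rightarrow> bool" where
  "ring_presheaf C A \<longleftrightarrow>
     (\<forall>x \<in> Ob C. small_cring (sec A x) \<and> res A (ide C x) = rid (sec A x)) \<and>
     (\<forall>f \<in> Ar C. res A f \<in> rhom (sec A (tgt C f)) (sec A (src C f))) \<and>
     (\<forall>f \<in> Ar C. \<forall>g \<in> Ar C. tgt C f = src C g \<longrightarrow>
        res A (g \<bullet>\<^bsub>C\<^esub> f) = rcomp (sec A (tgt C g)) (res A f) (res A g))"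

text \<open>
  A category over the category of affine schemes is a category \<open>\<E>\<close> with a presheaf of rings \<open>\<O>\<close>:
  the object \<open>x\<close> lies over \<open>Spec (sec \<O> x)\<close> and the arrow \<open>a\<close> over the morphism given by \<open>res \<O> a\<close>.
  If \<open>\<E>\<close> is fibred in groupoids, the 2-Yoneda lemma identifies objects over \<open>Spec R\<close> with morphisms
  \<open>Spec R \<rightarrow> \<E>\<close>, so that \<open>\<E>\<close> is also the category of affine schemes over the stack \<open>\<E>\<close>.
\<close>

definition fibred_in_groupoids :: "('o, 'a) category \<Rightarrow> ('o, 'a, 'u) presheaf \<Rightarrow> bool" where
  "fibred_in_groupoids \<E> \<O> \<longleftrightarrow>
     category \<E> \<and> ring_presheaf \<E> \<O> \<and>
     (\<forall>x \<in> Ob \<E>. \<forall>R. small_cring R \<longrightarrow> (\<forall>\<phi> \<in> rhom (sec \<O> x) R.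
        \<exists>y \<in> Ob \<E>. sec \<O> y = R \<and> (\<exists>a \<in> Hom \<E> y x. res \<O> a = \<phi>))) \<and>
     (\<forall>x \<in> Ob \<E>. \<forall>y \<in> Ob \<E>. \<forall>z \<in> Ob \<E>. \<forall>a \<in> Hom \<E> y x. \<forall>b \<in> Hom \<E> z x.
        \<forall>\<chi> \<in> rhom (sec \<O> y) (sec \<O> z). rcomp (sec \<O> x) \<chi> (res \<O> a) = res \<O> b \<longrightarrow>
          (\<exists>!c. c \<in> Hom \<E> z y \<and> res \<O> c = \<chi> \<and> a \<bullet>\<^bsub>\<E>\<^esub> c = b))"

text \<open>
  The morphisms \<open>Spec T \<rightarrow> Spec R\<close> which factor through a member of the family \<open>\<Phi>\<close>, and the full
  subcategory of affine schemes over \<open>Spec R\<close> on a set of such morphisms.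
\<close>

definition sieve :: "'u ring \<Rightarrow> ('u ring \<times> ('u \<Rightarrow> 'u)) set \<Rightarrow> ('u ring \<times> ('u \<Rightarrow> 'u)) set" where
  "sieve R \<Phi> =
     {(T, \<phi>). small_cring T \<and> \<phi> \<in> rhom R T \<and> (\<exists>(S, s) \<in> \<Phi>. \<exists>\<psi> \<in> rhom S T. \<phi> = rcomp R \<psi> s)}"

definition affine_slice ::
  "'u ring \<Rightarrow> ('u ring \<times> ('u \<Rightarrow> 'u)) set \<Rightarrow>
     ('u ring \<times> ('u \<Rightarrow> 'u),
      ('u ring \<times> ('u \<Rightarrow> 'u)) \<times> ('u \<Rightarrow> 'u) \<times> ('u ring \<times> ('u \<Rightarrow> 'u))) category" where
  "affine_slice R \<S> =
     \<lparr>Ob = \<S>,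
      Ar = {(t, \<chi>, t'). t \<in> \<S> \<and> t' \<in> \<S> \<and> \<chi> \<in> rhom (fst t') (fst t) \<and>
                        rcomp R \<chi> (snd t') = snd t},
      src = (\<lambda>(t, \<chi>, t'). t),
      tgt = (\<lambda>(t, \<chi>, t'). t'),
      ide = (\<lambda>t. (t, rid (fst t), t)),
      cmp = (\<lambda>(t', \<chi>', t'') (t, \<chi>, _). (t, rcomp (fst t'') \<chi> \<chi>', t''))\<rparr>"

text \<open>
  Stacks in the sieve form: for every covering sieve \<open>\<S>\<close> of \<open>Spec R\<close>, restriction from the fibre of
  \<open>\<E>\<close> over \<open>Spec R\<close> to the category of functors \<open>\<S> \<rightarrow> \<E>\<close> over affine schemes is fully faithful
  (\<open>morphisms_glue\<close>) and essentially surjective (\<open>objects_glue\<close>).  No choice of pullbacks is made: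
  a morphism between the restrictions of \<open>x\<close> and \<open>y\<close> to \<open>\<S>\<close> is a map \<open>m\<close> which turns an arrow to
  \<open>x\<close> lying over a member of \<open>\<S>\<close> into an arrow to \<open>y\<close> with the same source and over the same member.
\<close>

definition morphisms_glue ::
  "('o, 'a) category \<Rightarrow> ('o, 'a, 'u) presheaf \<Rightarrow> 'u ring \<Rightarrow> ('u ring \<times> ('u \<Rightarrow> 'u)) set \<Rightarrow> bool" where
  "morphisms_glue \<E> \<O> R \<S> \<longleftrightarrow>
     (\<forall>x \<in> Ob \<E>. \<forall>y \<in> Ob \<E>. \<forall>m.
        sec \<O> x = R \<and> sec \<O> y = R \<and>
        (\<forall>z \<in> Ob \<E>. \<forall>a \<in> Hom \<E> z x. (sec \<O> z, res \<O> a) \<in> \<S> \<longrightarrow>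
           m a \<in> Hom \<E> z y \<and> res \<O> (m a) = res \<O> a \<and>
           (\<forall>z' \<in> Ob \<E>. \<forall>b \<in> Hom \<E> z' z. m (a \<bullet>\<^bsub>\<E>\<^esub> b) = m a \<bullet>\<^bsub>\<E>\<^esub> b)) \<longrightarrow>
        (\<exists>!f. f \<in> Hom \<E> x y \<and> res \<O> f = rid R \<and>
           (\<forall>z \<in> Ob \<E>. \<forall>a \<in> Hom \<E> z x. (sec \<O> z, res \<O> a) \<in> \<S> \<longrightarrow> f \<bullet>\<^bsub>\<E>\<^esub> a = m a)))"

definition objects_glue ::
  "('o, 'a) category \<Rightarrow> ('o, 'a, 'u) presheaf \<Rightarrow> 'u ring \<Rightarrow> ('u ring \<times> ('u \<Rightarrow> 'u)) set \<Rightarrow> bool" where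
  "objects_glue \<E> \<O> R \<S> \<longleftrightarrow>
     (\<forall>D D'. is_functor (affine_slice R \<S>) \<E> D D' \<and>
        (\<forall>t \<in> \<S>. sec \<O> (D t) = fst t) \<and>
        (\<forall>(t, \<chi>, t') \<in> Ar (affine_slice R \<S>). res \<O> (D' (t, \<chi>, t')) = \<chi>) \<longrightarrow>
        (\<exists>x \<epsilon>. cocone (affine_slice R \<S>) \<E> D D' x \<epsilon> \<and> sec \<O> x = R \<and>
           (\<forall>t \<in> \<S>. res \<O> (\<epsilon> t) = snd t)))"

definition stack ::
  "('u ring \<Rightarrow> ('u ring \<times> ('u \<Rightarrow> 'u)) set \<Rightarrow> bool) \<Rightarrow>
     ('o, 'a) category \<Rightarrow> ('o, 'a, 'u) presheaf \<Rightarrow> bool" where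
  "stack cover \<E> \<O> \<longleftrightarrow>
     fibred_in_groupoids \<E> \<O> \<and>
     (\<forall>R \<Phi>. small_cring R \<and> cover R \<Phi> \<longrightarrow>
        morphisms_glue \<E> \<O> R (sieve R \<Phi>) \<and> objects_glue \<E> \<O> R (sieve R \<Phi>))"

text \<open>
  A sheaf of sets is regarded as a stack whose fibres have no automorphisms but identities, i.e. in
  which an arrow is determined by its source, its target and the underlying morphism of schemes.
\<close>

definition set_sheaf ::
  "('u ring \<Rightarrow> ('u ring \<times> ('u \<Rightarrow> 'u)) set \<Rightarrow> bool) \<Rightarrow>
     ('o, 'a) category \<Rightarrow> ('o, 'a, 'u) presheaf \<Rightarrow> bool" where
  "set_sheaf cover F \<O> \<longleftrightarrow>
     stack cover F \<O> \<and>
     (\<forall>x \<in> Ob F. \<forall>y \<in> Ob F. \<forall>a \<in> Hom F x y. \<forall>b \<in> Hom F x y. res \<O> a = res \<O> b \<longrightarrow> a = b)"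

text \<open>
  For \<open>x\<close> over \<open>U\<close> and \<open>y\<close> over \<open>V\<close>, the fibre product \<open>U \<times>\<^sub>\<E> V\<close> is the category of spans
  \<open>x \<leftarrow> z \<rightarrow> y\<close> in \<open>\<E>\<close>.  If \<open>U = V\<close>, the sheaf \<open>Isom(x, y)\<close> over \<open>U\<close> consists of the spans whose legs
  lie over the same morphism.
\<close>

definition spans ::
  "('o, 'a) category \<Rightarrow> 'o \<Rightarrow> 'o \<Rightarrow>
     ('o \<times> 'a \<times> 'a, ('o \<times> 'a \<times> 'a) \<times> 'a \<times> ('o \<times> 'a \<times> 'a)) category" where
  "spans \<E> x y =
     \<lparr>Ob = {(z, a, b). z \<in> Ob \<E> \<and> a \<in> Hom \<E> z x \<and> b \<in> Hom \<E> z y},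
      Ar = {((z, a, b), c, (z', a', b')).
              z \<in> Ob \<E> \<and> a \<in> Hom \<E> z x \<and> b \<in> Hom \<E> z y \<and>
              z' \<in> Ob \<E> \<and> a' \<in> Hom \<E> z' x \<and> b' \<in> Hom \<E> z' y \<and>
              c \<in> Hom \<E> z z' \<and> a' \<bullet>\<^bsub>\<E>\<^esub> c = a \<and> b' \<bullet>\<^bsub>\<E>\<^esub> c = b},
      src = (\<lambda>(s, c, s'). s),
      tgt = (\<lambda>(s, c, s'). s'),
      ide = (\<lambda>s. (s, ide \<E> (fst s), s)),
      cmp = (\<lambda>(s', c', s'') (s, c, _). (s, c' \<bullet>\<^bsub>\<E>\<^esub> c, s''))\<rparr>"

definition span_presheaf ::
  "('o, 'a, 'u) presheaf \<Rightarrow>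
     ('o \<times> 'a \<times> 'a, ('o \<times> 'a \<times> 'a) \<times> 'a \<times> ('o \<times> 'a \<times> 'a), 'u) presheaf" where
  "span_presheaf \<O> = \<lparr>sec = (\<lambda>(z, a, b). sec \<O> z), res = (\<lambda>(s, c, s'). res \<O> c)\<rparr>"

definition isoms ::
  "('o, 'a) category \<Rightarrow> ('o, 'a, 'u) presheaf \<Rightarrow> 'o \<Rightarrow> 'o \<Rightarrow>
     ('o \<times> 'a \<times> 'a, ('o \<times> 'a \<times> 'a) \<times> 'a \<times> ('o \<times> 'a \<times> 'a)) category" where
  "isoms \<E> \<O> x y =
     full_subcategory (spans \<E> x y) {(z, a, b) \<in> Ob (spans \<E> x y). res \<O> a = res \<O> b}"


section \<open>Schemes, algebraic spaces and algebraic stacks\<close>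

text \<open>
  Schemes as functors.  An object \<open>x\<close> over \<open>Spec R\<close> is a morphism \<open>Spec R \<rightarrow> F\<close>; it is an open
  immersion if it is a monomorphism and, for every \<open>y\<close> over \<open>Spec T\<close>, there is an ideal \<open>I\<close> of \<open>T\<close>
  such that a morphism \<open>Spec T' \<rightarrow> Spec T\<close> composed with \<open>y\<close> factors through \<open>x\<close> iff \<open>I\<close> generates the
  unit ideal of \<open>T'\<close>.
\<close>

definition open_immersion :: "('o, 'a) category \<Rightarrow> ('o, 'a, 'u) presheaf \<Rightarrow> 'o \<Rightarrow> bool" where
  "open_immersion F \<O> x \<longleftrightarrow>
     x \<in> Ob F \<and>
     (\<forall>z \<in> Ob F. \<forall>a \<in> Hom F z x. \<forall>b \<in> Hom F z x. a = b) \<and>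
     (\<forall>y \<in> Ob F. \<exists>I. ideal I (sec \<O> y) \<and>
        (\<forall>z \<in> Ob F. \<forall>b \<in> Hom F z y.
           Hom F z x \<noteq> {} \<longleftrightarrow> genideal (sec \<O> z) (res \<O> b ` I) = carrier (sec \<O> z)))"

definition affine_open_cover :: "('o, 'a) category \<Rightarrow> ('o, 'a, 'u) presheaf \<Rightarrow> 'o set \<Rightarrow> bool" where
  "affine_open_cover F \<O> S \<longleftrightarrow>
     S \<subseteq> Ob F \<and> small TYPE('u) S \<and> (\<forall>x \<in> S. open_immersion F \<O> x) \<and>
     (\<forall>z \<in> Ob F. field (sec \<O> z) \<longrightarrow> (\<exists>x \<in> S. Hom F z x \<noteq> {}))"

definition scheme :: "('o, 'a) category \<Rightarrow> ('o, 'a, 'u) presheaf \<Rightarrow> bool" where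
  "scheme F \<O> \<longleftrightarrow> set_sheaf zariski_cover F \<O> \<and> (\<exists>S. affine_open_cover F \<O> S)"

text \<open>
  A scheme to be used as an atlas may be replaced by the disjoint union of the members of an affine
  open cover.  An atlas is thus a small set of objects, each regarded as a morphism from an affine
  scheme, and surjectivity is tested on points with values in fields, up to field extension.
\<close>

definition surjective_family :: "('o, 'a) category \<Rightarrow> ('o, 'a, 'u) presheaf \<Rightarrow> 'o set \<Rightarrow> bool" where
  "surjective_family \<E> \<O> S \<longleftrightarrow>
     (\<forall>y \<in> Ob \<E>. field (sec \<O> y) \<longrightarrow>
        (\<exists>z \<in> Ob \<E>. field (sec \<O> z) \<and> Hom \<E> z y \<noteq> {} \<and> (\<exists>x \<in> S. Hom \<E> z x \<noteq> {})))"

definition etale_object :: "('o, 'a) category \<Rightarrow> ('o, 'a, 'u) presheaf \<Rightarrow> 'o \<Rightarrow> bool" where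
  "etale_object F \<O> x \<longleftrightarrow>
     x \<in> Ob F \<and>
     (\<forall>y \<in> Ob F. scheme (spans F x y) (span_presheaf \<O>) \<and>
        (\<exists>S. affine_open_cover (spans F x y) (span_presheaf \<O>) S \<and>
           (\<forall>(z, a, b) \<in> S. etale_hom (sec \<O> y) (sec \<O> z) (res \<O> b))))"

definition etale_atlas :: "('o, 'a) category \<Rightarrow> ('o, 'a, 'u) presheaf \<Rightarrow> 'o set \<Rightarrow> bool" where
  "etale_atlas F \<O> S \<longleftrightarrow>
     small TYPE('u) S \<and> (\<forall>x \<in> S. etale_object F \<O> x) \<and> surjective_family F \<O> S"

definition algebraic_space :: "('o, 'a) category \<Rightarrow> ('o, 'a, 'u) presheaf \<Rightarrow> bool" where
  "algebraic_space F \<O> \<longleftrightarrow>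
     set_sheaf etale_cover F \<O> \<and>
     (\<forall>x \<in> Ob F. \<forall>y \<in> Ob F. sec \<O> x = sec \<O> y \<longrightarrow> scheme (isoms F \<O> x y) (span_presheaf \<O>)) \<and>
     (\<exists>S. etale_atlas F \<O> S)"

text \<open>
  An object \<open>x\<close> over \<open>U\<close> is smooth if for all \<open>y\<close> over \<open>V\<close> the fibre product \<open>U \<times>\<^sub>\<E> V\<close> is an
  algebraic space smooth over \<open>V\<close>.
\<close>

definition smooth_object :: "('o, 'a) category \<Rightarrow> ('o, 'a, 'u) presheaf \<Rightarrow> 'o \<Rightarrow> bool" where
  "smooth_object \<E> \<O> x \<longleftrightarrow>
     x \<in> Ob \<E> \<and>
     (\<forall>y \<in> Ob \<E>. algebraic_space (spans \<E> x y) (span_presheaf \<O>) \<and>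
        (\<exists>S. etale_atlas (spans \<E> x y) (span_presheaf \<O>) S \<and>
           (\<forall>(z, a, b) \<in> S. smooth_hom (sec \<O> y) (sec \<O> z) (res \<O> b))))"

text \<open>
  Algebraic (Artin) stacks over the integers: stacks in groupoids for the etale topology whose
  diagonal is representable by algebraic spaces and which admit a smooth surjection from a scheme.
  No separation or quasi-compactness condition is put on the diagonal.
\<close>

definition algebraic_stack :: "('o, 'a) category \<Rightarrow> ('o, 'a, 'u) presheaf \<Rightarrow> bool" where
  "algebraic_stack \<E> \<O> \<longleftrightarrow>
     stack etale_cover \<E> \<O> \<and>
     (\<forall>x \<in> Ob \<E>. \<forall>y \<in> Ob \<E>. sec \<O> x = sec \<O> y \<longrightarrow>
        algebraic_space (isoms \<E> \<O> x y) (span_presheaf \<O>)) \<and>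
     (\<exists>S. small TYPE('u) S \<and> (\<forall>x \<in> S. smooth_object \<E> \<O> x) \<and> surjective_family \<E> \<O> S)"

definition smooth_affines ::
  "('o, 'a) category \<Rightarrow> ('o, 'a, 'u) presheaf \<Rightarrow> ('o, 'a) category" where
  "smooth_affines \<E> \<O> = full_subcategory \<E> {x. smooth_object \<E> \<O> x}"


section \<open>Flat sheaves of rings and quasi-coherent sheaves\<close>

text \<open>
  Sheaves for the etale topology on a category \<open>C\<close> of affine schemes over a stack.  As \<open>C\<close> is not
  given with fibre products, compatibility is tested on all objects \<open>v\<close> of \<open>C\<close> with arrows to two
  members of the covering family.
\<close>

definition ring_sheaf ::
  "('o, 'a) category \<Rightarrow> ('o, 'a, 'u) presheaf \<Rightarrow> ('o, 'a, 'u) presheaf \<Rightarrow> bool" where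
  "ring_sheaf C \<O> A \<longleftrightarrow>
     ring_presheaf C A \<and>
     (\<forall>x \<in> Ob C. \<forall>\<Phi> s.
        finite \<Phi> \<and> \<Phi> \<subseteq> {f \<in> Ar C. tgt C f = x} \<and>
        etale_cover (sec \<O> x) ((\<lambda>f. (sec \<O> (src C f), res \<O> f)) ` \<Phi>) \<and>
        (\<forall>f \<in> \<Phi>. s f \<in> carrier (sec A (src C f))) \<and>
        (\<forall>f \<in> \<Phi>. \<forall>g \<in> \<Phi>. \<forall>v \<in> Ob C. \<forall>a \<in> Hom C v (src C f). \<forall>b \<in> Hom C v (src C g).
           f \<bullet>\<^bsub>C\<^esub> a = g \<bullet>\<^bsub>C\<^esub> b \<longrightarrow> res A a (s f) = res A b (s g)) \<longrightarrow>
        (\<exists>!t. t \<in> carrier (sec A x) \<and> (\<forall>f \<in> \<Phi>. res A f t = s f)))"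

definition flat_presheaf :: "('o, 'a) category \<Rightarrow> ('o, 'a, 'u) presheaf \<Rightarrow> bool" where
  "flat_presheaf C A \<longleftrightarrow>
     (\<forall>f \<in> Ar C. flat_module (sec A (tgt C f)) (restrict_scalars (res A f) (sec A (src C f))))"

record ('o, 'a, 'u) module_presheaf =
  msec :: "'o \<Rightarrow> ('u, 'u) module"
  mres :: "'a \<Rightarrow> 'u \<Rightarrow> 'u"

text \<open>The induced map from the base change of \<open>M(W)\<close> to \<open>M(U)\<close> for an arrow \<open>f : U \<rightarrow> W\<close>.\<close>

definition induced_map ::
  "('o, 'a) category \<Rightarrow> ('o, 'a, 'u) module_presheaf \<Rightarrow> 'a \<Rightarrow> ('u \<times> 'u \<Rightarrow>\<^sub>0 int) set \<Rightarrow> 'u" where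
  "induced_map C M f =
     tensor_lift (msec M (src C f)) (\<lambda>(b, x). b \<odot>\<^bsub>msec M (src C f)\<^esub> mres M f x)"

definition cartesian_module ::
  "('o, 'a) category \<Rightarrow> ('o, 'a, 'u) presheaf \<Rightarrow> ('o, 'a, 'u) module_presheaf \<Rightarrow> bool" where
  "cartesian_module C A M \<longleftrightarrow>
     (\<forall>x \<in> Ob C. module (sec A x) (msec M x) \<and> small TYPE('u) (carrier (msec M x)) \<and>
        (\<forall>v \<in> carrier (msec M x). mres M (ide C x) v = v)) \<and>
     (\<forall>f \<in> Ar C.
        mres M f \<in> carrier (msec M (tgt C f)) \<rightarrow> carrier (msec M (src C f)) \<and>
        (\<forall>v \<in> carrier (msec M (tgt C f)). \<forall>w \<in> carrier (msec M (tgt C f)).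
           mres M f (v \<oplus>\<^bsub>msec M (tgt C f)\<^esub> w) = mres M f v \<oplus>\<^bsub>msec M (src C f)\<^esub> mres M f w) \<and>
        (\<forall>a \<in> carrier (sec A (tgt C f)). \<forall>v \<in> carrier (msec M (tgt C f)).
           mres M f (a \<odot>\<^bsub>msec M (tgt C f)\<^esub> v) = res A f a \<odot>\<^bsub>msec M (src C f)\<^esub> mres M f v)) \<and>
     (\<forall>f \<in> Ar C. \<forall>g \<in> Ar C. tgt C f = src C g \<longrightarrow>
        (\<forall>v \<in> carrier (msec M (tgt C g)). mres M (g \<bullet>\<^bsub>C\<^esub> f) v = mres M f (mres M g v))) \<and>
     (\<forall>f \<in> Ar C.
        let B = sec A (src C f);
            T = base_change (sec A (tgt C f)) B (res A f) (msec M (tgt C f))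
        in induced_map C M f \<in> linear_maps B T (msec M (src C f)) \<and>
           bij_betw (induced_map C M f) (carrier T) (carrier (msec M (src C f))))"

definition module_morphism ::
  "('o, 'a) category \<Rightarrow> ('o, 'a, 'u) presheaf \<Rightarrow> ('o, 'a, 'u) module_presheaf \<Rightarrow>
     ('o, 'a, 'u) module_presheaf \<Rightarrow> ('o \<Rightarrow> 'u \<Rightarrow> 'u) \<Rightarrow> bool" where
  "module_morphism C A M N \<phi> \<longleftrightarrow>
     \<phi> \<in> extensional (Ob C) \<and>
     (\<forall>x \<in> Ob C. \<phi> x \<in> linear_maps (sec A x) (msec M x) (msec N x) \<inter> extensional (carrier (msec M x))) \<and>
     (\<forall>f \<in> Ar C. \<forall>v \<in> carrier (msec M (tgt C f)).
        \<phi> (src C f) (mres M f v) = mres N f (\<phi> (tgt C f) v))"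

definition Qcoh ::
  "('o, 'a) category \<Rightarrow> ('o, 'a, 'u) presheaf \<Rightarrow>
     (('o, 'a, 'u) module_presheaf,
      ('o, 'a, 'u) module_presheaf \<times> ('o \<Rightarrow> 'u \<Rightarrow> 'u) \<times> ('o, 'a, 'u) module_presheaf) category" where
  "Qcoh C A =
     \<lparr>Ob = {M. cartesian_module C A M},
      Ar = {(M, \<phi>, N). cartesian_module C A M \<and> cartesian_module C A N \<and> module_morphism C A M N \<phi>},
      src = (\<lambda>(M, \<phi>, N). M),
      tgt = (\<lambda>(M, \<phi>, N). N),
      ide = (\<lambda>M. (M, \<lambda>x \<in> Ob C. restrict id (carrier (msec M x)), M)),
      cmp = (\<lambda>(_, \<psi>, N) (M, \<phi>, _). (M, \<lambda>x \<in> Ob C. compose (carrier (msec M x)) (\<psi> x) (\<phi> x), N))\<rparr>"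

end

(*
  The stack enters only through the small category C. A cartesian module on C is characterised without
  tensor products: for f : U -> W the module M(U) is generated by the restrictions from M(W), and every
  semilinear map from M(W) into an A(U)-module extends to M(U). Hence quotients, direct sums and images
  are pointwise, and by flatness a subpresheaf of a cartesian module is cartesian as soon as the
  generation condition holds; this gives kernels. So exactness and directed colimits are computed on
  elements. The generation condition is finitary, so each element lies in a cartesian submodule of
  cardinality at most a fixed kappa bounding C and A. There is a small set of such modules up to
  isomorphism; they are kappa^+-presentable, every module is the kappa^+-directed union of them, and
  their coproduct is a generator. Pointwise products need not be cartesian; the product is instead a
  quotient of the coproduct of the bounded modules equipped with a cone to the family.
*)
theory Submission
  imports Defs
begin

section \<open>Cardinalities\<close>

text \<open>The delicate point is the kernel of M -> N: that its restrictions generate is left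
  exactness of base change, while flatness is available only as "injective maps stay injective",
  hence for submodules. So the image I of M in N is treated first. It is generated by restrictions,
  hence cartesian; the map from M(W) to the quotient of M(U) by the span of the restricted kernel
  factors through I(W) and extends to I(U), so an element of M(U) that dies in I(U) dies in that
  quotient. A second obstacle is typing: elements of tensor products and direct sums do not have
  type \<open>'u\<close>. The universal property is therefore polymorphic in its target, quotients
  consist of representatives, and direct sums are moved into \<open>'u\<close> along an injection.
  The successor of kappa is taken because it is regular and "fewer than kappa^+" means "at most
  kappa": at most kappa submodules of size at most kappa lie in one of that size, and the at most
  kappa relations between the elements of a bounded module can all be satisfied at one stage of a
  kappa^+-directed system.\<close>

lemma small_subset: "small u B \<Longrightarrow> A \<subseteq> B \<Longrightarrow> small u A"
  unfolding small_def by (metis card_of_mono1 ordLeq_ordLess_trans)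

lemma small_image: "small u B \<Longrightarrow> small u (f ` B)"
  unfolding small_def by (metis card_of_image ordLeq_ordLess_trans)

lemma small_inj: "small u (f ` B) \<Longrightarrow> inj_on f B \<Longrightarrow> small u B"
  unfolding small_def
  by (metis bij_betw_def card_of_ordIso ordIso_ordLess_trans)

text \<open>The form in which smallness is mostly used: an object whose natural elements have
  another type is re-encoded inside \<open>'u\<close>.\<close>

lemma small_encode:
  assumes "small (u :: 'u itself) B"
  shows "\<exists>f :: _ \<Rightarrow> 'u. inj_on f B"
proof -
  have "|B| \<le>o |UNIV :: 'u set|" using assms unfolding small_def by (rule ordLess_imp_ordLeq)
  then show ?thesis using card_of_ordLeq[of B "UNIV :: 'u set"] by blast
qed

context
  fixes u :: "'u itself"
  assumes univ: "universe u"
begin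

lemma Cinfinite_universe: "Cinfinite |UNIV :: 'u set|"
proof -
  have "natLeq \<le>o |UNIV :: 'u set|"
    using univ unfolding universe_def by (auto intro: ordLess_imp_ordLeq)
  then have "infinite (UNIV :: 'u set)"
    using infinite_iff_natLeq_ordLeq by blast
  then show ?thesis by (simp add: cinfinite_def Field_card_of card_of_card_order_on)
qed

lemma small_finite: "finite B \<Longrightarrow> small u B"
  unfolding small_def
  using Cinfinite_universe
  by (metis (no_types, lifting) cinfinite_def finite_ordLess_infinite Field_card_of card_of_well_order_on)

text \<open>This is what regularity of the cardinality of \<open>'u\<close> provides; binary unions
  and dependent sums are reduced to it.\<close>

lemma small_UN:
  "small u I \<Longrightarrow> (\<And>i. i \<in> I \<Longrightarrow> small u (B i)) \<Longrightarrow> small u (\<Union>i\<in>I. B i)"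
  unfolding small_def using univ
  by (intro regularCard_UNION_bound[OF Cinfinite_universe]) (auto simp: universe_def)

lemma small_Un: "small u A \<Longrightarrow> small u B \<Longrightarrow> small u (A \<union> B)"
  using small_UN[of "UNIV :: bool set" "\<lambda>b. if b then A else B"] small_finite[of "UNIV :: bool set"]
  by (auto simp: UNIV_bool Un_commute)

lemma small_Sigma:
  "small u A \<Longrightarrow> (\<And>a. a \<in> A \<Longrightarrow> small u (B a)) \<Longrightarrow> small u (Sigma A B)"
  unfolding Sigma_def by (intro small_UN) (auto intro: small_finite)

text \<open>The universe axiom on power sets speaks of subsets of \<open>'u\<close> only; an
  encoding carries it to sets of any type.\<close>

lemma small_Pow:
  assumes "small u B"
  shows "small u (Pow B)"
proof -
  obtain f :: "_ \<Rightarrow> 'u" where f: "inj_on f B" using small_encode[OF assms] by blast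
  have "small u (Pow (f ` B))" using univ small_image[OF assms] unfolding universe_def by blast
  then have "small u ((`) f ` Pow B)" by (rule small_subset) auto
  then show ?thesis by (rule small_inj) (simp add: f inj_on_image_Pow)
qed

text \<open>An extensional function is determined by its graph, and the graphs lie in the power set
  of a small product.\<close>

lemma small_PiE:
  assumes "small u A" "\<And>a. a \<in> A \<Longrightarrow> small u (B a)"
  shows "small u (PiE A B)"
proof (rule small_inj)
  let ?g = "\<lambda>f. {(a, f a) |a. a \<in> A}"
  have "?g ` PiE A B \<subseteq> Pow (A \<times> (\<Union>a\<in>A. B a))" by (auto simp: PiE_iff)
  then show "small u (?g ` PiE A B)"
    by (rule small_subset[rotated]) (intro small_Pow small_Sigma small_UN assms)
  show "inj_on ?g (PiE A B)"
    by (rule inj_onI, rule PiE_ext) (auto simp: set_eq_iff)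
qed

text \<open>Adding a disjoint copy of the naturals makes the bound infinite, and
  \<open>natLeq <o |UNIV|\<close> keeps it small. After encoding it is a subset of
  \<open>'u\<close>, as the parameter \<open>Y\<close> of \<open>qcoh_bound\<close> has to
  be.\<close>

lemma small_infinite_bound:
  assumes "small u B"
  obtains Y :: "'u set" where "infinite Y" "small u Y" "|B| \<le>o |Y|"
proof -
  have nat: "small u (UNIV :: nat set)"
    using univ unfolding universe_def small_def
    by (metis card_of_nat ordIso_ordLess_trans)
  have "Inl ` B \<union> Inr ` (UNIV :: nat set) = Sum_Type.Plus B (UNIV :: nat set)" by auto
  then have sm: "small u (Sum_Type.Plus B (UNIV :: nat set))"
    using small_Un[OF small_image[OF assms] small_image[OF nat], of Inl Inr] by simp
  then obtain f :: "_ \<Rightarrow> 'u" where f: "inj_on f (Sum_Type.Plus B (UNIV :: nat set))"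
    using small_encode by blast
  let ?Y = "f ` (Sum_Type.Plus B (UNIV :: nat set))"
  show ?thesis
  proof (rule that)
    show "infinite ?Y" using f by (simp add: finite_image_iff)
    show "small u ?Y" using sm by (rule small_image)
    have "|Sum_Type.Plus B (UNIV :: nat set)| \<le>o |?Y|"
      using f by (intro card_of_ordLeqI[of f]) auto
    then show "|B| \<le>o |?Y|" using card_of_Plus1 ordLeq_transitive by blast
  qed
qed

end

section \<open>Sets of cardinality at most that of a fixed infinite set\<close>

lemma infinite_ordLeq_finite: "infinite Y \<Longrightarrow> finite B \<Longrightarrow> |B| \<le>o |Y|"
  by (intro ordLess_imp_ordLeq finite_ordLess_infinite) (auto simp: Field_card_of card_of_well_order_on)

lemma ordLeq_image: "|B| \<le>o |Y| \<Longrightarrow> |f ` B| \<le>o |Y|"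
  using card_of_image ordLeq_transitive by blast

lemma ordLeq_subset: "|B| \<le>o |Y| \<Longrightarrow> A \<subseteq> B \<Longrightarrow> |A| \<le>o |Y|"
  using card_of_mono1 ordLeq_transitive by blast

lemma ordLeq_UN:
  "infinite Y \<Longrightarrow> |I| \<le>o |Y| \<Longrightarrow> (\<And>i. i \<in> I \<Longrightarrow> |B i| \<le>o |Y| ) \<Longrightarrow> |\<Union>i\<in>I. B i| \<le>o |Y|"
  by (rule card_of_UNION_ordLeq_infinite) auto

lemma ordLeq_Sigma:
  "infinite Y \<Longrightarrow> |I| \<le>o |Y| \<Longrightarrow> (\<And>i. i \<in> I \<Longrightarrow> |B i| \<le>o |Y| ) \<Longrightarrow> |Sigma I B| \<le>o |Y|"
  by (rule card_of_Sigma_ordLeq_infinite) auto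

lemma ordLeq_Un: "infinite Y \<Longrightarrow> |A| \<le>o |Y| \<Longrightarrow> |B| \<le>o |Y| \<Longrightarrow> |A \<union> B| \<le>o |Y|"
  using ordLeq_UN[of Y "UNIV :: bool set" "\<lambda>b. if b then A else B"]
    infinite_ordLeq_finite[of Y "UNIV :: bool set"]
  by (auto simp: UNIV_bool Un_commute)

text \<open>Meant for closures that are reached after countably many rounds.\<close>

lemma ordLeq_nat_UN: "infinite Y \<Longrightarrow> (\<And>i. |B i| \<le>o |Y| ) \<Longrightarrow> |\<Union>i :: nat. B i| \<le>o |Y|"
  by (rule ordLeq_UN) (auto simp: infinite_iff_card_of_nat)

section \<open>Modules\<close>

lemma linear_mapsI:
  assumes "\<And>x. x \<in> carrier M \<Longrightarrow> f x \<in> carrier N"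
    and "\<And>x y. x \<in> carrier M \<Longrightarrow> y \<in> carrier M \<Longrightarrow> f (x \<oplus>\<^bsub>M\<^esub> y) = f x \<oplus>\<^bsub>N\<^esub> f y"
    and "\<And>a x. a \<in> carrier R \<Longrightarrow> x \<in> carrier M \<Longrightarrow> f (a \<odot>\<^bsub>M\<^esub> x) = a \<odot>\<^bsub>N\<^esub> f x"
  shows "f \<in> linear_maps R M N"
  using assms unfolding linear_maps_def by auto

lemma linear_mapsD:
  assumes "f \<in> linear_maps R M N"
  shows "x \<in> carrier M \<Longrightarrow> f x \<in> carrier N"
    and "x \<in> carrier M \<Longrightarrow> y \<in> carrier M \<Longrightarrow> f (x \<oplus>\<^bsub>M\<^esub> y) = f x \<oplus>\<^bsub>N\<^esub> f y"
    and "a \<in> carrier R \<Longrightarrow> x \<in> carrier M \<Longrightarrow> f (a \<odot>\<^bsub>M\<^esub> x) = a \<odot>\<^bsub>N\<^esub> f x"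
  using assms unfolding linear_maps_def by auto

text \<open>Members of \<open>linear_maps\<close> are not extensional: only values on the carrier
  count. Hence restricting a map to the carrier keeps it linear.\<close>

lemma linear_maps_cong:
  assumes "f \<in> linear_maps R M N" "\<And>x. x \<in> carrier M \<Longrightarrow> g x = f x" "module R M"
  shows "g \<in> linear_maps R M N"
proof -
  interpret M: module R M by fact
  show ?thesis using assms(1,2) by (auto intro!: linear_mapsI simp: linear_mapsD)
qed

lemma linear_maps_comp:
  "f \<in> linear_maps R M N \<Longrightarrow> g \<in> linear_maps R N P \<Longrightarrow> (\<lambda>x. g (f x)) \<in> linear_maps R M P"
  by (rule linear_mapsI) (auto simp: linear_mapsD)

text \<open>Formulated for additive maps, because it also serves semilinear maps and maps out of a
  tensor product whose linearity is still to be shown.\<close>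

lemma additive_zero:
  assumes "abelian_group M" "abelian_group N"
    and "\<And>x. x \<in> carrier M \<Longrightarrow> f x \<in> carrier N"
    and "\<And>x y. x \<in> carrier M \<Longrightarrow> y \<in> carrier M \<Longrightarrow> f (x \<oplus>\<^bsub>M\<^esub> y) = f x \<oplus>\<^bsub>N\<^esub> f y"
  shows "f \<zero>\<^bsub>M\<^esub> = \<zero>\<^bsub>N\<^esub>"
proof -
  interpret M: abelian_group M by fact
  interpret N: abelian_group N by fact
  have "f \<zero>\<^bsub>M\<^esub> \<oplus>\<^bsub>N\<^esub> f \<zero>\<^bsub>M\<^esub> = f \<zero>\<^bsub>M\<^esub> \<oplus>\<^bsub>N\<^esub> \<zero>\<^bsub>N\<^esub>"
    using assms(4)[of "\<zero>\<^bsub>M\<^esub>" "\<zero>\<^bsub>M\<^esub>"] assms(3)[of "\<zero>\<^bsub>M\<^esub>"] by simp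
  then show ?thesis using assms(3)[of "\<zero>\<^bsub>M\<^esub>"] N.add.l_cancel by blast
qed

lemma additive_minus:
  assumes "abelian_group M" "abelian_group N"
    and "\<And>x. x \<in> carrier M \<Longrightarrow> f x \<in> carrier N"
    and "\<And>x y. x \<in> carrier M \<Longrightarrow> y \<in> carrier M \<Longrightarrow> f (x \<oplus>\<^bsub>M\<^esub> y) = f x \<oplus>\<^bsub>N\<^esub> f y"
    and x: "x \<in> carrier M"
  shows "f (\<ominus>\<^bsub>M\<^esub> x) = \<ominus>\<^bsub>N\<^esub> f x"
proof -
  interpret M: abelian_group M by fact
  interpret N: abelian_group N by fact
  have "f (\<ominus>\<^bsub>M\<^esub> x) \<oplus>\<^bsub>N\<^esub> f x = \<zero>\<^bsub>N\<^esub>"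
    using assms(4)[of "\<ominus>\<^bsub>M\<^esub> x" x] x additive_zero[OF assms(1-4)] by (simp add: M.l_neg)
  then show ?thesis using N.minus_equality x assms(3) by (metis M.a_inv_closed)
qed

lemma linear_maps_zero:
  assumes "f \<in> linear_maps R M N" "module R M" "module R N"
  shows "f \<zero>\<^bsub>M\<^esub> = \<zero>\<^bsub>N\<^esub>"
  using assms by (intro additive_zero) (auto simp: linear_mapsD module_def)

lemma linear_maps_neg:
  assumes "f \<in> linear_maps R M N" "module R M" "module R N" "x \<in> carrier M"
  shows "f (\<ominus>\<^bsub>M\<^esub> x) = \<ominus>\<^bsub>N\<^esub> f x"
  using assms by (intro additive_minus) (auto simp: linear_mapsD module_def)

lemma linear_maps_diff:
  assumes "f \<in> linear_maps R M N" "module R M" "module R N" "x \<in> carrier M" "y \<in> carrier M"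
  shows "f (x \<ominus>\<^bsub>M\<^esub> y) = f x \<ominus>\<^bsub>N\<^esub> f y"
proof -
  interpret M: module R M by fact
  show ?thesis using assms
    by (simp add: a_minus_def linear_mapsD(2)[OF assms(1)] linear_maps_neg[OF assms(1-3)])
qed

section \<open>Submodules and spans\<close>

lemma (in module) neg_smult: "x \<in> carrier M \<Longrightarrow> \<ominus>\<^bsub>M\<^esub> x = (\<ominus> \<one>) \<odot>\<^bsub>M\<^esub> x"
  by (simp add: smult_l_minus)

text \<open>Closure under negatives is the action of -1, so it need not be listed on the
  right.\<close>

lemma (in module) submodule_iff:
  "submodule H R M \<longleftrightarrow> H \<subseteq> carrier M \<and> \<zero>\<^bsub>M\<^esub> \<in> H \<and> (\<forall>v\<in>H. \<forall>w\<in>H. v \<oplus>\<^bsub>M\<^esub> w \<in> H) \<and>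
     (\<forall>a\<in>carrier R. \<forall>v\<in>H. a \<odot>\<^bsub>M\<^esub> v \<in> H)" (is "?l \<longleftrightarrow> ?r")
proof
  assume ?l
  then show ?r using submoduleE[OF \<open>?l\<close>]
    by (auto simp: subgroup.one_closed[OF submodule.axioms(1), of H R M, simplified])
next
  assume r: ?r
  show ?l using r by (intro submoduleI) (auto simp: neg_smult subset_eq)
qed

lemma submodule_minus:
  assumes "module R M" "submodule H R M" "v \<in> H" "w \<in> H"
  shows "v \<ominus>\<^bsub>M\<^esub> w \<in> H"
proof -
  interpret M: module R M by fact
  show ?thesis unfolding a_minus_def using M.submoduleE[OF assms(2)] assms(3,4) by auto
qed

definition mspan :: "'r ring \<Rightarrow> ('r, 'm) module \<Rightarrow> 'm set \<Rightarrow> 'm set" where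
  "mspan R M S = \<Inter>{N. \<zero>\<^bsub>M\<^esub> \<in> N \<and> S \<subseteq> N \<and> (\<forall>v\<in>N. \<forall>w\<in>N. v \<oplus>\<^bsub>M\<^esub> w \<in> N) \<and>
     (\<forall>a\<in>carrier R. \<forall>v\<in>N. a \<odot>\<^bsub>M\<^esub> v \<in> N)}"

lemma mspan_zero: "\<zero>\<^bsub>M\<^esub> \<in> mspan R M S"
  and mspan_base: "x \<in> S \<Longrightarrow> x \<in> mspan R M S"
  and mspan_add: "v \<in> mspan R M S \<Longrightarrow> w \<in> mspan R M S \<Longrightarrow> v \<oplus>\<^bsub>M\<^esub> w \<in> mspan R M S"
  and mspan_smult: "a \<in> carrier R \<Longrightarrow> v \<in> mspan R M S \<Longrightarrow> a \<odot>\<^bsub>M\<^esub> v \<in> mspan R M S"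
  unfolding mspan_def by blast+

lemmas mspan_intros = mspan_zero mspan_base mspan_add mspan_smult

text \<open>The step cases also provide membership in the span; this is what places the elements in
  the carrier when linearity is applied to them.\<close>

lemma mspan_induct [consumes 1, case_names zero base add smult]:
  assumes "v \<in> mspan R M S"
    and "P \<zero>\<^bsub>M\<^esub>" "\<And>x. x \<in> S \<Longrightarrow> P x"
    and "\<And>v w. v \<in> mspan R M S \<Longrightarrow> P v \<Longrightarrow> w \<in> mspan R M S \<Longrightarrow> P w \<Longrightarrow> P (v \<oplus>\<^bsub>M\<^esub> w)"
    and "\<And>a v. a \<in> carrier R \<Longrightarrow> v \<in> mspan R M S \<Longrightarrow> P v \<Longrightarrow> P (a \<odot>\<^bsub>M\<^esub> v)"
  shows "P v"
proof -
  have "mspan R M S \<subseteq> {v \<in> mspan R M S. P v}"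
    unfolding mspan_def[of R M S]
    by (rule Inter_lower) (use assms(2-) in \<open>auto simp: mspan_intros simp flip: mspan_def\<close>)
  then show ?thesis using assms(1) by blast
qed

lemma mspan_subset:
  assumes "module R M" "submodule N R M" "S \<subseteq> N"
  shows "mspan R M S \<subseteq> N"
proof
  interpret M: module R M by fact
  fix v assume "v \<in> mspan R M S"
  then show "v \<in> N" using assms(2,3) unfolding M.submodule_iff
    by (induct rule: mspan_induct) auto
qed

lemma mspan_closed:
  assumes "module R M" "S \<subseteq> carrier M"
  shows "mspan R M S \<subseteq> carrier M"
  using mspan_subset[OF assms(1) module.carrier_is_submodule[OF assms(1)] assms(2)] .

lemma mspan_submodule:
  assumes "module R M" "S \<subseteq> carrier M"
  shows "submodule (mspan R M S) R M"
  using mspan_closed[OF assms] module.submodule_iff[OF assms(1)]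
  by (auto intro: mspan_intros)

lemma mspan_mono: "v \<in> mspan R M S \<Longrightarrow> S \<subseteq> Z \<Longrightarrow> v \<in> mspan R M Z"
  by (induct rule: mspan_induct) (auto intro: mspan_intros)

lemma mspan_image:
  assumes "f \<in> linear_maps R M N" "module R M" "module R N" "S \<subseteq> carrier M" "v \<in> mspan R M S"
  shows "f v \<in> mspan R N (f ` S)"
  using assms(5)
proof (induct rule: mspan_induct)
  case zero
  then show ?case using linear_maps_zero[OF assms(1-3)] by (simp add: mspan_zero)
qed (use mspan_closed[OF assms(2,4)] in
    \<open>auto simp: linear_mapsD[OF assms(1)] subset_eq intro: mspan_intros\<close>)

text \<open>Membership in a span is derived in finitely many steps. This finiteness is what makes
  bounded cartesian submodules possible.\<close>

lemma mspan_finite: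
  assumes "v \<in> mspan R M S"
  shows "\<exists>Z. finite Z \<and> Z \<subseteq> S \<and> v \<in> mspan R M Z"
  using assms
proof (induct rule: mspan_induct)
  case zero
  show ?case by (rule exI[of _ "{}"]) (simp add: mspan_zero)
next
  case (base x)
  then show ?case by (intro exI[of _ "{x}"]) (simp add: mspan_base)
next
  case (add v w)
  then obtain Z Z' where "finite Z" "Z \<subseteq> S" "v \<in> mspan R M Z" "finite Z'" "Z' \<subseteq> S" "w \<in> mspan R M Z'"
    by blast
  then show ?case
    by (intro exI[of _ "Z \<union> Z'"]) (auto intro!: mspan_add intro: mspan_mono)
next
  case (smult a v)
  then show ?case by (auto intro: mspan_smult)
qed

lemma linear_maps_eq_on_span:
  assumes "f \<in> linear_maps R M N" "g \<in> linear_maps R M N" "module R M" "module R N"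
    and "S \<subseteq> carrier M" "\<And>x. x \<in> S \<Longrightarrow> f x = g x" "v \<in> mspan R M S"
  shows "f v = g v"
  using assms(7)
proof (induct rule: mspan_induct)
  case zero
  then show ?case using linear_maps_zero assms(1-4) by metis
qed (use mspan_closed[OF assms(3,5)] in
   \<open>auto simp: linear_mapsD[OF assms(1)] linear_mapsD[OF assms(2)] assms(6) subset_eq\<close>)

lemma (in abelian_group) diff_add_diff:
  "u \<in> carrier G \<Longrightarrow> v \<in> carrier G \<Longrightarrow> w \<in> carrier G \<Longrightarrow> (u \<ominus> v) \<oplus> (v \<ominus> w) = u \<ominus> w"
  by (simp add: a_minus_def a_assoc r_neg1)

lemma (in abelian_group) minus_diff:
  "u \<in> carrier G \<Longrightarrow> v \<in> carrier G \<Longrightarrow> \<ominus> (u \<ominus> v) = v \<ominus> u"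
  by (simp add: a_minus_def minus_add a_comm)

lemma (in abelian_group) add_diff_add:
  "u \<in> carrier G \<Longrightarrow> v \<in> carrier G \<Longrightarrow> x \<in> carrier G \<Longrightarrow> y \<in> carrier G \<Longrightarrow>
     (u \<oplus> v) \<ominus> (x \<oplus> y) = (u \<ominus> x) \<oplus> (v \<ominus> y)"
  by (simp add: a_minus_def minus_add a_ac)

text \<open>Quotients are carried by a set of representatives, so that the type of elements is unchanged.\<close>

definition qrep :: "('r, 'm) module \<Rightarrow> 'm set \<Rightarrow> 'm \<Rightarrow> 'm" where
  "qrep M N v = (SOME w. w \<in> carrier M \<and> w \<ominus>\<^bsub>M\<^esub> v \<in> N)"

definition mquot :: "('r, 'm) module \<Rightarrow> 'm set \<Rightarrow> ('r, 'm) module" where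
  "mquot M N = \<lparr>carrier = qrep M N ` carrier M, monoid.mult = undefined, one = undefined,
     ring.zero = qrep M N \<zero>\<^bsub>M\<^esub>, ring.add = (\<lambda>v w. qrep M N (v \<oplus>\<^bsub>M\<^esub> w)),
     smult = (\<lambda>a v. qrep M N (a \<odot>\<^bsub>M\<^esub> v))\<rparr>"

context
  fixes R :: "'r ring" and M :: "('r, 'm) module" and N
  assumes M: "module R M" and N: "submodule N R M"
begin

interpretation M: module R M by (fact M)

lemma submodule_facts: "N \<subseteq> carrier M" "\<zero>\<^bsub>M\<^esub> \<in> N" "v \<in> N \<Longrightarrow> w \<in> N \<Longrightarrow> v \<oplus>\<^bsub>M\<^esub> w \<in> N"
  "a \<in> carrier R \<Longrightarrow> v \<in> N \<Longrightarrow> a \<odot>\<^bsub>M\<^esub> v \<in> N" "v \<in> N \<Longrightarrow> \<ominus>\<^bsub>M\<^esub> v \<in> N"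
  using N M.submodule_iff M.submoduleE(3)[OF N] by auto

lemma qrep_props:
  assumes "v \<in> carrier M"
  shows "qrep M N v \<in> carrier M" "qrep M N v \<ominus>\<^bsub>M\<^esub> v \<in> N"
proof -
  have "v \<in> carrier M \<and> v \<ominus>\<^bsub>M\<^esub> v \<in> N" using assms submodule_facts(2) by (simp add: a_minus_def M.r_neg)
  then have "qrep M N v \<in> carrier M \<and> qrep M N v \<ominus>\<^bsub>M\<^esub> v \<in> N"
    unfolding qrep_def by (rule someI)
  then show "qrep M N v \<in> carrier M" "qrep M N v \<ominus>\<^bsub>M\<^esub> v \<in> N" by auto
qed

text \<open>Congruent elements have the same admissible representatives, so the choice operator is
  applied to the same predicate and returns the same element.\<close>

lemma qrep_eq_iff:
  assumes v: "v \<in> carrier M" and w: "w \<in> carrier M"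
  shows "qrep M N v = qrep M N w \<longleftrightarrow> v \<ominus>\<^bsub>M\<^esub> w \<in> N"
proof
  assume eq: "qrep M N v = qrep M N w"
  have "(v \<ominus>\<^bsub>M\<^esub> qrep M N w) \<oplus>\<^bsub>M\<^esub> (qrep M N w \<ominus>\<^bsub>M\<^esub> w) \<in> N"
    using submodule_facts(3)[OF submodule_facts(5)[OF qrep_props(2)[OF v]] qrep_props(2)[OF w]]
    by (simp add: eq[symmetric] M.minus_diff v qrep_props)
  then show "v \<ominus>\<^bsub>M\<^esub> w \<in> N" by (simp add: M.diff_add_diff v w qrep_props)
next
  assume d: "v \<ominus>\<^bsub>M\<^esub> w \<in> N"
  have d': "w \<ominus>\<^bsub>M\<^esub> v \<in> N" using submodule_facts(5)[OF d] by (simp add: M.minus_diff v w)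
  have "z \<ominus>\<^bsub>M\<^esub> v \<in> N \<longleftrightarrow> z \<ominus>\<^bsub>M\<^esub> w \<in> N" if z: "z \<in> carrier M" for z
    using submodule_facts(3)[OF _ d, of "z \<ominus>\<^bsub>M\<^esub> v"] submodule_facts(3)[OF _ d', of "z \<ominus>\<^bsub>M\<^esub> w"]
    by (auto simp: M.diff_add_diff v w z)
  then have "(\<lambda>z. z \<in> carrier M \<and> z \<ominus>\<^bsub>M\<^esub> v \<in> N) = (\<lambda>z. z \<in> carrier M \<and> z \<ominus>\<^bsub>M\<^esub> w \<in> N)"
    by blast
  then show "qrep M N v = qrep M N w" unfolding qrep_def by simp
qed

lemma qrep_qrep: "v \<in> carrier M \<Longrightarrow> qrep M N (qrep M N v) = qrep M N v"
  by (simp add: qrep_eq_iff qrep_props)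

lemma qrep_add:
  assumes "v \<in> carrier M" "w \<in> carrier M"
  shows "qrep M N (qrep M N v \<oplus>\<^bsub>M\<^esub> qrep M N w) = qrep M N (v \<oplus>\<^bsub>M\<^esub> w)"
proof -
  have "(qrep M N v \<oplus>\<^bsub>M\<^esub> qrep M N w) \<ominus>\<^bsub>M\<^esub> (v \<oplus>\<^bsub>M\<^esub> w) =
     (qrep M N v \<ominus>\<^bsub>M\<^esub> v) \<oplus>\<^bsub>M\<^esub> (qrep M N w \<ominus>\<^bsub>M\<^esub> w)"
    using assms qrep_props(1) by (simp add: M.add_diff_add)
  then show ?thesis using assms qrep_props submodule_facts(3) by (simp add: qrep_eq_iff)
qed

lemma qrep_smult:
  assumes "v \<in> carrier M" "a \<in> carrier R"
  shows "qrep M N (a \<odot>\<^bsub>M\<^esub> qrep M N v) = qrep M N (a \<odot>\<^bsub>M\<^esub> v)"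
proof -
  have "(a \<odot>\<^bsub>M\<^esub> qrep M N v) \<ominus>\<^bsub>M\<^esub> (a \<odot>\<^bsub>M\<^esub> v) = a \<odot>\<^bsub>M\<^esub> (qrep M N v \<ominus>\<^bsub>M\<^esub> v)"
    using assms qrep_props(1) unfolding a_minus_def by (simp add: M.smult_r_distr M.smult_r_minus)
  then show ?thesis using assms qrep_props submodule_facts(4) by (simp add: qrep_eq_iff)
qed

lemma qrep_add_right: "v \<in> carrier M \<Longrightarrow> w \<in> carrier M \<Longrightarrow> qrep M N (v \<oplus>\<^bsub>M\<^esub> qrep M N w) = qrep M N (v \<oplus>\<^bsub>M\<^esub> w)"
  using qrep_add[of "qrep M N v" w] qrep_add[of v "qrep M N w"] qrep_add[of v w]
  by (metis qrep_add qrep_props(1) qrep_qrep)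

lemma qrep_add_right_assoc: "v \<in> carrier M \<Longrightarrow> w \<in> carrier M \<Longrightarrow> x \<in> carrier M \<Longrightarrow>
    qrep M N (v \<oplus>\<^bsub>M\<^esub> (w \<oplus>\<^bsub>M\<^esub> qrep M N x)) = qrep M N (v \<oplus>\<^bsub>M\<^esub> (w \<oplus>\<^bsub>M\<^esub> x))"
  using qrep_add_right[of "v \<oplus>\<^bsub>M\<^esub> w" x] by (simp add: M.a_assoc qrep_props)

lemma qrep_add_left: "v \<in> carrier M \<Longrightarrow> w \<in> carrier M \<Longrightarrow> qrep M N (qrep M N v \<oplus>\<^bsub>M\<^esub> w) = qrep M N (v \<oplus>\<^bsub>M\<^esub> w)"
  using qrep_add_right[of w v] qrep_props(1)[of v] by (simp add: M.a_comm)

lemma mquot_module: "module R (mquot M N)"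
proof (rule moduleI)
  show "cring R" by (rule module.axioms(1)[OF M])
  show "abelian_group (mquot M N)"
  proof (rule abelian_groupI)
    fix v assume "v \<in> carrier (mquot M N)"
    then obtain v' where v': "v' \<in> carrier M" "v = qrep M N v'" by (auto simp: mquot_def)
    then show "\<exists>y\<in>carrier (mquot M N). y \<oplus>\<^bsub>mquot M N\<^esub> v = \<zero>\<^bsub>mquot M N\<^esub>"
      by (auto simp: mquot_def qrep_add M.l_neg intro!: bexI[of _ "\<ominus>\<^bsub>M\<^esub> v'"])
  qed (auto simp: mquot_def qrep_props qrep_add qrep_qrep qrep_add_right qrep_add_right_assoc qrep_add_left M.a_ac)
qed (auto simp: mquot_def qrep_add qrep_smult M.smult_l_distr M.smult_r_distr M.smult_assoc1 qrep_qrep)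

lemma qrep_linear: "qrep M N \<in> linear_maps R M (mquot M N)"
  by (rule linear_mapsI) (auto simp: mquot_def qrep_add qrep_smult)

lemma qrep_zero_iff:
  assumes "v \<in> carrier M"
  shows "qrep M N v = \<zero>\<^bsub>mquot M N\<^esub> \<longleftrightarrow> v \<in> N"
proof -
  have "\<ominus>\<^bsub>M\<^esub> \<zero>\<^bsub>M\<^esub> = \<zero>\<^bsub>M\<^esub>" by (rule M.minus_equality) auto
  then have "v \<ominus>\<^bsub>M\<^esub> \<zero>\<^bsub>M\<^esub> = v" using assms by (simp only: a_minus_def M.r_zero)
  then show ?thesis using assms by (simp add: mquot_def qrep_eq_iff)
qed

end

lemma mquot_carrier: "carrier (mquot M N) = qrep M N ` carrier M"
  by (simp add: mquot_def)

section \<open>Tensor products and base change\<close>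

lemma keys_add_le: "Poly_Mapping.keys c \<subseteq> S \<Longrightarrow> Poly_Mapping.keys d \<subseteq> S \<Longrightarrow> Poly_Mapping.keys (c + d) \<subseteq> S"
  using keys_add[of c d] by blast

lemma (in abelian_group) add_diff_cancel:
  assumes "u \<in> carrier G" "v \<in> carrier G"
  shows "(u \<oplus> v) \<ominus> u \<ominus> v = \<zero>"
proof -
  have "(u \<oplus> v) \<ominus> u = v" using assms by (simp add: a_minus_def a_comm[of u v] a_assoc r_neg)
  then show ?thesis using assms by (simp add: a_minus_def r_neg)
qed

lemma (in module) smult_diff:
  "a \<in> carrier R \<Longrightarrow> x \<in> carrier M \<Longrightarrow> y \<in> carrier M \<Longrightarrow> a \<odot>\<^bsub>M\<^esub> (x \<ominus>\<^bsub>M\<^esub> y) = a \<odot>\<^bsub>M\<^esub> x \<ominus>\<^bsub>M\<^esub> a \<odot>\<^bsub>M\<^esub> y"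
  by (simp add: a_minus_def smult_r_distr smult_r_minus)

text \<open>A product over the keys of \<open>c\<close> has an index set that varies with
  \<open>c\<close>. Taking \<open>gfinprod\<close> over all of \<open>S\<close>, which ignores
  neutral factors, fixes the index set, and additivity becomes the distributivity of one
  product.\<close>

lemma (in comm_group) free_Abelian_group_extend:
  fixes f :: "'c \<Rightarrow> 'a"
  assumes f: "\<And>k. k \<in> S \<Longrightarrow> f k \<in> carrier G"
  obtains h :: "('c \<Rightarrow>\<^sub>0 int) \<Rightarrow> 'a" where
    "\<And>c. Poly_Mapping.keys c \<subseteq> S \<Longrightarrow> finprod G (\<lambda>k. f k [^] poly_mapping.lookup c k) (Poly_Mapping.keys c) = h c"
    "\<And>c. h c \<in> carrier G" "\<And>c d. h (c + d) = h c \<otimes> h d"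
proof
  define h where "h = (\<lambda>c :: 'c \<Rightarrow>\<^sub>0 int. gfinprod G (\<lambda>k. f k [^] poly_mapping.lookup c k) S)"
  have supp: "{k \<in> S. f k [^] poly_mapping.lookup c k \<noteq> \<one>} \<subseteq> Poly_Mapping.keys c" for c :: "'c \<Rightarrow>\<^sub>0 int"
    by (auto simp: in_keys_iff)
  have fin: "finite {k \<in> S. f k [^] poly_mapping.lookup c k \<noteq> \<one>}" for c :: "'c \<Rightarrow>\<^sub>0 int"
    by (rule finite_subset[OF supp]) simp
  show "finprod G (\<lambda>k. f k [^] poly_mapping.lookup c k) (Poly_Mapping.keys c) = h c"
    if "Poly_Mapping.keys c \<subseteq> S" for c
    unfolding h_def gfinprod_def using that fin[of c]
    by (simp only: if_True) (rule finprod_mono_neutral_cong_right, use supp[of c] f in auto)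
  show "h c \<in> carrier G" for c
    unfolding h_def using f by (intro gfinprod_closed) auto
  show "h (c + d) = h c \<otimes> h d" for c d
  proof -
    have "h (c + d) = gfinprod G (\<lambda>k. f k [^] poly_mapping.lookup c k \<otimes> f k [^] poly_mapping.lookup d k) S"
      unfolding h_def using f
      by (intro gfinprod_cong) (auto simp: lookup_add int_pow_mult simp_implies_def)
    also have "\<dots> = h c \<otimes> h d" unfolding h_def
      by (rule gfinprod_distrib[OF fin fin]) (use f in auto)
    finally show ?thesis .
  qed
qed

section \<open>Elements and universal property of the tensor product\<close>

context
  fixes R :: "'r ring" and M :: "('r, 'm) module" and N :: "('r, 'n) module"
  assumes M: "module R M" and N: "module R N"
begin

interpretation M: module R M by (fact M)
interpretation N: module R N by (fact N)

private abbreviation "G \<equiv> free_Abelian_group (carrier M \<times> carrier N)"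
private abbreviation "K \<equiv> tensor_kernel R M N"
private abbreviation "T \<equiv> tensor R M N"

lemma relators_subset: "tensor_relators R M N \<subseteq> carrier G"
  unfolding tensor_relators_def
  by (auto dest!: subsetD[OF keys_diff])

lemma kernel_subgroup: "subgroup K G"
  unfolding tensor_kernel_def
  by (rule group.generate_is_subgroup) (auto simp: relators_subset simp del: carrier_free_Abelian_group_iff)

lemma kernel_normal: "K \<lhd> G"
  using comm_group.subgroup_imp_normal[OF abelian_free_Abelian_group kernel_subgroup] .

lemma kernel_keys: "c \<in> K \<Longrightarrow> Poly_Mapping.keys c \<subseteq> carrier M \<times> carrier N"
  using subgroup.mem_carrier[OF kernel_subgroup] by (simp only: carrier_free_Abelian_group_iff)

lemma add_monoid_tensor: "add_monoid T = G Mod K"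
  by (simp add: tensor_def Let_def)

lemma tensor_abelian_group: "abelian_group T"
  by (rule comm_group_abelian_groupI)
    (simp only: add_monoid_tensor comm_group.abelian_FactGroup[OF abelian_free_Abelian_group kernel_subgroup])

interpretation T: abelian_group T by (rule tensor_abelian_group)

private abbreviation "cls c \<equiv> K #>\<^bsub>G\<^esub> c"

lemma tensor_carrier: "carrier T = {cls c |c. Poly_Mapping.keys c \<subseteq> carrier M \<times> carrier N}"
  by (auto simp: tensor_def Let_def FactGroup_def RCOSETS_def free_Abelian_group_def)

lemma cls_add:
  assumes "Poly_Mapping.keys c \<subseteq> carrier M \<times> carrier N" "Poly_Mapping.keys d \<subseteq> carrier M \<times> carrier N"
  shows "cls c \<oplus>\<^bsub>T\<^esub> cls d = cls (c + d)"
  using normal.rcos_sum[OF kernel_normal, of c d] assms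
  by (simp add: tensor_def Let_def FactGroup_def)

lemma cls_zero: "cls 0 = \<zero>\<^bsub>T\<^esub>"
  using group.coset_join2[OF group_free_Abelian_group _ kernel_subgroup, of 0]
    subgroup.one_closed[OF kernel_subgroup]
  by (simp add: tensor_def Let_def FactGroup_def)

lemma cls_in: "Poly_Mapping.keys c \<subseteq> carrier M \<times> carrier N \<Longrightarrow> cls c \<in> carrier T"
  by (auto simp: tensor_carrier)

lemma cls_minus:
  assumes "Poly_Mapping.keys c \<subseteq> carrier M \<times> carrier N"
  shows "\<ominus>\<^bsub>T\<^esub> cls c = cls (- c)"
  using assms by (intro T.minus_equality) (auto simp: cls_add cls_in cls_zero)

lemma cls_diff:
  assumes "Poly_Mapping.keys c \<subseteq> carrier M \<times> carrier N" "Poly_Mapping.keys d \<subseteq> carrier M \<times> carrier N"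
  shows "cls c \<ominus>\<^bsub>T\<^esub> cls d = cls (c - d)"
  using assms by (simp add: a_minus_def cls_minus cls_add)

lemma cls_eqI:
  assumes "c - d \<in> K" "Poly_Mapping.keys c \<subseteq> carrier M \<times> carrier N" "Poly_Mapping.keys d \<subseteq> carrier M \<times> carrier N"
  shows "cls c = cls d"
proof -
  have "c \<in> cls d" unfolding r_coset_def using assms(1) by (auto intro!: bexI[of _ "c - d"])
  then show ?thesis
    using group.repr_independence[OF group_free_Abelian_group _ _ kernel_subgroup, of c d] assms(3) by auto
qed

text \<open>The step is a subtraction because induction over free abelian groups has this form; it
  covers sums and negatives at once.\<close>

lemma tensor_induct [consumes 1, case_names zero pure diff]:
  assumes "t \<in> carrier T" "P \<zero>\<^bsub>T\<^esub>"
    and "\<And>x y. x \<in> carrier M \<Longrightarrow> y \<in> carrier N \<Longrightarrow> P (pure_tensor R M N x y)"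
    and "\<And>s t. s \<in> carrier T \<Longrightarrow> t \<in> carrier T \<Longrightarrow> P s \<Longrightarrow> P t \<Longrightarrow> P (s \<ominus>\<^bsub>T\<^esub> t)"
  shows "P t"
proof -
  obtain c where c: "t = cls c" "Poly_Mapping.keys c \<subseteq> carrier M \<times> carrier N"
    using assms(1) unfolding tensor_carrier by blast
  have "P (cls c)"
  proof (rule free_Abelian_group_induct[OF c(2), of "\<lambda>c. P (cls c)"])
    show "P (cls 0)" using assms(2) by (simp only: cls_zero)
  next
    fix x y :: "('m \<times> 'n) \<Rightarrow>\<^sub>0 int"
    assume "Poly_Mapping.keys x \<subseteq> carrier M \<times> carrier N" "Poly_Mapping.keys y \<subseteq> carrier M \<times> carrier N"
      "P (cls x)" "P (cls y)"
    then show "P (cls (x - y))" using assms(4)[of "cls x" "cls y"] by (simp add: cls_diff cls_in)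
  next
    fix a assume "a \<in> carrier M \<times> carrier N"
    then show "P (cls (frag_of a))" using assms(3) by (cases a) (simp add: pure_tensor_def)
  qed
  then show ?thesis by (simp add: c)
qed

lemma pure_closed: "x \<in> carrier M \<Longrightarrow> y \<in> carrier N \<Longrightarrow> pure_tensor R M N x y \<in> carrier T"
  unfolding pure_tensor_def by (rule cls_in) simp

lemma pure_add_left:
  assumes "x \<in> carrier M" "x' \<in> carrier M" "y \<in> carrier N"
  shows "pure_tensor R M N (x \<oplus>\<^bsub>M\<^esub> x') y = pure_tensor R M N x y \<oplus>\<^bsub>T\<^esub> pure_tensor R M N x' y"
proof -
  have "frag_of (x \<oplus>\<^bsub>M\<^esub> x', y) - frag_of (x, y) - frag_of (x', y) \<in> K"
    unfolding tensor_kernel_def tensor_relators_def using assms by (intro generate.incl) blast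
  then show ?thesis unfolding pure_tensor_def using assms
    by (subst cls_add) (simp_all add: cls_eqI diff_diff_add keys_add_le)
qed

lemma pure_add_right:
  assumes "x \<in> carrier M" "y \<in> carrier N" "y' \<in> carrier N"
  shows "pure_tensor R M N x (y \<oplus>\<^bsub>N\<^esub> y') = pure_tensor R M N x y \<oplus>\<^bsub>T\<^esub> pure_tensor R M N x y'"
proof -
  have "frag_of (x, y \<oplus>\<^bsub>N\<^esub> y') - frag_of (x, y) - frag_of (x, y') \<in> K"
    unfolding tensor_kernel_def tensor_relators_def using assms by (intro generate.incl) blast
  then show ?thesis unfolding pure_tensor_def using assms
    by (subst cls_add) (simp_all add: cls_eqI diff_diff_add keys_add_le)
qed

lemma pure_balanced:
  assumes "a \<in> carrier R" "x \<in> carrier M" "y \<in> carrier N"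
  shows "pure_tensor R M N (a \<odot>\<^bsub>M\<^esub> x) y = pure_tensor R M N x (a \<odot>\<^bsub>N\<^esub> y)"
proof -
  have "frag_of (a \<odot>\<^bsub>M\<^esub> x, y) - frag_of (x, a \<odot>\<^bsub>N\<^esub> y) \<in> K"
    unfolding tensor_kernel_def tensor_relators_def using assms by (intro generate.incl) blast
  then show ?thesis unfolding pure_tensor_def using assms
    by (intro cls_eqI) auto
qed

text \<open>\<open>tensor_lift\<close> evaluates the sum at every representative of a coset and
  takes the unique value. The extension \<open>h\<close> of \<beta> to the free group kills the
  relators, hence the subgroup they generate, so it is constant on cosets.\<close>

lemma tensor_lift:
  fixes P (structure)
  assumes P: "abelian_group P"
    and closed: "\<And>x y. x \<in> carrier M \<Longrightarrow> y \<in> carrier N \<Longrightarrow> \<beta> (x, y) \<in> carrier P"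
    and addl: "\<And>x x' y. x \<in> carrier M \<Longrightarrow> x' \<in> carrier M \<Longrightarrow> y \<in> carrier N \<Longrightarrow>
        \<beta> (x \<oplus>\<^bsub>M\<^esub> x', y) = \<beta> (x, y) \<oplus> \<beta> (x', y)"
    and addr: "\<And>x y y'. x \<in> carrier M \<Longrightarrow> y \<in> carrier N \<Longrightarrow> y' \<in> carrier N \<Longrightarrow>
        \<beta> (x, y \<oplus>\<^bsub>N\<^esub> y') = \<beta> (x, y) \<oplus> \<beta> (x, y')"
    and bal: "\<And>a x y. a \<in> carrier R \<Longrightarrow> x \<in> carrier M \<Longrightarrow> y \<in> carrier N \<Longrightarrow>
        \<beta> (a \<odot>\<^bsub>M\<^esub> x, y) = \<beta> (x, a \<odot>\<^bsub>N\<^esub> y)"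
  shows "t \<in> carrier T \<Longrightarrow> tensor_lift P \<beta> t \<in> carrier P" (is "?c \<Longrightarrow> _")
    and "t \<in> carrier T \<Longrightarrow> t' \<in> carrier T \<Longrightarrow>
        tensor_lift P \<beta> (t \<oplus>\<^bsub>T\<^esub> t') = tensor_lift P \<beta> t \<oplus> tensor_lift P \<beta> t'"
    and "x \<in> carrier M \<Longrightarrow> y \<in> carrier N \<Longrightarrow> tensor_lift P \<beta> (pure_tensor R M N x y) = \<beta> (x, y)"
proof -
  interpret P: abelian_group P by (fact P)
  let ?S = "carrier M \<times> carrier N"
  have cl: "\<beta> k \<in> carrier P" if "k \<in> ?S" for k using that closed by (cases k) auto
  obtain h :: "('m \<times> 'n \<Rightarrow>\<^sub>0 int) \<Rightarrow> _" where
    h: "\<And>c. Poly_Mapping.keys c \<subseteq> ?S \<Longrightarrow>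
        finprod (add_monoid P) (\<lambda>k. \<beta> k [^]\<^bsub>add_monoid P\<^esub> poly_mapping.lookup c k) (Poly_Mapping.keys c) = h c"
    and h_closed: "\<And>c. h c \<in> carrier (add_monoid P)"
    and h_add: "\<And>c d. h (c + d) = h c \<otimes>\<^bsub>add_monoid P\<^esub> h d"
    by (rule comm_group.free_Abelian_group_extend[OF P.a_comm_group, of ?S \<beta>]) (simp_all add: cl)
  have h_closed: "h c \<in> carrier P" for c using h_closed[of c] by simp
  have h_add: "h (c + d) = h c \<oplus> h d" for c d using h_add[of c d] by simp
  have h_eq: "(\<Oplus>\<^bsub>P\<^esub>k\<in>Poly_Mapping.keys c. [poly_mapping.lookup c k] \<cdot>\<^bsub>P\<^esub> \<beta> k) = h c"
    if "Poly_Mapping.keys c \<subseteq> ?S" for c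
    unfolding finsum_def add_pow_def using h[OF that] .
  have h_of: "h (frag_of k) = \<beta> k" if "k \<in> ?S" for k
  proof -
    have "h (frag_of k) = (\<Oplus>\<^bsub>P\<^esub>j\<in>{k}. [poly_mapping.lookup (frag_of k) j] \<cdot>\<^bsub>P\<^esub> \<beta> j)"
      using h_eq[of "frag_of k"] that by simp
    also have "\<dots> = (\<Oplus>\<^bsub>P\<^esub>j\<in>{k}. \<beta> j)"
      using cl[OF that] group.int_pow_1[OF P.a_group]
      by (intro P.finsum_cong') (simp_all add: add_pow_def)
    also have "\<dots> = \<beta> k" using cl[OF that] P.finsum_insert[of "{}" k \<beta>] by simp
    finally show ?thesis .
  qed
  have h0: "h 0 = \<zero>"
    using h_add[of 0 0] h_closed[of 0] P.add.r_cancel_one by simp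
  have h_diff: "h (c - d) = h c \<ominus> h d" for c d
  proof -
    have "h (c - d) \<oplus> h d = h c" using h_add[of "c - d" d] by simp
    then show ?thesis using h_closed P.add.inv_solve_right' unfolding a_minus_def by metis
  qed
  have hK: "h c = \<zero>" if "c \<in> K" for c
  proof -
    \<comment> \<open>The zero set of \<open>h\<close> is a subgroup, so it suffices to look at the
      relators.\<close>
    have sg: "subgroup {c \<in> carrier G. h c = \<zero>} G"
      using h_diff[of 0] by (intro group.subgroupI[OF group_free_Abelian_group])
        (auto simp: h_add h0 a_minus_def simp: keys_add_le intro!: exI[of _ 0])
    have "tensor_relators R M N \<subseteq> {c \<in> carrier G. h c = \<zero>}"
    proof
      fix c assume c: "c \<in> tensor_relators R M N"
      then have "h c = \<zero>" unfolding tensor_relators_def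
        by (auto simp: h_diff h_of addl addr bal closed P.add_diff_cancel) (simp add: a_minus_def P.r_neg closed)
      then show "c \<in> {c \<in> carrier G. h c = \<zero>}" using c relators_subset by blast
    qed
    then have "K \<subseteq> {c \<in> carrier G. h c = \<zero>}"
      unfolding tensor_kernel_def
      by (rule group.generate_subgroup_incl[OF group_free_Abelian_group _ sg])
    then show ?thesis using that by blast
  qed
  have lift: "tensor_lift P \<beta> (cls c) = h c" if "Poly_Mapping.keys c \<subseteq> ?S" for c
  proof -
    have "(\<lambda>c. \<Oplus>\<^bsub>P\<^esub>k\<in>Poly_Mapping.keys c. [poly_mapping.lookup c k] \<cdot>\<^bsub>P\<^esub> \<beta> k) ` cls c = {h c}"
    proof -
      have 1: "(\<Oplus>\<^bsub>P\<^esub>k\<in>Poly_Mapping.keys d. [poly_mapping.lookup d k] \<cdot>\<^bsub>P\<^esub> \<beta> k) = h c" if d: "d \<in> cls c" for d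
      proof -
        obtain k where k: "k \<in> K" "d = k + c" using d unfolding r_coset_def by auto
        then have "Poly_Mapping.keys d \<subseteq> ?S" 
          using kernel_keys[OF k(1)] \<open>Poly_Mapping.keys c \<subseteq> ?S\<close> k(2) by (simp only: keys_add_le)
        then show ?thesis using h_eq k hK[OF k(1)] h_closed by (simp add: h_add)
      qed
      \<comment> \<open>A coset must be nonempty for the set of values to be a singleton, as
        \<open>the_elem\<close> needs.\<close>
      have "cls c \<noteq> {}" using subgroup.one_closed[OF kernel_subgroup] unfolding r_coset_def by auto
      then show ?thesis using 1 by (force simp: image_iff)
    qed
    then show ?thesis unfolding tensor_lift_def by simp
  qed
  show "t \<in> carrier T \<Longrightarrow> tensor_lift P \<beta> t \<in> carrier P"
    unfolding tensor_carrier using lift h_closed by auto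
  show "t \<in> carrier T \<Longrightarrow> t' \<in> carrier T \<Longrightarrow>
        tensor_lift P \<beta> (t \<oplus>\<^bsub>T\<^esub> t') = tensor_lift P \<beta> t \<oplus> tensor_lift P \<beta> t'"
    unfolding tensor_carrier by (auto simp: cls_add lift h_add keys_add_le)
  show "x \<in> carrier M \<Longrightarrow> y \<in> carrier N \<Longrightarrow> tensor_lift P \<beta> (pure_tensor R M N x y) = \<beta> (x, y)"
    unfolding pure_tensor_def by (subst lift) (auto simp: h_of)
qed

end

text \<open>These are the \<open>R\<close>-linear maps from \<open>M\<close> to \<open>Q\<close>
  with scalars restricted along \<phi>, written without forming the restricted module.\<close>

definition semilinear ::
  "'r ring \<Rightarrow> ('r \<Rightarrow> 'b) \<Rightarrow> ('r, 'm) module \<Rightarrow> ('b, 'n) module \<Rightarrow> ('m \<Rightarrow> 'n) \<Rightarrow> bool" where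
  "semilinear R \<phi> M Q g \<longleftrightarrow>
     (\<forall>x\<in>carrier M. g x \<in> carrier Q) \<and>
     (\<forall>x\<in>carrier M. \<forall>y\<in>carrier M. g (x \<oplus>\<^bsub>M\<^esub> y) = g x \<oplus>\<^bsub>Q\<^esub> g y) \<and>
     (\<forall>a\<in>carrier R. \<forall>x\<in>carrier M. g (a \<odot>\<^bsub>M\<^esub> x) = \<phi> a \<odot>\<^bsub>Q\<^esub> g x)"

lemma semilinearI:
  assumes "\<And>x. x \<in> carrier M \<Longrightarrow> g x \<in> carrier Q"
    and "\<And>x y. x \<in> carrier M \<Longrightarrow> y \<in> carrier M \<Longrightarrow> g (x \<oplus>\<^bsub>M\<^esub> y) = g x \<oplus>\<^bsub>Q\<^esub> g y"
    and "\<And>a x. a \<in> carrier R \<Longrightarrow> x \<in> carrier M \<Longrightarrow> g (a \<odot>\<^bsub>M\<^esub> x) = \<phi> a \<odot>\<^bsub>Q\<^esub> g x"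
  shows "semilinear R \<phi> M Q g"
  using assms unfolding semilinear_def by auto

lemma semilinearD:
  assumes "semilinear R \<phi> M Q g"
  shows "x \<in> carrier M \<Longrightarrow> g x \<in> carrier Q"
    and "x \<in> carrier M \<Longrightarrow> y \<in> carrier M \<Longrightarrow> g (x \<oplus>\<^bsub>M\<^esub> y) = g x \<oplus>\<^bsub>Q\<^esub> g y"
    and "a \<in> carrier R \<Longrightarrow> x \<in> carrier M \<Longrightarrow> g (a \<odot>\<^bsub>M\<^esub> x) = \<phi> a \<odot>\<^bsub>Q\<^esub> g x"
  using assms unfolding semilinear_def by auto

lemma semilinear_linear:
  "semilinear R \<phi> M N g \<Longrightarrow> h \<in> linear_maps B N Q \<Longrightarrow> \<phi> \<in> ring_hom R B \<Longrightarrow>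
     semilinear R \<phi> M Q (\<lambda>x. h (g x))"
  by (rule semilinearI) (auto simp: semilinearD linear_mapsD ring_hom_closed)

lemma linear_semilinear:
  "f \<in> linear_maps R L M \<Longrightarrow> semilinear R \<phi> M Q g \<Longrightarrow> semilinear R \<phi> L Q (\<lambda>x. g (f x))"
  by (rule semilinearI) (auto simp: semilinearD linear_mapsD)

text \<open>The clause that \<open>cartesian_module\<close> imposes at a single arrow, detached from
  the category: the map from the base change of \<open>M\<close> to \<open>M'\<close> induced by
  \<open>m\<close> is an isomorphism.\<close>

definition extends_scalars ::
  "'u ring \<Rightarrow> 'u ring \<Rightarrow> ('u \<Rightarrow> 'u) \<Rightarrow> ('u, 'u) module \<Rightarrow> ('u, 'u) module \<Rightarrow> ('u \<Rightarrow> 'u) \<Rightarrow> bool" where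
  "extends_scalars R B \<phi> M M' m \<longleftrightarrow>
     tensor_lift M' (\<lambda>(b, x). b \<odot>\<^bsub>M'\<^esub> m x) \<in> linear_maps B (base_change R B \<phi> M) M' \<and>
     bij_betw (tensor_lift M' (\<lambda>(b, x). b \<odot>\<^bsub>M'\<^esub> m x)) (carrier (base_change R B \<phi> M)) (carrier M')"

section \<open>Base change along a ring homomorphism\<close>

context
  fixes R B :: "'u ring" and \<phi> and M :: "('u, 'u) module"
  assumes M: "module R M" and B: "cring B" and \<phi>: "\<phi> \<in> ring_hom R B"
begin

interpretation M: module R M by (fact M)
interpretation B: cring B by (fact B)

private abbreviation "B' \<equiv> restrict_scalars \<phi> B"
private abbreviation "Tb \<equiv> base_change R B \<phi> M"
private abbreviation "pt \<equiv> pure_tensor R B' M"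

lemma restrict_scalars_module: "module R B'"
proof (rule moduleI)
  show "cring R" by (rule module.axioms(1)[OF M])
  show "abelian_group B'"
    by (rule abelian_groupI) (auto simp: restrict_scalars_def B.a_ac intro: B.add.l_inv_ex)
qed (auto simp: restrict_scalars_def ring_hom_closed[OF \<phi>] ring_hom_add[OF \<phi>] ring_hom_mult[OF \<phi>]
    ring_hom_one[OF \<phi>] B.l_distr B.r_distr B.m_assoc)

lemma base_change_simps:
  "carrier Tb = carrier (tensor R B' M)" "\<zero>\<^bsub>Tb\<^esub> = \<zero>\<^bsub>tensor R B' M\<^esub>"
  "s \<oplus>\<^bsub>Tb\<^esub> t = s \<oplus>\<^bsub>tensor R B' M\<^esub> t"
  "b \<odot>\<^bsub>Tb\<^esub> t = tensor_lift (tensor R B' M) (\<lambda>(b', x). pt (b \<otimes>\<^bsub>B\<^esub> b') x) t"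
  by (simp_all add: base_change_def Let_def)

lemma base_change_minus: "s \<ominus>\<^bsub>Tb\<^esub> t = s \<ominus>\<^bsub>tensor R B' M\<^esub> t"
  by (simp add: a_minus_def a_inv_def m_inv_def base_change_simps)

lemma base_change_abelian_group: "abelian_group Tb"
proof -
  interpret t: abelian_group "tensor R B' M"
    by (rule tensor_abelian_group[OF restrict_scalars_module M])
  show ?thesis by (rule abelian_groupI) (auto simp: base_change_simps t.a_ac intro: t.add.l_inv_ex)
qed

lemmas restrict_scalars_simps = restrict_scalars_def[of \<phi> B, THEN arg_cong, of carrier, simplified]
  restrict_scalars_def[of \<phi> B, THEN arg_cong, of ring.add, simplified]
  restrict_scalars_def[of \<phi> B, THEN arg_cong, of module.smult, simplified]

lemma base_change_pure:
  "b \<in> carrier B \<Longrightarrow> x \<in> carrier M \<Longrightarrow> pt b x \<in> carrier Tb"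
  "b \<in> carrier B \<Longrightarrow> b' \<in> carrier B \<Longrightarrow> x \<in> carrier M \<Longrightarrow> pt (b \<oplus>\<^bsub>B\<^esub> b') x = pt b x \<oplus>\<^bsub>Tb\<^esub> pt b' x"
  "b \<in> carrier B \<Longrightarrow> x \<in> carrier M \<Longrightarrow> x' \<in> carrier M \<Longrightarrow> pt b (x \<oplus>\<^bsub>M\<^esub> x') = pt b x \<oplus>\<^bsub>Tb\<^esub> pt b x'"
  "a \<in> carrier R \<Longrightarrow> b \<in> carrier B \<Longrightarrow> x \<in> carrier M \<Longrightarrow> pt b (a \<odot>\<^bsub>M\<^esub> x) = pt (\<phi> a \<otimes>\<^bsub>B\<^esub> b) x"
  using pure_closed[OF restrict_scalars_module M] pure_add_left[OF restrict_scalars_module M]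
    pure_add_right[OF restrict_scalars_module M] pure_balanced[OF restrict_scalars_module M]
  by (auto simp: base_change_simps restrict_scalars_simps)

lemma base_change_induct [consumes 1, case_names zero pure diff]:
  assumes "t \<in> carrier Tb" "P \<zero>\<^bsub>Tb\<^esub>"
    and "\<And>b x. b \<in> carrier B \<Longrightarrow> x \<in> carrier M \<Longrightarrow> P (pt b x)"
    and "\<And>s t. s \<in> carrier Tb \<Longrightarrow> t \<in> carrier Tb \<Longrightarrow> P s \<Longrightarrow> P t \<Longrightarrow> P (s \<ominus>\<^bsub>Tb\<^esub> t)"
  shows "P t"
  by (rule tensor_induct[OF restrict_scalars_module M, of t P])
    (use assms in \<open>auto simp: base_change_simps base_change_minus restrict_scalars_simps\<close>)

lemma base_change_lift_additive:
  fixes P (structure)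
  assumes P: "abelian_group P"
    and closed: "\<And>b x. b \<in> carrier B \<Longrightarrow> x \<in> carrier M \<Longrightarrow> \<beta> (b, x) \<in> carrier P"
    and addl: "\<And>b b' x. b \<in> carrier B \<Longrightarrow> b' \<in> carrier B \<Longrightarrow> x \<in> carrier M \<Longrightarrow>
        \<beta> (b \<oplus>\<^bsub>B\<^esub> b', x) = \<beta> (b, x) \<oplus> \<beta> (b', x)"
    and addr: "\<And>b x x'. b \<in> carrier B \<Longrightarrow> x \<in> carrier M \<Longrightarrow> x' \<in> carrier M \<Longrightarrow>
        \<beta> (b, x \<oplus>\<^bsub>M\<^esub> x') = \<beta> (b, x) \<oplus> \<beta> (b, x')"
    and bal: "\<And>a b x. a \<in> carrier R \<Longrightarrow> b \<in> carrier B \<Longrightarrow> x \<in> carrier M \<Longrightarrow>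
        \<beta> (\<phi> a \<otimes>\<^bsub>B\<^esub> b, x) = \<beta> (b, a \<odot>\<^bsub>M\<^esub> x)"
  shows "t \<in> carrier Tb \<Longrightarrow> tensor_lift P \<beta> t \<in> carrier P"
    and "t \<in> carrier Tb \<Longrightarrow> t' \<in> carrier Tb \<Longrightarrow>
        tensor_lift P \<beta> (t \<oplus>\<^bsub>Tb\<^esub> t') = tensor_lift P \<beta> t \<oplus> tensor_lift P \<beta> t'"
    and "b \<in> carrier B \<Longrightarrow> x \<in> carrier M \<Longrightarrow> tensor_lift P \<beta> (pt b x) = \<beta> (b, x)"
  using tensor_lift[OF restrict_scalars_module M P, of \<beta>] closed addl addr bal
  by (simp_all add: base_change_simps restrict_scalars_simps)

text \<open>Multiplication by \<open>b\<close> is itself the lift of a biadditive map, so its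
  additivity is that of \<open>tensor_lift\<close>. That the map is balanced over \<open>R\<close>
  uses commutativity of \<open>B\<close>.\<close>

lemma base_change_smult:
  assumes b: "b \<in> carrier B"
  shows "t \<in> carrier Tb \<Longrightarrow> b \<odot>\<^bsub>Tb\<^esub> t \<in> carrier Tb"
    and "t \<in> carrier Tb \<Longrightarrow> t' \<in> carrier Tb \<Longrightarrow> b \<odot>\<^bsub>Tb\<^esub> (t \<oplus>\<^bsub>Tb\<^esub> t') = (b \<odot>\<^bsub>Tb\<^esub> t) \<oplus>\<^bsub>Tb\<^esub> (b \<odot>\<^bsub>Tb\<^esub> t')"
    and "b' \<in> carrier B \<Longrightarrow> x \<in> carrier M \<Longrightarrow> b \<odot>\<^bsub>Tb\<^esub> pt b' x = pt (b \<otimes>\<^bsub>B\<^esub> b') x"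
  using base_change_lift_additive[OF tensor_abelian_group[OF restrict_scalars_module M],
      of "\<lambda>(b', x). pt (b \<otimes>\<^bsub>B\<^esub> b') x"] b
  by (simp_all add: base_change_simps(1,3,4) base_change_pure[unfolded base_change_simps(1,3)] B.r_distr
      B.m_lcomm ring_hom_closed[OF \<phi>])

lemma base_change_smult_diff:
  assumes "b \<in> carrier B" "s \<in> carrier Tb" "t \<in> carrier Tb"
  shows "b \<odot>\<^bsub>Tb\<^esub> (s \<ominus>\<^bsub>Tb\<^esub> t) = (b \<odot>\<^bsub>Tb\<^esub> s) \<ominus>\<^bsub>Tb\<^esub> (b \<odot>\<^bsub>Tb\<^esub> t)"
proof -
  interpret Tb: abelian_group Tb by (rule base_change_abelian_group)
  show ?thesis unfolding a_minus_def using assms base_change_smult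
    by (simp add: additive_minus[OF base_change_abelian_group base_change_abelian_group, of "\<lambda>t. b \<odot>\<^bsub>Tb\<^esub> t"])
qed

lemma base_change_smult_zero: "b \<in> carrier B \<Longrightarrow> b \<odot>\<^bsub>Tb\<^esub> \<zero>\<^bsub>Tb\<^esub> = \<zero>\<^bsub>Tb\<^esub>"
  using base_change_smult
  by (intro additive_zero[OF base_change_abelian_group base_change_abelian_group, of "\<lambda>t. b \<odot>\<^bsub>Tb\<^esub> t"]) auto

text \<open>Both sides of each law are additive in the tensor, so pure tensors decide.\<close>

lemma base_change_module: "module B Tb"
proof -
  interpret Tb: abelian_group Tb by (rule base_change_abelian_group)
  show ?thesis
  proof (rule moduleI)
    show "cring B" by (rule B)
    show "abelian_group Tb" by (rule base_change_abelian_group)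
    show "b \<odot>\<^bsub>Tb\<^esub> t \<in> carrier Tb" if "b \<in> carrier B" "t \<in> carrier Tb" for b t
      using that base_change_smult by blast
    show "b \<odot>\<^bsub>Tb\<^esub> (s \<oplus>\<^bsub>Tb\<^esub> t) = b \<odot>\<^bsub>Tb\<^esub> s \<oplus>\<^bsub>Tb\<^esub> b \<odot>\<^bsub>Tb\<^esub> t" if "b \<in> carrier B" "s \<in> carrier Tb" "t \<in> carrier Tb" for b s t
      using that base_change_smult by blast
    show "(a \<oplus>\<^bsub>B\<^esub> b) \<odot>\<^bsub>Tb\<^esub> t = a \<odot>\<^bsub>Tb\<^esub> t \<oplus>\<^bsub>Tb\<^esub> b \<odot>\<^bsub>Tb\<^esub> t"
      if "a \<in> carrier B" "b \<in> carrier B" "t \<in> carrier Tb" for a b t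
      using that(3)
    proof (induct rule: base_change_induct)
      case (diff s t)
      then show ?case using that(1,2) base_change_smult(1)
        by (simp add: base_change_smult_diff Tb.add_diff_add)
    qed (simp_all add: that(1,2) base_change_smult_zero base_change_smult(3) base_change_pure B.l_distr)
    show "(a \<otimes>\<^bsub>B\<^esub> b) \<odot>\<^bsub>Tb\<^esub> t = a \<odot>\<^bsub>Tb\<^esub> (b \<odot>\<^bsub>Tb\<^esub> t)"
      if "a \<in> carrier B" "b \<in> carrier B" "t \<in> carrier Tb" for a b t
      using that(3)
    proof (induct rule: base_change_induct)
      case (diff s t)
      then show ?case using that(1,2) base_change_smult(1)
        by (simp add: base_change_smult_diff)
    qed (simp_all add: that(1,2) base_change_smult_zero base_change_smult(3) B.m_assoc)
    show "\<one>\<^bsub>B\<^esub> \<odot>\<^bsub>Tb\<^esub> t = t" if "t \<in> carrier Tb" for t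
      using that
      by (induct rule: base_change_induct)
        (simp_all add: base_change_smult_zero base_change_smult(3) base_change_smult_diff)
  qed
qed

text \<open>The map from x to 1 \<otimes> x, through which all semilinear maps out of
  \<open>M\<close> factor.\<close>

lemma base_change_unit: "semilinear R \<phi> M Tb (pt \<one>\<^bsub>B\<^esub>)"
  by (rule semilinearI) (auto simp: base_change_pure base_change_smult(3) ring_hom_closed[OF \<phi>])

lemma base_change_linear_eq:
  assumes "f \<in> linear_maps B Tb Q" "g \<in> linear_maps B Tb Q" "module B Q"
    and "\<And>b x. b \<in> carrier B \<Longrightarrow> x \<in> carrier M \<Longrightarrow> f (pt b x) = g (pt b x)" "t \<in> carrier Tb"
  shows "f t = g t"
  using assms(5)
  by (induct rule: base_change_induct)
    (simp_all add: linear_maps_zero[OF assms(1) base_change_module assms(3)]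
      linear_maps_zero[OF assms(2) base_change_module assms(3)] assms(4)
      linear_maps_diff[OF assms(1) base_change_module assms(3)]
      linear_maps_diff[OF assms(2) base_change_module assms(3)])

text \<open>The lift comes only as an additive map; compatibility with scalars from \<open>B\<close>
  is checked by induction over the tensor.\<close>

lemma base_change_lift:
  fixes Q :: "('u, 'q) module"
  assumes Q: "module B Q" and g: "semilinear R \<phi> M Q g"
  shows "tensor_lift Q (\<lambda>(b, x). b \<odot>\<^bsub>Q\<^esub> g x) \<in> linear_maps B Tb Q" (is "?H \<in> _")
    and "b \<in> carrier B \<Longrightarrow> x \<in> carrier M \<Longrightarrow> tensor_lift Q (\<lambda>(b, x). b \<odot>\<^bsub>Q\<^esub> g x) (pt b x) = b \<odot>\<^bsub>Q\<^esub> g x"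
proof -
  interpret Q: module B Q by (fact Q)
  interpret Tb: module B Tb by (rule base_change_module)
  have ag: "abelian_group Q" using Q by (simp add: module_def)
  note * = base_change_lift_additive[OF ag, of "\<lambda>(b, x). b \<odot>\<^bsub>Q\<^esub> g x"]
  have H: "t \<in> carrier Tb \<Longrightarrow> ?H t \<in> carrier Q"
    "t \<in> carrier Tb \<Longrightarrow> t' \<in> carrier Tb \<Longrightarrow> ?H (t \<oplus>\<^bsub>Tb\<^esub> t') = ?H t \<oplus>\<^bsub>Q\<^esub> ?H t'"
    "b \<in> carrier B \<Longrightarrow> x \<in> carrier M \<Longrightarrow> ?H (pt b x) = b \<odot>\<^bsub>Q\<^esub> g x" for t t' b x
    using * by (simp_all add: semilinearD[OF g] Q.smult_l_distr Q.smult_r_distr Q.smult_assoc1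
        ring_hom_closed[OF \<phi>] B.m_comm[of "\<phi> _"])
  have Hd: "?H (s \<ominus>\<^bsub>Tb\<^esub> t) = ?H s \<ominus>\<^bsub>Q\<^esub> ?H t" if "s \<in> carrier Tb" "t \<in> carrier Tb" for s t
    unfolding a_minus_def using that H additive_minus[OF base_change_abelian_group ag, of ?H] by simp
  have H0: "?H \<zero>\<^bsub>Tb\<^esub> = \<zero>\<^bsub>Q\<^esub>"
    using H additive_zero[OF base_change_abelian_group ag, of ?H] by simp
  have "?H (b \<odot>\<^bsub>Tb\<^esub> t) = b \<odot>\<^bsub>Q\<^esub> ?H t" if b: "b \<in> carrier B" and t: "t \<in> carrier Tb" for b t
    using t
  proof (induct rule: base_change_induct)
    case (diff s t)
    then show ?case using b
      by (simp add: base_change_smult_diff base_change_smult(1) Hd H Q.smult_diff)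
  qed (simp_all add: b H0 H base_change_smult(3) Q.smult_assoc1 semilinearD[OF g])
  then show "?H \<in> linear_maps B Tb Q" using H by (intro linear_mapsI) auto
  show "b \<in> carrier B \<Longrightarrow> x \<in> carrier M \<Longrightarrow> ?H (pt b x) = b \<odot>\<^bsub>Q\<^esub> g x" by (rule H(3))
qed

text \<open>A pure tensor of b and x goes to b times \<open>m x\<close>, which lies in the span, and
  differences of pure tensors exhaust the base change.\<close>

lemma extends_scalars_span:
  assumes M': "module B M'" and m: "semilinear R \<phi> M M' m" and e: "extends_scalars R B \<phi> M M' m"
    and v: "v \<in> carrier M'"
  shows "v \<in> mspan B M' (m ` carrier M)"
proof -
  interpret M': module B M' by (fact M')
  let ?H = "tensor_lift M' (\<lambda>(b, x). b \<odot>\<^bsub>M'\<^esub> m x)"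
  have sub: "submodule (mspan B M' (m ` carrier M)) B M'"
    using semilinearD(1)[OF m] by (intro mspan_submodule M') auto
  have "?H t \<in> mspan B M' (m ` carrier M)" if "t \<in> carrier Tb" for t
    using that
  proof (induct rule: base_change_induct)
    case zero
    show ?case using linear_maps_zero[OF base_change_lift(1)[OF M' m] base_change_module M']
      by (simp add: mspan_zero)
  next
    case (pure b x)
    then show ?case by (auto simp: base_change_lift(2)[OF M' m] intro: mspan_smult[OF _ mspan_base])
  next
    case (diff s t)
    then show ?case using linear_maps_diff[OF base_change_lift(1)[OF M' m] base_change_module M']
        submodule_minus[OF M' sub] by simp
  qed
  moreover obtain t where "t \<in> carrier Tb" "v = ?H t"
    using e v unfolding extends_scalars_def bij_betw_def by blast
  ultimately show ?thesis by simp
qed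

text \<open>The extension is the lift to the base change after the inverse \<open>?J\<close> of the
  induced bijection. The element type of \<open>Q\<close> is arbitrary, which permits
  \<open>Q\<close> to be a quotient, a direct sum or a base change.\<close>

lemma extends_scalars_univ:
  fixes Q :: "('u, 'q) module"
  assumes M': "module B M'" and m: "semilinear R \<phi> M M' m" and e: "extends_scalars R B \<phi> M M' m"
    and Q: "module B Q" and g: "semilinear R \<phi> M Q g"
  shows "\<exists>h\<in>linear_maps B M' Q. \<forall>x\<in>carrier M. h (m x) = g x"
proof -
  interpret M': module B M' by (fact M')
  interpret Q: module B Q by (fact Q)
  interpret Tb: module B Tb by (rule base_change_module)
  let ?I = "tensor_lift M' (\<lambda>(b, x). b \<odot>\<^bsub>M'\<^esub> m x)"
  let ?H = "tensor_lift Q (\<lambda>(b, x). b \<odot>\<^bsub>Q\<^esub> g x)"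
  let ?J = "inv_into (carrier Tb) ?I"
  have I: "?I \<in> linear_maps B Tb M'" and bij: "bij_betw ?I (carrier Tb) (carrier M')"
    using e unfolding extends_scalars_def by auto
  have inj: "inj_on ?I (carrier Tb)" using bij by (simp add: bij_betw_def)
  have J: "v \<in> carrier M' \<Longrightarrow> ?J v \<in> carrier Tb" "v \<in> carrier M' \<Longrightarrow> ?I (?J v) = v" for v
    using bij by (auto simp: bij_betw_def inv_into_into f_inv_into_f)
  have JI: "t \<in> carrier Tb \<Longrightarrow> ?I t = v \<Longrightarrow> ?J v = t" for t v
    using inv_into_f_f[OF inj] by blast
  have "?J \<in> linear_maps B M' Tb"
    by (rule linear_mapsI) (auto intro!: J(1) JI simp: linear_mapsD[OF I] J)
  then have "(\<lambda>v. ?H (?J v)) \<in> linear_maps B M' Q"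
    using base_change_lift(1)[OF Q g] by (rule linear_maps_comp)
  moreover have "?H (?J (m x)) = g x" if x: "x \<in> carrier M" for x
  proof -
    have "?J (m x) = pt \<one>\<^bsub>B\<^esub> x"
      using x by (intro JI) (auto simp: base_change_pure base_change_lift(2)[OF M' m] semilinearD[OF m])
    then show ?thesis using x by (simp add: base_change_lift(2)[OF Q g] semilinearD[OF g])
  qed
  ultimately show ?thesis by (intro bexI[of _ "\<lambda>v. ?H (?J v)"] ballI)
qed

text \<open>Converse to the two preceding facts. One instance of the universal property suffices,
  the target being the base change itself: the resulting \<open>h\<close> is a left inverse of the
  induced map, and generation makes that map surjective.\<close>

lemma extends_scalarsI:
  assumes M': "module B M'" and m: "semilinear R \<phi> M M' m"
    and gen: "carrier M' \<subseteq> mspan B M' (m ` carrier M)"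
    and h: "h \<in> linear_maps B M' Tb" "\<And>x. x \<in> carrier M \<Longrightarrow> h (m x) = pt \<one>\<^bsub>B\<^esub> x"
  shows "extends_scalars R B \<phi> M M' m"
proof -
  interpret M': module B M' by (fact M')
  interpret Tb: module B Tb by (rule base_change_module)
  let ?I = "tensor_lift M' (\<lambda>(b, x). b \<odot>\<^bsub>M'\<^esub> m x)"
  have I: "?I \<in> linear_maps B Tb M'" by (rule base_change_lift(1)[OF M' m])
  have mc: "m ` carrier M \<subseteq> carrier M'" using semilinearD(1)[OF m] by auto
  \<comment> \<open>Two linear maps on the base change agree as soon as they agree on pure
    tensors.\<close>
  have "h (?I t) = t" if t: "t \<in> carrier Tb" for t
  proof (rule base_change_linear_eq[OF linear_maps_comp[OF I h(1)] _ base_change_module _ t])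
    show "(\<lambda>t. t) \<in> linear_maps B Tb Tb" by (rule linear_mapsI) auto
    show "h (?I (pt b x)) = pt b x" if "b \<in> carrier B" "x \<in> carrier M" for b x
      using that by (simp add: base_change_lift(2)[OF M' m] linear_mapsD[OF h(1)] h(2)
          semilinearD[OF m] base_change_smult(3))
  qed
  then have inj: "inj_on ?I (carrier Tb)" by (rule inj_on_inverseI)
  have "v \<in> ?I ` carrier Tb" if "v \<in> mspan B M' (m ` carrier M)" for v
    using that
  proof (induct rule: mspan_induct)
    case zero
    show ?case using linear_maps_zero[OF I base_change_module M'] by (intro image_eqI[of _ _ "\<zero>\<^bsub>Tb\<^esub>"]) auto
  next
    case (base v)
    then obtain x where "x \<in> carrier M" "v = m x" by auto
    then show ?case
      by (intro image_eqI[of _ _ "pt \<one>\<^bsub>B\<^esub> x"]) (auto simp: base_change_lift(2)[OF M' m] base_change_pure semilinearD[OF m])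
  next
    case (add v w)
    then obtain s t where "s \<in> carrier Tb" "t \<in> carrier Tb" "v = ?I s" "w = ?I t" by auto
    then show ?case by (intro image_eqI[of _ _ "s \<oplus>\<^bsub>Tb\<^esub> t"]) (auto simp: linear_mapsD[OF I])
  next
    case (smult b v)
    then obtain s where "s \<in> carrier Tb" "v = ?I s" by auto
    then show ?case using smult(1) by (intro image_eqI[of _ _ "b \<odot>\<^bsub>Tb\<^esub> s"]) (auto simp: linear_mapsD[OF I])
  qed
  then have "?I ` carrier Tb = carrier M'" using gen linear_mapsD(1)[OF I] by blast
  then show ?thesis using I inj unfolding extends_scalars_def bij_betw_def by blast
qed

end

text \<open>The induced map of \<open>N\<close> is the composite of B \<otimes> N -> B \<otimes> M,
  injective by flatness, with the induced map of \<open>M\<close>, injective by hypothesis. Its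
  image is the span of the restrictions, which is all of \<open>N'\<close> by
  \<open>gen\<close>.\<close>

lemma extends_scalars_submodule:
  fixes M :: "('u, 'u) module"
  assumes M: "module R M" and B: "cring B" and \<phi>: "\<phi> \<in> ring_hom R B"
    and M': "module B M'" and m: "semilinear R \<phi> M M' m" and e: "extends_scalars R B \<phi> M M' m"
    and small: "small TYPE('u) (carrier M)" and flat: "flat_module R (restrict_scalars \<phi> B)"
    and N: "submodule N R M" and N': "submodule N' B M'"
    and mN: "m ` N \<subseteq> N'" and gen: "N' \<subseteq> mspan B M' (m ` N)"
  shows "extends_scalars R B \<phi> (M\<lparr>carrier := N\<rparr>) (M'\<lparr>carrier := N'\<rparr>) m"
proof -
  interpret M: module R M by (fact M)
  interpret M': module B M' by (fact M')
  let ?N = "M\<lparr>carrier := N\<rparr>" and ?N' = "M'\<lparr>carrier := N'\<rparr>" and ?B = "restrict_scalars \<phi> B"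
  let ?TN = "base_change R B \<phi> ?N" and ?TM = "base_change R B \<phi> M"
  have mN1: "module R ?N" and mN2: "module B ?N'"
    using submodule.submodule_is_module N N' M M' by blast+
  interpret N: module R ?N by (fact mN1)
  interpret N': module B ?N' by (fact mN2)
  have Nsub: "N \<subseteq> carrier M" and N'sub: "N' \<subseteq> carrier M'"
    using M.submoduleE(1)[OF N] M'.submoduleE(1)[OF N'] by auto
  have sm: "semilinear R \<phi> ?N ?N' m"
    using Nsub mN by (auto intro!: semilinearI simp: semilinearD[OF m] subset_eq)
  let ?I = "tensor_lift M' (\<lambda>(b, x). b \<odot>\<^bsub>M'\<^esub> m x)"
  let ?IN = "tensor_lift ?N' (\<lambda>(b, x). b \<odot>\<^bsub>?N'\<^esub> m x)"
  let ?J = "tensor_lift (tensor R ?B M) (\<lambda>(x, y). pure_tensor R ?B M x y)"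
  have incl: "(\<lambda>y. y) \<in> linear_maps R ?N M" using Nsub by (intro linear_mapsI) auto
  \<comment> \<open>\<open>flat_module\<close> tests small modules only.\<close>
  have smallN: "small TYPE('u) (carrier ?N)" using small small_subset Nsub by simp
  have "inj_on (tensor_lift (tensor R ?B M') (\<lambda>(x, y). pure_tensor R ?B M' x (f y))) (carrier (tensor R ?B L))"
    if "module R L" "module R M'" "small TYPE('u) (carrier L)" "small TYPE('u) (carrier M')"
      "f \<in> linear_maps R L M'" "inj_on f (carrier L)" for L M' :: "('u, 'u) module" and f
    using flat that unfolding flat_module_def by blast
  from this[OF mN1 M smallN small incl] have "inj_on ?J (carrier (tensor R ?B ?N))" by simp
  then have injJ: "inj_on ?J (carrier ?TN)" by (simp add: base_change_simps[OF mN1 B \<phi>])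
  have IN: "?IN \<in> linear_maps B ?TN ?N'" by (rule base_change_lift(1)[OF mN1 B \<phi> mN2 sm])
  have I: "?I \<in> linear_maps B ?TM M'" by (rule base_change_lift(1)[OF M B \<phi> M' m])
  have injI: "inj_on ?I (carrier ?TM)" using e by (simp add: extends_scalars_def bij_betw_def)
  have pN: "b \<in> carrier B \<Longrightarrow> x \<in> N \<Longrightarrow> pure_tensor R ?B M b x \<in> carrier ?TM" for b x
    using base_change_pure(1)[OF M B \<phi>] Nsub by blast
  note J = base_change_lift_additive[OF mN1 B \<phi> tensor_abelian_group[OF restrict_scalars_module[OF M B \<phi>] M],
      of "\<lambda>(x, y). pure_tensor R ?B M x y"]
  have J1: "t \<in> carrier ?TN \<Longrightarrow> ?J t \<in> carrier ?TM"
    "t \<in> carrier ?TN \<Longrightarrow> t' \<in> carrier ?TN \<Longrightarrow> ?J (t \<oplus>\<^bsub>?TN\<^esub> t') = ?J t \<oplus>\<^bsub>?TM\<^esub> ?J t'"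
    "b \<in> carrier B \<Longrightarrow> x \<in> N \<Longrightarrow> ?J (pure_tensor R ?B ?N b x) = pure_tensor R ?B M b x" for t t' b x
    using J base_change_pure[OF M B \<phi>, unfolded base_change_simps(1,3)[OF M B \<phi>]]
    by (simp_all add: base_change_simps(1,3)[OF M B \<phi>] subsetD[OF Nsub])
  have agN: "abelian_group ?TN" and agM: "abelian_group ?TM" 
    using base_change_abelian_group[OF mN1 B \<phi>] base_change_abelian_group[OF M B \<phi>] by auto
  interpret TN: abelian_group ?TN by (fact agN)
  interpret TM: abelian_group ?TM by (fact agM)
  have Jd: "?J (s \<ominus>\<^bsub>?TN\<^esub> t) = ?J s \<ominus>\<^bsub>?TM\<^esub> ?J t" if "s \<in> carrier ?TN" "t \<in> carrier ?TN" for s t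
    unfolding a_minus_def using that J1 additive_minus[OF agN agM, of ?J] by simp
  have J0: "?J \<zero>\<^bsub>?TN\<^esub> = \<zero>\<^bsub>?TM\<^esub>"
    using J1 additive_zero[OF agN agM, of ?J] by simp
  \<comment> \<open>Negatives in \<open>?N'\<close> are inverses within the smaller carrier.
    Following \<open>?IN\<close> by the inclusion lets differences be computed in
    \<open>M'\<close>.\<close>
  have incl': "(\<lambda>y. y) \<in> linear_maps B ?N' M'" using N'sub by (intro linear_mapsI) auto
  \<comment> \<open>The two ways from the base change of \<open>N\<close> to \<open>M'\<close>
    agree, which is checked on pure tensors.\<close>
  have eq: "?IN t = ?I (?J t)" if "t \<in> carrier ?TN" for t
  proof (rule base_change_induct[OF mN1 B \<phi> that, of "\<lambda>t. ?IN t = ?I (?J t)"])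
    show "?IN \<zero>\<^bsub>?TN\<^esub> = ?I (?J \<zero>\<^bsub>?TN\<^esub>)"
      using linear_maps_zero[OF IN base_change_module[OF mN1 B \<phi>] mN2]
        linear_maps_zero[OF I base_change_module[OF M B \<phi>] M'] by (simp add: J0)
    show "?IN (pure_tensor R ?B ?N b x) = ?I (?J (pure_tensor R ?B ?N b x))"
      if "b \<in> carrier B" "x \<in> carrier ?N" for b x
      using that subsetD[OF Nsub] base_change_lift(2)[OF mN1 B \<phi> mN2 sm]
      by (simp add: J1 base_change_lift(2)[OF M B \<phi> M' m])
    show "?IN (s \<ominus>\<^bsub>?TN\<^esub> t) = ?I (?J (s \<ominus>\<^bsub>?TN\<^esub> t))"
      if "s \<in> carrier ?TN" "t \<in> carrier ?TN" "?IN s = ?I (?J s)" "?IN t = ?I (?J t)" for s t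
      using that linear_maps_diff[OF linear_maps_comp[OF IN incl'] base_change_module[OF mN1 B \<phi>] M']
        linear_maps_diff[OF I base_change_module[OF M B \<phi>] M'] by (simp add: Jd J1)
  qed
  have injIN: "inj_on ?IN (carrier ?TN)"
  proof (rule inj_onI)
    fix s t assume st: "s \<in> carrier ?TN" "t \<in> carrier ?TN" "?IN s = ?IN t"
    then have "?J s = ?J t" using injI J1(1) eq by (auto dest: inj_onD)
    then show "s = t" using injJ st by (auto dest: inj_onD)
  qed
  have "v \<in> ?IN ` carrier ?TN" if "v \<in> mspan B M' (m ` N)" for v
    using that
  proof (induct rule: mspan_induct)
    case zero
    show ?case using linear_maps_zero[OF IN base_change_module[OF mN1 B \<phi>] mN2]
      by (intro image_eqI[of _ _ "\<zero>\<^bsub>?TN\<^esub>"]) auto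
  next
    case (base v)
    then obtain x where x: "x \<in> N" "v = m x" by auto
    then have "?IN (pure_tensor R ?B ?N \<one>\<^bsub>B\<^esub> x) = v"
      using base_change_lift(2)[OF mN1 B \<phi> mN2 sm cring.cring_simprules(6)[OF B], of x]
        semilinearD(1)[OF m] Nsub by auto
    moreover have "pure_tensor R ?B ?N \<one>\<^bsub>B\<^esub> x \<in> carrier ?TN"
      using base_change_pure(1)[OF mN1 B \<phi> cring.cring_simprules(6)[OF B]] x by simp
    ultimately show ?case by blast
  next
    case (add v w)
    then obtain s t where st: "s \<in> carrier ?TN" "t \<in> carrier ?TN" and "v = ?IN s" "w = ?IN t" by blast
    then have "?IN (s \<oplus>\<^bsub>?TN\<^esub> t) = v \<oplus>\<^bsub>M'\<^esub> w" using linear_mapsD(2)[OF IN st] by simp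
    then show ?case using TN.a_closed[OF st] by (rule image_eqI[OF sym])
  next
    case (smult b v)
    then obtain s where s: "s \<in> carrier ?TN" and "v = ?IN s" by blast
    then have "?IN (b \<odot>\<^bsub>?TN\<^esub> s) = b \<odot>\<^bsub>M'\<^esub> v" using linear_mapsD(3)[OF IN smult(1) s] by simp
    then show ?case using module.smult_closed[OF base_change_module[OF mN1 B \<phi>] smult(1) s] by (rule image_eqI[OF sym])
  qed
  then have "?IN ` carrier ?TN = carrier ?N'" using gen linear_mapsD(1)[OF IN] by auto
  then show ?thesis using IN injIN unfolding extends_scalars_def bij_betw_def by blast
qed

section \<open>Factorisations and direct sums of modules\<close>

lemma linear_iff_semilinear: "f \<in> linear_maps R M N \<longleftrightarrow> semilinear R (\<lambda>a. a) M N f"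
  by (auto simp: linear_maps_def semilinear_def)

lemma semilinear_zero:
  assumes "semilinear R \<phi> M N f" "module R M" "module B N"
  shows "f \<zero>\<^bsub>M\<^esub> = \<zero>\<^bsub>N\<^esub>"
  using assms by (intro additive_zero) (auto simp: semilinearD module_def)

lemma semilinear_diff:
  assumes "semilinear R \<phi> M N f" "module R M" "module B N" "x \<in> carrier M" "y \<in> carrier M"
  shows "f (x \<ominus>\<^bsub>M\<^esub> y) = f x \<ominus>\<^bsub>N\<^esub> f y"
proof -
  interpret M: module R M by fact
  have "abelian_group M" "abelian_group N" using assms by (auto simp: module_def)
  then show ?thesis unfolding a_minus_def
    using assms additive_minus[of M N f] by (simp add: semilinearD[OF assms(1)])
qed

lemma (in abelian_group) diff_zero_iff:
  "u \<in> carrier G \<Longrightarrow> v \<in> carrier G \<Longrightarrow> u \<ominus> v = \<zero> \<longleftrightarrow> u = v"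
  using r_neg minus_equality[of v "\<ominus> u"] minus_minus unfolding a_minus_def
  by (metis a_inv_closed minus_equality minus_minus)

text \<open>Two preimages under \<open>p\<close> differ by an element of its kernel, which
  \<open>g\<close> kills, so any choice of preimages defines the factorisation. With the identity
  for \<phi> this is the linear case.\<close>

lemma semilinear_factor:
  assumes p: "p \<in> linear_maps R M I" and surj: "p ` carrier M = carrier I"
    and g: "semilinear R \<phi> M Q g"
    and ker: "\<And>v. v \<in> carrier M \<Longrightarrow> p v = \<zero>\<^bsub>I\<^esub> \<Longrightarrow> g v = \<zero>\<^bsub>Q\<^esub>"
    and mods: "module R M" "module R I" "module B Q"
  shows "\<exists>h. semilinear R \<phi> I Q h \<and> (\<forall>v\<in>carrier M. h (p v) = g v)"
proof -
  interpret M: module R M by (fact mods)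
  interpret I: module R I by (fact mods)
  interpret Q: module B Q by (fact mods)
  define h where "h = (\<lambda>n. g (inv_into (carrier M) p n))"
  have eq: "g v = g w" if "v \<in> carrier M" "w \<in> carrier M" "p v = p w" for v w
  proof -
    have "p (v \<ominus>\<^bsub>M\<^esub> w) = \<zero>\<^bsub>I\<^esub>"
      using that I.diff_zero_iff linear_mapsD(1)[OF p] by (simp add: linear_maps_diff[OF p mods(1,2)])
    then have "g v \<ominus>\<^bsub>Q\<^esub> g w = \<zero>\<^bsub>Q\<^esub>" using ker[of "v \<ominus>\<^bsub>M\<^esub> w"] that semilinear_diff[OF g mods(1,3)] by simp
    then show ?thesis using Q.diff_zero_iff semilinearD(1)[OF g] that by simp
  qed
  have hp: "h (p v) = g v" if "v \<in> carrier M" for v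
    unfolding h_def using that by (intro eq) (auto intro: inv_into_into f_inv_into_f)
  have "semilinear R \<phi> I Q h"
  proof (rule semilinearI)
    fix x assume "x \<in> carrier I"
    then obtain v where v: "v \<in> carrier M" "x = p v" using surj by blast
    then show "h x \<in> carrier Q" by (simp add: hp semilinearD[OF g])
    show "h (a \<odot>\<^bsub>I\<^esub> x) = \<phi> a \<odot>\<^bsub>Q\<^esub> h x" if "a \<in> carrier R" for a
      using that v hp[of "a \<odot>\<^bsub>M\<^esub> v"] by (simp add: hp linear_mapsD[OF p] semilinearD[OF g])
    fix y assume "y \<in> carrier I"
    then obtain w where w: "w \<in> carrier M" "y = p w" using surj by blast
    then show "h (x \<oplus>\<^bsub>I\<^esub> y) = h x \<oplus>\<^bsub>Q\<^esub> h y"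
      using v hp[of "v \<oplus>\<^bsub>M\<^esub> w"] by (simp add: hp linear_mapsD[OF p] semilinearD[OF g])
  qed
  then show ?thesis using hp by blast
qed

text \<open>The carrier of the quotient consists of elements of \<open>M\<close>, so the factorised
  map is the same function \<open>h\<close>.\<close>

lemma mquot_lift:
  assumes h: "h \<in> linear_maps R M Q" and M: "module R M" and Q: "module R Q" and N: "submodule N R M"
    and kill: "\<And>v. v \<in> N \<Longrightarrow> h v = \<zero>\<^bsub>Q\<^esub>"
  shows "h \<in> linear_maps R (mquot M N) Q" and "v \<in> carrier M \<Longrightarrow> h (qrep M N v) = h v"
proof -
  interpret M: module R M by fact
  interpret Q: module R Q by fact
  have q: "h (qrep M N v) = h v" if "v \<in> carrier M" for v
    using kill[OF qrep_props(2)[OF M N that]] linear_maps_diff[OF h M Q qrep_props(1)[OF M N that] that]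
      Q.diff_zero_iff linear_mapsD(1)[OF h] qrep_props(1)[OF M N that] that by auto
  show "h \<in> linear_maps R (mquot M N) Q"
    by (rule linear_mapsI) (auto simp: mquot_def q linear_mapsD[OF h] qrep_props[OF M N])
  show "v \<in> carrier M \<Longrightarrow> h (qrep M N v) = h v" by (rule q)
qed

text \<open>Transport of structure along an injection. It brings direct sums, whose elements are
  functions, back to the type \<open>'u\<close>.\<close>

definition mtransport :: "('m \<Rightarrow> 'n) \<Rightarrow> ('r, 'm) module \<Rightarrow> ('r, 'n) module" where
  "mtransport e M = \<lparr>carrier = e ` carrier M, monoid.mult = undefined, one = undefined,
     ring.zero = e \<zero>\<^bsub>M\<^esub>,
     ring.add = (\<lambda>v w. e (inv_into (carrier M) e v \<oplus>\<^bsub>M\<^esub> inv_into (carrier M) e w)),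
     smult = (\<lambda>a v. e (a \<odot>\<^bsub>M\<^esub> inv_into (carrier M) e v))\<rparr>"

lemma mtransport:
  assumes M: "module R M" and e: "inj_on e (carrier M)"
  shows "module R (mtransport e M)" and "e \<in> linear_maps R M (mtransport e M)"
    and "inv_into (carrier M) e \<in> linear_maps R (mtransport e M) M"
proof -
  interpret M: module R M by fact
  have [simp]: "v \<in> carrier M \<Longrightarrow> inv_into (carrier M) e (e v) = v" for v
    using e by simp
  show "module R (mtransport e M)"
  proof (rule moduleI)
    show "cring R" by (rule module.axioms(1)[OF M])
    show "abelian_group (mtransport e M)"
      by (rule abelian_groupI) (auto simp: mtransport_def M.a_ac M.r_neg intro!: bexI[OF _ M.a_inv_closed])
  qed (auto simp: mtransport_def M.smult_l_distr M.smult_r_distr M.smult_assoc1)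
  show "e \<in> linear_maps R M (mtransport e M)"
    by (rule linear_mapsI) (auto simp: mtransport_def)
  show "inv_into (carrier M) e \<in> linear_maps R (mtransport e M) M"
    by (rule linear_mapsI) (auto simp: mtransport_def)
qed

lemma mtransport_carrier: "carrier (mtransport e M) = e ` carrier M"
  by (simp add: mtransport_def)

definition dir_sum :: "'i set \<Rightarrow> ('i \<Rightarrow> ('r, 'm) module) \<Rightarrow> ('r, 'i \<Rightarrow> 'm) module" where
  "dir_sum I M = \<lparr>carrier = {w \<in> \<Pi>\<^sub>E i\<in>I. carrier (M i). finite {i \<in> I. w i \<noteq> \<zero>\<^bsub>M i\<^esub>}},
     monoid.mult = undefined, one = undefined, ring.zero = (\<lambda>i\<in>I. \<zero>\<^bsub>M i\<^esub>),
     ring.add = (\<lambda>v w. \<lambda>i\<in>I. v i \<oplus>\<^bsub>M i\<^esub> w i), smult = (\<lambda>a w. \<lambda>i\<in>I. a \<odot>\<^bsub>M i\<^esub> w i)\<rparr>"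

definition dinj :: "'i set \<Rightarrow> ('i \<Rightarrow> ('r, 'm) module) \<Rightarrow> 'i \<Rightarrow> 'm \<Rightarrow> 'i \<Rightarrow> 'm" where
  "dinj I M i v = (\<lambda>j\<in>I. if j = i then v else \<zero>\<^bsub>M j\<^esub>)"

section \<open>Direct sums\<close>

context
  fixes R :: "'r ring" and I :: "'i set" and M :: "'i \<Rightarrow> ('r, 'm) module"
  assumes R: "cring R" and M: "\<And>i. i \<in> I \<Longrightarrow> module R (M i)"
begin

lemma component_facts: assumes i: "i \<in> I"
  shows "\<zero>\<^bsub>M i\<^esub> \<in> carrier (M i)" "v \<in> carrier (M i) \<Longrightarrow> w \<in> carrier (M i) \<Longrightarrow> v \<oplus>\<^bsub>M i\<^esub> w \<in> carrier (M i)"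
    "\<zero>\<^bsub>M i\<^esub> \<oplus>\<^bsub>M i\<^esub> \<zero>\<^bsub>M i\<^esub> = \<zero>\<^bsub>M i\<^esub>" "a \<in> carrier R \<Longrightarrow> a \<odot>\<^bsub>M i\<^esub> \<zero>\<^bsub>M i\<^esub> = \<zero>\<^bsub>M i\<^esub>"
    "v \<in> carrier (M i) \<Longrightarrow> v \<oplus>\<^bsub>M i\<^esub> \<zero>\<^bsub>M i\<^esub> = v" "v \<in> carrier (M i) \<Longrightarrow> \<zero>\<^bsub>M i\<^esub> \<oplus>\<^bsub>M i\<^esub> v = v"
    "v \<in> carrier (M i) \<Longrightarrow> a \<in> carrier R \<Longrightarrow> a \<odot>\<^bsub>M i\<^esub> v \<in> carrier (M i)"
proof -
  interpret M: module R "M i" by (rule M[OF i])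
  show "\<zero>\<^bsub>M i\<^esub> \<in> carrier (M i)" "v \<in> carrier (M i) \<Longrightarrow> w \<in> carrier (M i) \<Longrightarrow> v \<oplus>\<^bsub>M i\<^esub> w \<in> carrier (M i)"
    "\<zero>\<^bsub>M i\<^esub> \<oplus>\<^bsub>M i\<^esub> \<zero>\<^bsub>M i\<^esub> = \<zero>\<^bsub>M i\<^esub>" "a \<in> carrier R \<Longrightarrow> a \<odot>\<^bsub>M i\<^esub> \<zero>\<^bsub>M i\<^esub> = \<zero>\<^bsub>M i\<^esub>"
    "v \<in> carrier (M i) \<Longrightarrow> v \<oplus>\<^bsub>M i\<^esub> \<zero>\<^bsub>M i\<^esub> = v" "v \<in> carrier (M i) \<Longrightarrow> \<zero>\<^bsub>M i\<^esub> \<oplus>\<^bsub>M i\<^esub> v = v"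
    "v \<in> carrier (M i) \<Longrightarrow> a \<in> carrier R \<Longrightarrow> a \<odot>\<^bsub>M i\<^esub> v \<in> carrier (M i)" by auto
qed

lemma dir_sum_add_closed:
  assumes "v \<in> carrier (dir_sum I M)" "w \<in> carrier (dir_sum I M)"
  shows "v \<oplus>\<^bsub>dir_sum I M\<^esub> w \<in> carrier (dir_sum I M)"
proof -
  have "{i \<in> I. v i \<oplus>\<^bsub>M i\<^esub> w i \<noteq> \<zero>\<^bsub>M i\<^esub>} \<subseteq> {i \<in> I. v i \<noteq> \<zero>\<^bsub>M i\<^esub>} \<union> {i \<in> I. w i \<noteq> \<zero>\<^bsub>M i\<^esub>}"
    using component_facts by auto
  then have "finite {i \<in> I. v i \<oplus>\<^bsub>M i\<^esub> w i \<noteq> \<zero>\<^bsub>M i\<^esub>}"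
    using assms by (auto simp: dir_sum_def intro: finite_subset)
  then show ?thesis using assms component_facts by (auto simp: dir_sum_def PiE_iff cong: conj_cong)
qed

lemma dir_sum_smult_closed:
  assumes "a \<in> carrier R" "w \<in> carrier (dir_sum I M)"
  shows "a \<odot>\<^bsub>dir_sum I M\<^esub> w \<in> carrier (dir_sum I M)"
proof -
  have "{i \<in> I. a \<odot>\<^bsub>M i\<^esub> w i \<noteq> \<zero>\<^bsub>M i\<^esub>} \<subseteq> {i \<in> I. w i \<noteq> \<zero>\<^bsub>M i\<^esub>}"
    using component_facts assms by auto
  then have "finite {i \<in> I. a \<odot>\<^bsub>M i\<^esub> w i \<noteq> \<zero>\<^bsub>M i\<^esub>}"
    using assms by (auto simp: dir_sum_def intro: finite_subset)
  then show ?thesis using assms component_facts by (auto simp: dir_sum_def PiE_iff cong: conj_cong)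
qed

lemma dir_sum_zero_closed: "\<zero>\<^bsub>dir_sum I M\<^esub> \<in> carrier (dir_sum I M)"
  using component_facts by (auto simp: dir_sum_def cong: conj_cong)

lemma dir_sum_eqI:
  assumes "v \<in> carrier (dir_sum I M)" "w \<in> carrier (dir_sum I M)" "\<And>i. i \<in> I \<Longrightarrow> v i = w i"
  shows "v = w"
  using assms by (auto simp: dir_sum_def intro: PiE_ext)

lemma dir_sum_apply: "i \<in> I \<Longrightarrow> (v \<oplus>\<^bsub>dir_sum I M\<^esub> w) i = v i \<oplus>\<^bsub>M i\<^esub> w i"
  "i \<in> I \<Longrightarrow> (a \<odot>\<^bsub>dir_sum I M\<^esub> w) i = a \<odot>\<^bsub>M i\<^esub> w i" "i \<in> I \<Longrightarrow> \<zero>\<^bsub>dir_sum I M\<^esub> i = \<zero>\<^bsub>M i\<^esub>"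
  by (auto simp: dir_sum_def)

lemma dir_sum_carrierD: "w \<in> carrier (dir_sum I M) \<Longrightarrow> i \<in> I \<Longrightarrow> w i \<in> carrier (M i)"
  by (auto simp: dir_sum_def)

lemma dir_sum_module: "module R (dir_sum I M)"
proof (rule moduleI)
  show "cring R" by (rule R)
  have am: "module R (M i)" "abelian_group (M i)" if "i \<in> I" for i using M[OF that] by (auto simp: module_def)
  show "abelian_group (dir_sum I M)"
  proof (rule abelian_groupI)
    fix u v w assume uvw: "u \<in> carrier (dir_sum I M)" "v \<in> carrier (dir_sum I M)" "w \<in> carrier (dir_sum I M)"
    show "u \<oplus>\<^bsub>dir_sum I M\<^esub> v \<oplus>\<^bsub>dir_sum I M\<^esub> w = u \<oplus>\<^bsub>dir_sum I M\<^esub> (v \<oplus>\<^bsub>dir_sum I M\<^esub> w)"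
      using uvw am by (intro dir_sum_eqI) (auto simp: dir_sum_add_closed dir_sum_apply dir_sum_carrierD
          abelian_monoid.a_assoc abelian_group_def)
  next
    fix v w assume vw: "v \<in> carrier (dir_sum I M)" "w \<in> carrier (dir_sum I M)"
    show "v \<oplus>\<^bsub>dir_sum I M\<^esub> w = w \<oplus>\<^bsub>dir_sum I M\<^esub> v"
      using vw am by (intro dir_sum_eqI) (auto simp: dir_sum_add_closed dir_sum_apply dir_sum_carrierD
          abelian_monoid.a_comm abelian_group_def)
  next
    fix v assume v: "v \<in> carrier (dir_sum I M)"
    show "\<zero>\<^bsub>dir_sum I M\<^esub> \<oplus>\<^bsub>dir_sum I M\<^esub> v = v"
      using v by (intro dir_sum_eqI) (auto simp: dir_sum_add_closed dir_sum_zero_closed dir_sum_apply dir_sum_carrierD component_facts)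
    \<comment> \<open>The negative is formed as the action of -1, because closure under scalars is
      already available.\<close>
    have "(\<ominus>\<^bsub>R\<^esub> \<one>\<^bsub>R\<^esub>) \<odot>\<^bsub>dir_sum I M\<^esub> v \<in> carrier (dir_sum I M)"
      using v cring.cring_simprules(3,6)[OF R] by (intro dir_sum_smult_closed) auto
    moreover have "(\<ominus>\<^bsub>R\<^esub> \<one>\<^bsub>R\<^esub>) \<odot>\<^bsub>dir_sum I M\<^esub> v \<oplus>\<^bsub>dir_sum I M\<^esub> v = \<zero>\<^bsub>dir_sum I M\<^esub>"
      using v calculation am by (intro dir_sum_eqI)
        (auto simp: dir_sum_add_closed dir_sum_zero_closed dir_sum_apply dir_sum_carrierD abelian_group.l_neg
          simp flip: module.neg_smult)
    ultimately show "\<exists>y\<in>carrier (dir_sum I M). y \<oplus>\<^bsub>dir_sum I M\<^esub> v = \<zero>\<^bsub>dir_sum I M\<^esub>" by blast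
  qed (auto simp: dir_sum_add_closed dir_sum_zero_closed)
next
  have am: "module R (M i)" if "i \<in> I" for i using M[OF that] .
  fix a b v assume abv: "a \<in> carrier R" "b \<in> carrier R" "v \<in> carrier (dir_sum I M)"
  show "(a \<oplus>\<^bsub>R\<^esub> b) \<odot>\<^bsub>dir_sum I M\<^esub> v = a \<odot>\<^bsub>dir_sum I M\<^esub> v \<oplus>\<^bsub>dir_sum I M\<^esub> b \<odot>\<^bsub>dir_sum I M\<^esub> v"
    using abv am cring.cring_simprules(1)[OF R] by (intro dir_sum_eqI)
      (auto simp: dir_sum_add_closed dir_sum_smult_closed dir_sum_apply dir_sum_carrierD module.smult_l_distr)
  show "a \<otimes>\<^bsub>R\<^esub> b \<odot>\<^bsub>dir_sum I M\<^esub> v = a \<odot>\<^bsub>dir_sum I M\<^esub> (b \<odot>\<^bsub>dir_sum I M\<^esub> v)"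
    using abv am cring.cring_simprules(5)[OF R] by (intro dir_sum_eqI)
      (auto simp: dir_sum_add_closed dir_sum_smult_closed dir_sum_apply dir_sum_carrierD module.smult_assoc1)
next
  have am: "module R (M i)" if "i \<in> I" for i using M[OF that] .
  fix v assume abv: "v \<in> carrier (dir_sum I M)"
  show "\<one>\<^bsub>R\<^esub> \<odot>\<^bsub>dir_sum I M\<^esub> v = v"
    using abv am cring.cring_simprules(6)[OF R] by (intro dir_sum_eqI)
      (auto simp: dir_sum_smult_closed dir_sum_apply dir_sum_carrierD module.smult_one)
next
  have am: "module R (M i)" "abelian_group (M i)" if "i \<in> I" for i using M[OF that] by (auto simp: module_def)
  fix a v w assume abv: "a \<in> carrier R" "v \<in> carrier (dir_sum I M)" "w \<in> carrier (dir_sum I M)"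
  show "a \<odot>\<^bsub>dir_sum I M\<^esub> (v \<oplus>\<^bsub>dir_sum I M\<^esub> w) = a \<odot>\<^bsub>dir_sum I M\<^esub> v \<oplus>\<^bsub>dir_sum I M\<^esub> a \<odot>\<^bsub>dir_sum I M\<^esub> w"
    using abv am by (intro dir_sum_eqI)
      (auto simp: dir_sum_add_closed dir_sum_smult_closed dir_sum_apply dir_sum_carrierD module.smult_r_distr[OF am(1)])
qed (rule dir_sum_smult_closed)

lemma dinj_closed: "i \<in> I \<Longrightarrow> v \<in> carrier (M i) \<Longrightarrow> dinj I M i v \<in> carrier (dir_sum I M)"
  using component_facts by (auto simp: dir_sum_def dinj_def intro!: finite_subset[of _ "{i}"])

lemma dinj_linear: "i \<in> I \<Longrightarrow> dinj I M i \<in> linear_maps R (M i) (dir_sum I M)"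
  by (intro linear_mapsI dinj_closed dir_sum_eqI)
    (auto simp: component_facts dinj_closed dir_sum_apply dir_sum_add_closed dir_sum_smult_closed, auto simp: dinj_def component_facts)

text \<open>Induction over a finite set that contains the support: splitting off the component at
  one index leaves an element \<open>w'\<close> supported on the rest.\<close>

lemma dir_sum_induct [consumes 1, case_names zero inj add]:
  assumes "w \<in> carrier (dir_sum I M)" "P \<zero>\<^bsub>dir_sum I M\<^esub>"
    and inj: "\<And>i v. i \<in> I \<Longrightarrow> v \<in> carrier (M i) \<Longrightarrow> P (dinj I M i v)"
    and add: "\<And>v w. v \<in> carrier (dir_sum I M) \<Longrightarrow> w \<in> carrier (dir_sum I M) \<Longrightarrow> P v \<Longrightarrow> P w \<Longrightarrow>
        P (v \<oplus>\<^bsub>dir_sum I M\<^esub> w)"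
  shows "P w"
proof -
  have "w \<in> carrier (dir_sum I M) \<Longrightarrow> {i \<in> I. w i \<noteq> \<zero>\<^bsub>M i\<^esub>} \<subseteq> S \<Longrightarrow> P w" if "finite S" for S
    using that
  proof (induct S arbitrary: w)
    case empty
    then have "w = \<zero>\<^bsub>dir_sum I M\<^esub>" by (intro dir_sum_eqI) (auto simp: dir_sum_zero_closed dir_sum_apply)
    then show ?case using assms(2) by simp
  next
    case (insert k S)
    show ?case
    proof (cases "k \<in> I")
      case True
      define w' where "w' = (\<lambda>i\<in>I. if i = k then \<zero>\<^bsub>M i\<^esub> else w i)"
      have "finite {i \<in> I. w' i \<noteq> \<zero>\<^bsub>M i\<^esub>}"
        using insert.hyps(1) insert.prems(2) by (auto simp: w'_def intro!: finite_subset[of _ "insert k S"])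
      then have w': "w' \<in> carrier (dir_sum I M)"
        using insert.prems(1) component_facts by (auto simp: dir_sum_def w'_def PiE_iff)
      have wk: "w k \<in> carrier (M k)" using dir_sum_carrierD[OF insert.prems(1) True] .
      have "w = dinj I M k (w k) \<oplus>\<^bsub>dir_sum I M\<^esub> w'"
        using insert.prems(1) w' dinj_closed[OF True wk] wk
        by (intro dir_sum_eqI) (auto simp: dir_sum_add_closed dir_sum_apply w'_def dinj_def component_facts dir_sum_carrierD)
      moreover have "P w'" using insert.prems(2) by (intro insert.hyps(3) w') (auto simp: w'_def)
      ultimately show ?thesis using add[OF dinj_closed[OF True wk] w' inj[OF True wk]] by simp
    next
      case False
      then show ?thesis using insert by auto
    qed
  qed
  then show ?thesis using assms(1) by (auto simp: dir_sum_def)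
qed

text \<open>The additive part is the universal property of the library's \<open>sum_group\<close>,
  which has the same carrier; linearity then follows by induction over the direct sum.\<close>

lemma dir_sum_univ:
  fixes Q :: "('r, 'q) module"
  assumes Q: "module R Q" and g: "\<And>i. i \<in> I \<Longrightarrow> g i \<in> linear_maps R (M i) Q"
  shows "\<exists>h\<in>linear_maps R (dir_sum I M) Q. \<forall>i\<in>I. \<forall>v\<in>carrier (M i). h (dinj I M i v) = g i v"
proof -
  interpret Q: module R Q by fact
  interpret D: module R "dir_sum I M" by (rule dir_sum_module)
  let ?A = "\<lambda>i. add_monoid (M i)" and ?Q = "add_monoid Q"
  define h where "h = (\<lambda>x. gfinprod ?Q (\<lambda>i. (g i) (x i)) I)"
  have grp: "group (?A i)" if "i \<in> I" for i using M[OF that]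
    by (auto simp: module_def intro: abelian_group.a_group)
  have "h \<in> hom (sum_group I ?A) ?Q"
    unfolding h_def
    by (rule comm_group.hom_group_sum[OF Q.a_comm_group])
      (use grp in \<open>auto simp: hom_def linear_mapsD[OF g]\<close>)
  moreover have "carrier (sum_group I ?A) = carrier (dir_sum I M)"
    using grp by (subst carrier_sum_group) (auto simp: dir_sum_def)
  ultimately have h: "w \<in> carrier (dir_sum I M) \<Longrightarrow> h w \<in> carrier Q"
    "v \<in> carrier (dir_sum I M) \<Longrightarrow> w \<in> carrier (dir_sum I M) \<Longrightarrow> h (v \<oplus>\<^bsub>dir_sum I M\<^esub> w) = h v \<oplus>\<^bsub>Q\<^esub> h w" for v w
    by (auto simp: hom_def dir_sum_def)
  have h_inj: "h (dinj I M i v) = g i v" if i: "i \<in> I" and v: "v \<in> carrier (M i)" for i v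
  proof -
    have eq: "g j (dinj I M i v j) = (if j = i then g i v else \<zero>\<^bsub>Q\<^esub>)" if "j \<in> I" for j
      using that linear_maps_zero[OF g M Q] by (auto simp: dinj_def)
    then have "h (dinj I M i v) = gfinprod ?Q (\<lambda>j. if j = i then g i v else \<zero>\<^bsub>Q\<^esub>) I"
      unfolding h_def gfinprod_def using linear_mapsD(1)[OF g[OF i] v]
      by (intro if_cong arg_cong[of _ _ finite] comm_monoid.finprod_cong[OF comm_group.axioms(1)[OF Q.a_comm_group]])
        (auto simp: simp_implies_def split: if_splits)
    also have "\<dots> = g i v"
    \<comment> \<open>\<open>gfinprod\<close> runs over the non-neutral indices: there is one of
      them, or none when \<open>g i v\<close> is zero.\<close>
    proof (cases "g i v = \<zero>\<^bsub>Q\<^esub>")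
      case True
      have "{x \<in> I. (if x = i then g i v else \<zero>\<^bsub>Q\<^esub>) \<noteq> \<one>\<^bsub>?Q\<^esub>} = {}" using True by auto
      note * = this
      show ?thesis unfolding gfinprod_def * using True Q.finsum_empty by (simp add: finsum_def)
    next
      case False
      then have *: "{x \<in> I. (if x = i then g i v else \<zero>\<^bsub>Q\<^esub>) \<noteq> \<one>\<^bsub>?Q\<^esub>} = {i}" using i by auto
      have "(\<Oplus>\<^bsub>Q\<^esub>j\<in>{i}. if j = i then g i v else \<zero>\<^bsub>Q\<^esub>) = g i v"
        using linear_mapsD(1)[OF g[OF i] v] by simp
      then show ?thesis unfolding gfinprod_def * by (simp only: finsum_def) simp
    qed
    finally show ?thesis .
  qed
  have h0: "h \<zero>\<^bsub>dir_sum I M\<^esub> = \<zero>\<^bsub>Q\<^esub>"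
    using h by (intro additive_zero[OF D.abelian_group_axioms Q.abelian_group_axioms]) simp_all
  have hs: "h (a \<odot>\<^bsub>dir_sum I M\<^esub> w) = a \<odot>\<^bsub>Q\<^esub> h w" if a: "a \<in> carrier R" and w: "w \<in> carrier (dir_sum I M)" for a w
    using w
  proof (induct rule: dir_sum_induct)
    case (inj i v)
    then show ?case using a h_inj[of i "a \<odot>\<^bsub>M i\<^esub> v"] linear_mapsD(3)[OF dinj_linear, of i a v]
        component_facts(7) h_inj linear_mapsD(3)[OF g] by simp
  qed (simp_all add: a h0 D.smult_r_distr Q.smult_r_distr h)
  have "h \<in> linear_maps R (dir_sum I M) Q" using h hs by (intro linear_mapsI) auto
  then show ?thesis using h_inj by (intro bexI[of _ h]) auto
qed

end

section \<open>Cartesian modules\<close>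

locale qcoh =
  fixes C :: "('o, 'a) category" and A :: "('o, 'a, 'u) presheaf"
  assumes cat: "category C" and rings: "ring_presheaf C A" and flat: "flat_presheaf C A"
    and univ: "universe TYPE('u)"
    and small_Ob: "small TYPE('u) (Ob C)" and small_Ar: "small TYPE('u) (Ar C)"
begin

abbreviation cart where "cart M \<equiv> cartesian_module C A M"

lemma Ar_Ob: "f \<in> Ar C \<Longrightarrow> src C f \<in> Ob C" "f \<in> Ar C \<Longrightarrow> tgt C f \<in> Ob C"
  using cat by (auto simp: category_def)

lemma ide_Ar: "x \<in> Ob C \<Longrightarrow> ide C x \<in> Ar C \<and> src C (ide C x) = x \<and> tgt C (ide C x) = x"
  using cat by (auto simp: category_def Hom_def)

lemma cmp_Ar: "f \<in> Ar C \<Longrightarrow> g \<in> Ar C \<Longrightarrow> tgt C f = src C g \<Longrightarrow>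
    g \<bullet>\<^bsub>C\<^esub> f \<in> Ar C \<and> src C (g \<bullet>\<^bsub>C\<^esub> f) = src C f \<and> tgt C (g \<bullet>\<^bsub>C\<^esub> f) = tgt C g"
  using cat by (auto simp: category_def Hom_def)

lemma A_cring: "x \<in> Ob C \<Longrightarrow> cring (sec A x)"
  and A_small: "x \<in> Ob C \<Longrightarrow> small TYPE('u) (carrier (sec A x))"
  using rings by (auto simp: ring_presheaf_def small_cring_def)

lemma A_hom: "f \<in> Ar C \<Longrightarrow> res A f \<in> ring_hom (sec A (tgt C f)) (sec A (src C f))"
  using rings by (auto simp: ring_presheaf_def rhom_def)

lemma A_flat: "f \<in> Ar C \<Longrightarrow> flat_module (sec A (tgt C f)) (restrict_scalars (res A f) (sec A (src C f)))"
  using flat by (auto simp: flat_presheaf_def)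

text \<open>All of \<open>cartesian_module\<close> except the condition on base change.\<close>

definition presheaf_module :: "('o, 'a, 'u) module_presheaf \<Rightarrow> bool" where
  "presheaf_module M \<longleftrightarrow>
     (\<forall>x\<in>Ob C. module (sec A x) (msec M x) \<and> small TYPE('u) (carrier (msec M x)) \<and>
        (\<forall>v\<in>carrier (msec M x). mres M (ide C x) v = v)) \<and>
     (\<forall>f\<in>Ar C. semilinear (sec A (tgt C f)) (res A f) (msec M (tgt C f)) (msec M (src C f)) (mres M f)) \<and>
     (\<forall>f\<in>Ar C. \<forall>g\<in>Ar C. tgt C f = src C g \<longrightarrow>
        (\<forall>v\<in>carrier (msec M (tgt C g)). mres M (g \<bullet>\<^bsub>C\<^esub> f) v = mres M f (mres M g v)))"

lemma cart_iff:
  "cart M \<longleftrightarrow> presheaf_module M \<and>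
     (\<forall>f\<in>Ar C. extends_scalars (sec A (tgt C f)) (sec A (src C f)) (res A f)
        (msec M (tgt C f)) (msec M (src C f)) (mres M f))"
  unfolding cartesian_module_def presheaf_module_def extends_scalars_def induced_map_def Let_def
    semilinear_def Pi_iff
  by blast

lemma cartD:
  assumes "cart M"
  shows "x \<in> Ob C \<Longrightarrow> module (sec A x) (msec M x)"
    and "x \<in> Ob C \<Longrightarrow> small TYPE('u) (carrier (msec M x))"
    and "x \<in> Ob C \<Longrightarrow> v \<in> carrier (msec M x) \<Longrightarrow> mres M (ide C x) v = v"
    and "f \<in> Ar C \<Longrightarrow> semilinear (sec A (tgt C f)) (res A f) (msec M (tgt C f)) (msec M (src C f)) (mres M f)"
    and "f \<in> Ar C \<Longrightarrow> g \<in> Ar C \<Longrightarrow> tgt C f = src C g \<Longrightarrow> v \<in> carrier (msec M (tgt C g)) \<Longrightarrow>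
        mres M (g \<bullet>\<^bsub>C\<^esub> f) v = mres M f (mres M g v)"
    and "f \<in> Ar C \<Longrightarrow> extends_scalars (sec A (tgt C f)) (sec A (src C f)) (res A f)
        (msec M (tgt C f)) (msec M (src C f)) (mres M f)"
  using assms unfolding cart_iff presheaf_module_def by blast+

lemma cart_group: "cart M \<Longrightarrow> x \<in> Ob C \<Longrightarrow> abelian_group (msec M x)"
  using cartD(1) by (auto simp: module_def)

lemma cart_span:
  assumes "cart M" "f \<in> Ar C" "v \<in> carrier (msec M (src C f))"
  shows "v \<in> mspan (sec A (src C f)) (msec M (src C f)) (mres M f ` carrier (msec M (tgt C f)))"
  using assms
  by (intro extends_scalars_span[OF cartD(1)[OF assms(1)] A_cring A_hom cartD(1)[OF assms(1)] cartD(4,6)])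
    (auto simp: Ar_Ob)

text \<open>The target \<open>Q\<close> is any module over A(U), on any element type; it need not be
  the value of a presheaf.\<close>

lemma cart_univ:
  fixes Q :: "('u, 'q) module"
  assumes M: "cart M" and f: "f \<in> Ar C" and Q: "module (sec A (src C f)) Q"
    and g: "semilinear (sec A (tgt C f)) (res A f) (msec M (tgt C f)) Q g"
  shows "\<exists>h\<in>linear_maps (sec A (src C f)) (msec M (src C f)) Q.
     \<forall>v\<in>carrier (msec M (tgt C f)). h (mres M f v) = g v"
  using f by (intro extends_scalars_univ[OF cartD(1)[OF M] A_cring A_hom cartD(1)[OF M]
        cartD(4)[OF M] cartD(6)[OF M] Q g]) (auto simp: Ar_Ob)

text \<open>\<open>univ\<close> is demanded only for targets on the element type of tensor products,
  because the one target to which it is applied is the base change itself.\<close>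

lemma cartI:
  assumes M: "presheaf_module M"
    and gen: "\<And>f. f \<in> Ar C \<Longrightarrow> carrier (msec M (src C f)) \<subseteq>
        mspan (sec A (src C f)) (msec M (src C f)) (mres M f ` carrier (msec M (tgt C f)))"
    and univ: "\<And>f (Q :: ('u, ('u \<times> 'u \<Rightarrow>\<^sub>0 int) set) module) g. f \<in> Ar C \<Longrightarrow>
        module (sec A (src C f)) Q \<Longrightarrow> semilinear (sec A (tgt C f)) (res A f) (msec M (tgt C f)) Q g \<Longrightarrow>
        \<exists>h\<in>linear_maps (sec A (src C f)) (msec M (src C f)) Q.
          \<forall>v\<in>carrier (msec M (tgt C f)). h (mres M f v) = g v"
  shows "cart M"
  unfolding cart_iff
proof (intro conjI ballI)
  show "presheaf_module M" by fact
  fix f assume f: "f \<in> Ar C"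
  have m: "module (sec A (tgt C f)) (msec M (tgt C f))" "module (sec A (src C f)) (msec M (src C f))"
    using M Ar_Ob[OF f] by (auto simp: presheaf_module_def)
  have s: "semilinear (sec A (tgt C f)) (res A f) (msec M (tgt C f)) (msec M (src C f)) (mres M f)"
    using M f by (auto simp: presheaf_module_def)
  note B = A_cring[OF Ar_Ob(1)[OF f]] and hom = A_hom[OF f]
  obtain h where h: "h \<in> linear_maps (sec A (src C f)) (msec M (src C f))
      (base_change (sec A (tgt C f)) (sec A (src C f)) (res A f) (msec M (tgt C f)))"
    and eq: "\<forall>v\<in>carrier (msec M (tgt C f)). h (mres M f v) =
      pure_tensor (sec A (tgt C f)) (restrict_scalars (res A f) (sec A (src C f))) (msec M (tgt C f)) \<one>\<^bsub>sec A (src C f)\<^esub> v"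
    using univ[OF f base_change_module[OF m(1) B hom] base_change_unit[OF m(1) B hom]] by blast
  show "extends_scalars (sec A (tgt C f)) (sec A (src C f)) (res A f)
        (msec M (tgt C f)) (msec M (src C f)) (mres M f)"
    by (rule extends_scalarsI[OF m(1) B hom m(2) s gen[OF f] h]) (use eq in blast)
qed

subsection \<open>Cartesian submodules\<close>

text \<open>
  By flatness the generation condition alone makes a subpresheaf of a cartesian module cartesian.
\<close>

definition csub :: "('o, 'a, 'u) module_presheaf \<Rightarrow> ('o \<Rightarrow> 'u set) \<Rightarrow> bool" where
  "csub M N \<longleftrightarrow>
     (\<forall>x\<in>Ob C. submodule (N x) (sec A x) (msec M x)) \<and>
     (\<forall>f\<in>Ar C. mres M f ` N (tgt C f) \<subseteq> N (src C f) \<and>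
        N (src C f) \<subseteq> mspan (sec A (src C f)) (msec M (src C f)) (mres M f ` N (tgt C f)))"

lemma csubD:
  assumes "csub M N"
  shows "x \<in> Ob C \<Longrightarrow> submodule (N x) (sec A x) (msec M x)"
    and "f \<in> Ar C \<Longrightarrow> v \<in> N (tgt C f) \<Longrightarrow> mres M f v \<in> N (src C f)"
    and "f \<in> Ar C \<Longrightarrow> v \<in> N (src C f) \<Longrightarrow>
        v \<in> mspan (sec A (src C f)) (msec M (src C f)) (mres M f ` N (tgt C f))"
  using assms unfolding csub_def by blast+

lemma csub_props:
  assumes "cart M" "csub M N" "x \<in> Ob C"
  shows "N x \<subseteq> carrier (msec M x)" "\<zero>\<^bsub>msec M x\<^esub> \<in> N x"
    "v \<in> N x \<Longrightarrow> w \<in> N x \<Longrightarrow> v \<oplus>\<^bsub>msec M x\<^esub> w \<in> N x"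
    "a \<in> carrier (sec A x) \<Longrightarrow> v \<in> N x \<Longrightarrow> a \<odot>\<^bsub>msec M x\<^esub> v \<in> N x"
  using csubD(1)[OF assms(2,3)] module.submodule_iff[OF cartD(1)[OF assms(1,3)]] by auto

definition subm :: "('o, 'a, 'u) module_presheaf \<Rightarrow> ('o \<Rightarrow> 'u set) \<Rightarrow> ('o, 'a, 'u) module_presheaf" where
  "subm M N = \<lparr>msec = (\<lambda>x. (msec M x)\<lparr>carrier := N x\<rparr>), mres = mres M\<rparr>"

lemma subm_simps [simp]: "msec (subm M N) x = (msec M x)\<lparr>carrier := N x\<rparr>" "mres (subm M N) = mres M"
  by (simp_all add: subm_def)

text \<open>The only place where flatness is invoked; kernels and images inherit it from
  here.\<close>

lemma subm_cart:
  assumes M: "cart M" and N: "csub M N"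
  shows "cart (subm M N)"
  unfolding cart_iff
proof (intro conjI ballI)
  show "presheaf_module (subm M N)"
    unfolding presheaf_module_def
  proof (intro conjI ballI impI)
    fix x assume x: "x \<in> Ob C"
    show "module (sec A x) (msec (subm M N) x)"
      using submodule.submodule_is_module[OF csubD(1)[OF N x] cartD(1)[OF M x]] by simp
    show "small TYPE('u) (carrier (msec (subm M N) x))"
      using small_subset[OF cartD(2)[OF M x] csub_props(1)[OF M N x]] by simp
    show "mres (subm M N) (ide C x) v = v" if "v \<in> carrier (msec (subm M N) x)" for v
      using that csub_props(1)[OF M N x] cartD(3)[OF M x] by auto
  next
    fix f assume f: "f \<in> Ar C"
    show "semilinear (sec A (tgt C f)) (res A f) (msec (subm M N) (tgt C f)) (msec (subm M N) (src C f)) (mres (subm M N) f)"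
      using subsetD[OF csub_props(1)[OF M N Ar_Ob(2)[OF f]]] csubD(2)[OF N f]
      by (intro semilinearI) (auto simp: semilinearD[OF cartD(4)[OF M f]])
  next
    fix f g v
    assume "f \<in> Ar C" "g \<in> Ar C" "tgt C f = src C g" "v \<in> carrier (msec (subm M N) (tgt C g))"
    then show "mres (subm M N) (g \<bullet>\<^bsub>C\<^esub> f) v = mres (subm M N) f (mres (subm M N) g v)"
      using cartD(5)[OF M] subsetD[OF csub_props(1)[OF M N Ar_Ob(2)]] by simp
  qed
  fix f assume f: "f \<in> Ar C"
  show "extends_scalars (sec A (tgt C f)) (sec A (src C f)) (res A f)
        (msec (subm M N) (tgt C f)) (msec (subm M N) (src C f)) (mres (subm M N) f)"
    unfolding subm_simps
    using csubD(2,3)[OF N f] Ar_Ob[OF f]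
    by (intro extends_scalars_submodule cartD[OF M] A_cring A_hom A_flat csubD(1)[OF N] f) auto
qed

subsection \<open>Morphisms, images and kernels\<close>

text \<open>\<open>module_morphism\<close> without extensionality, so that maps can be given by
  plain formulas on elements.\<close>

definition mor :: "('o, 'a, 'u) module_presheaf \<Rightarrow> ('o, 'a, 'u) module_presheaf \<Rightarrow> ('o \<Rightarrow> 'u \<Rightarrow> 'u) \<Rightarrow> bool" where
  "mor M N \<phi> \<longleftrightarrow>
     (\<forall>x\<in>Ob C. \<phi> x \<in> linear_maps (sec A x) (msec M x) (msec N x)) \<and>
     (\<forall>f\<in>Ar C. \<forall>v\<in>carrier (msec M (tgt C f)). \<phi> (src C f) (mres M f v) = mres N f (\<phi> (tgt C f) v))"

lemma morD:
  assumes "mor M N \<phi>"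
  shows "x \<in> Ob C \<Longrightarrow> \<phi> x \<in> linear_maps (sec A x) (msec M x) (msec N x)"
    and "f \<in> Ar C \<Longrightarrow> v \<in> carrier (msec M (tgt C f)) \<Longrightarrow> \<phi> (src C f) (mres M f v) = mres N f (\<phi> (tgt C f) v)"
  using assms unfolding mor_def by blast+

text \<open>Sections over U are combinations of restrictions from W, and \<phi> carries these to
  combinations of restrictions of elements of the image.\<close>

lemma csub_image:
  assumes M: "cart M" and N: "cart N" and \<phi>: "mor M N \<phi>"
  shows "csub N (\<lambda>x. \<phi> x ` carrier (msec M x))"
  unfolding csub_def
proof (intro conjI ballI)
  fix x assume x: "x \<in> Ob C"
  interpret M: module "sec A x" "msec M x" by (rule cartD(1)[OF M x])
  note l = morD(1)[OF \<phi> x]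
  have "\<zero>\<^bsub>msec N x\<^esub> \<in> \<phi> x ` carrier (msec M x)"
    using linear_maps_zero[OF l cartD(1)[OF M x] cartD(1)[OF N x]] by (metis M.zero_closed image_eqI)
  then show "submodule (\<phi> x ` carrier (msec M x)) (sec A x) (msec N x)"
    unfolding module.submodule_iff[OF cartD(1)[OF N x]]
    using linear_mapsD[OF l] by (auto simp flip: linear_mapsD(2,3)[OF l])
next
  fix f assume f: "f \<in> Ar C"
  note l = morD(1)[OF \<phi> Ar_Ob(1)[OF f]]
  show "mres N f ` \<phi> (tgt C f) ` carrier (msec M (tgt C f)) \<subseteq> \<phi> (src C f) ` carrier (msec M (src C f))"
    using semilinearD(1)[OF cartD(4)[OF M f]] morD(2)[OF \<phi> f] by (auto simp flip: morD(2)[OF \<phi> f])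
  show "\<phi> (src C f) ` carrier (msec M (src C f)) \<subseteq>
     mspan (sec A (src C f)) (msec N (src C f)) (mres N f ` \<phi> (tgt C f) ` carrier (msec M (tgt C f)))"
  proof (clarify)
    fix v assume "v \<in> carrier (msec M (src C f))"
    then have "\<phi> (src C f) v \<in> mspan (sec A (src C f)) (msec N (src C f)) (\<phi> (src C f) ` mres M f ` carrier (msec M (tgt C f)))"
      using f Ar_Ob[OF f] semilinearD(1)[OF cartD(4)[OF M f]]
      by (intro mspan_image[OF l] cart_span M N cartD(1)) auto
    then show "\<phi> (src C f) v \<in> mspan (sec A (src C f)) (msec N (src C f)) (mres N f ` \<phi> (tgt C f) ` carrier (msec M (tgt C f)))"
      by (rule mspan_mono) (auto simp: morD(2)[OF \<phi> f])
  qed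
qed

text \<open>Let E be the span of the restricted kernel in M(U). Elements of M(W) that \<phi> kills
  restrict into E, so M(W) -> M(U)/E factors through the image of \<phi> over W. The image is
  cartesian, hence the factor extends over U, and its composite with \<phi> is the projection of
  M(U) to M(U)/E. The kernel over U is therefore contained in E.\<close>

lemma csub_kernel:
  assumes M: "cart M" and N: "cart N" and \<phi>: "mor M N \<phi>"
  shows "csub M (\<lambda>x. {v \<in> carrier (msec M x). \<phi> x v = \<zero>\<^bsub>msec N x\<^esub>})" (is "csub M ?K")
  unfolding csub_def
proof (intro conjI ballI)
  fix x assume x: "x \<in> Ob C"
  interpret M: module "sec A x" "msec M x" by (rule cartD(1)[OF M x])
  interpret N: module "sec A x" "msec N x" by (rule cartD(1)[OF N x])
  note l = morD(1)[OF \<phi> x]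
  show "submodule (?K x) (sec A x) (msec M x)"
    unfolding M.submodule_iff
    by (auto simp: linear_mapsD[OF l] linear_maps_zero[OF l cartD(1)[OF M x] cartD(1)[OF N x]])
next
  fix f assume f: "f \<in> Ar C"
  note U = Ar_Ob(1)[OF f] and W = Ar_Ob(2)[OF f]
  note lU = morD(1)[OF \<phi> U] and lW = morD(1)[OF \<phi> W]
  note MU = cartD(1)[OF M U] and MW = cartD(1)[OF M W] and NU = cartD(1)[OF N U] and NW = cartD(1)[OF N W]
  note sM = cartD(4)[OF M f]
  show sub: "mres M f ` ?K (tgt C f) \<subseteq> ?K (src C f)"
    using semilinearD(1)[OF sM] semilinear_zero[OF cartD(4)[OF N f] NW NU]
    by (auto simp: morD(2)[OF \<phi> f])
  let ?E = "mspan (sec A (src C f)) (msec M (src C f)) (mres M f ` ?K (tgt C f))"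
  have E: "submodule ?E (sec A (src C f)) (msec M (src C f))"
    using sub by (intro mspan_submodule MU) auto
  let ?Q = "mquot (msec M (src C f)) ?E" and ?q = "qrep (msec M (src C f)) ?E"
  note Q = mquot_module[OF MU E] and q = qrep_linear[OF MU E]
  \<comment> \<open>The image as a cartesian module in its own right; its extension property
    replaces an exactness argument with tensor products.\<close>
  let ?I = "subm N (\<lambda>x. \<phi> x ` carrier (msec M x))"
  have I: "cart ?I" by (rule subm_cart[OF N csub_image[OF M N \<phi>]])
  have pI: "\<phi> (tgt C f) \<in> linear_maps (sec A (tgt C f)) (msec M (tgt C f)) (msec ?I (tgt C f))"
    "\<phi> (src C f) \<in> linear_maps (sec A (src C f)) (msec M (src C f)) (msec ?I (src C f))"
    using linear_mapsD[OF lW] linear_mapsD[OF lU] by (auto intro!: linear_mapsI)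
  \<comment> \<open>Existence of the factor over W: the kernel of \<phi> there restricts into
    \<open>?E\<close>, which the projection \<open>?q\<close> kills.\<close>
  have "\<exists>g. semilinear (sec A (tgt C f)) (res A f) (msec ?I (tgt C f)) ?Q g \<and>
      (\<forall>v\<in>carrier (msec M (tgt C f)). g (\<phi> (tgt C f) v) = ?q (mres M f v))"
  proof (rule semilinear_factor[OF pI(1) _ semilinear_linear[OF sM q A_hom[OF f]] _ MW cartD(1)[OF I W] Q])
    fix v assume "v \<in> carrier (msec M (tgt C f))" "\<phi> (tgt C f) v = \<zero>\<^bsub>msec ?I (tgt C f)\<^esub>"
    then have "mres M f v \<in> ?E" "mres M f v \<in> carrier (msec M (src C f))"
      by (auto intro!: mspan_base semilinearD(1)[OF sM])
    then show "?q (mres M f v) = \<zero>\<^bsub>?Q\<^esub>" using qrep_zero_iff[OF MU E] by blast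
  qed simp
  then obtain g where g: "semilinear (sec A (tgt C f)) (res A f) (msec ?I (tgt C f)) ?Q g"
    and gq: "\<And>v. v \<in> carrier (msec M (tgt C f)) \<Longrightarrow> g (\<phi> (tgt C f) v) = ?q (mres M f v)" by blast
  obtain h where h: "h \<in> linear_maps (sec A (src C f)) (msec ?I (src C f)) ?Q"
    and hg: "\<And>n. n \<in> carrier (msec ?I (tgt C f)) \<Longrightarrow> h (mres ?I f n) = g n"
    using cart_univ[OF I f Q g] by blast
  \<comment> \<open>Both sides are linear on M(U) and agree on restrictions from W, which generate
    M(U).\<close>
  have eq: "h (\<phi> (src C f) v) = ?q v" if v: "v \<in> carrier (msec M (src C f))" for v
  proof (rule linear_maps_eq_on_span[OF linear_maps_comp[OF pI(2) h] q MU Q _ _ cart_span[OF M f v]])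
    show "mres M f ` carrier (msec M (tgt C f)) \<subseteq> carrier (msec M (src C f))"
      using semilinearD(1)[OF sM] by auto
    fix w assume "w \<in> mres M f ` carrier (msec M (tgt C f))"
    then obtain v where v: "v \<in> carrier (msec M (tgt C f))" "w = mres M f v" by auto
    then show "h (\<phi> (src C f) w) = ?q w"
      using hg[of "\<phi> (tgt C f) v"] by (simp add: morD(2)[OF \<phi> f] gq)
  qed
  show "?K (src C f) \<subseteq> ?E"
  proof
    fix v assume v: "v \<in> ?K (src C f)"
    then have "?q v = h \<zero>\<^bsub>msec ?I (src C f)\<^esub>" using eq[of v] by simp
    also have "\<dots> = \<zero>\<^bsub>?Q\<^esub>" by (rule linear_maps_zero[OF h cartD(1)[OF I U] Q])
    finally show "v \<in> ?E" using v qrep_zero_iff[OF MU E, of v] by simp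
  qed
qed

subsection \<open>Quotients\<close>

definition quotm :: "('o, 'a, 'u) module_presheaf \<Rightarrow> ('o \<Rightarrow> 'u set) \<Rightarrow> ('o, 'a, 'u) module_presheaf" where
  "quotm M N = \<lparr>msec = (\<lambda>x. mquot (msec M x) (N x)),
     mres = (\<lambda>f v. qrep (msec M (src C f)) (N (src C f)) (mres M f v))\<rparr>"

lemma quotm_simps [simp]: "msec (quotm M N) x = mquot (msec M x) (N x)"
  "mres (quotm M N) f v = qrep (msec M (src C f)) (N (src C f)) (mres M f v)"
  by (simp_all add: quotm_def)

context
  fixes M N assumes M: "cart M" and N: "csub M N"
begin

private abbreviation "q x \<equiv> qrep (msec M x) (N x)"

text \<open>Restriction on the quotient is defined on representatives. A representative differs from
  the element by a member of N, and restriction preserves N, so the class of the result is the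
  expected one.\<close>

lemma quotm_res:
  assumes f: "f \<in> Ar C" and v: "v \<in> carrier (msec M (tgt C f))"
  shows "mres (quotm M N) f (q (tgt C f) v) = q (src C f) (mres M f v)"
proof -
  note U = Ar_Ob(1)[OF f] and W = Ar_Ob(2)[OF f]
  note MU = cartD(1)[OF M U] and MW = cartD(1)[OF M W]
  note qp = qrep_props[OF MW csubD(1)[OF N W] v]
  note sM = cartD(4)[OF M f]
  have "mres M f (q (tgt C f) v) \<ominus>\<^bsub>msec M (src C f)\<^esub> mres M f v \<in> N (src C f)"
    using csubD(2)[OF N f qp(2)] semilinear_diff[OF sM MW MU qp(1) v] by simp
  then show ?thesis using qrep_eq_iff[OF MU csubD(1)[OF N U]] qp(1) v by (simp add: semilinearD(1)[OF sM])
qed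

lemma quotm_proj: "mor M (quotm M N) q"
  unfolding mor_def using quotm_res qrep_linear[OF cartD(1)[OF M] csubD(1)[OF N]]
  by (auto simp del: quotm_simps(2))

lemma quotm_ker: "x \<in> Ob C \<Longrightarrow> v \<in> carrier (msec M x) \<Longrightarrow> q x v = \<zero>\<^bsub>msec (quotm M N) x\<^esub> \<longleftrightarrow> v \<in> N x"
  using qrep_zero_iff[OF cartD(1)[OF M] csubD(1)[OF N]] by simp

text \<open>Restrictions generate because they do so in M. A semilinear map out of the quotient over
  W is pulled back to M(W), extended to M(U), and descends because N(U) is generated by restrictions
  from N(W).\<close>

lemma quotm_cart: "cart (quotm M N)"
proof (rule cartI)
  note ql = morD(1)[OF quotm_proj]
  have mod: "module (sec A x) (msec (quotm M N) x)" if "x \<in> Ob C" for x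
    using mquot_module[OF cartD(1)[OF M that] csubD(1)[OF N that]] by simp
  have car: "carrier (msec (quotm M N) x) = q x ` carrier (msec M x)" for x
    by (simp add: mquot_carrier)
  show "presheaf_module (quotm M N)"
    unfolding presheaf_module_def
  proof (intro conjI ballI impI)
    fix x assume x: "x \<in> Ob C"
    show "module (sec A x) (msec (quotm M N) x)" using mod[OF x] .
    show "small TYPE('u) (carrier (msec (quotm M N) x))"
      unfolding car by (rule small_image[OF cartD(2)[OF M x]])
    show "mres (quotm M N) (ide C x) v = v" if "v \<in> carrier (msec (quotm M N) x)" for v
      using that quotm_res[of "ide C x"] ide_Ar[OF x] cartD(3)[OF M x] unfolding car by auto
  next
    fix f assume f: "f \<in> Ar C"
    note U = Ar_Ob(1)[OF f] and W = Ar_Ob(2)[OF f]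
    note sM = cartD(4)[OF M f]
    have sq: "semilinear (sec A (tgt C f)) (res A f) (msec M (tgt C f)) (msec (quotm M N) (src C f)) (\<lambda>v. q (src C f) (mres M f v))"
      by (rule semilinear_linear[OF sM ql[OF U] A_hom[OF f]])
    \<comment> \<open>\<open>quotm\<close> adds and restricts chosen representatives, so
      semilinearity is awkward to verify directly; it is transferred from the map that factoring
      through the quotient produces.\<close>
    have "\<exists>h. semilinear (sec A (tgt C f)) (res A f) (msec (quotm M N) (tgt C f)) (msec (quotm M N) (src C f)) h \<and>
      (\<forall>v\<in>carrier (msec M (tgt C f)). h (q (tgt C f) v) = q (src C f) (mres M f v))"
      using quotm_ker W U csubD(2)[OF N f] semilinearD(1)[OF sM]
      by (intro semilinear_factor[OF ql[OF W] car[symmetric] sq _ cartD(1)[OF M W] mod[OF W] mod[OF U]]) blast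
    then obtain h where h: "semilinear (sec A (tgt C f)) (res A f) (msec (quotm M N) (tgt C f)) (msec (quotm M N) (src C f)) h"
      and hq: "\<And>v. v \<in> carrier (msec M (tgt C f)) \<Longrightarrow> h (q (tgt C f) v) = q (src C f) (mres M f v)" by blast
    interpret Q: module "sec A (tgt C f)" "msec (quotm M N) (tgt C f)" by (rule mod[OF W])
    have eq: "mres (quotm M N) f v = h v" if "v \<in> carrier (msec (quotm M N) (tgt C f))" for v
      using that hq quotm_res[OF f] unfolding car by auto
    show "semilinear (sec A (tgt C f)) (res A f) (msec (quotm M N) (tgt C f)) (msec (quotm M N) (src C f)) (mres (quotm M N) f)"
      by (rule semilinearI) (simp_all only: eq semilinearD[OF h] Q.a_closed Q.smult_closed)
  next
    fix f g v
    assume fg: "f \<in> Ar C" "g \<in> Ar C" "tgt C f = src C g" "v \<in> carrier (msec (quotm M N) (tgt C g))"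
    obtain w where w: "w \<in> carrier (msec M (tgt C g))" "v = q (tgt C g) w" using fg(4) unfolding car by blast
    show "mres (quotm M N) (g \<bullet>\<^bsub>C\<^esub> f) v = mres (quotm M N) f (mres (quotm M N) g v)"
      using quotm_res[of "g \<bullet>\<^bsub>C\<^esub> f" w] cmp_Ar[OF fg(1-3)] w quotm_res[OF fg(2), of w]
        quotm_res[OF fg(1), of "mres M g w"] semilinearD(1)[OF cartD(4)[OF M fg(2)]] fg(3)
        cartD(5)[OF M fg(1-3) w(1)]
      by (simp del: quotm_simps)
  qed
  fix f assume f: "f \<in> Ar C"
  note U = Ar_Ob(1)[OF f] and W = Ar_Ob(2)[OF f]
  note sM = cartD(4)[OF M f]
  show "carrier (msec (quotm M N) (src C f)) \<subseteq>
     mspan (sec A (src C f)) (msec (quotm M N) (src C f)) (mres (quotm M N) f ` carrier (msec (quotm M N) (tgt C f)))"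
  proof
    fix v assume "v \<in> carrier (msec (quotm M N) (src C f))"
    then obtain w where w: "w \<in> carrier (msec M (src C f))" "v = q (src C f) w" unfolding car by blast
    have "v \<in> mspan (sec A (src C f)) (msec (quotm M N) (src C f)) (q (src C f) ` mres M f ` carrier (msec M (tgt C f)))"
      unfolding w(2) using semilinearD(1)[OF sM]
      by (intro mspan_image[OF ql[OF U] cartD(1)[OF M U] mod[OF U]] cart_span[OF M f] w(1)) auto
    then show "v \<in> mspan (sec A (src C f)) (msec (quotm M N) (src C f)) (mres (quotm M N) f ` carrier (msec (quotm M N) (tgt C f)))"
      by (rule mspan_mono) (auto simp: car quotm_res[OF f, symmetric] simp del: quotm_simps)
  qed
  fix Q :: "('u, ('u \<times> 'u \<Rightarrow>\<^sub>0 int) set) module" and g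
  assume Q: "module (sec A (src C f)) Q"
    and g: "semilinear (sec A (tgt C f)) (res A f) (msec (quotm M N) (tgt C f)) Q g"
  note qW = ql[OF W]
  obtain h where h: "h \<in> linear_maps (sec A (src C f)) (msec M (src C f)) Q"
    and hg: "\<And>v. v \<in> carrier (msec M (tgt C f)) \<Longrightarrow> h (mres M f v) = g (q (tgt C f) v)"
    using cart_univ[OF M f Q linear_semilinear[OF qW g]] by blast
  \<comment> \<open>On N(U) the extension is compared with the zero map: they agree on restrictions
    from N(W), where the projection is zero.\<close>
  have "h v = \<zero>\<^bsub>Q\<^esub>" if v: "v \<in> N (src C f)" for v
  proof (rule linear_maps_eq_on_span[OF h _ cartD(1)[OF M U] Q _ _ csubD(3)[OF N f v]])
    interpret Q: module "sec A (src C f)" Q by (rule Q)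
    show "(\<lambda>_. \<zero>\<^bsub>Q\<^esub>) \<in> linear_maps (sec A (src C f)) (msec M (src C f)) Q" by (rule linear_mapsI) auto
    show "mres M f ` N (tgt C f) \<subseteq> carrier (msec M (src C f))"
      using csubD(2)[OF N f] csub_props(1)[OF M N U] by blast
    fix w assume "w \<in> mres M f ` N (tgt C f)"
    then obtain n where n: "n \<in> N (tgt C f)" "w = mres M f n" by auto
    then have "n \<in> carrier (msec M (tgt C f))" using csub_props(1)[OF M N W] by blast
    then show "h w = \<zero>\<^bsub>Q\<^esub>" using n quotm_ker[OF W, of n] hg semilinear_zero[OF g mod[OF W] Q] by simp
  qed
  from mquot_lift[OF h cartD(1)[OF M U] Q csubD(1)[OF N U] this]
  have h1: "h \<in> linear_maps (sec A (src C f)) (msec (quotm M N) (src C f)) Q"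
    and h2: "v \<in> carrier (msec M (src C f)) \<Longrightarrow> h (q (src C f) v) = h v" for v by auto
  have "h (mres (quotm M N) f v) = g v" if v: "v \<in> carrier (msec (quotm M N) (tgt C f))" for v
  proof -
    obtain w where w: "w \<in> carrier (msec M (tgt C f))" "v = q (tgt C f) w" using v unfolding car by blast
    show ?thesis using w quotm_res[OF f w(1)] h2 hg semilinearD(1)[OF sM] by (simp del: quotm_simps)
  qed
  then show "\<exists>h\<in>linear_maps (sec A (src C f)) (msec (quotm M N) (src C f)) Q.
     \<forall>v\<in>carrier (msec (quotm M N) (tgt C f)). h (mres (quotm M N) f v) = g v"
    using h1 by (intro bexI[of _ h]) auto
qed

end

section \<open>Direct sums of cartesian modules\<close>

definition ds :: "'i set \<Rightarrow> ('i \<Rightarrow> ('o, 'a, 'u) module_presheaf) \<Rightarrow> 'o \<Rightarrow> ('u, 'i \<Rightarrow> 'u) module" where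
  "ds I F x = dir_sum I (\<lambda>i. msec (F i) x)"

text \<open>\<open>msec\<close> requires elements of type \<open>'u\<close>, while the direct sum
  consists of functions on the index set. Smallness guarantees that an injection exists; any one
  will do.\<close>

definition enc :: "'i set \<Rightarrow> ('i \<Rightarrow> ('o, 'a, 'u) module_presheaf) \<Rightarrow> 'o \<Rightarrow> ('i \<Rightarrow> 'u) \<Rightarrow> 'u" where
  "enc I F x = (SOME e. inj_on e (carrier (ds I F x)))"

abbreviation "dec I F x \<equiv> inv_into (carrier (ds I F x)) (enc I F x)"

definition dres :: "'i set \<Rightarrow> ('i \<Rightarrow> ('o, 'a, 'u) module_presheaf) \<Rightarrow> 'a \<Rightarrow> ('i \<Rightarrow> 'u) \<Rightarrow> 'i \<Rightarrow> 'u" where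
  "dres I F f w = (\<lambda>i\<in>I. mres (F i) f (w i))"

definition coprod :: "'i set \<Rightarrow> ('i \<Rightarrow> ('o, 'a, 'u) module_presheaf) \<Rightarrow> ('o, 'a, 'u) module_presheaf" where
  "coprod I F = \<lparr>msec = (\<lambda>x. mtransport (enc I F x) (ds I F x)),
     mres = (\<lambda>f v. enc I F (src C f) (dres I F f (dec I F (tgt C f) v)))\<rparr>"

definition cinj :: "'i set \<Rightarrow> ('i \<Rightarrow> ('o, 'a, 'u) module_presheaf) \<Rightarrow> 'i \<Rightarrow> 'o \<Rightarrow> 'u \<Rightarrow> 'u" where
  "cinj I F i x v = enc I F x (dinj I (\<lambda>i. msec (F i) x) i v)"

context
  fixes I :: "'i set" and F
  assumes small_I: "small TYPE('u) I" and F: "\<And>i. i \<in> I \<Longrightarrow> cart (F i)"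
begin

lemma ds_module: "x \<in> Ob C \<Longrightarrow> module (sec A x) (ds I F x)"
  unfolding ds_def by (rule dir_sum_module) (auto simp: A_cring cartD F)

lemma ds_small:
  assumes "x \<in> Ob C"
  shows "small TYPE('u) (carrier (ds I F x))"
proof -
  have "small TYPE('u) (\<Pi>\<^sub>E i\<in>I. carrier (msec (F i) x))"
    by (intro small_PiE univ small_I cartD F assms)
  then show ?thesis by (rule small_subset) (auto simp: ds_def dir_sum_def)
qed

lemma enc_inj: "x \<in> Ob C \<Longrightarrow> inj_on (enc I F x) (carrier (ds I F x))"
  unfolding enc_def by (rule someI_ex[OF small_encode[OF ds_small]])

lemma coprod_simps:
  "msec (coprod I F) x = mtransport (enc I F x) (ds I F x)"
  "carrier (msec (coprod I F) x) = enc I F x ` carrier (ds I F x)"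
  by (simp_all add: coprod_def mtransport_carrier)

lemma coprod_module: "x \<in> Ob C \<Longrightarrow> module (sec A x) (msec (coprod I F) x)"
  and enc_linear: "x \<in> Ob C \<Longrightarrow> enc I F x \<in> linear_maps (sec A x) (ds I F x) (msec (coprod I F) x)"
  and dec_linear: "x \<in> Ob C \<Longrightarrow> dec I F x \<in> linear_maps (sec A x) (msec (coprod I F) x) (ds I F x)"
  using mtransport[OF ds_module enc_inj] by (simp_all add: coprod_simps)

text \<open>Restrictions preserve zero, hence componentwise restriction preserves finite
  support.\<close>

lemma ds_zero: "i \<in> I \<Longrightarrow> f \<in> Ar C \<Longrightarrow> mres (F i) f \<zero>\<^bsub>msec (F i) (tgt C f)\<^esub> = \<zero>\<^bsub>msec (F i) (src C f)\<^esub>"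
  using semilinear_zero[OF cartD(4)[OF F] cartD(1)[OF F] cartD(1)[OF F]] Ar_Ob by blast

lemma dres_closed:
  assumes f: "f \<in> Ar C" and w: "w \<in> carrier (ds I F (tgt C f))"
  shows "dres I F f w \<in> carrier (ds I F (src C f))"
proof -
  have "{i \<in> I. mres (F i) f (w i) \<noteq> \<zero>\<^bsub>msec (F i) (src C f)\<^esub>} \<subseteq> {i \<in> I. w i \<noteq> \<zero>\<^bsub>msec (F i) (tgt C f)\<^esub>}"
    using ds_zero f by auto
  then have "finite {i \<in> I. mres (F i) f (w i) \<noteq> \<zero>\<^bsub>msec (F i) (src C f)\<^esub>}"
    using w by (auto simp: ds_def dir_sum_def intro: finite_subset)
  then show ?thesis using w semilinearD(1)[OF cartD(4)[OF F f]]
    by (auto simp: ds_def dir_sum_def dres_def cong: conj_cong)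
qed

lemma dres_semilinear:
  assumes f: "f \<in> Ar C"
  shows "semilinear (sec A (tgt C f)) (res A f) (ds I F (tgt C f)) (ds I F (src C f)) (dres I F f)"
proof (rule semilinearI)
  note U = Ar_Ob(1)[OF f] and W = Ar_Ob(2)[OF f]
  fix v assume v: "v \<in> carrier (ds I F (tgt C f))"
  then have vi: "v i \<in> carrier (msec (F i) (tgt C f))" if "i \<in> I" for i
    using that by (auto simp: ds_def dir_sum_def)
  show "dres I F f v \<in> carrier (ds I F (src C f))" by (rule dres_closed[OF f v])
  show "dres I F f (a \<odot>\<^bsub>ds I F (tgt C f)\<^esub> v) = res A f a \<odot>\<^bsub>ds I F (src C f)\<^esub> dres I F f v"
    if "a \<in> carrier (sec A (tgt C f))" for a
    using that vi by (auto simp: ds_def dir_sum_def dres_def semilinearD(3)[OF cartD(4)[OF F f]])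
  fix w assume w: "w \<in> carrier (ds I F (tgt C f))"
  then have wi: "w i \<in> carrier (msec (F i) (tgt C f))" if "i \<in> I" for i
    using that by (auto simp: ds_def dir_sum_def)
  show "dres I F f (v \<oplus>\<^bsub>ds I F (tgt C f)\<^esub> w) = dres I F f v \<oplus>\<^bsub>ds I F (src C f)\<^esub> dres I F f w"
    using vi wi by (auto simp: ds_def dir_sum_def dres_def semilinearD(2)[OF cartD(4)[OF F f]])
qed

lemma coprod_res:
  "f \<in> Ar C \<Longrightarrow> w \<in> carrier (ds I F (tgt C f)) \<Longrightarrow>
     mres (coprod I F) f (enc I F (tgt C f) w) = enc I F (src C f) (dres I F f w)"
  by (simp add: coprod_def enc_inj Ar_Ob)

lemma cinj_linear: "i \<in> I \<Longrightarrow> x \<in> Ob C \<Longrightarrow> cinj I F i x \<in> linear_maps (sec A x) (msec (F i) x) (msec (coprod I F) x)"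
  unfolding cinj_def
  by (rule linear_maps_comp[OF _ enc_linear]) (auto simp: ds_def intro!: dinj_linear A_cring cartD F)

lemma dinj_ds: "i \<in> I \<Longrightarrow> x \<in> Ob C \<Longrightarrow> v \<in> carrier (msec (F i) x) \<Longrightarrow>
    dinj I (\<lambda>i. msec (F i) x) i v \<in> carrier (ds I F x)"
  unfolding ds_def by (intro dinj_closed[OF A_cring]) (auto simp: cartD F)

lemma cinj_mor: assumes i: "i \<in> I" shows "mor (F i) (coprod I F) (cinj I F i)"
  unfolding mor_def
proof (intro conjI ballI)
  fix f v assume f: "f \<in> Ar C" and v: "v \<in> carrier (msec (F i) (tgt C f))"
  have "dres I F f (dinj I (\<lambda>i. msec (F i) (tgt C f)) i v) = dinj I (\<lambda>i. msec (F i) (src C f)) i (mres (F i) f v)"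
    using ds_zero f by (auto simp: dres_def dinj_def)
  then show "cinj I F i (src C f) (mres (F i) f v) = mres (coprod I F) f (cinj I F i (tgt C f) v)"
    unfolding cinj_def using coprod_res[OF f dinj_ds[OF i Ar_Ob(2)[OF f] v]] by simp
qed (rule cinj_linear[OF i])

lemma coprod_induct [consumes 2, case_names zero inj add]:
  assumes x: "x \<in> Ob C" and v: "v \<in> carrier (msec (coprod I F) x)"
    and zero: "P \<zero>\<^bsub>msec (coprod I F) x\<^esub>"
    and inj: "\<And>i v. i \<in> I \<Longrightarrow> v \<in> carrier (msec (F i) x) \<Longrightarrow> P (cinj I F i x v)"
    and add: "\<And>v w. v \<in> carrier (msec (coprod I F) x) \<Longrightarrow> w \<in> carrier (msec (coprod I F) x) \<Longrightarrow>
        P v \<Longrightarrow> P w \<Longrightarrow> P (v \<oplus>\<^bsub>msec (coprod I F) x\<^esub> w)"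
  shows "P v"
proof -
  obtain w where w: "w \<in> carrier (ds I F x)" "v = enc I F x w" using v unfolding coprod_simps(2) by blast
  note l = enc_linear[OF x]
  have "P (enc I F x w)"
    using w(1) unfolding ds_def
  proof (rule dir_sum_induct[OF A_cring[OF x], rotated])
    show "P (enc I F x \<zero>\<^bsub>dir_sum I (\<lambda>i. msec (F i) x)\<^esub>)"
      using zero linear_maps_zero[OF l ds_module[OF x] coprod_module[OF x]] by (simp add: ds_def)
    show "P (enc I F x (dinj I (\<lambda>i. msec (F i) x) i v))" if "i \<in> I" "v \<in> carrier (msec (F i) x)" for i v
      using inj[OF that] by (simp add: cinj_def)
    show "P (enc I F x (v \<oplus>\<^bsub>dir_sum I (\<lambda>i. msec (F i) x)\<^esub> w))"
      if "v \<in> carrier (dir_sum I (\<lambda>i. msec (F i) x))" "w \<in> carrier (dir_sum I (\<lambda>i. msec (F i) x))"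
        "P (enc I F x v)" "P (enc I F x w)" for v w
      using add[OF _ _ that(3,4)] linear_mapsD(1,2)[OF l] that(1,2) by (simp flip: ds_def)
  qed (auto simp: cartD F x)
  then show ?thesis by (simp add: w)
qed

lemma coprod_univ:
  fixes Q :: "('u, 'q) module"
  assumes x: "x \<in> Ob C" and Q: "module (sec A x) Q"
    and g: "\<And>i. i \<in> I \<Longrightarrow> g i \<in> linear_maps (sec A x) (msec (F i) x) Q"
  shows "\<exists>h\<in>linear_maps (sec A x) (msec (coprod I F) x) Q. \<forall>i\<in>I. \<forall>v\<in>carrier (msec (F i) x). h (cinj I F i x v) = g i v"
proof -
  have "\<exists>h\<in>linear_maps (sec A x) (ds I F x) Q. \<forall>i\<in>I. \<forall>v\<in>carrier (msec (F i) x). h (dinj I (\<lambda>i. msec (F i) x) i v) = g i v"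
    unfolding ds_def by (rule dir_sum_univ[OF A_cring[OF x] _ Q g]) (auto simp: cartD F x)
  then obtain h where h: "h \<in> linear_maps (sec A x) (ds I F x) Q"
    and hg: "\<And>i v. i \<in> I \<Longrightarrow> v \<in> carrier (msec (F i) x) \<Longrightarrow> h (dinj I (\<lambda>i. msec (F i) x) i v) = g i v" by blast
  show ?thesis
  proof (rule bexI[OF _ linear_maps_comp[OF dec_linear[OF x] h]], intro ballI)
    fix i v assume "i \<in> I" "v \<in> carrier (msec (F i) x)"
    then show "h (dec I F x (cinj I F i x v)) = g i v"
      unfolding cinj_def using dinj_ds x by (simp add: enc_inj hg)
  qed
qed

lemma coprod_linear_eq:
  assumes x: "x \<in> Ob C" and Q: "module B Q"
    and f: "semilinear (sec A x) \<phi> (msec (coprod I F) x) Q f" "semilinear (sec A x) \<phi> (msec (coprod I F) x) Q g"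
    and eq: "\<And>i v. i \<in> I \<Longrightarrow> v \<in> carrier (msec (F i) x) \<Longrightarrow> f (cinj I F i x v) = g (cinj I F i x v)"
    and v: "v \<in> carrier (msec (coprod I F) x)"
  shows "f v = g v"
  using x v
proof (induct rule: coprod_induct)
  case zero
  show ?case using semilinear_zero[OF _ coprod_module[OF x] Q] f by metis
qed (auto simp: eq semilinearD(2)[OF f(1)] semilinearD(2)[OF f(2)])

text \<open>Both conditions are inherited summand by summand: a generated element is sent to a
  generated one by each injection, and extensions over the summands are assembled by the universal
  property of the direct sum.\<close>

lemma coprod_cart: "cart (coprod I F)"
proof (rule cartI)
  show "presheaf_module (coprod I F)"
    unfolding presheaf_module_def
  proof (intro conjI ballI impI)
    fix x assume x: "x \<in> Ob C"
    show "module (sec A x) (msec (coprod I F) x)" by (rule coprod_module[OF x])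
    show "small TYPE('u) (carrier (msec (coprod I F) x))"
      unfolding coprod_simps(2) by (rule small_image[OF ds_small[OF x]])
    fix v assume "v \<in> carrier (msec (coprod I F) x)"
    then obtain w where w: "w \<in> carrier (ds I F x)" "v = enc I F x w" unfolding coprod_simps(2) by blast
    have "dres I F (ide C x) w = w"
      using w(1) cartD(3)[OF F x] unfolding ds_def dir_sum_def dres_def
      by (auto simp: PiE_iff extensional_def)
    then show "mres (coprod I F) (ide C x) v = v"
      using coprod_res[of "ide C x" w] ide_Ar[OF x] w by simp
  next
    fix f assume f: "f \<in> Ar C"
    note U = Ar_Ob(1)[OF f] and W = Ar_Ob(2)[OF f]
    have "semilinear (sec A (tgt C f)) (res A f) (msec (coprod I F) (tgt C f)) (msec (coprod I F) (src C f))
       (\<lambda>v. enc I F (src C f) (dres I F f (dec I F (tgt C f) v)))"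
      by (rule semilinear_linear[OF linear_semilinear[OF dec_linear[OF W] dres_semilinear[OF f]] enc_linear[OF U] A_hom[OF f]])
    then show "semilinear (sec A (tgt C f)) (res A f) (msec (coprod I F) (tgt C f)) (msec (coprod I F) (src C f))
       (mres (coprod I F) f)"
      by (simp add: coprod_def)
  next
    fix f g v
    assume fg: "f \<in> Ar C" "g \<in> Ar C" "tgt C f = src C g" and "v \<in> carrier (msec (coprod I F) (tgt C g))"
    then obtain w where w: "w \<in> carrier (ds I F (tgt C g))" "v = enc I F (tgt C g) w" unfolding coprod_simps(2) by blast
    have wi: "w i \<in> carrier (msec (F i) (tgt C g))" if "i \<in> I" for i
      using w(1) that by (auto simp: ds_def dir_sum_def)
    have "dres I F (g \<bullet>\<^bsub>C\<^esub> f) w = dres I F f (dres I F g w)"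
      unfolding dres_def using wi cartD(5)[OF F fg] by (intro restrict_ext) simp
    then show "mres (coprod I F) (g \<bullet>\<^bsub>C\<^esub> f) v = mres (coprod I F) f (mres (coprod I F) g v)"
      using coprod_res[of "g \<bullet>\<^bsub>C\<^esub> f" w] cmp_Ar[OF fg] w coprod_res[OF fg(2), of w]
        coprod_res[OF fg(1), of "dres I F g w"] dres_closed[OF fg(2), of w] fg(3) by simp
  qed
  fix f assume f: "f \<in> Ar C"
  note U = Ar_Ob(1)[OF f] and W = Ar_Ob(2)[OF f]
  let ?P = "coprod I F"
  let ?E = "mspan (sec A (src C f)) (msec ?P (src C f)) (mres ?P f ` carrier (msec ?P (tgt C f)))"
  show "carrier (msec ?P (src C f)) \<subseteq> ?E"
  proof
    fix v assume "v \<in> carrier (msec ?P (src C f))"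
    with U show "v \<in> ?E"
    proof (induct rule: coprod_induct)
      case (inj i v)
      note l = cinj_linear[OF inj(1)]
      have "cinj I F i (src C f) v \<in> mspan (sec A (src C f)) (msec ?P (src C f))
          (cinj I F i (src C f) ` mres (F i) f ` carrier (msec (F i) (tgt C f)))"
        using semilinearD(1)[OF cartD(4)[OF F[OF inj(1)] f]] inj
        by (intro mspan_image[OF l[OF U] _ coprod_module[OF U]] cartD(1) U F cart_span f) auto
      then show ?case
        by (rule mspan_mono)
          (auto simp: morD(2)[OF cinj_mor[OF inj(1)] f] intro: linear_mapsD(1)[OF l[OF W]])
    qed (auto intro: mspan_zero mspan_add)
  qed
  fix Q :: "('u, ('u \<times> 'u \<Rightarrow>\<^sub>0 int) set) module" and g
  assume Q: "module (sec A (src C f)) Q"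
    and g: "semilinear (sec A (tgt C f)) (res A f) (msec ?P (tgt C f)) Q g"
  \<comment> \<open>Extension on each summand separately, before the pieces are joined.\<close>
  have "\<exists>h. h \<in> linear_maps (sec A (src C f)) (msec (F i) (src C f)) Q \<and>
     (\<forall>v\<in>carrier (msec (F i) (tgt C f)). h (mres (F i) f v) = g (cinj I F i (tgt C f) v))" if i: "i \<in> I" for i
    using cart_univ[OF F[OF i] f Q linear_semilinear[OF cinj_linear[OF i W] g]] by blast
  then obtain k where k: "\<And>i. i \<in> I \<Longrightarrow> k i \<in> linear_maps (sec A (src C f)) (msec (F i) (src C f)) Q"
    and kg: "\<And>i v. i \<in> I \<Longrightarrow> v \<in> carrier (msec (F i) (tgt C f)) \<Longrightarrow> k i (mres (F i) f v) = g (cinj I F i (tgt C f) v)"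
    by metis
  obtain h where h: "h \<in> linear_maps (sec A (src C f)) (msec ?P (src C f)) Q"
    and hk: "\<And>i v. i \<in> I \<Longrightarrow> v \<in> carrier (msec (F i) (src C f)) \<Longrightarrow> h (cinj I F i (src C f) v) = k i v"
    using coprod_univ[OF U Q k] by blast
  have sl: "semilinear (sec A (tgt C f)) (res A f) (msec ?P (tgt C f)) (msec ?P (src C f)) (mres ?P f)"
  proof -
    have "semilinear (sec A (tgt C f)) (res A f) (msec ?P (tgt C f)) (msec ?P (src C f))
       (\<lambda>v. enc I F (src C f) (dres I F f (dec I F (tgt C f) v)))"
      by (rule semilinear_linear[OF linear_semilinear[OF dec_linear[OF W] dres_semilinear[OF f]] enc_linear[OF U] A_hom[OF f]])
    then show ?thesis by (simp add: coprod_def)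
  qed
  have "h (mres ?P f v) = g v" if "v \<in> carrier (msec ?P (tgt C f))" for v
  proof (rule coprod_linear_eq[OF W Q semilinear_linear[OF sl h A_hom[OF f]] g _ that])
    fix i v assume iv: "i \<in> I" "v \<in> carrier (msec (F i) (tgt C f))"
    then have "h (cinj I F i (src C f) (mres (F i) f v)) = k i (mres (F i) f v)"
      using semilinearD(1)[OF cartD(4)[OF F f]] by (intro hk) auto
    then show "h (mres ?P f (cinj I F i (tgt C f) v)) = g (cinj I F i (tgt C f) v)"
      using iv by (simp add: kg morD(2)[OF cinj_mor f])
  qed
  then show "\<exists>h\<in>linear_maps (sec A (src C f)) (msec ?P (src C f)) Q.
     \<forall>v\<in>carrier (msec ?P (tgt C f)). h (mres ?P f v) = g v"
    using h by (intro bexI[of _ h]) auto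
qed

text \<open>The map is assembled at each object independently; naturality then needs to be tested
  only on the summands.\<close>

lemma coprod_mor:
  assumes K: "cart K" and \<kappa>: "\<And>i. i \<in> I \<Longrightarrow> mor (F i) K (\<kappa> i)"
  shows "\<exists>u. mor (coprod I F) K u \<and> (\<forall>i\<in>I. \<forall>x\<in>Ob C. \<forall>v\<in>carrier (msec (F i) x). u x (cinj I F i x v) = \<kappa> i x v)"
proof -
  have "\<exists>h. h \<in> linear_maps (sec A x) (msec (coprod I F) x) (msec K x) \<and>
      (\<forall>i\<in>I. \<forall>v\<in>carrier (msec (F i) x). h (cinj I F i x v) = \<kappa> i x v)" if x: "x \<in> Ob C" for x
    using coprod_univ[OF x cartD(1)[OF K x], of "\<lambda>i. \<kappa> i x"] morD(1)[OF \<kappa> x] by blast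
  then obtain u where u: "\<And>x. x \<in> Ob C \<Longrightarrow> u x \<in> linear_maps (sec A x) (msec (coprod I F) x) (msec K x)"
    and uk: "\<And>x i v. x \<in> Ob C \<Longrightarrow> i \<in> I \<Longrightarrow> v \<in> carrier (msec (F i) x) \<Longrightarrow> u x (cinj I F i x v) = \<kappa> i x v"
    by metis
  have "u (src C f) (mres (coprod I F) f v) = mres K f (u (tgt C f) v)"
    if f: "f \<in> Ar C" and v: "v \<in> carrier (msec (coprod I F) (tgt C f))" for f v
  proof (rule coprod_linear_eq[OF Ar_Ob(2)[OF f] cartD(1)[OF K Ar_Ob(1)[OF f]]
        semilinear_linear[OF cartD(4)[OF coprod_cart f] u[OF Ar_Ob(1)[OF f]] A_hom[OF f]]
        linear_semilinear[OF u[OF Ar_Ob(2)[OF f]] cartD(4)[OF K f]] _ v])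
    fix i v assume "i \<in> I" "v \<in> carrier (msec (F i) (tgt C f))"
    then show "u (src C f) (mres (coprod I F) f (cinj I F i (tgt C f) v)) = mres K f (u (tgt C f) (cinj I F i (tgt C f) v))"
      using f Ar_Ob[OF f] semilinearD(1)[OF cartD(4)[OF F f]]
      by (simp add: uk morD(2)[OF \<kappa> f] flip: morD(2)[OF cinj_mor f])
  qed
  then have "mor (coprod I F) K u" using u by (simp add: mor_def)
  then show ?thesis using uk by (intro exI[of _ u]) auto
qed

end

section \<open>The category of cartesian modules\<close>

abbreviation "Q \<equiv> Qcoh C A"

abbreviation el :: "('o, 'a, 'u) module_presheaf \<Rightarrow> 'o \<Rightarrow> 'u set" where
  "el M x \<equiv> carrier (msec M x)"

definition app ::
  "('o, 'a, 'u) module_presheaf \<times> ('o \<Rightarrow> 'u \<Rightarrow> 'u) \<times> ('o, 'a, 'u) module_presheaf \<Rightarrow> 'o \<Rightarrow> 'u \<Rightarrow> 'u" where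
  "app f = fst (snd f)"

lemma Q_simps: "Ob Q = Collect cart" "M \<in> Ob Q \<longleftrightarrow> cart M"
  "src Q (M, \<phi>, N) = M" "tgt Q (M, \<phi>, N) = N"
  "(M, \<phi>, N) \<in> Ar Q \<longleftrightarrow> cart M \<and> cart N \<and> module_morphism C A M N \<phi>"
  by (simp_all add: Qcoh_def)

lemma Hom_iff: "f \<in> Hom Q M N \<longleftrightarrow> (\<exists>\<phi>. f = (M, \<phi>, N) \<and> cart M \<and> cart N \<and> module_morphism C A M N \<phi>)"
  by (cases f) (auto simp: Hom_def Q_simps)

lemma Ar_Q: "f \<in> Ar Q \<longleftrightarrow> f \<in> Hom Q (src Q f) (tgt Q f)"
  by (auto simp: Hom_def)

lemma HomD: "f \<in> Hom Q M N \<Longrightarrow> f \<in> Ar Q \<and> src Q f = M \<and> tgt Q f = N"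
  by (auto simp: Hom_def)

lemma Hom_cart: assumes "f \<in> Hom Q M N" shows "cart M" "cart N"
  using assms unfolding Hom_iff by auto

lemma Hom_mor: "f \<in> Hom Q M N \<Longrightarrow> mor M N (app f)"
  unfolding Hom_iff by (auto simp: app_def mor_def module_morphism_def)

lemma hom_eqI:
  assumes "f \<in> Hom Q M N" "g \<in> Hom Q M N"
    and "\<And>x v. x \<in> Ob C \<Longrightarrow> v \<in> el M x \<Longrightarrow> app f x v = app g x v"
  shows "f = g"
proof -
  obtain \<phi> \<psi> where fg: "f = (M, \<phi>, N)" "g = (M, \<psi>, N)"
    and mm: "module_morphism C A M N \<phi>" "module_morphism C A M N \<psi>"
    using assms(1,2) unfolding Hom_iff by blast
  have "\<phi> = \<psi>"
  proof (rule extensionalityI[of _ "Ob C"])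
    show "\<phi> \<in> extensional (Ob C)" "\<psi> \<in> extensional (Ob C)" using mm by (auto simp: module_morphism_def)
    fix x assume x: "x \<in> Ob C"
    show "\<phi> x = \<psi> x"
    proof (rule extensionalityI[of _ "el M x"])
      show "\<phi> x \<in> extensional (el M x)" "\<psi> x \<in> extensional (el M x)"
        using mm x by (auto simp: module_morphism_def)
      show "\<phi> x v = \<psi> x v" if "v \<in> el M x" for v
        using assms(3)[OF x that] by (simp add: fg app_def)
    qed
  qed
  then show ?thesis by (simp add: fg)
qed

text \<open>Arrows of \<open>Qcoh\<close> are extensional both in the object and in the element.
  \<open>arr\<close> makes such an arrow from any family of functions by discarding the other
  values.\<close>

definition arr :: "('o, 'a, 'u) module_presheaf \<Rightarrow> ('o \<Rightarrow> 'u \<Rightarrow> 'u) \<Rightarrow> ('o, 'a, 'u) module_presheaf \<Rightarrow>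
    ('o, 'a, 'u) module_presheaf \<times> ('o \<Rightarrow> 'u \<Rightarrow> 'u) \<times> ('o, 'a, 'u) module_presheaf" where
  "arr M \<phi> N = (M, \<lambda>x\<in>Ob C. restrict (\<phi> x) (el M x), N)"

lemma app_arr: "x \<in> Ob C \<Longrightarrow> v \<in> el M x \<Longrightarrow> app (arr M \<phi> N) x v = \<phi> x v"
  by (simp add: app_def arr_def)

lemma arr_Hom:
  assumes "cart M" "cart N" "mor M N \<phi>"
  shows "arr M \<phi> N \<in> Hom Q M N"
  unfolding Hom_iff
proof (intro exI conjI)
  show "arr M \<phi> N = (M, \<lambda>x\<in>Ob C. restrict (\<phi> x) (el M x), N)" by (simp add: arr_def)
  show "module_morphism C A M N (\<lambda>x\<in>Ob C. restrict (\<phi> x) (el M x))"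
    unfolding module_morphism_def
  proof (intro conjI ballI)
    fix x assume x: "x \<in> Ob C"
    have "restrict (\<phi> x) (el M x) \<in> linear_maps (sec A x) (msec M x) (msec N x)"
      by (rule linear_maps_cong[OF morD(1)[OF assms(3) x] _ cartD(1)[OF assms(1) x]]) simp
    then show "(\<lambda>x\<in>Ob C. restrict (\<phi> x) (el M x)) x \<in>
        linear_maps (sec A x) (msec M x) (msec N x) \<inter> extensional (el M x)" using x by simp
  next
    fix f v assume "f \<in> Ar C" "v \<in> el M (tgt C f)"
    then show "(\<lambda>x\<in>Ob C. restrict (\<phi> x) (el M x)) (src C f) (mres M f v) =
        mres N f ((\<lambda>x\<in>Ob C. restrict (\<phi> x) (el M x)) (tgt C f) v)"
      using Ar_Ob semilinearD(1)[OF cartD(4)[OF assms(1)]] morD(2)[OF assms(3)] by simp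
  qed simp
qed fact+

lemma hom_closed: "f \<in> Hom Q M N \<Longrightarrow> x \<in> Ob C \<Longrightarrow> v \<in> el M x \<Longrightarrow> app f x v \<in> el N x"
  using linear_mapsD(1)[OF morD(1)[OF Hom_mor]] .

lemma hom_add: "f \<in> Hom Q M N \<Longrightarrow> x \<in> Ob C \<Longrightarrow> v \<in> el M x \<Longrightarrow> w \<in> el M x \<Longrightarrow>
    app f x (v \<oplus>\<^bsub>msec M x\<^esub> w) = app f x v \<oplus>\<^bsub>msec N x\<^esub> app f x w"
  using linear_mapsD(2)[OF morD(1)[OF Hom_mor]] .

lemma hom_smult: "f \<in> Hom Q M N \<Longrightarrow> x \<in> Ob C \<Longrightarrow> a \<in> carrier (sec A x) \<Longrightarrow> v \<in> el M x \<Longrightarrow>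
    app f x (a \<odot>\<^bsub>msec M x\<^esub> v) = a \<odot>\<^bsub>msec N x\<^esub> app f x v"
  using linear_mapsD(3)[OF morD(1)[OF Hom_mor]] .

lemma hom_zero: "f \<in> Hom Q M N \<Longrightarrow> x \<in> Ob C \<Longrightarrow> app f x \<zero>\<^bsub>msec M x\<^esub> = \<zero>\<^bsub>msec N x\<^esub>"
  using linear_maps_zero[OF morD(1)[OF Hom_mor] cartD(1)[OF Hom_cart(1)] cartD(1)[OF Hom_cart(2)]] .

lemma hom_diff: "f \<in> Hom Q M N \<Longrightarrow> x \<in> Ob C \<Longrightarrow> v \<in> el M x \<Longrightarrow> w \<in> el M x \<Longrightarrow>
    app f x (v \<ominus>\<^bsub>msec M x\<^esub> w) = app f x v \<ominus>\<^bsub>msec N x\<^esub> app f x w"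
  using linear_maps_diff[OF morD(1)[OF Hom_mor] cartD(1)[OF Hom_cart(1)] cartD(1)[OF Hom_cart(2)]] .

lemma hom_nat: "h \<in> Hom Q M N \<Longrightarrow> f \<in> Ar C \<Longrightarrow> v \<in> el M (tgt C f) \<Longrightarrow>
    app h (src C f) (mres M f v) = mres N f (app h (tgt C f) v)"
  using morD(2)[OF Hom_mor] .

lemma res_closed: "cart M \<Longrightarrow> f \<in> Ar C \<Longrightarrow> v \<in> el M (tgt C f) \<Longrightarrow> mres M f v \<in> el M (src C f)"
  using semilinearD(1)[OF cartD(4)] .

lemma comp_arr: "f \<in> Hom Q M N \<Longrightarrow> g \<in> Hom Q N P \<Longrightarrow> g \<bullet>\<^bsub>Q\<^esub> f = arr M (\<lambda>x v. app g x (app f x v)) P"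
  unfolding Hom_iff arr_def app_def by (auto simp: Qcoh_def compose_def intro!: restrict_ext)

lemma comp_Hom:
  assumes "f \<in> Hom Q M N" "g \<in> Hom Q N P"
  shows "g \<bullet>\<^bsub>Q\<^esub> f \<in> Hom Q M P"
  unfolding comp_arr[OF assms]
  by (rule arr_Hom[OF Hom_cart(1)[OF assms(1)] Hom_cart(2)[OF assms(2)]])
    (auto simp: mor_def hom_nat[OF assms(1)] hom_nat[OF assms(2)] Ar_Ob hom_closed[OF assms(1)]
      intro!: linear_maps_comp[OF morD(1)[OF Hom_mor[OF assms(1)]] morD(1)[OF Hom_mor[OF assms(2)]]])

lemma comp_app: "f \<in> Hom Q M N \<Longrightarrow> g \<in> Hom Q N P \<Longrightarrow> x \<in> Ob C \<Longrightarrow> v \<in> el M x \<Longrightarrow>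
    app (g \<bullet>\<^bsub>Q\<^esub> f) x v = app g x (app f x v)"
  by (simp add: comp_arr app_arr)

lemma ide_arr: "ide Q M = arr M (\<lambda>x v. v) M"
  by (auto simp: Qcoh_def arr_def intro!: restrict_ext)

lemma ide_Hom: "cart M \<Longrightarrow> ide Q M \<in> Hom Q M M"
  unfolding ide_arr by (rule arr_Hom) (auto simp: mor_def intro!: linear_mapsI)

lemma ide_app: "x \<in> Ob C \<Longrightarrow> v \<in> el M x \<Longrightarrow> app (ide Q M) x v = v"
  by (simp add: ide_arr app_arr)

lemma comp_assoc:
  "f \<in> Hom Q M N \<Longrightarrow> g \<in> Hom Q N P \<Longrightarrow> h \<in> Hom Q P L \<Longrightarrow> h \<bullet>\<^bsub>Q\<^esub> (g \<bullet>\<^bsub>Q\<^esub> f) = (h \<bullet>\<^bsub>Q\<^esub> g) \<bullet>\<^bsub>Q\<^esub> f"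
  by (rule hom_eqI[of _ M L]) (auto intro: comp_Hom simp: comp_app[OF _ comp_Hom] comp_app hom_closed
      comp_app[OF comp_Hom])

lemma comp_ide: "f \<in> Hom Q M N \<Longrightarrow> f \<bullet>\<^bsub>Q\<^esub> ide Q M = f" "f \<in> Hom Q M N \<Longrightarrow> ide Q N \<bullet>\<^bsub>Q\<^esub> f = f"
  by (rule hom_eqI[of _ M N]; auto intro: comp_Hom ide_Hom Hom_cart simp: comp_app[OF ide_Hom[OF Hom_cart(1)]]
      comp_app[OF _ ide_Hom[OF Hom_cart(2)]] ide_app hom_closed)+

lemma category_Q: "category Q"
  unfolding category_def
proof (intro conjI ballI impI)
  fix f assume "f \<in> Ar Q"
  then have f: "f \<in> Hom Q (src Q f) (tgt Q f)" by (simp add: Ar_Q)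
  show "src Q f \<in> Ob Q" "tgt Q f \<in> Ob Q" using Hom_cart[OF f] by (auto simp: Q_simps)
  show "f \<bullet>\<^bsub>Q\<^esub> ide Q (src Q f) = f" "ide Q (tgt Q f) \<bullet>\<^bsub>Q\<^esub> f = f" using comp_ide[OF f] by auto
next
  fix M assume "M \<in> Ob Q" then show "ide Q M \<in> Hom Q M M" by (simp add: Q_simps ide_Hom)
next
  fix f g assume "f \<in> Ar Q" "g \<in> Ar Q" "tgt Q f = src Q g"
  then show "g \<bullet>\<^bsub>Q\<^esub> f \<in> Hom Q (src Q f) (tgt Q g)"
    by (intro comp_Hom[of f _ "tgt Q f"]) (auto simp: Ar_Q)
next
  fix f g h assume "f \<in> Ar Q" "g \<in> Ar Q" "h \<in> Ar Q" "tgt Q f = src Q g \<and> tgt Q g = src Q h"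
  then show "h \<bullet>\<^bsub>Q\<^esub> (g \<bullet>\<^bsub>Q\<^esub> f) = (h \<bullet>\<^bsub>Q\<^esub> g) \<bullet>\<^bsub>Q\<^esub> f"
    by (intro comp_assoc[of f "src Q f" "tgt Q f" g "tgt Q g" h "tgt Q h"]) (auto simp: Ar_Q)
qed

text \<open>Extensionality is essential: it places the component families inside a product of small
  sets.\<close>

lemma small_Hom:
  assumes "cart M" "cart N"
  shows "small TYPE('u) (Hom Q M N)"
proof -
  let ?P = "\<Pi>\<^sub>E x\<in>Ob C. \<Pi>\<^sub>E v\<in>el M x. el N x"
  have "small TYPE('u) ?P"
    by (intro small_PiE univ small_Ob cartD assms)
  then have "small TYPE('u) ((\<lambda>\<phi>. (M, \<phi>, N)) ` ?P)" by (rule small_image)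
  moreover have "Hom Q M N \<subseteq> (\<lambda>\<phi>. (M, \<phi>, N)) ` ?P"
    unfolding Hom_iff by (auto simp: module_morphism_def linear_maps_def PiE_def Hom_iff)
  ultimately show ?thesis by (rule small_subset)
qed

lemma locally_small_Q: "locally_small TYPE('u) Q"
  unfolding locally_small_def by (simp add: Q_simps small_Hom)

subsection \<open>Factorisation, subobjects and quotients\<close>

text \<open>Together with \<open>into\<close> the elementwise form of epimorphisms and
  monomorphisms; that \<open>epic\<close> and \<open>monic\<close> imply it is shown once kernels
  and cokernels are available.\<close>

definition onto :: "('o, 'a, 'u) module_presheaf \<Rightarrow> ('o, 'a, 'u) module_presheaf \<times> ('o \<Rightarrow> 'u \<Rightarrow> 'u) \<times> ('o, 'a, 'u) module_presheaf \<Rightarrow> bool" where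
  "onto N f \<longleftrightarrow> (\<forall>x\<in>Ob C. \<forall>w\<in>el N x. \<exists>v\<in>el (src Q f) x. app f x v = w)"

definition into :: "('o, 'a, 'u) module_presheaf \<times> ('o \<Rightarrow> 'u \<Rightarrow> 'u) \<times> ('o, 'a, 'u) module_presheaf \<Rightarrow> bool" where
  "into f \<longleftrightarrow> (\<forall>x\<in>Ob C. inj_on (app f x) (el (src Q f) x))"

lemma ontoD: "onto N f \<Longrightarrow> f \<in> Hom Q M N \<Longrightarrow> x \<in> Ob C \<Longrightarrow> w \<in> el N x \<Longrightarrow> \<exists>v\<in>el M x. app f x v = w"
  unfolding onto_def by (auto dest: HomD)

lemma ontoI: "f \<in> Hom Q M N \<Longrightarrow> (\<And>x w. x \<in> Ob C \<Longrightarrow> w \<in> el N x \<Longrightarrow> \<exists>v\<in>el M x. app f x v = w) \<Longrightarrow> onto N f"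
  unfolding onto_def by (auto dest: HomD)

lemma intoD: "into f \<Longrightarrow> f \<in> Hom Q M N \<Longrightarrow> x \<in> Ob C \<Longrightarrow> v \<in> el M x \<Longrightarrow> w \<in> el M x \<Longrightarrow> app f x v = app f x w \<Longrightarrow> v = w"
  unfolding into_def by (auto dest!: HomD inj_onD)

lemma el_zero: "cart M \<Longrightarrow> x \<in> Ob C \<Longrightarrow> \<zero>\<^bsub>msec M x\<^esub> \<in> el M x"
  by (rule abelian_groupE(2)[OF cart_group])

lemma el_add: "cart M \<Longrightarrow> x \<in> Ob C \<Longrightarrow> v \<in> el M x \<Longrightarrow> w \<in> el M x \<Longrightarrow> v \<oplus>\<^bsub>msec M x\<^esub> w \<in> el M x"
  by (rule abelian_groupE(1)[OF cart_group])

lemma el_smult: "cart M \<Longrightarrow> x \<in> Ob C \<Longrightarrow> a \<in> carrier (sec A x) \<Longrightarrow> v \<in> el M x \<Longrightarrow> a \<odot>\<^bsub>msec M x\<^esub> v \<in> el M x"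
  by (rule module.smult_closed[OF cartD(1)])

lemma el_diff: "cart M \<Longrightarrow> x \<in> Ob C \<Longrightarrow> v \<in> el M x \<Longrightarrow> w \<in> el M x \<Longrightarrow> v \<ominus>\<^bsub>msec M x\<^esub> w \<in> el M x"
  using abelian_group.minus_closed[OF cart_group] .

lemma diff_zero: "cart M \<Longrightarrow> x \<in> Ob C \<Longrightarrow> v \<in> el M x \<Longrightarrow> w \<in> el M x \<Longrightarrow> v \<ominus>\<^bsub>msec M x\<^esub> w = \<zero>\<^bsub>msec M x\<^esub> \<longleftrightarrow> v = w"
  using abelian_group.diff_zero_iff[OF cart_group] .

lemma intoI:
  assumes f: "f \<in> Hom Q M N" and "\<And>x v. x \<in> Ob C \<Longrightarrow> v \<in> el M x \<Longrightarrow> app f x v = \<zero>\<^bsub>msec N x\<^esub> \<Longrightarrow> v = \<zero>\<^bsub>msec M x\<^esub>"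
  shows "into f"
  unfolding into_def
proof (intro ballI inj_onI)
  fix x v w assume x: "x \<in> Ob C" and vw: "v \<in> el (src Q f) x" "w \<in> el (src Q f) x" "app f x v = app f x w"
  then have vw: "v \<in> el M x" "w \<in> el M x" using HomD[OF f] by auto
  have "app f x (v \<ominus>\<^bsub>msec M x\<^esub> w) = \<zero>\<^bsub>msec N x\<^esub>"
    using vw x f \<open>app f x v = app f x w\<close> diff_zero[OF Hom_cart(2)[OF f] x] by (simp add: hom_diff hom_closed)
  then have "v \<ominus>\<^bsub>msec M x\<^esub> w = \<zero>\<^bsub>msec M x\<^esub>"
    using assms(2)[OF x] el_diff[OF Hom_cart(1)[OF f] x] vw by blast
  then show "v = w" using diff_zero[OF Hom_cart(1)[OF f] x] vw by blast
qed

text \<open>At each object the factor exists by \<open>semilinear_factor\<close>; surjectivity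
  forces the factors to be compatible with restriction.\<close>

lemma factor_onto:
  assumes q: "q \<in> Hom Q M N" "onto N q" and h: "h \<in> Hom Q M P"
    and ker: "\<And>x v. x \<in> Ob C \<Longrightarrow> v \<in> el M x \<Longrightarrow> app q x v = \<zero>\<^bsub>msec N x\<^esub> \<Longrightarrow> app h x v = \<zero>\<^bsub>msec P x\<^esub>"
  shows "\<exists>u\<in>Hom Q N P. u \<bullet>\<^bsub>Q\<^esub> q = h"
proof -
  note cM = Hom_cart(1)[OF q(1)] and cN = Hom_cart(2)[OF q(1)] and cP = Hom_cart(2)[OF h]
  have "\<exists>u. semilinear (sec A x) (\<lambda>a. a) (msec N x) (msec P x) u \<and> (\<forall>v\<in>el M x. u (app q x v) = app h x v)"
    if x: "x \<in> Ob C" for x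
  proof (rule semilinear_factor[OF morD(1)[OF Hom_mor[OF q(1)] x] _ _ ker[OF x] cartD(1)[OF cM x] cartD(1)[OF cN x] cartD(1)[OF cP x]])
    show "app q x ` el M x = el N x" using ontoD[OF q(2,1) x] hom_closed[OF q(1) x] by blast
    show "semilinear (sec A x) (\<lambda>a. a) (msec M x) (msec P x) (app h x)"
      using morD(1)[OF Hom_mor[OF h] x] by (simp add: linear_iff_semilinear)
  qed
  then obtain u where u: "\<And>x. x \<in> Ob C \<Longrightarrow> u x \<in> linear_maps (sec A x) (msec N x) (msec P x)"
    and uq: "\<And>x v. x \<in> Ob C \<Longrightarrow> v \<in> el M x \<Longrightarrow> u x (app q x v) = app h x v"
    unfolding linear_iff_semilinear by metis
  have m: "mor N P u"
    unfolding mor_def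
  proof (intro conjI ballI)
    fix f w assume f: "f \<in> Ar C" and w: "w \<in> el N (tgt C f)"
    obtain v where v: "v \<in> el M (tgt C f)" "app q (tgt C f) v = w" using ontoD[OF q(2,1) Ar_Ob(2)[OF f] w] by blast
    show "u (src C f) (mres N f w) = mres P f (u (tgt C f) w)"
      using v f uq[OF Ar_Ob(2)[OF f] v(1)] uq[OF Ar_Ob(1)[OF f] res_closed[OF cM f v(1)]]
        hom_nat[OF q(1) f v(1)] hom_nat[OF h f v(1)] by simp
  qed (rule u)
  have "arr N u P \<bullet>\<^bsub>Q\<^esub> q = h"
    using arr_Hom[OF cN cP m] q(1) h
    by (intro hom_eqI[of _ M P]) (auto intro: comp_Hom simp: comp_app app_arr hom_closed uq)
  then show ?thesis using arr_Hom[OF cN cP m] by blast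
qed

lemma factor_into:
  assumes k: "k \<in> Hom Q K M" "into k" and h: "h \<in> Hom Q P M"
    and im: "\<And>x v. x \<in> Ob C \<Longrightarrow> v \<in> el P x \<Longrightarrow> \<exists>w\<in>el K x. app k x w = app h x v"
  shows "\<exists>u\<in>Hom Q P K. k \<bullet>\<^bsub>Q\<^esub> u = h"
proof -
  note cK = Hom_cart(1)[OF k(1)] and cM = Hom_cart(2)[OF k(1)] and cP = Hom_cart(1)[OF h]
  obtain u where u: "\<And>x v. x \<in> Ob C \<Longrightarrow> v \<in> el P x \<Longrightarrow> u x v \<in> el K x \<and> app k x (u x v) = app h x v"
    using im by metis
  \<comment> \<open>Preimages under an injective map are unique, so linearity and naturality of
    \<open>u\<close> are checked after applying \<open>k\<close>.\<close>
  have eq: "w = u x v" if "x \<in> Ob C" "v \<in> el P x" "w \<in> el K x" "app k x w = app h x v" for x v w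
    using intoD[OF k(2,1) that(1,3)] u[OF that(1,2)] that(4) by simp
  have m: "mor P K u"
    unfolding mor_def
  proof (intro conjI ballI linear_mapsI)
    fix x v assume x: "x \<in> Ob C" and v: "v \<in> el P x"
    show "u x v \<in> el K x" using u[OF x v] by blast
    show "u x (v \<oplus>\<^bsub>msec P x\<^esub> w) = u x v \<oplus>\<^bsub>msec K x\<^esub> u x w" if w: "w \<in> el P x" for w
      using u[OF x v] u[OF x w] x v w cP cK
      by (intro eq[symmetric]) (auto simp: el_add hom_add[OF k(1)] hom_add[OF h])
  next
    fix x v a assume x: "x \<in> Ob C" and v: "v \<in> el P x" and a: "a \<in> carrier (sec A x)"
    show "u x (a \<odot>\<^bsub>msec P x\<^esub> v) = a \<odot>\<^bsub>msec K x\<^esub> u x v"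
      using u[OF x v] x v a cP cK
      by (intro eq[symmetric]) (auto simp: el_smult hom_smult[OF k(1)] hom_smult[OF h])
  next
    fix f v assume f: "f \<in> Ar C" and v: "v \<in> el P (tgt C f)"
    show "u (src C f) (mres P f v) = mres K f (u (tgt C f) v)"
      using u[OF Ar_Ob(2)[OF f] v] f v cP cK
      by (intro eq[symmetric]) (auto simp: res_closed Ar_Ob hom_nat[OF k(1)] hom_nat[OF h])
  qed
  have "k \<bullet>\<^bsub>Q\<^esub> arr P u K = h"
    using arr_Hom[OF cP cK m] k(1) h u
    by (intro hom_eqI[of _ P M]) (auto intro: comp_Hom simp: comp_app app_arr)
  then show ?thesis using arr_Hom[OF cP cK m] by blast
qed

lemma sub_hom:
  assumes M: "cart M" and N: "csub M N"
  obtains k where "k \<in> Hom Q (subm M N) M" "into k" "\<And>x v. x \<in> Ob C \<Longrightarrow> v \<in> N x \<Longrightarrow> app k x v = v"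
proof
  have "mor (subm M N) M (\<lambda>x v. v)"
    using subsetD[OF csub_props(1)[OF M N]] unfolding mor_def by (auto intro!: linear_mapsI)
  from arr_Hom[OF subm_cart[OF M N] M this] show k: "arr (subm M N) (\<lambda>x v. v) M \<in> Hom Q (subm M N) M" .
  show eq: "x \<in> Ob C \<Longrightarrow> v \<in> N x \<Longrightarrow> app (arr (subm M N) (\<lambda>x v. v) M) x v = v" for x v
    by (rule app_arr) simp_all
  show "into (arr (subm M N) (\<lambda>x v. v) M)"
    unfolding into_def using HomD[OF k] by (auto intro!: inj_onI simp: eq)
qed

lemma quot_hom:
  assumes M: "cart M" and N: "csub M N"
  obtains q where "q \<in> Hom Q M (quotm M N)" "onto (quotm M N) q"
    "\<And>x v. x \<in> Ob C \<Longrightarrow> v \<in> el M x \<Longrightarrow> app q x v = \<zero>\<^bsub>msec (quotm M N) x\<^esub> \<longleftrightarrow> v \<in> N x"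
proof
  let ?q = "arr M (\<lambda>x. qrep (msec M x) (N x)) (quotm M N)"
  show q: "?q \<in> Hom Q M (quotm M N)" by (rule arr_Hom[OF M quotm_cart[OF M N] quotm_proj[OF M N]])
  show "onto (quotm M N) ?q"
    by (rule ontoI[OF q]) (auto simp: mquot_carrier app_arr)
  show "app ?q x v = \<zero>\<^bsub>msec (quotm M N) x\<^esub> \<longleftrightarrow> v \<in> N x" if "x \<in> Ob C" "v \<in> el M x" for x v
    unfolding app_arr[OF that] by (rule quotm_ker[OF M N that])
qed

lemma csub_hom_image: "f \<in> Hom Q M N \<Longrightarrow> csub N (\<lambda>x. app f x ` el M x)"
  by (rule csub_image[OF Hom_cart Hom_mor])

lemma csub_hom_kernel: "f \<in> Hom Q M N \<Longrightarrow> csub M (\<lambda>x. {v \<in> el M x. app f x v = \<zero>\<^bsub>msec N x\<^esub>})"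
  by (rule csub_kernel[OF Hom_cart Hom_mor])

text \<open>The preimage of L is the kernel of M -> N -> N/L, hence cartesian by the result on
  kernels.\<close>

lemma csub_preimage:
  assumes f: "f \<in> Hom Q M N" and L: "csub N L"
  shows "csub M (\<lambda>x. {v \<in> el M x. app f x v \<in> L x})"
proof -
  obtain q where q: "q \<in> Hom Q N (quotm N L)" and
    "onto (quotm N L) q" and q2: "\<And>x v. x \<in> Ob C \<Longrightarrow> v \<in> el N x \<Longrightarrow> app q x v = \<zero>\<^bsub>msec (quotm N L) x\<^esub> \<longleftrightarrow> v \<in> L x"
    by (rule quot_hom[OF Hom_cart(2)[OF f] L]) blast
  have "csub M (\<lambda>x. {v \<in> el M x. app (q \<bullet>\<^bsub>Q\<^esub> f) x v = \<zero>\<^bsub>msec (quotm N L) x\<^esub>})"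
    by (rule csub_hom_kernel[OF comp_Hom[OF f q]])
  moreover have "{v \<in> el M x. app (q \<bullet>\<^bsub>Q\<^esub> f) x v = \<zero>\<^bsub>msec (quotm N L) x\<^esub>} = {v \<in> el M x. app f x v \<in> L x}"
    if "x \<in> Ob C" for x using that q2 by (auto simp: comp_app[OF f q] hom_closed[OF f])
  ultimately show ?thesis unfolding csub_def by (auto simp: Ar_Ob)
qed

subsection \<open>Zero morphisms\<close>

text \<open>The direct sum over the empty index set; the index type and the family are
  arbitrary.\<close>

definition zmod :: "('o, 'a, 'u) module_presheaf" where
  "zmod = coprod ({} :: nat set) (\<lambda>_. undefined)"

lemma small_empty: "small TYPE('u) {}"
  by (rule small_finite[OF univ]) simp

lemma zmod_cart: "cart zmod"
  unfolding zmod_def by (rule coprod_cart) (auto intro: small_empty)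

lemma zmod_el:
  assumes x: "x \<in> Ob C" and v: "v \<in> el zmod x"
  shows "v = \<zero>\<^bsub>msec zmod x\<^esub>"
proof -
  interpret Z: abelian_group "msec zmod x" by (rule cart_group[OF zmod_cart x])
  show ?thesis
    using Z.zero_closed Z.r_zero unfolding zmod_def
    by (intro coprod_induct[of "{} :: nat set" "\<lambda>_. undefined" x v "\<lambda>v. v = \<zero>\<^bsub>msec (coprod ({} :: nat set) (\<lambda>_. undefined)) x\<^esub>"]
        small_empty x v[unfolded zmod_def]) simp_all
qed

definition zhom where "zhom M N = arr M (\<lambda>x v. \<zero>\<^bsub>msec N x\<^esub>) N"

lemma zhom_Hom:
  assumes "cart M" "cart N"
  shows "zhom M N \<in> Hom Q M N"
  unfolding zhom_def
proof (rule arr_Hom[OF assms])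
  show "mor M N (\<lambda>x v. \<zero>\<^bsub>msec N x\<^esub>)"
    unfolding mor_def
  proof (intro conjI ballI linear_mapsI)
    fix x assume x: "x \<in> Ob C"
    interpret N: module "sec A x" "msec N x" by (rule cartD(1)[OF assms(2) x])
    show "\<zero>\<^bsub>msec N x\<^esub> \<in> el N x" "\<zero>\<^bsub>msec N x\<^esub> = \<zero>\<^bsub>msec N x\<^esub> \<oplus>\<^bsub>msec N x\<^esub> \<zero>\<^bsub>msec N x\<^esub>" by auto
    show "\<zero>\<^bsub>msec N x\<^esub> = a \<odot>\<^bsub>msec N x\<^esub> \<zero>\<^bsub>msec N x\<^esub>" if "a \<in> carrier (sec A x)" for a using that by simp
  next
    fix f assume f: "f \<in> Ar C"
    show "\<zero>\<^bsub>msec N (src C f)\<^esub> = mres N f \<zero>\<^bsub>msec N (tgt C f)\<^esub>"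
      using semilinear_zero[OF cartD(4)[OF assms(2) f] cartD(1)[OF assms(2)] cartD(1)[OF assms(2)]] Ar_Ob[OF f] by simp
  qed
qed

lemma zhom_app: "x \<in> Ob C \<Longrightarrow> v \<in> el M x \<Longrightarrow> app (zhom M N) x v = \<zero>\<^bsub>msec N x\<^esub>"
  unfolding zhom_def by (rule app_arr)

lemma zero_object_Q: "zero_object Q zmod"
  unfolding zero_object_def
proof (intro conjI ballI)
  show "zmod \<in> Ob Q" by (simp add: Q_simps zmod_cart)
  fix M assume "M \<in> Ob Q"
  then have M: "cart M" by (simp add: Q_simps)
  have "f = g" if "f \<in> Hom Q M zmod" "g \<in> Hom Q M zmod" for f g
    using that by (intro hom_eqI[OF that]) (metis zmod_el hom_closed)
  then show "\<exists>!f. f \<in> Hom Q M zmod" using zhom_Hom[OF M zmod_cart] by blast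
  have "f = g" if "f \<in> Hom Q zmod M" "g \<in> Hom Q zmod M" for f g
    using that by (intro hom_eqI[OF that]) (metis zmod_el hom_zero)
  then show "\<exists>!f. f \<in> Hom Q zmod M" using zhom_Hom[OF zmod_cart M] by blast
qed

lemma zero_arrow_iff:
  assumes f: "f \<in> Hom Q M N"
  shows "zero_arrow Q f \<longleftrightarrow> (\<forall>x\<in>Ob C. \<forall>v\<in>el M x. app f x v = \<zero>\<^bsub>msec N x\<^esub>)"
proof
  note M = Hom_cart(1)[OF f] and N = Hom_cart(2)[OF f]
  assume "zero_arrow Q f"
  then obtain z g h where z: "zero_object Q z" and g: "g \<in> Hom Q M z" and h: "h \<in> Hom Q z N"
    and fhg: "f = h \<bullet>\<^bsub>Q\<^esub> g"
    unfolding zero_arrow_def using HomD[OF f] by auto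
  have cz: "cart z" using Hom_cart[OF g] by simp
  \<comment> \<open>A zero object has only one endomorphism. Identity and zero therefore coincide,
    and all elements of \<open>z\<close> vanish.\<close>
  have "ide Q z = zhom z z"
    using z ide_Hom[OF cz] zhom_Hom[OF cz cz] cz unfolding zero_object_def Q_simps by blast
  then have "v = \<zero>\<^bsub>msec z x\<^esub>" if "x \<in> Ob C" "v \<in> el z x" for x v
    using zhom_app[OF that] ide_app[OF that] by metis
  then show "\<forall>x\<in>Ob C. \<forall>v\<in>el M x. app f x v = \<zero>\<^bsub>msec N x\<^esub>"
    using hom_closed[OF g] hom_zero[OF h] by (metis fhg comp_app[OF g h])
next
  note M = Hom_cart(1)[OF f] and N = Hom_cart(2)[OF f]
  note g = zhom_Hom[OF M zmod_cart] and h = zhom_Hom[OF zmod_cart N]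
  assume *: "\<forall>x\<in>Ob C. \<forall>v\<in>el M x. app f x v = \<zero>\<^bsub>msec N x\<^esub>"
  have "f = zhom zmod N \<bullet>\<^bsub>Q\<^esub> zhom M zmod"
    using * by (intro hom_eqI[OF f comp_Hom[OF g h]])
      (auto simp: comp_app[OF g h] zhom_app hom_zero[OF h] hom_closed[OF g])
  then show "zero_arrow Q f"
    unfolding zero_arrow_def using zero_object_Q g h HomD[OF f] by auto
qed

subsection \<open>Kernels and cokernels\<close>

lemma into_eq:
  assumes "into k" and k: "k \<in> Hom Q K M" and u: "u \<in> Hom Q P K" and u': "u' \<in> Hom Q P K"
    and eq: "k \<bullet>\<^bsub>Q\<^esub> u = k \<bullet>\<^bsub>Q\<^esub> u'"
  shows "u = u'"
proof (rule hom_eqI[OF u u'])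
  fix x v assume x: "x \<in> Ob C" and v: "v \<in> el P x"
  show "app u x v = app u' x v"
    using comp_app[OF u k x v] comp_app[OF u' k x v] eq
    by (intro intoD[OF assms(1) k x hom_closed[OF u x v] hom_closed[OF u' x v]]) simp
qed

lemma onto_eq:
  assumes "onto N c" and c: "c \<in> Hom Q M N" and u: "u \<in> Hom Q N P" and u': "u' \<in> Hom Q N P"
    and eq: "u \<bullet>\<^bsub>Q\<^esub> c = u' \<bullet>\<^bsub>Q\<^esub> c"
  shows "u = u'"
proof (rule hom_eqI[OF u u'])
  fix x w assume x: "x \<in> Ob C" and "w \<in> el N x"
  then obtain v where v: "v \<in> el M x" "app c x v = w" using ontoD[OF assms(1) c] by blast
  show "app u x w = app u' x w"
    using comp_app[OF c u x v(1)] comp_app[OF c u' x v(1)] eq v(2) by simp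
qed

lemma is_kernelI:
  assumes f: "f \<in> Hom Q M N" and k: "k \<in> Hom Q K M" and "into k"
    and ker: "\<And>x. x \<in> Ob C \<Longrightarrow> {v \<in> el M x. app f x v = \<zero>\<^bsub>msec N x\<^esub>} = app k x ` el K x"
  shows "is_kernel Q f k"
  unfolding is_kernel_def
proof (intro conjI ballI impI)
  show "f \<in> Ar Q" "k \<in> Ar Q" "tgt Q k = src Q f" using HomD[OF f] HomD[OF k] by auto
  show "zero_arrow Q (f \<bullet>\<^bsub>Q\<^esub> k)"
    unfolding zero_arrow_iff[OF comp_Hom[OF k f]] using ker by (auto simp: comp_app[OF k f])
  fix h assume "h \<in> Ar Q" and h0: "tgt Q h = src Q f \<and> zero_arrow Q (f \<bullet>\<^bsub>Q\<^esub> h)"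
  define P where "P = src Q h"
  have h: "h \<in> Hom Q P M" using \<open>h \<in> Ar Q\<close> h0 HomD[OF f] by (simp add: Hom_def P_def)
  have z: "app f x (app h x v) = \<zero>\<^bsub>msec N x\<^esub>" if "x \<in> Ob C" "v \<in> el P x" for x v
    using h0 that zero_arrow_iff[OF comp_Hom[OF h f]] by (simp add: comp_app[OF h f])
  have "\<exists>w\<in>el K x. app k x w = app h x v" if "x \<in> Ob C" "v \<in> el P x" for x v
  proof -
    have "app h x v \<in> {v \<in> el M x. app f x v = \<zero>\<^bsub>msec N x\<^esub>}" using z hom_closed[OF h] that by simp
    then show ?thesis unfolding ker[OF that(1)] by auto
  qed
  then have "\<exists>u\<in>Hom Q P K. k \<bullet>\<^bsub>Q\<^esub> u = h" by (rule factor_into[OF k \<open>into k\<close> h])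
  moreover have "u = u'" if "u \<in> Hom Q P K" "u' \<in> Hom Q P K" "k \<bullet>\<^bsub>Q\<^esub> u = k \<bullet>\<^bsub>Q\<^esub> u'" for u u'
    using into_eq[OF \<open>into k\<close> k that] .
  moreover have "src Q h = P" "src Q k = K" using HomD[OF k] by (simp_all add: P_def)
  ultimately show "\<exists>!u. u \<in> Hom Q (src Q h) (src Q k) \<and> k \<bullet>\<^bsub>Q\<^esub> u = h"
    by (intro ex_ex1I) auto
qed

lemma is_cokernelI:
  assumes f: "f \<in> Hom Q K M" and c: "c \<in> Hom Q M N" and "onto N c"
    and ker: "\<And>x. x \<in> Ob C \<Longrightarrow> {v \<in> el M x. app c x v = \<zero>\<^bsub>msec N x\<^esub>} = app f x ` el K x"
  shows "is_cokernel Q f c"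
  unfolding is_cokernel_def
proof (intro conjI ballI impI)
  show "f \<in> Ar Q" "c \<in> Ar Q" "src Q c = tgt Q f" using HomD[OF f] HomD[OF c] by auto
  show "zero_arrow Q (c \<bullet>\<^bsub>Q\<^esub> f)"
    unfolding zero_arrow_iff[OF comp_Hom[OF f c]] using ker by (auto simp: comp_app[OF f c])
  fix h assume "h \<in> Ar Q" and h0: "src Q h = tgt Q f \<and> zero_arrow Q (h \<bullet>\<^bsub>Q\<^esub> f)"
  define P where "P = tgt Q h"
  have h: "h \<in> Hom Q M P" using \<open>h \<in> Ar Q\<close> h0 HomD[OF f] by (simp add: Hom_def P_def)
  have z: "app h x (app f x v) = \<zero>\<^bsub>msec P x\<^esub>" if "x \<in> Ob C" "v \<in> el K x" for x v
    using h0 that zero_arrow_iff[OF comp_Hom[OF f h]] by (simp add: comp_app[OF f h])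
  have "app h x v = \<zero>\<^bsub>msec P x\<^esub>" if "x \<in> Ob C" "v \<in> el M x" "app c x v = \<zero>\<^bsub>msec N x\<^esub>" for x v
  proof -
    have "v \<in> app f x ` el K x" using ker[OF that(1)] that by blast
    then show ?thesis using z that(1) by auto
  qed
  then have "\<exists>u\<in>Hom Q N P. u \<bullet>\<^bsub>Q\<^esub> c = h" by (rule factor_onto[OF c \<open>onto N c\<close> h])
  moreover have "u = u'" if "u \<in> Hom Q N P" "u' \<in> Hom Q N P" "u \<bullet>\<^bsub>Q\<^esub> c = u' \<bullet>\<^bsub>Q\<^esub> c" for u u'
    using onto_eq[OF \<open>onto N c\<close> c that] .
  moreover have "tgt Q h = P" "tgt Q c = N" using HomD[OF c] by (simp_all add: P_def)
  ultimately show "\<exists>!u. u \<in> Hom Q (tgt Q c) (tgt Q h) \<and> u \<bullet>\<^bsub>Q\<^esub> c = h"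
    by (intro ex_ex1I) auto
qed

lemma kernel_exists:
  assumes f: "f \<in> Hom Q M N"
  obtains K k where "k \<in> Hom Q K M" "into k"
    "\<And>x. x \<in> Ob C \<Longrightarrow> {v \<in> el M x. app f x v = \<zero>\<^bsub>msec N x\<^esub>} = app k x ` el K x"
proof -
  let ?K = "\<lambda>x. {v \<in> el M x. app f x v = \<zero>\<^bsub>msec N x\<^esub>}"
  obtain k where k: "k \<in> Hom Q (subm M ?K) M" "into k" "\<And>x v. x \<in> Ob C \<Longrightarrow> v \<in> ?K x \<Longrightarrow> app k x v = v"
    by (rule sub_hom[OF Hom_cart(1)[OF f] csub_hom_kernel[OF f]]) blast
  have "?K x = app k x ` el (subm M ?K) x" if "x \<in> Ob C" for x
    using k(3)[OF that] by (auto simp: image_iff)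
  then show ?thesis using that k by blast
qed

lemma cokernel_exists:
  assumes f: "f \<in> Hom Q K M"
  obtains N c where "c \<in> Hom Q M N" "onto N c"
    "\<And>x. x \<in> Ob C \<Longrightarrow> {v \<in> el M x. app c x v = \<zero>\<^bsub>msec N x\<^esub>} = app f x ` el K x"
proof -
  let ?I = "\<lambda>x. app f x ` el K x"
  obtain c where c: "c \<in> Hom Q M (quotm M ?I)" "onto (quotm M ?I) c"
    "\<And>x v. x \<in> Ob C \<Longrightarrow> v \<in> el M x \<Longrightarrow> app c x v = \<zero>\<^bsub>msec (quotm M ?I) x\<^esub> \<longleftrightarrow> v \<in> ?I x"
    by (rule quot_hom[OF Hom_cart(2)[OF f] csub_hom_image[OF f]]) blast
  have "{v \<in> el M x. app c x v = \<zero>\<^bsub>msec (quotm M ?I) x\<^esub>} = ?I x" if "x \<in> Ob C" for x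
    using c(3)[OF that] hom_closed[OF f that] by blast
  then show ?thesis using that c(1,2) by blast
qed

lemma comp_zhom: "f \<in> Hom Q M N \<Longrightarrow> cart L \<Longrightarrow> f \<bullet>\<^bsub>Q\<^esub> zhom L M = zhom L N"
  by (rule hom_eqI[of _ L N])
    (auto intro: comp_Hom zhom_Hom Hom_cart simp: comp_app[OF zhom_Hom[OF _ Hom_cart(1)]] zhom_app hom_zero)

lemma zhom_comp: "f \<in> Hom Q M N \<Longrightarrow> cart L \<Longrightarrow> zhom N L \<bullet>\<^bsub>Q\<^esub> f = zhom M L"
  by (rule hom_eqI[of _ M L])
    (auto intro: comp_Hom zhom_Hom Hom_cart simp: comp_app[OF _ zhom_Hom[OF Hom_cart(2)]] zhom_app hom_closed)

lemma zero_arrow_zhom: "cart M \<Longrightarrow> cart N \<Longrightarrow> zero_arrow Q (zhom M N)"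
  using zero_arrow_iff[OF zhom_Hom] zhom_app by blast

lemma zero_arrow_eq: "f \<in> Hom Q M N \<Longrightarrow> zero_arrow Q f \<Longrightarrow> f = zhom M N"
  using zero_arrow_iff zhom_app by (intro hom_eqI[of _ M N]) (auto intro: zhom_Hom Hom_cart)

text \<open>The cancellation property is applied to the inclusion of the kernel: it vanishes after
  \<open>f\<close>, hence is zero, so the kernel has no nonzero elements.\<close>

lemma into_cancel:
  assumes f: "f \<in> Hom Q M N"
    and canc: "\<And>L g. g \<in> Hom Q L M \<Longrightarrow> f \<bullet>\<^bsub>Q\<^esub> g = zhom L N \<Longrightarrow> g = zhom L M"
  shows "into f"
proof (rule intoI[OF f])
  obtain K k where k: "k \<in> Hom Q K M" "\<And>x. x \<in> Ob C \<Longrightarrow> {v \<in> el M x. app f x v = \<zero>\<^bsub>msec N x\<^esub>} = app k x ` el K x"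
    by (rule kernel_exists[OF f]) blast
  have "f \<bullet>\<^bsub>Q\<^esub> k = zhom K N"
    using k(2) by (intro hom_eqI[OF comp_Hom[OF k(1) f] zhom_Hom[OF Hom_cart(1)[OF k(1)] Hom_cart(2)[OF f]]])
      (auto simp: comp_app[OF k(1) f] zhom_app)
  then have kz: "k = zhom K M" by (rule canc[OF k(1)])
  fix x v assume xv: "x \<in> Ob C" "v \<in> el M x" "app f x v = \<zero>\<^bsub>msec N x\<^esub>"
  then obtain w where "w \<in> el K x" "v = app k x w" using k(2)[OF xv(1)] by blast
  then show "v = \<zero>\<^bsub>msec M x\<^esub>" using xv(1) by (simp add: kz zhom_app)
qed

text \<open>Dually, the projection to the cokernel vanishes on the image of \<open>f\<close>, hence
  is zero, so the image is everything.\<close>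

lemma onto_cancel:
  assumes f: "f \<in> Hom Q M N"
    and canc: "\<And>L g. g \<in> Hom Q N L \<Longrightarrow> g \<bullet>\<^bsub>Q\<^esub> f = zhom M L \<Longrightarrow> g = zhom N L"
  shows "onto N f"
proof (rule ontoI[OF f])
  obtain L c where c: "c \<in> Hom Q N L" "\<And>x. x \<in> Ob C \<Longrightarrow> {v \<in> el N x. app c x v = \<zero>\<^bsub>msec L x\<^esub>} = app f x ` el M x"
    by (rule cokernel_exists[OF f]) blast
  have "c \<bullet>\<^bsub>Q\<^esub> f = zhom M L"
    using c(2) by (intro hom_eqI[OF comp_Hom[OF f c(1)] zhom_Hom[OF Hom_cart(1)[OF f] Hom_cart(2)[OF c(1)]]])
      (auto simp: comp_app[OF f c(1)] zhom_app)
  then have cz: "c = zhom N L" by (rule canc[OF c(1)])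
  fix x w assume xw: "x \<in> Ob C" "w \<in> el N x"
  then have "w \<in> {v \<in> el N x. app c x v = \<zero>\<^bsub>msec L x\<^esub>}" by (simp add: cz zhom_app)
  then show "\<exists>v\<in>el M x. app f x v = w" unfolding c(2)[OF xw(1)] by auto
qed

text \<open>The concrete kernel factors through an abstract one, which gives one inclusion of
  images; the other holds because \<open>f\<close> kills \<open>k\<close>.\<close>

lemma is_kernelD:
  assumes f: "f \<in> Hom Q M N" and k: "k \<in> Hom Q K M" and ker: "is_kernel Q f k"
  shows "into k" and "x \<in> Ob C \<Longrightarrow> {v \<in> el M x. app f x v = \<zero>\<^bsub>msec N x\<^esub>} = app k x ` el K x"
proof -
  note M = Hom_cart(1)[OF f] and N = Hom_cart(2)[OF f] and K = Hom_cart(1)[OF k]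
  have fk: "f \<bullet>\<^bsub>Q\<^esub> k = zhom K N"
    using ker by (intro zero_arrow_eq[OF comp_Hom[OF k f]]) (simp add: is_kernel_def)
  have ex: "\<exists>!u. u \<in> Hom Q L K \<and> k \<bullet>\<^bsub>Q\<^esub> u = h" if h: "h \<in> Hom Q L M" "f \<bullet>\<^bsub>Q\<^esub> h = zhom L N" for h L
    using ker HomD[OF h(1)] HomD[OF f] HomD[OF k] zero_arrow_zhom[OF Hom_cart(1)[OF h(1)] N] h(2)
    unfolding is_kernel_def by metis
  show "into k"
  proof (rule into_cancel[OF k])
    fix L g assume g: "g \<in> Hom Q L K" "k \<bullet>\<^bsub>Q\<^esub> g = zhom L M"
    note L = Hom_cart(1)[OF g(1)]
    show "g = zhom L K"
      using ex[OF zhom_Hom[OF L M] comp_zhom[OF f L]] g zhom_Hom[OF L K] comp_zhom[OF k L] by blast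
  qed
  assume x: "x \<in> Ob C"
  obtain K' k' where k': "k' \<in> Hom Q K' M" "\<And>x. x \<in> Ob C \<Longrightarrow> {v \<in> el M x. app f x v = \<zero>\<^bsub>msec N x\<^esub>} = app k' x ` el K' x"
    by (rule kernel_exists[OF f]) blast
  have "f \<bullet>\<^bsub>Q\<^esub> k' = zhom K' N"
    using k'(2) by (intro hom_eqI[OF comp_Hom[OF k'(1) f] zhom_Hom[OF Hom_cart(1)[OF k'(1)] N]])
      (auto simp: comp_app[OF k'(1) f] zhom_app)
  then obtain u where u: "u \<in> Hom Q K' K" "k \<bullet>\<^bsub>Q\<^esub> u = k'" using ex[OF k'(1)] by blast
  have 1: "app k' x v \<in> app k x ` el K x" if "v \<in> el K' x" for v
    using that comp_app[OF u(1) k x that] hom_closed[OF u(1) x that] by (auto simp: u(2))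
  have 2: "app f x (app k x v) = \<zero>\<^bsub>msec N x\<^esub>" if "v \<in> el K x" for v
    using comp_app[OF k f x that] by (simp add: fk zhom_app[OF x that])
  show "{v \<in> el M x. app f x v = \<zero>\<^bsub>msec N x\<^esub>} = app k x ` el K x"
  proof
    show "{v \<in> el M x. app f x v = \<zero>\<^bsub>msec N x\<^esub>} \<subseteq> app k x ` el K x"
      unfolding k'(2)[OF x] using 1 by blast
    show "app k x ` el K x \<subseteq> {v \<in> el M x. app f x v = \<zero>\<^bsub>msec N x\<^esub>}"
      using hom_closed[OF k x] 2 by auto
  qed
qed

text \<open>The concrete cokernel map factors through \<open>c\<close>, so whatever \<open>c\<close>
  kills lies in the image of \<open>f\<close>.\<close>

lemma is_cokernelD:
  assumes f: "f \<in> Hom Q K M" and c: "c \<in> Hom Q M N" and coker: "is_cokernel Q f c"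
  shows "onto N c" and "x \<in> Ob C \<Longrightarrow> {v \<in> el M x. app c x v = \<zero>\<^bsub>msec N x\<^esub>} = app f x ` el K x"
proof -
  note K = Hom_cart(1)[OF f] and M = Hom_cart(2)[OF f] and N = Hom_cart(2)[OF c]
  have cf: "c \<bullet>\<^bsub>Q\<^esub> f = zhom K N"
    using coker by (intro zero_arrow_eq[OF comp_Hom[OF f c]]) (simp add: is_cokernel_def)
  have ex: "\<exists>!u. u \<in> Hom Q N L \<and> u \<bullet>\<^bsub>Q\<^esub> c = h" if h: "h \<in> Hom Q M L" "h \<bullet>\<^bsub>Q\<^esub> f = zhom K L" for h L
    using coker HomD[OF h(1)] HomD[OF f] HomD[OF c] zero_arrow_zhom[OF K Hom_cart(2)[OF h(1)]] h(2)
    unfolding is_cokernel_def by metis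
  show "onto N c"
  proof (rule onto_cancel[OF c])
    fix L g assume g: "g \<in> Hom Q N L" "g \<bullet>\<^bsub>Q\<^esub> c = zhom M L"
    note L = Hom_cart(2)[OF g(1)]
    show "g = zhom N L"
      using ex[OF zhom_Hom[OF M L] zhom_comp[OF f L]] g zhom_Hom[OF N L] zhom_comp[OF c L] by blast
  qed
  assume x: "x \<in> Ob C"
  obtain N' c' where c': "c' \<in> Hom Q M N'" "\<And>x. x \<in> Ob C \<Longrightarrow> {v \<in> el M x. app c' x v = \<zero>\<^bsub>msec N' x\<^esub>} = app f x ` el K x"
    by (rule cokernel_exists[OF f]) blast
  have "c' \<bullet>\<^bsub>Q\<^esub> f = zhom K N'"
    using c'(2) by (intro hom_eqI[OF comp_Hom[OF f c'(1)] zhom_Hom[OF K Hom_cart(2)[OF c'(1)]]])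
      (auto simp: comp_app[OF f c'(1)] zhom_app)
  then obtain u where u: "u \<in> Hom Q N N'" "u \<bullet>\<^bsub>Q\<^esub> c = c'" using ex[OF c'(1)] by blast
  have 1: "v \<in> app f x ` el K x" if "v \<in> el M x" "app c x v = \<zero>\<^bsub>msec N x\<^esub>" for v
  proof -
    have "v \<in> {v \<in> el M x. app c' x v = \<zero>\<^bsub>msec N' x\<^esub>}"
      using comp_app[OF c u(1) x that(1)] that hom_zero[OF u(1) x] by (simp add: u(2))
    then show ?thesis unfolding c'(2)[OF x] .
  qed
  have 2: "app c x (app f x v) = \<zero>\<^bsub>msec N x\<^esub>" if "v \<in> el K x" for v
    using comp_app[OF f c x that] by (simp add: cf zhom_app[OF x that])
  show "{v \<in> el M x. app c x v = \<zero>\<^bsub>msec N x\<^esub>} = app f x ` el K x"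
    using hom_closed[OF f x] 1 2 by auto
qed

lemma monic_into:
  assumes f: "f \<in> Hom Q M N" and "monic Q f"
  shows "into f"
proof (rule into_cancel[OF f])
  fix L g assume g: "g \<in> Hom Q L M" and "f \<bullet>\<^bsub>Q\<^esub> g = zhom L N"
  then have "f \<bullet>\<^bsub>Q\<^esub> g = f \<bullet>\<^bsub>Q\<^esub> zhom L M" by (simp add: comp_zhom[OF f Hom_cart(1)[OF g]])
  then show "g = zhom L M"
    using assms(2) HomD[OF f] HomD[OF g] HomD[OF zhom_Hom[OF Hom_cart[OF g]]] unfolding monic_def by metis
qed

lemma epic_onto:
  assumes f: "f \<in> Hom Q M N" and "epic Q f"
  shows "onto N f"
proof (rule onto_cancel[OF f])
  fix L g assume g: "g \<in> Hom Q N L" and "g \<bullet>\<^bsub>Q\<^esub> f = zhom M L"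
  then have "g \<bullet>\<^bsub>Q\<^esub> f = zhom N L \<bullet>\<^bsub>Q\<^esub> f" by (simp add: zhom_comp[OF f Hom_cart(2)[OF g]])
  then show "g = zhom N L"
    using assms(2) HomD[OF f] HomD[OF g] HomD[OF zhom_Hom[OF Hom_cart[OF g]]] unfolding epic_def by metis
qed

subsection \<open>Addition of morphisms\<close>

text \<open>\<open>preadditive\<close> asks for one addition on the type of all arrows, so source
  and target are read off the first summand.\<close>

definition hadd where
  "hadd f g = arr (src Q f) (\<lambda>x v. app f x v \<oplus>\<^bsub>msec (tgt Q f) x\<^esub> app g x v) (tgt Q f)"

definition hneg where
  "hneg f = arr (src Q f) (\<lambda>x v. \<ominus>\<^bsub>msec (tgt Q f) x\<^esub> app f x v) (tgt Q f)"

lemma hadd_Hom: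
  assumes f: "f \<in> Hom Q M N" and g: "g \<in> Hom Q M N"
  shows "hadd f g \<in> Hom Q M N" and "x \<in> Ob C \<Longrightarrow> v \<in> el M x \<Longrightarrow> app (hadd f g) x v = app f x v \<oplus>\<^bsub>msec N x\<^esub> app g x v"
proof -
  note M = Hom_cart(1)[OF f] and N = Hom_cart(2)[OF f]
  have eq: "hadd f g = arr M (\<lambda>x v. app f x v \<oplus>\<^bsub>msec N x\<^esub> app g x v) N"
    using HomD[OF f] by (simp add: hadd_def)
  have "mor M N (\<lambda>x v. app f x v \<oplus>\<^bsub>msec N x\<^esub> app g x v)"
    unfolding mor_def
  proof (intro conjI ballI linear_mapsI)
    fix x assume x: "x \<in> Ob C"
    interpret N: module "sec A x" "msec N x" by (rule cartD(1)[OF N x])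
    note c = hom_closed[OF f x] hom_closed[OF g x]
    fix v assume v: "v \<in> el M x"
    show "app f x v \<oplus>\<^bsub>msec N x\<^esub> app g x v \<in> el N x" using c[OF v] by simp
    show "app f x (v \<oplus>\<^bsub>msec M x\<^esub> w) \<oplus>\<^bsub>msec N x\<^esub> app g x (v \<oplus>\<^bsub>msec M x\<^esub> w) =
       app f x v \<oplus>\<^bsub>msec N x\<^esub> app g x v \<oplus>\<^bsub>msec N x\<^esub> (app f x w \<oplus>\<^bsub>msec N x\<^esub> app g x w)" if w: "w \<in> el M x" for w
      using c v w by (simp add: hom_add[OF f x] hom_add[OF g x] N.a_ac)
  next
    fix x a v assume x: "x \<in> Ob C" and a: "a \<in> carrier (sec A x)" and v: "v \<in> el M x"
    interpret N: module "sec A x" "msec N x" by (rule cartD(1)[OF N x])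
    show "app f x (a \<odot>\<^bsub>msec M x\<^esub> v) \<oplus>\<^bsub>msec N x\<^esub> app g x (a \<odot>\<^bsub>msec M x\<^esub> v) = a \<odot>\<^bsub>msec N x\<^esub> (app f x v \<oplus>\<^bsub>msec N x\<^esub> app g x v)"
      using a v x hom_closed[OF f x] hom_closed[OF g x] by (simp add: hom_smult[OF f x] hom_smult[OF g x] N.smult_r_distr)
  next
    fix h v assume h: "h \<in> Ar C" and v: "v \<in> el M (tgt C h)"
    show "app f (src C h) (mres M h v) \<oplus>\<^bsub>msec N (src C h)\<^esub> app g (src C h) (mres M h v) =
        mres N h (app f (tgt C h) v \<oplus>\<^bsub>msec N (tgt C h)\<^esub> app g (tgt C h) v)"
      using h v Ar_Ob[OF h]
      by (simp add: hom_nat[OF f] hom_nat[OF g] semilinearD(2)[OF cartD(4)[OF N h]] hom_closed[OF f] hom_closed[OF g])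
  qed
  from arr_Hom[OF M N this] show "hadd f g \<in> Hom Q M N" by (simp add: eq)
  show "x \<in> Ob C \<Longrightarrow> v \<in> el M x \<Longrightarrow> app (hadd f g) x v = app f x v \<oplus>\<^bsub>msec N x\<^esub> app g x v"
    unfolding eq by (rule app_arr)
qed

lemma hneg_Hom:
  assumes f: "f \<in> Hom Q M N"
  shows "hneg f \<in> Hom Q M N" and "x \<in> Ob C \<Longrightarrow> v \<in> el M x \<Longrightarrow> app (hneg f) x v = \<ominus>\<^bsub>msec N x\<^esub> app f x v"
proof -
  note M = Hom_cart(1)[OF f] and N = Hom_cart(2)[OF f]
  have eq: "hneg f = arr M (\<lambda>x v. \<ominus>\<^bsub>msec N x\<^esub> app f x v) N"
    using HomD[OF f] by (simp add: hneg_def)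
  have "mor M N (\<lambda>x v. \<ominus>\<^bsub>msec N x\<^esub> app f x v)"
    unfolding mor_def
  proof (intro conjI ballI linear_mapsI)
    fix x assume x: "x \<in> Ob C"
    interpret N: module "sec A x" "msec N x" by (rule cartD(1)[OF N x])
    note c = hom_closed[OF f x]
    fix v assume v: "v \<in> el M x"
    show "\<ominus>\<^bsub>msec N x\<^esub> app f x v \<in> el N x" using c[OF v] by simp
    show "\<ominus>\<^bsub>msec N x\<^esub> app f x (v \<oplus>\<^bsub>msec M x\<^esub> w) = \<ominus>\<^bsub>msec N x\<^esub> app f x v \<oplus>\<^bsub>msec N x\<^esub> \<ominus>\<^bsub>msec N x\<^esub> app f x w" if w: "w \<in> el M x" for w
      using c v w by (simp add: hom_add[OF f x] N.minus_add)
  next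
    fix x a v assume x: "x \<in> Ob C" and a: "a \<in> carrier (sec A x)" and v: "v \<in> el M x"
    interpret N: module "sec A x" "msec N x" by (rule cartD(1)[OF N x])
    show "\<ominus>\<^bsub>msec N x\<^esub> app f x (a \<odot>\<^bsub>msec M x\<^esub> v) = a \<odot>\<^bsub>msec N x\<^esub> (\<ominus>\<^bsub>msec N x\<^esub> app f x v)"
      using a v x hom_closed[OF f x] by (simp add: hom_smult[OF f x] N.smult_r_minus)
  next
    fix h v assume h: "h \<in> Ar C" and v: "v \<in> el M (tgt C h)"
    show "\<ominus>\<^bsub>msec N (src C h)\<^esub> app f (src C h) (mres M h v) = mres N h (\<ominus>\<^bsub>msec N (tgt C h)\<^esub> app f (tgt C h) v)"
      using h v Ar_Ob[OF h] additive_minus[OF cart_group[OF N Ar_Ob(2)[OF h]] cart_group[OF N Ar_Ob(1)[OF h]], of "mres N h"]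
      by (simp add: hom_nat[OF f] semilinearD[OF cartD(4)[OF N h]] hom_closed[OF f])
  qed
  from arr_Hom[OF M N this] show "hneg f \<in> Hom Q M N" by (simp add: eq)
  show "x \<in> Ob C \<Longrightarrow> v \<in> el M x \<Longrightarrow> app (hneg f) x v = \<ominus>\<^bsub>msec N x\<^esub> app f x v"
    unfolding eq by (rule app_arr)
qed

definition hdiff where "hdiff f g = hadd f (hneg g)"

lemma hdiff_Hom:
  assumes f: "f \<in> Hom Q M N" and g: "g \<in> Hom Q M N"
  shows "hdiff f g \<in> Hom Q M N" and "x \<in> Ob C \<Longrightarrow> v \<in> el M x \<Longrightarrow> app (hdiff f g) x v = app f x v \<ominus>\<^bsub>msec N x\<^esub> app g x v"
  unfolding hdiff_def using hadd_Hom[OF f hneg_Hom(1)[OF g]] hneg_Hom[OF g] by (auto simp: a_minus_def)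

lemma preadditive_Q: "preadditive Q"
  unfolding preadditive_def
proof (intro exI[of _ hadd] exI[of _ zhom] conjI ballI)
  fix M N assume "M \<in> Ob Q" "N \<in> Ob Q"
  then have M: "cart M" and N: "cart N" by (auto simp: Q_simps)
  show "comm_group \<lparr>carrier = Hom Q M N, monoid.mult = hadd, one = zhom M N\<rparr>" (is "comm_group ?G")
  proof (rule comm_groupI)
    fix f g h assume "f \<in> carrier ?G" "g \<in> carrier ?G" "h \<in> carrier ?G"
    then have f: "f \<in> Hom Q M N" and g: "g \<in> Hom Q M N" and h: "h \<in> Hom Q M N" by auto
    show "f \<otimes>\<^bsub>?G\<^esub> g \<otimes>\<^bsub>?G\<^esub> h = f \<otimes>\<^bsub>?G\<^esub> (g \<otimes>\<^bsub>?G\<^esub> h)"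
      using abelian_monoid.a_assoc[OF abelian_group.axioms(1)[OF cart_group[OF N]]]
      by simp (rule hom_eqI[of _ M N], auto simp: hadd_Hom f g h hom_closed[OF f] hom_closed[OF g] hom_closed[OF h]
        hadd_Hom(2)[OF f hadd_Hom(1)[OF g h]] hadd_Hom(2)[OF hadd_Hom(1)[OF f g] h] hadd_Hom(2)[OF f g] hadd_Hom(2)[OF g h])
  next
    fix f g assume "f \<in> carrier ?G" "g \<in> carrier ?G"
    then have f: "f \<in> Hom Q M N" and g: "g \<in> Hom Q M N" by auto
    show "f \<otimes>\<^bsub>?G\<^esub> g = g \<otimes>\<^bsub>?G\<^esub> f"
      using abelian_monoid.a_comm[OF abelian_group.axioms(1)[OF cart_group[OF N]]]
      by simp (rule hom_eqI[of _ M N], auto simp: hadd_Hom f g hom_closed[OF f] hom_closed[OF g] hadd_Hom(2)[OF f g] hadd_Hom(2)[OF g f])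
  next
    fix f assume "f \<in> carrier ?G"
    then have f: "f \<in> Hom Q M N" by simp
    show "\<one>\<^bsub>?G\<^esub> \<otimes>\<^bsub>?G\<^esub> f = f"
      using abelian_monoid.l_zero[OF abelian_group.axioms(1)[OF cart_group[OF N]]]
      by simp (rule hom_eqI[of _ M N], auto simp: hadd_Hom f zhom_Hom M N zhom_app hom_closed[OF f] hadd_Hom(2)[OF zhom_Hom[OF M N] f])
    have "hadd (hneg f) f = zhom M N"
      using abelian_group.l_neg[OF cart_group[OF N]]
      by (intro hom_eqI[of _ M N]) (auto simp: hadd_Hom f zhom_Hom M N zhom_app hom_closed[OF f]
         hneg_Hom hadd_Hom(2)[OF hneg_Hom(1)[OF f] f] hneg_Hom(2)[OF f])
    then show "\<exists>g\<in>carrier ?G. g \<otimes>\<^bsub>?G\<^esub> f = \<one>\<^bsub>?G\<^esub>" using hneg_Hom(1)[OF f] by auto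
  qed (auto simp: hadd_Hom zhom_Hom M N)
next
  fix M N P f f' g g'
  assume f: "f \<in> Hom Q M N" and f': "f' \<in> Hom Q M N" and g: "g \<in> Hom Q N P" and g': "g' \<in> Hom Q N P"
  show "g \<bullet>\<^bsub>Q\<^esub> hadd f f' = hadd (g \<bullet>\<^bsub>Q\<^esub> f) (g \<bullet>\<^bsub>Q\<^esub> f')"
    by (rule hom_eqI[OF comp_Hom[OF hadd_Hom(1)[OF f f'] g] hadd_Hom(1)[OF comp_Hom[OF f g] comp_Hom[OF f' g]]])
      (simp add: comp_app[OF hadd_Hom(1)[OF f f'] g] hadd_Hom(2)[OF f f'] hadd_Hom(2)[OF comp_Hom[OF f g] comp_Hom[OF f' g]]
        comp_app[OF f g] comp_app[OF f' g] hom_add[OF g] hom_closed[OF f] hom_closed[OF f'])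
  show "hadd g g' \<bullet>\<^bsub>Q\<^esub> f = hadd (g \<bullet>\<^bsub>Q\<^esub> f) (g' \<bullet>\<^bsub>Q\<^esub> f)"
    by (rule hom_eqI[OF comp_Hom[OF f hadd_Hom(1)[OF g g']] hadd_Hom(1)[OF comp_Hom[OF f g] comp_Hom[OF f g']]])
      (simp add: comp_app[OF f hadd_Hom(1)[OF g g']] hadd_Hom(2)[OF g g'] hadd_Hom(2)[OF comp_Hom[OF f g] comp_Hom[OF f g']]
        comp_app[OF f g] comp_app[OF f g'] hom_closed[OF f])
qed

section \<open>Coproducts and colimits\<close>

definition cmor where "cmor I F i = arr (F i) (cinj I F i) (coprod I F)"

context
  fixes I :: "'i set" and F
  assumes small_I: "small TYPE('u) I" and F: "\<And>i. i \<in> I \<Longrightarrow> cart (F i)"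
begin

lemma cmor_Hom: "i \<in> I \<Longrightarrow> cmor I F i \<in> Hom Q (F i) (coprod I F)"
  unfolding cmor_def by (rule arr_Hom[OF F coprod_cart[where F = F, OF small_I F] cinj_mor[where F = F, OF small_I F]])

lemma cmor_app: "x \<in> Ob C \<Longrightarrow> v \<in> el (F i) x \<Longrightarrow> app (cmor I F i) x v = cinj I F i x v"
  unfolding cmor_def by (rule app_arr)

lemma coprod_gen:
  assumes x: "x \<in> Ob C" and v: "v \<in> el (coprod I F) x"
    and "\<zero>\<^bsub>msec (coprod I F) x\<^esub> \<in> T"
    and "\<And>i v. i \<in> I \<Longrightarrow> v \<in> el (F i) x \<Longrightarrow> app (cmor I F i) x v \<in> T"
    and "\<And>v w. v \<in> el (coprod I F) x \<Longrightarrow> w \<in> el (coprod I F) x \<Longrightarrow> v \<in> T \<Longrightarrow> w \<in> T \<Longrightarrow>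
        v \<oplus>\<^bsub>msec (coprod I F) x\<^esub> w \<in> T"
  shows "v \<in> T"
proof (rule coprod_induct[where F = F and P = "\<lambda>v. v \<in> T", OF small_I F x v])
  show "cinj I F i x v \<in> T" if "i \<in> I" "v \<in> el (F i) x" for i v
    using assms(4)[OF that] cmor_app[OF x that(2)] by simp
qed (use assms in auto)

lemma coprod_desc:
  assumes K: "cart K" and \<kappa>: "\<And>i. i \<in> I \<Longrightarrow> \<kappa> i \<in> Hom Q (F i) K"
  shows "\<exists>u\<in>Hom Q (coprod I F) K. \<forall>i\<in>I. u \<bullet>\<^bsub>Q\<^esub> cmor I F i = \<kappa> i"
proof -
  obtain u where u: "mor (coprod I F) K u"
    and uk: "\<And>i x v. i \<in> I \<Longrightarrow> x \<in> Ob C \<Longrightarrow> v \<in> el (F i) x \<Longrightarrow> u x (cinj I F i x v) = app (\<kappa> i) x v"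
    using coprod_mor[where F = F and \<kappa> = "\<lambda>i. app (\<kappa> i)", OF small_I F K] Hom_mor[OF \<kappa>] by blast
  note uH = arr_Hom[OF coprod_cart[where F = F, OF small_I F] K u]
  have "arr (coprod I F) u K \<bullet>\<^bsub>Q\<^esub> cmor I F i = \<kappa> i" if i: "i \<in> I" for i
  proof (rule hom_eqI[OF comp_Hom[OF cmor_Hom[OF i] uH] \<kappa>[OF i]])
    fix x v assume xv: "x \<in> Ob C" "v \<in> el (F i) x"
    show "app (arr (coprod I F) u K \<bullet>\<^bsub>Q\<^esub> cmor I F i) x v = app (\<kappa> i) x v"
      using xv hom_closed[OF cmor_Hom[OF i] xv]
      by (simp add: comp_app[OF cmor_Hom[OF i] uH] cmor_app app_arr uk[OF i])
  qed
  then show ?thesis using uH by blast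
qed

lemma coprod_hom_eq:
  assumes u: "u \<in> Hom Q (coprod I F) K" and u': "u' \<in> Hom Q (coprod I F) K"
    and eq: "\<And>i. i \<in> I \<Longrightarrow> u \<bullet>\<^bsub>Q\<^esub> cmor I F i = u' \<bullet>\<^bsub>Q\<^esub> cmor I F i"
  shows "u = u'"
proof (rule hom_eqI[OF u u'])
  fix x v assume x: "x \<in> Ob C" and v: "v \<in> el (coprod I F) x"
  note P = coprod_cart[where F = F, OF small_I F]
  have "v \<in> {v \<in> el (coprod I F) x. app u x v = app u' x v}"
  proof (rule coprod_gen[OF x v])
    fix i v assume i: "i \<in> I" and v: "v \<in> el (F i) x"
    show "app (cmor I F i) x v \<in> {v \<in> el (coprod I F) x. app u x v = app u' x v}"
      using eq[OF i] comp_app[OF cmor_Hom[OF i] u x v] comp_app[OF cmor_Hom[OF i] u' x v]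
        hom_closed[OF cmor_Hom[OF i] x v] by simp
  qed (use P x in \<open>auto simp: el_zero el_add hom_zero[OF u] hom_zero[OF u'] hom_add[OF u] hom_add[OF u']\<close>)
  then show "app u x v = app u' x v" by simp
qed

lemma is_coproduct_coprod: "is_coproduct Q I F (coprod I F) (cmor I F)"
  unfolding is_coproduct_def
proof (intro conjI ballI allI impI)
  show "coprod I F \<in> Ob Q" by (simp add: Q_simps coprod_cart[where F = F, OF small_I F])
  show "cmor I F i \<in> Hom Q (F i) (coprod I F)" if "i \<in> I" for i by (rule cmor_Hom[OF that])
  fix K \<kappa> assume "K \<in> Ob Q" and \<kappa>: "\<forall>i\<in>I. \<kappa> i \<in> Hom Q (F i) K"
  then have K: "cart K" by (simp add: Q_simps)
  show "\<exists>!u. u \<in> Hom Q (coprod I F) K \<and> (\<forall>i\<in>I. u \<bullet>\<^bsub>Q\<^esub> cmor I F i = \<kappa> i)"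
  proof (intro ex_ex1I)
    show "\<exists>u. u \<in> Hom Q (coprod I F) K \<and> (\<forall>i\<in>I. u \<bullet>\<^bsub>Q\<^esub> cmor I F i = \<kappa> i)"
      using coprod_desc[OF K, of \<kappa>] \<kappa> by blast
    fix u u' assume "u \<in> Hom Q (coprod I F) K \<and> (\<forall>i\<in>I. u \<bullet>\<^bsub>Q\<^esub> cmor I F i = \<kappa> i)"
      "u' \<in> Hom Q (coprod I F) K \<and> (\<forall>i\<in>I. u' \<bullet>\<^bsub>Q\<^esub> cmor I F i = \<kappa> i)"
    then show "u = u'" by (intro coprod_hom_eq[of u K u']) auto
  qed
qed

end

text \<open>The index type is arbitrary: binary coproducts are indexed by \<open>bool\<close>,
  whereas \<open>has_coproducts\<close> indexes by subsets of \<open>'u\<close>.\<close>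

lemma coproducts:
  assumes "small TYPE('u) I" "F ` I \<subseteq> Ob Q"
  shows "\<exists>P \<iota>. is_coproduct Q I F P \<iota>"
proof -
  have "\<And>i. i \<in> I \<Longrightarrow> cart (F i)" using assms(2) by (auto simp: Q_simps)
  from is_coproduct_coprod[where F = F, OF assms(1) this] show ?thesis by blast
qed

lemma has_coproducts_Q: "has_coproducts TYPE('u) Q"
  unfolding has_coproducts_def using coproducts by blast

text \<open>The colimit is the cokernel of the difference of the two maps between coproducts.\<close>

lemma colimit_construction:
  fixes J :: "('i, 'k) category"
  assumes sO: "small TYPE('u) (Ob J)" and sA: "small TYPE('u) (Ar J)"
    and J: "\<And>f. f \<in> Ar J \<Longrightarrow> src J f \<in> Ob J" "\<And>f. f \<in> Ar J \<Longrightarrow> tgt J f \<in> Ob J"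
    and fct: "is_functor J Q F F'"
  obtains L p where "p \<in> Hom Q (coprod (Ob J) F) L" "onto L p"
    "is_colimit J Q F F' L (\<lambda>i. p \<bullet>\<^bsub>Q\<^esub> cmor (Ob J) F i)"
    "\<And>x v T. x \<in> Ob C \<Longrightarrow> v \<in> el (coprod (Ob J) F) x \<Longrightarrow> app p x v = \<zero>\<^bsub>msec L x\<^esub> \<Longrightarrow>
       \<zero>\<^bsub>msec (coprod (Ob J) F) x\<^esub> \<in> T \<Longrightarrow>
       (\<And>v w. v \<in> T \<Longrightarrow> w \<in> T \<Longrightarrow> v \<oplus>\<^bsub>msec (coprod (Ob J) F) x\<^esub> w \<in> T) \<Longrightarrow>
       (\<And>f w. f \<in> Ar J \<Longrightarrow> w \<in> el (F (src J f)) x \<Longrightarrow>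
          app (cmor (Ob J) F (tgt J f)) x (app (F' f) x w) \<ominus>\<^bsub>msec (coprod (Ob J) F) x\<^esub>
          app (cmor (Ob J) F (src J f)) x w \<in> T) \<Longrightarrow> v \<in> T"
proof -
  have F: "cart (F i)" if "i \<in> Ob J" for i using fct that by (auto simp: is_functor_def Q_simps)
  have F': "F' f \<in> Hom Q (F (src J f)) (F (tgt J f))" if "f \<in> Ar J" for f
    using fct that by (auto simp: is_functor_def)
  let ?P = "coprod (Ob J) F" and ?\<iota> = "cmor (Ob J) F"
  let ?G = "\<lambda>f. F (src J f)"
  let ?E = "coprod (Ar J) ?G" and ?\<epsilon> = "cmor (Ar J) ?G"
  have G: "cart (?G f)" if "f \<in> Ar J" for f using F J that by blast
  have P: "cart ?P" by (rule coprod_cart) (use sO F in auto)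
  have E: "cart ?E" by (rule coprod_cart) (use sA G in auto)
  have \<iota>: "?\<iota> i \<in> Hom Q (F i) ?P" if "i \<in> Ob J" for i by (rule cmor_Hom) (use sO F that in auto)
  have \<epsilon>: "?\<epsilon> f \<in> Hom Q (?G f) ?E" if "f \<in> Ar J" for f by (rule cmor_Hom) (use sA G that in auto)
  \<comment> \<open>One relation for each arrow of the diagram: the image of an element under the
    arrow is identified with the element itself.\<close>
  let ?\<delta> = "\<lambda>f. hdiff (?\<iota> (tgt J f) \<bullet>\<^bsub>Q\<^esub> F' f) (?\<iota> (src J f))"
  have it: "?\<iota> (tgt J f) \<bullet>\<^bsub>Q\<^esub> F' f \<in> Hom Q (?G f) ?P" if "f \<in> Ar J" for f
    by (rule comp_Hom[OF F'[OF that] \<iota>[OF J(2)[OF that]]])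
  have \<delta>: "?\<delta> f \<in> Hom Q (?G f) ?P" if "f \<in> Ar J" for f
    by (rule hdiff_Hom(1)[OF it[OF that] \<iota>[OF J(1)[OF that]]])
  have \<delta>_app: "app (?\<delta> f) x w = app (?\<iota> (tgt J f)) x (app (F' f) x w) \<ominus>\<^bsub>msec ?P x\<^esub> app (?\<iota> (src J f)) x w"
    if "f \<in> Ar J" "x \<in> Ob C" "w \<in> el (?G f) x" for f x w
    using hdiff_Hom(2)[OF it[OF that(1)] \<iota>[OF J(1)[OF that(1)]] that(2,3)]
      comp_app[OF F'[OF that(1)] \<iota>[OF J(2)[OF that(1)]] that(2,3)] by simp
  obtain d where d: "d \<in> Hom Q ?E ?P" and d\<epsilon>: "\<And>f. f \<in> Ar J \<Longrightarrow> d \<bullet>\<^bsub>Q\<^esub> ?\<epsilon> f = ?\<delta> f"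
    using coprod_desc[where F = ?G, OF sA G P \<delta>] by blast
  obtain L p where p: "p \<in> Hom Q ?P L" "onto L p"
    and ker: "\<And>x. x \<in> Ob C \<Longrightarrow> {v \<in> el ?P x. app p x v = \<zero>\<^bsub>msec L x\<^esub>} = app d x ` el ?E x"
    by (rule cokernel_exists[OF d]) blast
  note L = Hom_cart(2)[OF p(1)]
  have coc: "cocone J Q F F' L (\<lambda>i. p \<bullet>\<^bsub>Q\<^esub> ?\<iota> i)"
    unfolding cocone_def
  proof (intro conjI ballI)
    show "L \<in> Ob Q" using L by (simp add: Q_simps)
    show "p \<bullet>\<^bsub>Q\<^esub> ?\<iota> i \<in> Hom Q (F i) L" if "i \<in> Ob J" for i by (rule comp_Hom[OF \<iota>[OF that] p(1)])
    fix f assume f: "f \<in> Ar J"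
    note \<iota>s = \<iota>[OF J(1)[OF f]] and \<iota>t = \<iota>[OF J(2)[OF f]]
    show "(p \<bullet>\<^bsub>Q\<^esub> ?\<iota> (tgt J f)) \<bullet>\<^bsub>Q\<^esub> F' f = p \<bullet>\<^bsub>Q\<^esub> ?\<iota> (src J f)"
    proof (rule hom_eqI[OF comp_Hom[OF F'[OF f] comp_Hom[OF \<iota>t p(1)]] comp_Hom[OF \<iota>s p(1)]])
      fix x w assume x: "x \<in> Ob C" and w: "w \<in> el (?G f) x"
      note c1 = hom_closed[OF \<iota>t x hom_closed[OF F'[OF f] x w]] and c2 = hom_closed[OF \<iota>s x w]
      have "app (?\<delta> f) x w = app d x (app (?\<epsilon> f) x w)"
        using comp_app[OF \<epsilon>[OF f] d x w] by (simp add: d\<epsilon>[OF f])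
      then have "app (?\<delta> f) x w \<in> app d x ` el ?E x" using hom_closed[OF \<epsilon>[OF f] x w] by simp
      then have "app p x (app (?\<delta> f) x w) = \<zero>\<^bsub>msec L x\<^esub>" unfolding ker[OF x, symmetric] by simp
      then have "app p x (app (?\<iota> (tgt J f)) x (app (F' f) x w)) = app p x (app (?\<iota> (src J f)) x w)"
        unfolding \<delta>_app[OF f x w] hom_diff[OF p(1) x c1 c2]
        using diff_zero[OF L x hom_closed[OF p(1) x c1] hom_closed[OF p(1) x c2]] by simp
      then show "app ((p \<bullet>\<^bsub>Q\<^esub> ?\<iota> (tgt J f)) \<bullet>\<^bsub>Q\<^esub> F' f) x w = app (p \<bullet>\<^bsub>Q\<^esub> ?\<iota> (src J f)) x w"
        by (simp add: comp_app[OF F'[OF f] comp_Hom[OF \<iota>t p(1)] x w] comp_app[OF \<iota>s p(1) x w]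
            comp_app[OF \<iota>t p(1) x hom_closed[OF F'[OF f] x w]])
    qed
  qed
  have colim: "is_colimit J Q F F' L (\<lambda>i. p \<bullet>\<^bsub>Q\<^esub> ?\<iota> i)"
    unfolding is_colimit_def
  proof (intro conjI allI impI coc)
    fix K \<kappa> assume c: "cocone J Q F F' K \<kappa>"
    then have K: "cart K" and \<kappa>: "\<And>i. i \<in> Ob J \<Longrightarrow> \<kappa> i \<in> Hom Q (F i) K"
      and \<kappa>': "\<And>f. f \<in> Ar J \<Longrightarrow> \<kappa> (tgt J f) \<bullet>\<^bsub>Q\<^esub> F' f = \<kappa> (src J f)"
      by (auto simp: cocone_def Q_simps)
    obtain h where h: "h \<in> Hom Q ?P K" and h\<kappa>: "\<And>i. i \<in> Ob J \<Longrightarrow> h \<bullet>\<^bsub>Q\<^esub> ?\<iota> i = \<kappa> i"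
      using coprod_desc[where F = F, OF sO F K \<kappa>] by blast
    \<comment> \<open>\<open>h\<close> respects all relations because \<kappa> is a cocone, so it
      vanishes on the image of \<open>d\<close> and descends to the cokernel.\<close>
    have "h \<bullet>\<^bsub>Q\<^esub> d = zhom ?E K"
    proof (rule coprod_hom_eq[where F = ?G, OF sA G comp_Hom[OF d h] zhom_Hom[OF E K]])
      fix f assume f: "f \<in> Ar J"
      note \<iota>s = \<iota>[OF J(1)[OF f]] and \<iota>t = \<iota>[OF J(2)[OF f]]
      have "(h \<bullet>\<^bsub>Q\<^esub> d) \<bullet>\<^bsub>Q\<^esub> ?\<epsilon> f = h \<bullet>\<^bsub>Q\<^esub> ?\<delta> f"
        by (simp add: comp_assoc[OF \<epsilon>[OF f] d h, symmetric] d\<epsilon>[OF f])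
      also have "\<dots> = zhom (?G f) K"
      proof (rule hom_eqI[OF comp_Hom[OF \<delta>[OF f] h] zhom_Hom[OF G[OF f] K]])
        fix x w assume x: "x \<in> Ob C" and w: "w \<in> el (?G f) x"
        note F'w = hom_closed[OF F'[OF f] x w]
        note c1 = hom_closed[OF \<iota>t x F'w] and c2 = hom_closed[OF \<iota>s x w]
        have "app h x (app (?\<iota> (tgt J f)) x (app (F' f) x w)) = app (\<kappa> (src J f)) x w"
          using comp_app[OF \<iota>t h x F'w] comp_app[OF F'[OF f] \<kappa>[OF J(2)[OF f]] x w]
          by (simp add: h\<kappa>[OF J(2)[OF f]] \<kappa>'[OF f])
        moreover have "app h x (app (?\<iota> (src J f)) x w) = app (\<kappa> (src J f)) x w"
          using comp_app[OF \<iota>s h x w] by (simp add: h\<kappa>[OF J(1)[OF f]])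
        ultimately show "app (h \<bullet>\<^bsub>Q\<^esub> ?\<delta> f) x w = app (zhom (?G f) K) x w"
          unfolding comp_app[OF \<delta>[OF f] h x w] \<delta>_app[OF f x w] hom_diff[OF h x c1 c2] zhom_app[OF x w]
          using diff_zero[OF K x hom_closed[OF h x c1] hom_closed[OF h x c2]] by simp
      qed
      also have "\<dots> = zhom ?E K \<bullet>\<^bsub>Q\<^esub> ?\<epsilon> f" by (rule zhom_comp[OF \<epsilon>[OF f] K, symmetric])
      finally show "(h \<bullet>\<^bsub>Q\<^esub> d) \<bullet>\<^bsub>Q\<^esub> ?\<epsilon> f = zhom ?E K \<bullet>\<^bsub>Q\<^esub> ?\<epsilon> f" .
    qed
    then have hd: "app h x (app d x w) = \<zero>\<^bsub>msec K x\<^esub>" if "x \<in> Ob C" "w \<in> el ?E x" for x w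
      using comp_app[OF d h that] zhom_app[OF that] by simp
    have "\<exists>u\<in>Hom Q L K. u \<bullet>\<^bsub>Q\<^esub> p = h"
    proof (rule factor_onto[OF p h])
      fix x v assume x: "x \<in> Ob C" and "v \<in> el ?P x" "app p x v = \<zero>\<^bsub>msec L x\<^esub>"
      then have "v \<in> app d x ` el ?E x" unfolding ker[OF x, symmetric] by simp
      then show "app h x v = \<zero>\<^bsub>msec K x\<^esub>" using hd[OF x] by auto
    qed
    then obtain u where u: "u \<in> Hom Q L K" "u \<bullet>\<^bsub>Q\<^esub> p = h" by blast
    have uk: "u \<bullet>\<^bsub>Q\<^esub> (p \<bullet>\<^bsub>Q\<^esub> ?\<iota> i) = \<kappa> i" if "i \<in> Ob J" for i
      using comp_assoc[OF \<iota>[OF that] p(1) u(1)] by (simp add: u(2) h\<kappa>[OF that])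
    have uniq: "u' = u" if u': "u' \<in> Hom Q L K" and eq: "\<forall>i\<in>Ob J. u' \<bullet>\<^bsub>Q\<^esub> (p \<bullet>\<^bsub>Q\<^esub> ?\<iota> i) = \<kappa> i" for u'
    proof (rule onto_eq[OF p(2,1) u' u(1)], rule coprod_hom_eq[where F = F, OF sO F comp_Hom[OF p(1) u'] comp_Hom[OF p(1) u(1)]])
      fix i assume i: "i \<in> Ob J"
      show "(u' \<bullet>\<^bsub>Q\<^esub> p) \<bullet>\<^bsub>Q\<^esub> ?\<iota> i = (u \<bullet>\<^bsub>Q\<^esub> p) \<bullet>\<^bsub>Q\<^esub> ?\<iota> i"
        using eq i comp_assoc[OF \<iota>[OF i] p(1) u'] by (simp add: u(2) h\<kappa>[OF i])
    qed
    show "\<exists>!u. u \<in> Hom Q L K \<and> (\<forall>i\<in>Ob J. u \<bullet>\<^bsub>Q\<^esub> (p \<bullet>\<^bsub>Q\<^esub> ?\<iota> i) = \<kappa> i)"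
    proof (rule ex1I[of _ u])
      show "u \<in> Hom Q L K \<and> (\<forall>i\<in>Ob J. u \<bullet>\<^bsub>Q\<^esub> (p \<bullet>\<^bsub>Q\<^esub> ?\<iota> i) = \<kappa> i)" using u(1) uk by blast
    qed (blast intro: uniq)
  qed
  show thesis
  proof (rule that[OF p colim])
    fix x v T
    assume x: "x \<in> Ob C" and v: "v \<in> el ?P x" "app p x v = \<zero>\<^bsub>msec L x\<^esub>"
      and T0: "\<zero>\<^bsub>msec ?P x\<^esub> \<in> T" and Tadd: "\<And>v w. v \<in> T \<Longrightarrow> w \<in> T \<Longrightarrow> v \<oplus>\<^bsub>msec ?P x\<^esub> w \<in> T"
      and Trel: "\<And>f w. f \<in> Ar J \<Longrightarrow> w \<in> el (?G f) x \<Longrightarrow>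
          app (?\<iota> (tgt J f)) x (app (F' f) x w) \<ominus>\<^bsub>msec ?P x\<^esub> app (?\<iota> (src J f)) x w \<in> T"
    have "v \<in> app d x ` el ?E x" unfolding ker[OF x, symmetric] using v by simp
    then obtain y where y: "y \<in> el ?E x" "v = app d x y" by blast
    \<comment> \<open>The kernel of \<open>p\<close> is the image of \<open>d\<close>. The set of
      those y with \<open>d y\<close> in T contains all summands and is closed under sums, hence is
      everything: the relations generate the kernel additively. Scalars are absorbed, as each
      relation is available for all w.\<close>
    have "y \<in> {y. app d x y \<in> T}"
    proof (rule coprod_gen[where F = ?G, OF sA G x y(1)])
      show "\<zero>\<^bsub>msec ?E x\<^esub> \<in> {y. app d x y \<in> T}" using T0 by (simp add: hom_zero[OF d x])
      show "app (?\<epsilon> f) x w \<in> {y. app d x y \<in> T}" if "f \<in> Ar J" "w \<in> el (?G f) x" for f w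
        using Trel[OF that] comp_app[OF \<epsilon>[OF that(1)] d x that(2)] by (simp add: d\<epsilon>[OF that(1)] \<delta>_app[OF that(1) x that(2)])
      show "v \<oplus>\<^bsub>msec ?E x\<^esub> w \<in> {y. app d x y \<in> T}"
        if "v \<in> el ?E x" "w \<in> el ?E x" "v \<in> {y. app d x y \<in> T}" "w \<in> {y. app d x y \<in> T}" for v w
        using that Tadd by (simp add: hom_add[OF d x])
    qed
    then show "v \<in> T" by (simp add: y(2))
  qed
qed

lemma cocomplete_Q: "cocomplete TYPE('u) Q"
  unfolding cocomplete_def
proof (intro allI impI)
  fix J :: "('u, 'u) category" and F F'
  assume J: "category J \<and> small TYPE('u) (Ob J) \<and> small TYPE('u) (Ar J) \<and> is_functor J Q F F'"
  show "\<exists>L \<iota>. is_colimit J Q F F' L \<iota>"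
    by (rule colimit_construction[of J F F']) (use J in \<open>auto simp: category_def\<close>)
qed

subsection \<open>Directed colimits\<close>

lemma poset_category_simps [simp]:
  "Ob (poset_category I r) = I" "Ar (poset_category I r) = r" "src (poset_category I r) = fst"
  "tgt (poset_category I r) = snd" "ide (poset_category I r) i = (i, i)"
  "cmp (poset_category I r) g f = (fst f, snd g)"
  by (simp_all add: poset_category_def)

lemma directedD:
  assumes "directed_poset I r"
  shows "r \<subseteq> I \<times> I" and "i \<in> I \<Longrightarrow> (i, i) \<in> r" and "(i, j) \<in> r \<Longrightarrow> (j, k) \<in> r \<Longrightarrow> (i, k) \<in> r"
    and "i \<in> I \<Longrightarrow> j \<in> I \<Longrightarrow> \<exists>k\<in>I. (i, k) \<in> r \<and> (j, k) \<in> r" and "I \<noteq> {}"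
proof -
  show "r \<subseteq> I \<times> I" "i \<in> I \<Longrightarrow> (i, i) \<in> r"
    using assms by (auto simp: directed_poset_def partial_order_on_def preorder_on_def refl_on_def)
  show "(i, j) \<in> r \<Longrightarrow> (j, k) \<in> r \<Longrightarrow> (i, k) \<in> r"
    using assms unfolding directed_poset_def partial_order_on_def preorder_on_def by (meson transD)
  have dir: "\<exists>u\<in>I. \<forall>k\<in>K. (k, u) \<in> r" if "K \<subseteq> I" "finite K" for K
    using assms that by (auto simp: directed_poset_def)
  show "i \<in> I \<Longrightarrow> j \<in> I \<Longrightarrow> \<exists>k\<in>I. (i, k) \<in> r \<and> (j, k) \<in> r" using dir[of "{i, j}"] by auto
  \<comment> \<open>The empty subset has an upper bound too, so directed sets are nonempty
    here.\<close>
  show "I \<noteq> {}" using dir[of "{}"] by auto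
qed

context
  fixes I :: "'i set" and r F F'
  assumes fct: "is_functor (poset_category I r) Q F F'" and dir: "directed_poset I r"
begin

lemma poset_functor:
  shows "i \<in> I \<Longrightarrow> cart (F i)" and "(i, j) \<in> r \<Longrightarrow> F' (i, j) \<in> Hom Q (F i) (F j)"
    and "(i, j) \<in> r \<Longrightarrow> (j, k) \<in> r \<Longrightarrow> x \<in> Ob C \<Longrightarrow> v \<in> el (F i) x \<Longrightarrow>
      app (F' (i, k)) x v = app (F' (j, k)) x (app (F' (i, j)) x v)"
    and "i \<in> I \<Longrightarrow> x \<in> Ob C \<Longrightarrow> v \<in> el (F i) x \<Longrightarrow> app (F' (i, i)) x v = v"
proof -
  show "i \<in> I \<Longrightarrow> cart (F i)" using fct by (simp add: is_functor_def Q_simps)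
  have F': "F' (i, j) \<in> Hom Q (F i) (F j)" if "(i, j) \<in> r" for i j
    using fct that unfolding is_functor_def by force
  then show "(i, j) \<in> r \<Longrightarrow> F' (i, j) \<in> Hom Q (F i) (F j)" .
  have "F' (i, k) = F' (j, k) \<bullet>\<^bsub>Q\<^esub> F' (i, j)" if "(i, j) \<in> r" "(j, k) \<in> r" for i j k
    using fct that unfolding is_functor_def by force
  then show "(i, j) \<in> r \<Longrightarrow> (j, k) \<in> r \<Longrightarrow> x \<in> Ob C \<Longrightarrow> v \<in> el (F i) x \<Longrightarrow>
      app (F' (i, k)) x v = app (F' (j, k)) x (app (F' (i, j)) x v)"
    using comp_app[OF F' F'] by metis
  show "i \<in> I \<Longrightarrow> x \<in> Ob C \<Longrightarrow> v \<in> el (F i) x \<Longrightarrow> app (F' (i, i)) x v = v"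
    using fct by (simp add: is_functor_def ide_app)
qed

lemma poset_cocone:
  assumes "cocone (poset_category I r) Q F F' L \<iota>"
  shows "cart L" and "i \<in> I \<Longrightarrow> \<iota> i \<in> Hom Q (F i) L"
    and "(i, j) \<in> r \<Longrightarrow> x \<in> Ob C \<Longrightarrow> v \<in> el (F i) x \<Longrightarrow> app (\<iota> j) x (app (F' (i, j)) x v) = app (\<iota> i) x v"
proof -
  show "cart L" using assms by (simp add: cocone_def Q_simps)
  have \<iota>: "\<iota> i \<in> Hom Q (F i) L" if "i \<in> I" for i using assms that by (simp add: cocone_def)
  then show "i \<in> I \<Longrightarrow> \<iota> i \<in> Hom Q (F i) L" .
  assume ij: "(i, j) \<in> r" and xv: "x \<in> Ob C" "v \<in> el (F i) x"
  then have "\<iota> j \<bullet>\<^bsub>Q\<^esub> F' (i, j) = \<iota> i" using assms by (force simp: cocone_def)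
  moreover have "j \<in> I" using directedD(1)[OF dir] ij by blast
  ultimately show "app (\<iota> j) x (app (F' (i, j)) x v) = app (\<iota> i) x v"
    using comp_app[OF poset_functor(2)[OF ij] \<iota> xv] by simp
qed

text \<open>Each image is cartesian, and directedness puts any two elements of the union into a
  common image, which gives closure under addition.\<close>

lemma csub_cocone_union:
  assumes coc: "cocone (poset_category I r) Q F F' L \<iota>"
  shows "csub L (\<lambda>x. \<Union>i\<in>I. app (\<iota> i) x ` el (F i) x)"
  unfolding csub_def
proof (intro conjI ballI)
  note L = poset_cocone(1)[OF coc] and \<iota> = poset_cocone(2)[OF coc] and \<iota>F = poset_cocone(3)[OF coc]
  note img = csub_hom_image[OF \<iota>]
  fix x assume x: "x \<in> Ob C"
  let ?R = "\<Union>i\<in>I. app (\<iota> i) x ` el (F i) x"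
  have z: "\<zero>\<^bsub>msec L x\<^esub> \<in> ?R"
    using csub_props(2)[OF L img x] directedD(5)[OF dir] by blast
  have ad: "u \<oplus>\<^bsub>msec L x\<^esub> w \<in> ?R" if uw: "u \<in> ?R" "w \<in> ?R" for u w
  proof -
    obtain i v j v' where i: "i \<in> I" "v \<in> el (F i) x" "u = app (\<iota> i) x v" and j: "j \<in> I" "v' \<in> el (F j) x" "w = app (\<iota> j) x v'"
      using uw by blast
    obtain k where k: "k \<in> I" "(i, k) \<in> r" "(j, k) \<in> r" using directedD(4)[OF dir i(1) j(1)] by blast
    have "u \<in> app (\<iota> k) x ` el (F k) x" "w \<in> app (\<iota> k) x ` el (F k) x"
      using i j \<iota>F[OF k(2) x i(2)] \<iota>F[OF k(3) x j(2)] hom_closed[OF poset_functor(2)[OF k(2)] x i(2)]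
        hom_closed[OF poset_functor(2)[OF k(3)] x j(2)] by (metis image_eqI)+
    then have "u \<oplus>\<^bsub>msec L x\<^esub> w \<in> app (\<iota> k) x ` el (F k) x" by (rule csub_props(3)[OF L img[OF k(1)] x])
    then show ?thesis using k(1) by blast
  qed
  have sm: "a \<odot>\<^bsub>msec L x\<^esub> u \<in> ?R" if "a \<in> carrier (sec A x)" "u \<in> ?R" for a u
    using csub_props(4)[OF L img x that(1)] that(2) by blast
  have su: "?R \<subseteq> el L x" using csub_props(1)[OF L img x] by blast
  show "submodule ?R (sec A x) (msec L x)"
    unfolding module.submodule_iff[OF cartD(1)[OF L x]] by (intro conjI ballI su z ad sm)
next
  note L = poset_cocone(1)[OF coc] and \<iota> = poset_cocone(2)[OF coc]
  note img = csub_hom_image[OF \<iota>]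
  fix f assume f: "f \<in> Ar C"
  let ?R = "\<lambda>x. \<Union>i\<in>I. app (\<iota> i) x ` el (F i) x"
  show "mres L f ` ?R (tgt C f) \<subseteq> ?R (src C f)" using csubD(2)[OF img f] by fast
  show "?R (src C f) \<subseteq> mspan (sec A (src C f)) (msec L (src C f)) (mres L f ` ?R (tgt C f))"
  proof
    fix v assume "v \<in> ?R (src C f)"
    then obtain i where i: "i \<in> I" "v \<in> app (\<iota> i) (src C f) ` el (F i) (src C f)" by blast
    show "v \<in> mspan (sec A (src C f)) (msec L (src C f)) (mres L f ` ?R (tgt C f))"
      by (rule mspan_mono[OF csubD(3)[OF img[OF i(1)] f i(2)]]) (use i(1) in blast)
  qed
qed

context
  fixes L \<iota>
  assumes colim: "is_colimit (poset_category I r) Q F F' L \<iota>" and small_I: "small TYPE('u) I"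
begin

lemma colimit_cocone: "cocone (poset_category I r) Q F F' L \<iota>"
  using colim by (simp add: is_colimit_def)

text \<open>The composites of \<open>u\<close> with the injections form a cocone, whose
  factorisation through the colimit is unique.\<close>

lemma colimit_eq:
  assumes u: "u \<in> Hom Q L K" and u': "u' \<in> Hom Q L K"
    and eq: "\<And>i. i \<in> I \<Longrightarrow> u \<bullet>\<^bsub>Q\<^esub> \<iota> i = u' \<bullet>\<^bsub>Q\<^esub> \<iota> i"
  shows "u = u'"
proof -
  note \<iota> = poset_cocone(2)[OF colimit_cocone]
  have "cocone (poset_category I r) Q F F' K (\<lambda>i. u \<bullet>\<^bsub>Q\<^esub> \<iota> i)"
    unfolding cocone_def
  proof (intro conjI ballI)
    show "K \<in> Ob Q" using Hom_cart(2)[OF u] by (simp add: Q_simps)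
    show "u \<bullet>\<^bsub>Q\<^esub> \<iota> i \<in> Hom Q (F i) K" if "i \<in> Ob (poset_category I r)" for i using comp_Hom[OF \<iota> u] that by simp
    fix f assume "f \<in> Ar (poset_category I r)"
    then obtain i j where ij: "f = (i, j)" "(i, j) \<in> r" "i \<in> I" "j \<in> I"
      using directedD(1)[OF dir] by (cases f) auto
    have "\<iota> j \<bullet>\<^bsub>Q\<^esub> F' (i, j) = \<iota> i" using colimit_cocone ij(2) by (force simp: cocone_def)
    then show "(u \<bullet>\<^bsub>Q\<^esub> \<iota> (tgt (poset_category I r) f)) \<bullet>\<^bsub>Q\<^esub> F' f = u \<bullet>\<^bsub>Q\<^esub> \<iota> (src (poset_category I r) f)"
      using comp_assoc[OF poset_functor(2)[OF ij(2)] \<iota>[OF ij(4)] u] ij by simp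
  qed
  then have "\<exists>!w. w \<in> Hom Q L K \<and> (\<forall>i\<in>I. w \<bullet>\<^bsub>Q\<^esub> \<iota> i = u \<bullet>\<^bsub>Q\<^esub> \<iota> i)"
    using colim by (simp add: is_colimit_def)
  then show ?thesis using u u' eq by metis
qed

text \<open>The union of the images is a cartesian submodule. Projection to the quotient by it
  vanishes on every stage, hence is zero, so the union is the whole colimit.\<close>

lemma colimit_elem:
  assumes x: "x \<in> Ob C" and l: "l \<in> el L x"
  shows "\<exists>i\<in>I. \<exists>v\<in>el (F i) x. app (\<iota> i) x v = l"
proof -
  note \<iota> = poset_cocone(2)[OF colimit_cocone] and L = poset_cocone(1)[OF colimit_cocone]
  let ?R = "\<lambda>x. \<Union>i\<in>I. app (\<iota> i) x ` el (F i) x"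
  note R = csub_cocone_union[OF colimit_cocone]
  obtain q where q: "q \<in> Hom Q L (quotm L ?R)" and "onto (quotm L ?R) q"
    and q2: "\<And>x v. x \<in> Ob C \<Longrightarrow> v \<in> el L x \<Longrightarrow> app q x v = \<zero>\<^bsub>msec (quotm L ?R) x\<^esub> \<longleftrightarrow> v \<in> ?R x"
    by (rule quot_hom[OF L R]) blast
  note c = Hom_cart(2)[OF q]
  have "q = zhom L (quotm L ?R)"
  proof (rule colimit_eq[OF q zhom_Hom[OF L c]])
    fix i assume i: "i \<in> I"
    show "q \<bullet>\<^bsub>Q\<^esub> \<iota> i = zhom L (quotm L ?R) \<bullet>\<^bsub>Q\<^esub> \<iota> i"
      unfolding zhom_comp[OF \<iota>[OF i] c]
    proof (rule hom_eqI[OF comp_Hom[OF \<iota>[OF i] q] zhom_Hom[OF Hom_cart(1)[OF \<iota>[OF i]] c]])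
      fix x v assume xv: "x \<in> Ob C" "v \<in> el (F i) x"
      have "app (\<iota> i) x v \<in> ?R x" using i xv by blast
      then show "app (q \<bullet>\<^bsub>Q\<^esub> \<iota> i) x v = app (zhom (F i) (quotm L ?R)) x v"
        unfolding comp_app[OF \<iota>[OF i] q xv] zhom_app[OF xv]
        by (subst q2[OF xv(1) hom_closed[OF \<iota>[OF i] xv]])
    qed
  qed
  then have "app q x l = \<zero>\<^bsub>msec (quotm L ?R) x\<^esub>" using zhom_app[OF x l] by simp
  then have "l \<in> ?R x" using q2[OF x l] by blast
  then show ?thesis by auto
qed

text \<open>In the explicit colimit the element lies in the subgroup generated by the relations.
  Mapping the coproduct of all stages to a late stage j kills each relation once j is above its
  indices, and only finitely many relations occur.\<close>

lemma colimit_zero: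
  assumes i: "i \<in> I" and x: "x \<in> Ob C" and v: "v \<in> el (F i) x" and z: "app (\<iota> i) x v = \<zero>\<^bsub>msec L x\<^esub>"
  shows "\<exists>j. (i, j) \<in> r \<and> app (F' (i, j)) x v = \<zero>\<^bsub>msec (F j) x\<^esub>"
proof -
  let ?J = "poset_category I r"
  note F = poset_functor(1) and F' = poset_functor(2) and F'' = poset_functor(3)
  have sr: "small TYPE('u) r"
    by (rule small_subset[OF small_Sigma[OF univ small_I small_I] directedD(1)[OF dir]])
  note rI = directedD(1)[OF dir]
  obtain L0 p where p: "p \<in> Hom Q (coprod I F) L0"
    and col0: "is_colimit ?J Q F F' L0 (\<lambda>i. p \<bullet>\<^bsub>Q\<^esub> cmor I F i)"
    and ker: "\<And>x v T. x \<in> Ob C \<Longrightarrow> v \<in> el (coprod I F) x \<Longrightarrow> app p x v = \<zero>\<^bsub>msec L0 x\<^esub> \<Longrightarrow>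
       \<zero>\<^bsub>msec (coprod I F) x\<^esub> \<in> T \<Longrightarrow>
       (\<And>v w. v \<in> T \<Longrightarrow> w \<in> T \<Longrightarrow> v \<oplus>\<^bsub>msec (coprod I F) x\<^esub> w \<in> T) \<Longrightarrow>
       (\<And>f w. f \<in> r \<Longrightarrow> w \<in> el (F (fst f)) x \<Longrightarrow>
          app (cmor I F (snd f)) x (app (F' f) x w) \<ominus>\<^bsub>msec (coprod I F) x\<^esub>
          app (cmor I F (fst f)) x w \<in> T) \<Longrightarrow> v \<in> T"
    by (rule colimit_construction[of ?J F F']) (use small_I sr rI fct in \<open>auto\<close>)
  let ?P = "coprod I F" and ?\<iota> = "cmor I F"
  have P: "cart ?P" by (rule coprod_cart) (use small_I F in auto)
  have \<iota>': "?\<iota> i \<in> Hom Q (F i) ?P" if "i \<in> I" for i by (rule cmor_Hom) (use small_I F that in auto)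
  \<comment> \<open>A comparison map suffices: it carries the vanishing from \<open>L\<close> to the
    explicit colimit, whose kernel is known.\<close>
  obtain u where u: "u \<in> Hom Q L L0" "\<And>i. i \<in> I \<Longrightarrow> u \<bullet>\<^bsub>Q\<^esub> \<iota> i = p \<bullet>\<^bsub>Q\<^esub> ?\<iota> i"
    using colim col0 unfolding is_colimit_def by (metis poset_category_simps(1))
  have pz: "app p x (app (?\<iota> i) x v) = \<zero>\<^bsub>msec L0 x\<^esub>"
    using comp_app[OF \<iota>'[OF i] p x v] comp_app[OF poset_cocone(2)[OF colimit_cocone i] u(1) x v] u(2)[OF i]
    by (simp add: z hom_zero[OF u(1) x])
  \<comment> \<open>The map from the coproduct to stage j: the transition on stages below j, zero on
    the others.\<close>
  have "\<exists>s. s \<in> Hom Q ?P (F j) \<and> (\<forall>i\<in>I. s \<bullet>\<^bsub>Q\<^esub> ?\<iota> i = (if (i, j) \<in> r then F' (i, j) else zhom (F i) (F j)))"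
    if j: "j \<in> I" for j
  proof -
    have "(if (i, j) \<in> r then F' (i, j) else zhom (F i) (F j)) \<in> Hom Q (F i) (F j)" if "i \<in> I" for i
      using F' zhom_Hom[OF F[OF that] F[OF j]] by (cases "(i, j) \<in> r") simp_all
    then show ?thesis
      using coprod_desc[where F = F and \<kappa> = "\<lambda>i. if (i, j) \<in> r then F' (i, j) else zhom (F i) (F j)", OF small_I F F[OF j]]
      by blast
  qed
  then obtain s where s: "\<And>j. j \<in> I \<Longrightarrow> s j \<in> Hom Q ?P (F j)"
    and s\<iota>: "\<And>i j. j \<in> I \<Longrightarrow> i \<in> I \<Longrightarrow> s j \<bullet>\<^bsub>Q\<^esub> ?\<iota> i = (if (i, j) \<in> r then F' (i, j) else zhom (F i) (F j))"
    by metis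
  have s_app: "app (s j) x (app (?\<iota> i) x v) = app (F' (i, j)) x v" if "(i, j) \<in> r" "v \<in> el (F i) x" for i j v
  proof -
    have ij: "i \<in> I" "j \<in> I" using that(1) rI by auto
    show ?thesis using comp_app[OF \<iota>'[OF ij(1)] s[OF ij(2)] x that(2)] s\<iota>[OF ij(2,1)] that(1) by simp
  qed
  \<comment> \<open>Elements that die at all stages from some k on. The relation for a pair (a, b)
    belongs to T with k = b, because transitions from a to a later j factor through b.\<close>
  define T where "T = {w \<in> el ?P x. \<exists>k\<in>I. \<forall>j. (k, j) \<in> r \<longrightarrow> app (s j) x w = \<zero>\<^bsub>msec (F j) x\<^esub>}"
  have "app (?\<iota> i) x v \<in> T"
  proof (rule ker[OF x hom_closed[OF \<iota>'[OF i] x v] pz])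
    obtain k where k: "k \<in> I" using directedD(5)[OF dir] by blast
    have "app (s j) x \<zero>\<^bsub>msec ?P x\<^esub> = \<zero>\<^bsub>msec (F j) x\<^esub>" if "(k, j) \<in> r" for j
      using hom_zero[OF s x] that rI by blast
    then show "\<zero>\<^bsub>msec ?P x\<^esub> \<in> T"
      unfolding T_def using el_zero[OF P x] k by blast
  next
    fix a b assume "a \<in> T" "b \<in> T"
    then obtain k l where a: "a \<in> el ?P x" "k \<in> I" "\<And>j. (k, j) \<in> r \<Longrightarrow> app (s j) x a = \<zero>\<^bsub>msec (F j) x\<^esub>"
      and b: "b \<in> el ?P x" "l \<in> I" "\<And>j. (l, j) \<in> r \<Longrightarrow> app (s j) x b = \<zero>\<^bsub>msec (F j) x\<^esub>"
      unfolding T_def by blast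
    obtain m where m: "m \<in> I" "(k, m) \<in> r" "(l, m) \<in> r" using directedD(4)[OF dir a(2) b(2)] by blast
    have "app (s j) x (a \<oplus>\<^bsub>msec ?P x\<^esub> b) = \<zero>\<^bsub>msec (F j) x\<^esub>" if j: "(m, j) \<in> r" for j
    proof -
      have jI: "j \<in> I" using j rI by auto
      interpret Fj: abelian_group "msec (F j) x" by (rule cart_group[OF F[OF jI] x])
      show ?thesis
        using a(3)[OF directedD(3)[OF dir m(2) j]] b(3)[OF directedD(3)[OF dir m(3) j]]
        by (simp add: hom_add[OF s[OF jI] x a(1) b(1)])
    qed
    then show "a \<oplus>\<^bsub>msec ?P x\<^esub> b \<in> T" unfolding T_def using m(1) el_add[OF P x a(1) b(1)] by blast
  next
    fix f w assume f: "f \<in> r" and w: "w \<in> el (F (fst f)) x"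
    obtain a b where ab: "f = (a, b)" by (cases f)
    have abI: "a \<in> I" "b \<in> I" "(a, b) \<in> r" and w: "w \<in> el (F a) x" using f w rI by (auto simp: ab)
    note Fw = hom_closed[OF F'[OF abI(3)] x w]
    note c1 = hom_closed[OF \<iota>'[OF abI(2)] x Fw] and c2 = hom_closed[OF \<iota>'[OF abI(1)] x w]
    have "app (s j) x (app (?\<iota> b) x (app (F' (a, b)) x w) \<ominus>\<^bsub>msec ?P x\<^esub> app (?\<iota> a) x w) = \<zero>\<^bsub>msec (F j) x\<^esub>"
      if j: "(b, j) \<in> r" for j
    proof -
      have jI: "j \<in> I" using j rI by auto
      have aj: "(a, j) \<in> r" by (rule directedD(3)[OF dir abI(3) j])
      show ?thesis
        unfolding hom_diff[OF s[OF jI] x c1 c2] s_app[OF j Fw] s_app[OF aj w] F''[OF abI(3) j x w]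
        using diff_zero[OF F[OF jI] x] hom_closed[OF F'[OF j] x Fw] by simp
    qed
    then show "app (?\<iota> (snd f)) x (app (F' f) x w) \<ominus>\<^bsub>msec ?P x\<^esub> app (?\<iota> (fst f)) x w \<in> T"
      unfolding T_def ab using abI(2) el_diff[OF P x c1 c2] by auto
  qed
  then obtain k where k: "k \<in> I" "\<And>j. (k, j) \<in> r \<Longrightarrow> app (s j) x (app (?\<iota> i) x v) = \<zero>\<^bsub>msec (F j) x\<^esub>"
    unfolding T_def by blast
  \<comment> \<open>Above k the map \<open>s j\<close> kills the element, and above i it acts on it
    as the transition map.\<close>
  obtain j where j: "(k, j) \<in> r" "(i, j) \<in> r" using directedD(4)[OF dir k(1) i] by blast
  have "app (F' (i, j)) x v = \<zero>\<^bsub>msec (F j) x\<^esub>" using k(2)[OF j(1)] s_app[OF j(2) v] by simp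
  then show ?thesis using j(2) by blast
qed

end

lemma directed_colimit_exists:
  assumes "small TYPE('u) I"
  shows "\<exists>L \<iota>. is_colimit (poset_category I r) Q F F' L \<iota>"
proof -
  have sr: "small TYPE('u) r"
    by (rule small_subset[OF small_Sigma[OF univ assms assms] directedD(1)[OF dir]])
  show ?thesis
    by (rule colimit_construction[of "poset_category I r" F F'])
      (use assms sr directedD(1)[OF dir] fct in auto)
qed

text \<open>The comparison from an existing colimit is surjective by \<open>sur\<close>, and
  injective because an element comes from one stage, where \<open>e i\<close> is injective. The
  universal property is then transferred along it without an inverse being constructed.\<close>

lemma directed_union_colimit:
  assumes small_I: "small TYPE('u) I"
    and coc: "cocone (poset_category I r) Q F F' M e" and inj: "\<And>i. i \<in> I \<Longrightarrow> into (e i)"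
    and sur: "\<And>x v. x \<in> Ob C \<Longrightarrow> v \<in> el M x \<Longrightarrow> \<exists>i\<in>I. \<exists>w\<in>el (F i) x. app (e i) x w = v"
  shows "is_colimit (poset_category I r) Q F F' M e"
proof -
  obtain L \<iota> where col: "is_colimit (poset_category I r) Q F F' L \<iota>"
    using directed_colimit_exists[OF small_I] by blast
  note cL = colimit_cocone[OF col small_I]
  note e = poset_cocone(2)[OF coc] and \<iota> = poset_cocone(2)[OF cL]
  obtain t where t: "t \<in> Hom Q L M" and t\<iota>: "\<And>i. i \<in> I \<Longrightarrow> t \<bullet>\<^bsub>Q\<^esub> \<iota> i = e i"
    using col coc unfolding is_colimit_def by (metis poset_category_simps(1))
  have t_app: "app t x (app (\<iota> i) x w) = app (e i) x w" if "i \<in> I" "x \<in> Ob C" "w \<in> el (F i) x" for i x w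
    using comp_app[OF \<iota>[OF that(1)] t that(2,3)] by (simp add: t\<iota>[OF that(1)])
  have on: "onto M t"
  proof (rule ontoI[OF t])
    fix x v assume x: "x \<in> Ob C" and "v \<in> el M x"
    then obtain i w where i: "i \<in> I" "w \<in> el (F i) x" "app (e i) x w = v" using sur by blast
    show "\<exists>l\<in>el L x. app t x l = v"
      using t_app[OF i(1) x i(2)] i(3) hom_closed[OF \<iota>[OF i(1)] x i(2)] by blast
  qed
  have kt: "l = \<zero>\<^bsub>msec L x\<^esub>" if x: "x \<in> Ob C" and l: "l \<in> el L x" and z: "app t x l = \<zero>\<^bsub>msec M x\<^esub>" for x l
  proof -
    obtain i w where i: "i \<in> I" "w \<in> el (F i) x" "app (\<iota> i) x w = l" using colimit_elem[OF col small_I x l] by blast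
    have "app (e i) x w = app (e i) x \<zero>\<^bsub>msec (F i) x\<^esub>"
      using t_app[OF i(1) x i(2)] i(3) z hom_zero[OF e[OF i(1)] x] by simp
    then have "w = \<zero>\<^bsub>msec (F i) x\<^esub>"
      using intoD[OF inj[OF i(1)] e[OF i(1)] x i(2) el_zero[OF Hom_cart(1)[OF e[OF i(1)]] x]] by simp
    then show ?thesis using i(3) hom_zero[OF \<iota>[OF i(1)] x] by simp
  qed
  show ?thesis
    unfolding is_colimit_def
  proof (intro conjI allI impI coc)
    fix K \<kappa> assume cK: "cocone (poset_category I r) Q F F' K \<kappa>"
    then obtain u where u: "u \<in> Hom Q L K" "\<And>i. i \<in> I \<Longrightarrow> u \<bullet>\<^bsub>Q\<^esub> \<iota> i = \<kappa> i"
      using col unfolding is_colimit_def by (metis poset_category_simps(1))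
    \<comment> \<open>Since \<open>t\<close> has zero kernel, \<open>factor_onto\<close> yields a
      factorisation of every map out of \<open>L\<close>.\<close>
    have "\<exists>w\<in>Hom Q M K. w \<bullet>\<^bsub>Q\<^esub> t = u"
      by (rule factor_onto[OF t on u(1)]) (use kt hom_zero[OF u(1)] in auto)
    then obtain w where w: "w \<in> Hom Q M K" "w \<bullet>\<^bsub>Q\<^esub> t = u" by blast
    have wk: "w \<bullet>\<^bsub>Q\<^esub> e i = \<kappa> i" if "i \<in> I" for i
      using comp_assoc[OF \<iota>[OF that] t w(1)] by (simp add: t\<iota>[OF that] w(2) u(2)[OF that])
    have uniq: "w' = w" if w': "w' \<in> Hom Q M K" and eq: "\<forall>i\<in>I. w' \<bullet>\<^bsub>Q\<^esub> e i = \<kappa> i" for w'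
    proof (rule onto_eq[OF on t w' w(1)], rule colimit_eq[OF col small_I comp_Hom[OF t w'] comp_Hom[OF t w(1)]])
      fix i assume i: "i \<in> I"
      show "(w' \<bullet>\<^bsub>Q\<^esub> t) \<bullet>\<^bsub>Q\<^esub> \<iota> i = (w \<bullet>\<^bsub>Q\<^esub> t) \<bullet>\<^bsub>Q\<^esub> \<iota> i"
        using eq i comp_assoc[OF \<iota>[OF i] t w'] by (simp add: t\<iota>[OF i] w(2) u(2)[OF i])
    qed
    show "\<exists>!u. u \<in> Hom Q M K \<and> (\<forall>i\<in>Ob (poset_category I r). u \<bullet>\<^bsub>Q\<^esub> e i = \<kappa> i)"
      unfolding poset_category_simps
    proof (rule ex1I[of _ w])
      show "w \<in> Hom Q M K \<and> (\<forall>i\<in>I. w \<bullet>\<^bsub>Q\<^esub> e i = \<kappa> i)" using w(1) wk by blast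
    qed (blast intro: uniq)
  qed
qed

end

lemma short_exact_iff:
  assumes f: "f \<in> Hom Q K M" and g: "g \<in> Hom Q M N"
  shows "short_exact Q f g \<longleftrightarrow> into f \<and> onto N g \<and>
    (\<forall>x\<in>Ob C. {v \<in> el M x. app g x v = \<zero>\<^bsub>msec N x\<^esub>} = app f x ` el K x)"
proof
  assume "short_exact Q f g"
  then show "into f \<and> onto N g \<and> (\<forall>x\<in>Ob C. {v \<in> el M x. app g x v = \<zero>\<^bsub>msec N x\<^esub>} = app f x ` el K x)"
    unfolding short_exact_def using is_kernelD[OF g f] is_cokernelD(1)[OF f g] by blast
next
  assume "into f \<and> onto N g \<and> (\<forall>x\<in>Ob C. {v \<in> el M x. app g x v = \<zero>\<^bsub>msec N x\<^esub>} = app f x ` el K x)"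
  then show "short_exact Q f g"
    unfolding short_exact_def by (intro conjI is_kernelI[OF g f] is_cokernelI[OF f g]) auto
qed

text \<open>An element chase: \<open>colimit_elem\<close> lifts elements to a stage,
  \<open>colimit_zero\<close> turns vanishing in the colimit into vanishing at a later stage, and
  there the given short exact sequence applies.\<close>

lemma exact_direct_limits_Q: "has_exact_direct_limits TYPE('u) Q"
  unfolding has_exact_direct_limits_def Let_def
proof (intro allI impI conjI)
  fix I :: "'u set" and r F F'
  assume "small TYPE('u) I \<and> directed_poset I r" "is_functor (poset_category I r) Q F F'"
  then show "\<exists>L \<iota>. is_colimit (poset_category I r) Q F F' L \<iota>" using directed_colimit_exists by blast
next
  fix I :: "'u set" and r F F' G G' H H' \<alpha> \<beta> L \<iota> M \<mu> N \<nu> a b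
  let ?J = "poset_category I r"
  assume I: "small TYPE('u) I \<and> directed_poset I r"
  assume *: "is_functor ?J Q F F' \<and> is_functor ?J Q G G' \<and> is_functor ?J Q H H' \<and>
     natural_transf ?J Q F F' G G' \<alpha> \<and> natural_transf ?J Q G G' H H' \<beta> \<and>
     (\<forall>i\<in>I. short_exact Q (\<alpha> i) (\<beta> i)) \<and>
     is_colimit ?J Q F F' L \<iota> \<and> is_colimit ?J Q G G' M \<mu> \<and> is_colimit ?J Q H H' N \<nu> \<and>
     a \<in> Hom Q L M \<and> (\<forall>i\<in>I. a \<bullet>\<^bsub>Q\<^esub> \<iota> i = \<mu> i \<bullet>\<^bsub>Q\<^esub> \<alpha> i) \<and>
     b \<in> Hom Q M N \<and> (\<forall>i\<in>I. b \<bullet>\<^bsub>Q\<^esub> \<mu> i = \<nu> i \<bullet>\<^bsub>Q\<^esub> \<beta> i)"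
  have sI: "small TYPE('u) I" and dir: "directed_poset I r" using I by auto
  have fF: "is_functor ?J Q F F'" and fG: "is_functor ?J Q G G'" and fH: "is_functor ?J Q H H'"
    and cF: "is_colimit ?J Q F F' L \<iota>" and cG: "is_colimit ?J Q G G' M \<mu>" and cH: "is_colimit ?J Q H H' N \<nu>"
    and a: "a \<in> Hom Q L M" and b: "b \<in> Hom Q M N"
    and se: "\<And>i. i \<in> I \<Longrightarrow> short_exact Q (\<alpha> i) (\<beta> i)" using * by auto
  note \<iota> = poset_cocone(2)[OF fF dir colimit_cocone[OF fF dir cF sI]]
    and \<mu> = poset_cocone(2)[OF fG dir colimit_cocone[OF fG dir cG sI]]
    and \<nu> = poset_cocone(2)[OF fH dir colimit_cocone[OF fH dir cH sI]]
  have \<alpha>: "\<alpha> i \<in> Hom Q (F i) (G i)" and \<beta>: "\<beta> i \<in> Hom Q (G i) (H i)" if "i \<in> I" for i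
    using * that by (auto simp: natural_transf_def)
  have rI: "i \<in> I" "j \<in> I" if "(i, j) \<in> r" for i j using directedD(1)[OF dir] that by auto
  have nat\<alpha>: "app (G' (i, j)) x (app (\<alpha> i) x v) = app (\<alpha> j) x (app (F' (i, j)) x v)"
    if ij: "(i, j) \<in> r" and x: "x \<in> Ob C" "v \<in> el (F i) x" for i j x v
  proof -
    have "G' (i, j) \<bullet>\<^bsub>Q\<^esub> \<alpha> i = \<alpha> j \<bullet>\<^bsub>Q\<^esub> F' (i, j)" using * ij by (force simp: natural_transf_def)
    then show ?thesis
      using comp_app[OF \<alpha>[OF rI(1)[OF ij]] poset_functor(2)[OF fG dir ij] x]
        comp_app[OF poset_functor(2)[OF fF dir ij] \<alpha>[OF rI(2)[OF ij]] x] by simp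
  qed
  have nat\<beta>: "app (H' (i, j)) x (app (\<beta> i) x v) = app (\<beta> j) x (app (G' (i, j)) x v)"
    if ij: "(i, j) \<in> r" and x: "x \<in> Ob C" "v \<in> el (G i) x" for i j x v
  proof -
    have "H' (i, j) \<bullet>\<^bsub>Q\<^esub> \<beta> i = \<beta> j \<bullet>\<^bsub>Q\<^esub> G' (i, j)" using * ij by (force simp: natural_transf_def)
    then show ?thesis
      using comp_app[OF \<beta>[OF rI(1)[OF ij]] poset_functor(2)[OF fH dir ij] x]
        comp_app[OF poset_functor(2)[OF fG dir ij] \<beta>[OF rI(2)[OF ij]] x] by simp
  qed
  have a_app: "app a x (app (\<iota> i) x v) = app (\<mu> i) x (app (\<alpha> i) x v)" if "i \<in> I" "x \<in> Ob C" "v \<in> el (F i) x" for i x v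
    using comp_app[OF \<iota>[OF that(1)] a that(2,3)] comp_app[OF \<alpha>[OF that(1)] \<mu>[OF that(1)] that(2,3)] * that(1) by simp
  have b_app: "app b x (app (\<mu> i) x v) = app (\<nu> i) x (app (\<beta> i) x v)" if "i \<in> I" "x \<in> Ob C" "v \<in> el (G i) x" for i x v
    using comp_app[OF \<mu>[OF that(1)] b that(2,3)] comp_app[OF \<beta>[OF that(1)] \<nu>[OF that(1)] that(2,3)] * that(1) by simp
  have into\<alpha>: "into (\<alpha> i)" and onto\<beta>: "onto (H i) (\<beta> i)" if "i \<in> I" for i
    using se[OF that] short_exact_iff[OF \<alpha>[OF that] \<beta>[OF that]] by auto
  have ex: "{v \<in> el (G i) x. app (\<beta> i) x v = \<zero>\<^bsub>msec (H i) x\<^esub>} = app (\<alpha> i) x ` el (F i) x" if "i \<in> I" "x \<in> Ob C" for i x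
    using se[OF that(1)] short_exact_iff[OF \<alpha>[OF that(1)] \<beta>[OF that(1)]] that(2) by blast
  have into_a: "into a"
  proof (rule intoI[OF a])
    fix x l assume x: "x \<in> Ob C" and l: "l \<in> el L x" and z: "app a x l = \<zero>\<^bsub>msec M x\<^esub>"
    obtain i v where i: "i \<in> I" "v \<in> el (F i) x" "app (\<iota> i) x v = l"
      using colimit_elem[OF fF dir cF sI x l] by blast
    have "app (\<mu> i) x (app (\<alpha> i) x v) = \<zero>\<^bsub>msec M x\<^esub>" using a_app[OF i(1) x i(2)] i(3) z by simp
    then obtain j where j: "(i, j) \<in> r" "app (G' (i, j)) x (app (\<alpha> i) x v) = \<zero>\<^bsub>msec (G j) x\<^esub>"
      using colimit_zero[OF fG dir cG sI i(1) x hom_closed[OF \<alpha>[OF i(1)] x i(2)]] by blast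
    note jI = rI(2)[OF j(1)] and Fv = hom_closed[OF poset_functor(2)[OF fF dir j(1)] x i(2)]
    have "app (\<alpha> j) x (app (F' (i, j)) x v) = app (\<alpha> j) x \<zero>\<^bsub>msec (F j) x\<^esub>"
      using nat\<alpha>[OF j(1) x i(2)] j(2) hom_zero[OF \<alpha>[OF jI] x] by simp
    then have "app (F' (i, j)) x v = \<zero>\<^bsub>msec (F j) x\<^esub>"
      using intoD[OF into\<alpha>[OF jI] \<alpha>[OF jI] x Fv el_zero[OF Hom_cart(1)[OF \<alpha>[OF jI]] x]] by blast
    then show "l = \<zero>\<^bsub>msec L x\<^esub>"
      using poset_cocone(3)[OF fF dir colimit_cocone[OF fF dir cF sI] j(1) x i(2)] i(3) hom_zero[OF \<iota>[OF jI] x] by simp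
  qed
  have onto_b: "onto N b"
  proof (rule ontoI[OF b])
    fix x n assume x: "x \<in> Ob C" and n: "n \<in> el N x"
    obtain i v where i: "i \<in> I" "v \<in> el (H i) x" "app (\<nu> i) x v = n"
      using colimit_elem[OF fH dir cH sI x n] by blast
    obtain w where w: "w \<in> el (G i) x" "app (\<beta> i) x w = v" using ontoD[OF onto\<beta>[OF i(1)] \<beta>[OF i(1)] x i(2)] by blast
    show "\<exists>m\<in>el M x. app b x m = n"
      using b_app[OF i(1) x w(1)] w(2) i(3) hom_closed[OF \<mu>[OF i(1)] x w(1)] by blast
  qed
  have "{m \<in> el M x. app b x m = \<zero>\<^bsub>msec N x\<^esub>} = app a x ` el L x" if x: "x \<in> Ob C" for x
  proof
    show "{m \<in> el M x. app b x m = \<zero>\<^bsub>msec N x\<^esub>} \<subseteq> app a x ` el L x"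
    proof
      fix m assume "m \<in> {m \<in> el M x. app b x m = \<zero>\<^bsub>msec N x\<^esub>}"
      then have m: "m \<in> el M x" "app b x m = \<zero>\<^bsub>msec N x\<^esub>" by auto
      obtain i v where i: "i \<in> I" "v \<in> el (G i) x" "app (\<mu> i) x v = m"
        using colimit_elem[OF fG dir cG sI x m(1)] by blast
      have "app (\<nu> i) x (app (\<beta> i) x v) = \<zero>\<^bsub>msec N x\<^esub>" using b_app[OF i(1) x i(2)] i(3) m(2) by simp
      then obtain j where j: "(i, j) \<in> r" "app (H' (i, j)) x (app (\<beta> i) x v) = \<zero>\<^bsub>msec (H j) x\<^esub>"
        using colimit_zero[OF fH dir cH sI i(1) x hom_closed[OF \<beta>[OF i(1)] x i(2)]] by blast
      note jI = rI(2)[OF j(1)]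
      \<comment> \<open>At stage j the element has become a cycle, so exactness there provides the
        preimage \<open>w\<close>.\<close>
      have "app (G' (i, j)) x v \<in> {v \<in> el (G j) x. app (\<beta> j) x v = \<zero>\<^bsub>msec (H j) x\<^esub>}"
        using nat\<beta>[OF j(1) x i(2)] j(2) hom_closed[OF poset_functor(2)[OF fG dir j(1)] x i(2)] by simp
      then obtain w where w: "w \<in> el (F j) x" "app (G' (i, j)) x v = app (\<alpha> j) x w"
        unfolding ex[OF jI x] by blast
      have "app a x (app (\<iota> j) x w) = m"
        using a_app[OF jI x w(1)] w(2) i(3) poset_cocone(3)[OF fG dir colimit_cocone[OF fG dir cG sI] j(1) x i(2)] by simp
      then show "m \<in> app a x ` el L x" using hom_closed[OF \<iota>[OF jI] x w(1)] by blast
    qed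
    show "app a x ` el L x \<subseteq> {m \<in> el M x. app b x m = \<zero>\<^bsub>msec N x\<^esub>}"
    proof
      fix m assume "m \<in> app a x ` el L x"
      then obtain l where l: "l \<in> el L x" "m = app a x l" by blast
      obtain i v where i: "i \<in> I" "v \<in> el (F i) x" "app (\<iota> i) x v = l"
        using colimit_elem[OF fF dir cF sI x l(1)] by blast
      have "app (\<alpha> i) x v \<in> {v \<in> el (G i) x. app (\<beta> i) x v = \<zero>\<^bsub>msec (H i) x\<^esub>}" unfolding ex[OF i(1) x] using i(2) by blast
      then have "app b x m = \<zero>\<^bsub>msec N x\<^esub>"
        using a_app[OF i(1) x i(2)] b_app[OF i(1) x hom_closed[OF \<alpha>[OF i(1)] x i(2)]] i(3) l(2) hom_zero[OF \<nu>[OF i(1)] x] by simp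
      then show "m \<in> {m \<in> el M x. app b x m = \<zero>\<^bsub>msec N x\<^esub>}" using hom_closed[OF a x l(1)] l(2) by simp
    qed
  qed
  then show "short_exact Q a b" unfolding short_exact_iff[OF a b] using into_a onto_b by blast
qed

end

section \<open>Presentability\<close>

text \<open>The cardinality of \<open>Y\<close> is kappa; \<open>l_Y\<close> describes
  \<open>l\<close> as its successor. \<open>l\<close> is a relation on \<open>'u\<close> because
  \<open>locally_presentable\<close> quantifies over such relations.\<close>

locale qcoh_bound = qcoh C A
  for C :: "('o, 'a) category" and A :: "('o, 'a, 'u) presheaf" +
  fixes Y :: "'u set" and l :: "'u rel"
  assumes inf_Y: "infinite Y" and small_Y: "small TYPE('u) Y"
    and Ob_Y: "|Ob C| \<le>o |Y|" and Ar_Y: "|Ar C| \<le>o |Y|"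
    and A_Y: "\<And>x. x \<in> Ob C \<Longrightarrow> |carrier (sec A x)| \<le>o |Y|"
    and l_Y: "\<And>K :: 'u set. |K| <o l \<longleftrightarrow> |K| \<le>o |Y|"
    and l_props: "Cinfinite l" "regularCard l" "l <o |UNIV :: 'u set|"
begin

definition bounded :: "('o, 'a, 'u) module_presheaf \<Rightarrow> bool" where
  "bounded M \<longleftrightarrow> cart M \<and> (\<forall>x\<in>Ob C. |el M x| \<le>o |Y| )"

text \<open>Submodules are normalised to be extensional, so that a cartesian module has only a small
  set of them and pointwise equality is equality.\<close>

lemma csub_restrict: "csub M (restrict N (Ob C)) \<longleftrightarrow> csub M N"
  unfolding csub_def by (simp add: Ar_Ob)

subsection \<open>Bounded cartesian submodules\<close>

text \<open>
  Besides the module operations and restrictions, the closure adjoins, for each element of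
  \<open>M (src f)\<close>, finitely many elements of \<open>M (tgt f)\<close> whose restrictions generate it.
\<close>

lemma bounded_csub:
  assumes M: "cart M" and B: "\<And>x. x \<in> Ob C \<Longrightarrow> B x \<subseteq> el M x" "\<And>x. x \<in> Ob C \<Longrightarrow> |B x| \<le>o |Y|"
  shows "\<exists>N. csub M N \<and> N \<in> extensional (Ob C) \<and> (\<forall>x\<in>Ob C. B x \<subseteq> N x \<and> |N x| \<le>o |Y| )"
proof -
  \<comment> \<open>A finite part of the generating restrictions suffices for \<open>v\<close>; this
    keeps the number of adjoined elements below the bound.\<close>
  have "\<exists>Z. finite Z \<and> Z \<subseteq> el M (tgt C f) \<and> v \<in> mspan (sec A (src C f)) (msec M (src C f)) (mres M f ` Z)"
    if f: "f \<in> Ar C" and v: "v \<in> el M (src C f)" for f v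
  proof -
    obtain Z' where Z': "finite Z'" "Z' \<subseteq> mres M f ` el M (tgt C f)" "v \<in> mspan (sec A (src C f)) (msec M (src C f)) Z'"
      using mspan_finite[OF cart_span[OF M f v]] by blast
    then obtain Z where "Z \<subseteq> el M (tgt C f)" "finite Z" "Z' = mres M f ` Z" using finite_subset_image by metis
    then show ?thesis using Z'(3) by blast
  qed
  then obtain ch where ch: "\<And>f v. f \<in> Ar C \<Longrightarrow> v \<in> el M (src C f) \<Longrightarrow> finite (ch f v) \<and> ch f v \<subseteq> el M (tgt C f) \<and>
      v \<in> mspan (sec A (src C f)) (msec M (src C f)) (mres M f ` ch f v)" by metis
  define step where "step N x = N x \<union> {\<zero>\<^bsub>msec M x\<^esub>} \<union> (\<lambda>(v, w). v \<oplus>\<^bsub>msec M x\<^esub> w) ` (N x \<times> N x) \<union>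
      (\<lambda>(a, v). a \<odot>\<^bsub>msec M x\<^esub> v) ` (carrier (sec A x) \<times> N x) \<union>
      (\<Union>f\<in>{f \<in> Ar C. src C f = x}. mres M f ` N (tgt C f)) \<union>
      (\<Union>f\<in>{f \<in> Ar C. tgt C f = x}. \<Union>v\<in>N (src C f). ch f v)" for N x
  define N where "N n = (step ^^ n) B" for n
  have NS: "N (Suc n) = step (N n)" for n by (simp add: N_def)
  have sub: "N n x \<subseteq> el M x" if "x \<in> Ob C" for n x
    using that
  proof (induct n arbitrary: x)
    case 0
    then show ?case using B by (simp add: N_def)
  next
    case (Suc n)
    have 1: "(\<Union>f\<in>{f \<in> Ar C. src C f = x}. mres M f ` N n (tgt C f)) \<subseteq> el M x"
      using Suc(1) Ar_Ob res_closed[OF M] by blast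
    have 2: "(\<Union>f\<in>{f \<in> Ar C. tgt C f = x}. \<Union>v\<in>N n (src C f). ch f v) \<subseteq> el M x"
      using Suc(1) Ar_Ob ch by blast
    show ?case
      unfolding NS step_def using 1 2 Suc(1)[OF Suc(2)] el_zero[OF M Suc(2)] el_add[OF M Suc(2)] el_smult[OF M Suc(2)]
      by (intro Un_least) (auto simp: subset_eq)
  qed
  have bd: "|N n x| \<le>o |Y|" if "x \<in> Ob C" for n x
    using that
  proof (induct n arbitrary: x)
    case 0
    then show ?case using B by (simp add: N_def)
  next
    case (Suc n)
    note f = infinite_ordLeq_finite[OF inf_Y] and t = ordLeq_Sigma[OF inf_Y]
    have 1: "|\<Union>f\<in>{f \<in> Ar C. src C f = x}. mres M f ` N n (tgt C f)| \<le>o |Y|"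
      by (rule ordLeq_UN[OF inf_Y ordLeq_subset[OF Ar_Y]]) (auto intro!: ordLeq_image Suc(1) Ar_Ob)
    have 2: "|\<Union>f\<in>{f \<in> Ar C. tgt C f = x}. \<Union>v\<in>N n (src C f). ch f v| \<le>o |Y|"
    proof (rule ordLeq_UN[OF inf_Y ordLeq_subset[OF Ar_Y]])
      fix g assume g: "g \<in> {f \<in> Ar C. tgt C f = x}"
      show "|\<Union>v\<in>N n (src C g). ch g v| \<le>o |Y|"
      proof (rule ordLeq_UN[OF inf_Y])
        show "|N n (src C g)| \<le>o |Y|" using Suc(1) Ar_Ob g by blast
        show "|ch g v| \<le>o |Y|" if "v \<in> N n (src C g)" for v
          using ch sub Ar_Ob g that by (intro f) blast
      qed
    qed blast
    show ?case
      unfolding NS step_def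
      by (intro ordLeq_Un[OF inf_Y] 1 2 Suc(1) Suc(2) ordLeq_image t A_Y f) simp
  qed
  have mono: "N m x \<subseteq> N n x" if "m \<le> n" for m n x
    using that by (induct rule: dec_induct) (auto simp: NS step_def)
  \<comment> \<open>Countably many rounds are enough: each closure condition involves finitely many
    elements, and these occur together in some round.\<close>
  define U where "U x = (\<Union>n. N n x)" for x
  have Usub: "U x \<subseteq> el M x" if "x \<in> Ob C" for x using sub that by (auto simp: U_def)
  have stepU: "v \<in> U x" if "v \<in> step (N n) x" for v n x
    using that unfolding U_def NS[symmetric] by blast
  have "csub M U"
    unfolding csub_def
  proof (intro conjI ballI)
    fix x assume x: "x \<in> Ob C"
    have add: "v \<oplus>\<^bsub>msec M x\<^esub> w \<in> U x" if vw: "v \<in> U x" "w \<in> U x" for v w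
    proof -
      obtain m n where mn: "v \<in> N m x" "w \<in> N n x" using vw by (auto simp: U_def)
      then have "v \<in> N (max m n) x" "w \<in> N (max m n) x" using mono[of m "max m n" x] mono[of n "max m n" x] by auto
      then show ?thesis by (intro stepU[of _ "max m n"]) (auto simp: step_def)
    qed
    have sm: "a \<odot>\<^bsub>msec M x\<^esub> v \<in> U x" if a: "a \<in> carrier (sec A x)" and v: "v \<in> U x" for a v
    proof -
      obtain n where "v \<in> N n x" using v by (auto simp: U_def)
      then show ?thesis using a by (intro stepU[of _ n]) (auto simp: step_def)
    qed
    have z: "\<zero>\<^bsub>msec M x\<^esub> \<in> U x" by (rule stepU[of _ 0]) (simp add: step_def)
    show "submodule (U x) (sec A x) (msec M x)"
      unfolding module.submodule_iff[OF cartD(1)[OF M x]] by (intro conjI ballI Usub[OF x] z add sm)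
  next
    fix f assume f: "f \<in> Ar C"
    show "mres M f ` U (tgt C f) \<subseteq> U (src C f)"
    proof clarify
      fix v assume "v \<in> U (tgt C f)"
      then obtain n where "v \<in> N n (tgt C f)" by (auto simp: U_def)
      then show "mres M f v \<in> U (src C f)" using f by (intro stepU[of _ n]) (auto simp: step_def)
    qed
    show "U (src C f) \<subseteq> mspan (sec A (src C f)) (msec M (src C f)) (mres M f ` U (tgt C f))"
    proof
      fix v assume v: "v \<in> U (src C f)"
      then obtain n where n: "v \<in> N n (src C f)" by (auto simp: U_def)
      have "w \<in> U (tgt C f)" if "w \<in> ch f v" for w
        using that n f by (intro stepU[of _ n]) (auto simp: step_def)
      then have "mres M f ` ch f v \<subseteq> mres M f ` U (tgt C f)" by blast
      moreover have "v \<in> mspan (sec A (src C f)) (msec M (src C f)) (mres M f ` ch f v)"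
        using ch[OF f] v Usub[OF Ar_Ob(1)[OF f]] by blast
      ultimately show "v \<in> mspan (sec A (src C f)) (msec M (src C f)) (mres M f ` U (tgt C f))"
        by (rule mspan_mono[rotated])
    qed
  qed
  moreover have "B x \<subseteq> U x" for x
    unfolding U_def using UN_upper[of 0 UNIV "\<lambda>n. N n x"] by (simp add: N_def)
  moreover have "|U x| \<le>o |Y|" if "x \<in> Ob C" for x
    unfolding U_def by (rule ordLeq_nat_UN[OF inf_Y bd[OF that]])
  ultimately show ?thesis
    by (intro exI[of _ "restrict U (Ob C)"]) (simp add: csub_restrict)
qed

subsection \<open>A small set of representatives\<close>

text \<open>
  A bounded module is determined up to isomorphism by its structure constants, read off through an
  injection of its elements into \<open>Y\<close>.
\<close>

definition code :: "('o, 'a, 'u) module_presheaf \<Rightarrow> 'o \<Rightarrow> 'u \<Rightarrow> 'u" where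
  "code M x = (SOME j. inj_on j (el M x) \<and> j ` el M x \<subseteq> Y)"

lemma code:
  assumes "bounded M" "x \<in> Ob C"
  shows "inj_on (code M x) (el M x)" "v \<in> el M x \<Longrightarrow> code M x v \<in> Y"
proof -
  have "\<exists>j. inj_on j (el M x) \<and> j ` el M x \<subseteq> Y"
    using assms card_of_ordLeq[of "el M x" Y] by (simp add: bounded_def)
  then have "inj_on (code M x) (el M x) \<and> code M x ` el M x \<subseteq> Y"
    unfolding code_def by (rule someI_ex)
  then show "inj_on (code M x) (el M x)" "v \<in> el M x \<Longrightarrow> code M x v \<in> Y" by auto
qed

text \<open>Zero is not recorded, being determined by addition. The coded carrier can be read off
  the first arguments in the addition table.\<close>

definition struct where
  "struct M =
     ({(x, code M x v, code M x w, code M x (v \<oplus>\<^bsub>msec M x\<^esub> w)) |x v w. x \<in> Ob C \<and> v \<in> el M x \<and> w \<in> el M x},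
      {(x, a, code M x v, code M x (a \<odot>\<^bsub>msec M x\<^esub> v)) |x a v. x \<in> Ob C \<and> a \<in> carrier (sec A x) \<and> v \<in> el M x},
      {(f, code M (tgt C f) v, code M (src C f) (mres M f v)) |f v. f \<in> Ar C \<and> v \<in> el M (tgt C f)})"

text \<open>One module is chosen for each value of \<open>struct\<close>. These values are triples
  of subsets of small sets, which is why \<open>reps\<close> is small.\<close>

definition reps :: "('o, 'a, 'u) module_presheaf set" where
  "reps = (\<lambda>t. SOME M. bounded M \<and> struct M = t) ` struct ` Collect bounded"

lemma small_reps: "small TYPE('u) reps"
proof -
  let ?R = "\<Union>x\<in>Ob C. carrier (sec A x)"
  let ?T = "Pow (Ob C \<times> Y \<times> Y \<times> Y) \<times> Pow (Ob C \<times> ?R \<times> Y \<times> Y) \<times> Pow (Ar C \<times> Y \<times> Y)"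
  have "small TYPE('u) ?T"
    by (intro small_Sigma small_Pow small_UN univ small_Ob small_Ar small_Y A_small)
  moreover have "struct ` Collect bounded \<subseteq> ?T"
  proof (rule image_subsetI)
    fix M assume "M \<in> Collect bounded"
    then have b: "bounded M" and M: "cart M" by (auto simp: bounded_def)
    note c = code(2)[OF b]
    show "struct M \<in> ?T"
      unfolding struct_def using c el_add[OF M] el_smult[OF M] res_closed[OF M] Ar_Ob by auto
  qed
  ultimately show ?thesis unfolding reps_def by (rule small_image[OF small_subset])
qed

lemma reps_bounded: "s \<in> reps \<Longrightarrow> bounded s"
proof -
  assume "s \<in> reps"
  then obtain M where M: "bounded M" "s = (SOME N. bounded N \<and> struct N = struct M)"
    unfolding reps_def by blast
  have "bounded s \<and> struct s = struct M"
    unfolding M(2) by (rule someI[of "\<lambda>N. bounded N \<and> struct N = struct M" M]) (simp add: M(1))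
  then show ?thesis by simp
qed

lemma reps_cart: "s \<in> reps \<Longrightarrow> cart s"
  using reps_bounded by (simp add: bounded_def)

text \<open>Modules with equal \<open>struct\<close> have the same coded elements and coded
  operations, so decoding in \<open>M\<close> what was encoded in \<open>s\<close> is an
  isomorphism.\<close>

lemma reps_iso:
  assumes M: "bounded M"
  shows "\<exists>s\<in>reps. \<exists>e\<in>Hom Q s M. into e \<and> onto M e"
proof -
  define s where "s = (SOME N. bounded N \<and> struct N = struct M)"
  have "bounded s \<and> struct s = struct M"
    unfolding s_def by (rule someI[of "\<lambda>N. bounded N \<and> struct N = struct M" M]) (simp add: M)
  then have s: "bounded s" and st: "struct s = struct M" by auto
  have srep: "s \<in> reps" unfolding reps_def s_def using M by blast
  have cM: "cart M" and cs: "cart s" using M s by (auto simp: bounded_def)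
  have eqs: "{(x, code s x v, code s x w, code s x (v \<oplus>\<^bsub>msec s x\<^esub> w)) |x v w. x \<in> Ob C \<and> v \<in> el s x \<and> w \<in> el s x} =
     {(x, code M x v, code M x w, code M x (v \<oplus>\<^bsub>msec M x\<^esub> w)) |x v w. x \<in> Ob C \<and> v \<in> el M x \<and> w \<in> el M x}"
    "{(x, a, code s x v, code s x (a \<odot>\<^bsub>msec s x\<^esub> v)) |x a v. x \<in> Ob C \<and> a \<in> carrier (sec A x) \<and> v \<in> el s x} =
     {(x, a, code M x v, code M x (a \<odot>\<^bsub>msec M x\<^esub> v)) |x a v. x \<in> Ob C \<and> a \<in> carrier (sec A x) \<and> v \<in> el M x}"
    "{(f, code s (tgt C f) v, code s (src C f) (mres s f v)) |f v. f \<in> Ar C \<and> v \<in> el s (tgt C f)} =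
     {(f, code M (tgt C f) v, code M (src C f) (mres M f v)) |f v. f \<in> Ar C \<and> v \<in> el M (tgt C f)}"
    using st unfolding struct_def by auto
  have add: "\<exists>v'\<in>el M x. \<exists>w'\<in>el M x. code M x v' = code s x v \<and> code M x w' = code s x w \<and>
      code M x (v' \<oplus>\<^bsub>msec M x\<^esub> w') = code s x (v \<oplus>\<^bsub>msec s x\<^esub> w)"
    if "x \<in> Ob C" "v \<in> el s x" "w \<in> el s x" for x v w
  proof -
    have "(x, code s x v, code s x w, code s x (v \<oplus>\<^bsub>msec s x\<^esub> w)) \<in>
       {(x, code M x v, code M x w, code M x (v \<oplus>\<^bsub>msec M x\<^esub> w)) |x v w. x \<in> Ob C \<and> v \<in> el M x \<and> w \<in> el M x}"
      unfolding eqs(1)[symmetric] using that by blast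
    then show ?thesis by force
  qed
  have smu: "\<exists>v'\<in>el M x. code M x v' = code s x v \<and> code M x (a \<odot>\<^bsub>msec M x\<^esub> v') = code s x (a \<odot>\<^bsub>msec s x\<^esub> v)"
    if "x \<in> Ob C" "a \<in> carrier (sec A x)" "v \<in> el s x" for x a v
  proof -
    have "(x, a, code s x v, code s x (a \<odot>\<^bsub>msec s x\<^esub> v)) \<in>
       {(x, a, code M x v, code M x (a \<odot>\<^bsub>msec M x\<^esub> v)) |x a v. x \<in> Ob C \<and> a \<in> carrier (sec A x) \<and> v \<in> el M x}"
      unfolding eqs(2)[symmetric] using that by blast
    then show ?thesis by force
  qed
  have rs: "\<exists>v'\<in>el M (tgt C f). code M (tgt C f) v' = code s (tgt C f) v \<and> code M (src C f) (mres M f v') = code s (src C f) (mres s f v)"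
    if "f \<in> Ar C" "v \<in> el s (tgt C f)" for f v
  proof -
    have "(f, code s (tgt C f) v, code s (src C f) (mres s f v)) \<in>
       {(f, code M (tgt C f) v, code M (src C f) (mres M f v)) |f v. f \<in> Ar C \<and> v \<in> el M (tgt C f)}"
      unfolding eqs(3)[symmetric] using that by blast
    then show ?thesis by force
  qed
  \<comment> \<open>The table entry for the sum of \<open>v'\<close> with itself is used only
    because it exhibits the code of \<open>v'\<close>.\<close>
  have sur: "\<exists>v\<in>el s x. code s x v = code M x v'" if "x \<in> Ob C" "v' \<in> el M x" for x v'
  proof -
    have "(x, code M x v', code M x v', code M x (v' \<oplus>\<^bsub>msec M x\<^esub> v')) \<in>
       {(x, code s x v, code s x w, code s x (v \<oplus>\<^bsub>msec s x\<^esub> w)) |x v w. x \<in> Ob C \<and> v \<in> el s x \<and> w \<in> el s x}"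
      unfolding eqs(1) using that by blast
    then show ?thesis by force
  qed
  have "\<exists>v'. v' \<in> el M x \<and> code M x v' = code s x v" if "x \<in> Ob C" "v \<in> el s x" for x v
    using add[OF that that(2)] by blast
  then obtain \<phi> where \<phi>: "\<And>x v. x \<in> Ob C \<Longrightarrow> v \<in> el s x \<Longrightarrow> \<phi> x v \<in> el M x \<and> code M x (\<phi> x v) = code s x v"
    by metis
  have \<phi>_eq: "\<phi> x v = v'" if "x \<in> Ob C" "v \<in> el s x" "v' \<in> el M x" "code M x v' = code s x v" for x v v'
    by (rule inj_onD[OF code(1)[OF M that(1)]]) (use \<phi>[OF that(1,2)] that(3,4) in simp_all)
  have m: "mor s M \<phi>"
    unfolding mor_def
  proof (intro conjI ballI linear_mapsI)
    fix x v assume x: "x \<in> Ob C" and v: "v \<in> el s x"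
    show "\<phi> x v \<in> el M x" using \<phi>[OF x v] by simp
    show "\<phi> x (v \<oplus>\<^bsub>msec s x\<^esub> w) = \<phi> x v \<oplus>\<^bsub>msec M x\<^esub> \<phi> x w" if w: "w \<in> el s x" for w
    proof -
      obtain v' w' where vw: "v' \<in> el M x" "w' \<in> el M x" "code M x v' = code s x v" "code M x w' = code s x w"
        "code M x (v' \<oplus>\<^bsub>msec M x\<^esub> w') = code s x (v \<oplus>\<^bsub>msec s x\<^esub> w)" using add[OF x v w] by blast
      show ?thesis
        using \<phi>_eq[OF x v vw(1,3)] \<phi>_eq[OF x w vw(2,4)] \<phi>_eq[OF x el_add[OF cs x v w] el_add[OF cM x vw(1,2)] vw(5)] by simp
    qed
  next
    fix x a v assume x: "x \<in> Ob C" and a: "a \<in> carrier (sec A x)" and v: "v \<in> el s x"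
    obtain v' where v': "v' \<in> el M x" "code M x v' = code s x v" "code M x (a \<odot>\<^bsub>msec M x\<^esub> v') = code s x (a \<odot>\<^bsub>msec s x\<^esub> v)"
      using smu[OF x a v] by blast
    show "\<phi> x (a \<odot>\<^bsub>msec s x\<^esub> v) = a \<odot>\<^bsub>msec M x\<^esub> \<phi> x v"
      using \<phi>_eq[OF x v v'(1,2)] \<phi>_eq[OF x el_smult[OF cs x a v] el_smult[OF cM x a v'(1)] v'(3)] by simp
  next
    fix f v assume f: "f \<in> Ar C" and v: "v \<in> el s (tgt C f)"
    obtain v' where v': "v' \<in> el M (tgt C f)" "code M (tgt C f) v' = code s (tgt C f) v"
      "code M (src C f) (mres M f v') = code s (src C f) (mres s f v)" using rs[OF f v] by blast
    show "\<phi> (src C f) (mres s f v) = mres M f (\<phi> (tgt C f) v)"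
      using \<phi>_eq[OF Ar_Ob(2)[OF f] v v'(1,2)]
        \<phi>_eq[OF Ar_Ob(1)[OF f] res_closed[OF cs f v] res_closed[OF cM f v'(1)] v'(3)] by simp
  qed
  note e = arr_Hom[OF cs cM m]
  have "into (arr s \<phi> M)"
    unfolding into_def
  proof (intro ballI inj_onI)
    fix x v w assume x: "x \<in> Ob C" and "v \<in> el (src Q (arr s \<phi> M)) x" "w \<in> el (src Q (arr s \<phi> M)) x"
      and eq: "app (arr s \<phi> M) x v = app (arr s \<phi> M) x w"
    then have vw: "v \<in> el s x" "w \<in> el s x" using HomD[OF e] by auto
    then have "code s x v = code s x w" using eq \<phi>[OF x vw(1)] \<phi>[OF x vw(2)] app_arr[OF x vw(1)] app_arr[OF x vw(2)] by simp
    then show "v = w" by (rule inj_onD[OF code(1)[OF s x] _ vw])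
  qed
  moreover have "onto M (arr s \<phi> M)"
  proof (rule ontoI[OF e])
    fix x v' assume x: "x \<in> Ob C" and v': "v' \<in> el M x"
    obtain v where v: "v \<in> el s x" "code s x v = code M x v'" using sur[OF x v'] by blast
    show "\<exists>v\<in>el s x. app (arr s \<phi> M) x v = v'"
      using v \<phi>_eq[OF x v(1) v' v(2)[symmetric]] app_arr[OF x v(1)] by auto
  qed
  ultimately show ?thesis using srep e by blast
qed

text \<open>A bounded submodule is replaced by an isomorphic representative, together with its
  embedding into \<open>M\<close>.\<close>

lemma reps_sub:
  assumes M: "cart M" and N: "csub M N" "\<And>x. x \<in> Ob C \<Longrightarrow> |N x| \<le>o |Y|"
  shows "\<exists>s e. s \<in> reps \<and> e \<in> Hom Q s M \<and> into e \<and> (\<forall>x\<in>Ob C. app e x ` el s x = N x)"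
proof -
  have "bounded (subm M N)" unfolding bounded_def using subm_cart[OF M N(1)] N(2) by simp
  then obtain s e where s: "s \<in> reps" and e: "e \<in> Hom Q s (subm M N)" "into e" "onto (subm M N) e"
    using reps_iso by blast
  obtain k where k: "k \<in> Hom Q (subm M N) M" "into k" and kv: "\<And>x v. x \<in> Ob C \<Longrightarrow> v \<in> N x \<Longrightarrow> app k x v = v"
    by (rule sub_hom[OF M N(1)]) blast
  note ke = comp_Hom[OF e(1) k(1)]
  have ke_app: "app (k \<bullet>\<^bsub>Q\<^esub> e) x v = app e x v" if "x \<in> Ob C" "v \<in> el s x" for x v
    using comp_app[OF e(1) k(1) that] kv[OF that(1)] hom_closed[OF e(1) that] by simp
  have "into (k \<bullet>\<^bsub>Q\<^esub> e)"
    unfolding into_def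
  proof (intro ballI inj_onI)
    fix x v w assume x: "x \<in> Ob C" and "v \<in> el (src Q (k \<bullet>\<^bsub>Q\<^esub> e)) x" "w \<in> el (src Q (k \<bullet>\<^bsub>Q\<^esub> e)) x"
      and eq: "app (k \<bullet>\<^bsub>Q\<^esub> e) x v = app (k \<bullet>\<^bsub>Q\<^esub> e) x w"
    then have vw: "v \<in> el s x" "w \<in> el s x" using HomD[OF ke] by auto
    show "v = w" using intoD[OF e(2,1) x vw] eq ke_app[OF x vw(1)] ke_app[OF x vw(2)] by simp
  qed
  moreover have "app (k \<bullet>\<^bsub>Q\<^esub> e) x ` el s x = N x" if x: "x \<in> Ob C" for x
  proof -
    have "app (k \<bullet>\<^bsub>Q\<^esub> e) x ` el s x = app e x ` el s x" using ke_app[OF x] by simp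
    also have "\<dots> = N x" using hom_closed[OF e(1) x] ontoD[OF e(3,1) x] by (force simp: image_iff)
    finally show ?thesis .
  qed
  ultimately show ?thesis using s ke by blast
qed

text \<open>Having fewer than \<open>l\<close> elements means having at most kappa; finite sets are
  included, as \<open>Y\<close> is infinite.\<close>

lemma card_directedD:
  fixes I :: "'u set"
  assumes "card_directed_poset l I r"
  shows "directed_poset I r" and "K \<subseteq> I \<Longrightarrow> |K| \<le>o |Y| \<Longrightarrow> \<exists>u\<in>I. \<forall>k\<in>K. (k, u) \<in> r"
proof -
  have *: "\<exists>u\<in>I. \<forall>k\<in>K. (k, u) \<in> r" if "K \<subseteq> I" "|K| \<le>o |Y|" for K
    using assms that by (simp add: card_directed_poset_def l_Y)
  then show "K \<subseteq> I \<Longrightarrow> |K| \<le>o |Y| \<Longrightarrow> \<exists>u\<in>I. \<forall>k\<in>K. (k, u) \<in> r" .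
  show "directed_poset I r"
    unfolding directed_poset_def
  proof (intro conjI allI impI)
    show "partial_order_on I r" using assms by (simp add: card_directed_poset_def)
    show "\<exists>u\<in>I. \<forall>k\<in>K. (k, u) \<in> r" if "K \<subseteq> I" "finite K" for K
      by (rule *[OF that(1) infinite_ordLeq_finite[OF inf_Y that(2)]])
  qed
qed

text \<open>The diagram is the set of all bounded cartesian submodules ordered by inclusion, encoded
  in \<open>'u\<close>, with each submodule replaced by an isomorphic representative.\<close>

lemma colimit_of_reps:
  assumes M: "cart M"
  shows "\<exists>(I :: 'u set) r F F' \<iota>. small TYPE('u) I \<and> card_directed_poset l I r \<and> F ` I \<subseteq> reps \<and>
     is_functor (poset_category I r) Q F F' \<and> is_colimit (poset_category I r) Q F F' M \<iota>"
proof -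
  define Sub where "Sub = {N \<in> extensional (Ob C). csub M N \<and> (\<forall>x\<in>Ob C. |N x| \<le>o |Y| )}"
  have "Sub \<subseteq> (\<Pi>\<^sub>E x\<in>Ob C. Pow (el M x))"
    using csub_props(1)[OF M] by (auto simp: Sub_def PiE_def)
  then have small_Sub: "small TYPE('u) Sub"
    by (rule small_subset[rotated]) (intro small_PiE small_Pow univ small_Ob cartD M)
  obtain g :: "_ \<Rightarrow> 'u" where g: "inj_on g Sub" using small_encode[OF small_Sub] by blast
  define I where "I = g ` Sub"
  define b where "b = inv_into Sub g"
  have b: "b i \<in> Sub" "g (b i) = i" if "i \<in> I" for i
    using that by (auto simp: I_def b_def inv_into_into f_inv_into_f)
  have bg: "b (g N) = N" if "N \<in> Sub" for N using that g by (simp add: b_def)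
  define r where "r = {(i, j). i \<in> I \<and> j \<in> I \<and> (\<forall>x\<in>Ob C. b i x \<subseteq> b j x)}"
  have smallI: "small TYPE('u) I" unfolding I_def by (rule small_image[OF small_Sub])
  have "\<exists>s e. s \<in> reps \<and> e \<in> Hom Q s M \<and> into e \<and> (\<forall>x\<in>Ob C. app e x ` el s x = b i x)" if "i \<in> I" for i
    using reps_sub[OF M, of "b i"] b(1)[OF that] by (simp add: Sub_def)
  then obtain F e where F: "\<And>i. i \<in> I \<Longrightarrow> F i \<in> reps" and e: "\<And>i. i \<in> I \<Longrightarrow> e i \<in> Hom Q (F i) M"
    and ei: "\<And>i. i \<in> I \<Longrightarrow> into (e i)" and eb: "\<And>i x. i \<in> I \<Longrightarrow> x \<in> Ob C \<Longrightarrow> app (e i) x ` el (F i) x = b i x"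
    by metis
  have "\<exists>u. u \<in> Hom Q (F i) (F j) \<and> e j \<bullet>\<^bsub>Q\<^esub> u = e i" if ij: "(i, j) \<in> r" for i j
  proof -
    have I: "i \<in> I" "j \<in> I" and sub: "\<And>x. x \<in> Ob C \<Longrightarrow> b i x \<subseteq> b j x" using ij by (auto simp: r_def)
    have "\<exists>w\<in>el (F j) x. app (e j) x w = app (e i) x v" if "x \<in> Ob C" "v \<in> el (F i) x" for x v
    proof -
      have "app (e i) x v \<in> app (e j) x ` el (F j) x"
        using eb[OF I(1) that(1)] eb[OF I(2) that(1)] sub[OF that(1)] that(2) by blast
      then show ?thesis by auto
    qed
    then show ?thesis using factor_into[OF e[OF I(2)] ei[OF I(2)] e[OF I(1)]] by blast
  qed
  \<comment> \<open>The transition maps are determined by the injective embeddings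
    \<open>e j\<close>; functoriality follows by cancelling these.\<close>
  then obtain F2 where F2: "\<And>i j. (i, j) \<in> r \<Longrightarrow> F2 i j \<in> Hom Q (F i) (F j) \<and> e j \<bullet>\<^bsub>Q\<^esub> F2 i j = e i" by metis
  define F' where "F' = case_prod F2"
  have F': "F' (i, j) \<in> Hom Q (F i) (F j)" "e j \<bullet>\<^bsub>Q\<^esub> F' (i, j) = e i" if "(i, j) \<in> r" for i j
    using F2[OF that] by (auto simp: F'_def)
  have po: "partial_order_on I r"
    unfolding partial_order_on_def preorder_on_def
  proof (intro conjI)
    show "r \<subseteq> I \<times> I" "refl_on I r" "trans r" by (auto simp: r_def refl_on_def trans_def)
    show "antisym r"
    proof (rule antisymI)
      fix i j assume ij: "(i, j) \<in> r" "(j, i) \<in> r"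
      then have I: "i \<in> I" "j \<in> I" by (auto simp: r_def)
      \<comment> \<open>Mutual inclusion concerns objects of \<open>C\<close> only; extensionality
        makes it an equality of functions.\<close>
      have "b i = b j"
        by (rule extensionalityI[of _ "Ob C"]) (use ij b(1)[OF I(1)] b(1)[OF I(2)] in \<open>auto simp: r_def Sub_def\<close>)
      then show "i = j" using b(2) I by metis
    qed
  qed
  have cd: "card_directed_poset l I r"
    unfolding card_directed_poset_def
  proof (intro conjI po allI impI)
    fix K assume K: "K \<subseteq> I" "|K| <o l"
    have KI: "b k \<in> Sub" if "k \<in> K" for k using K(1) b(1) that by blast
    \<comment> \<open>An upper bound: the pointwise union of at most kappa bounded sets is bounded,
      and its closure is a bounded cartesian submodule.\<close>
    have "\<exists>N. csub M N \<and> N \<in> extensional (Ob C) \<and> (\<forall>x\<in>Ob C. (\<Union>k\<in>K. b k x) \<subseteq> N x \<and> |N x| \<le>o |Y| )"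
    proof (rule bounded_csub[OF M])
      fix x assume x: "x \<in> Ob C"
      show "(\<Union>k\<in>K. b k x) \<subseteq> el M x" using csub_props(1)[OF M _ x] KI by (force simp: Sub_def)
      show "|\<Union>k\<in>K. b k x| \<le>o |Y|"
        by (rule ordLeq_UN[OF inf_Y]) (use K(2) KI x in \<open>auto simp: l_Y Sub_def\<close>)
    qed
    then obtain N where N: "N \<in> Sub" and KN: "\<And>x. x \<in> Ob C \<Longrightarrow> (\<Union>k\<in>K. b k x) \<subseteq> N x" by (auto simp: Sub_def)
    have "g N \<in> I" using N by (simp add: I_def)
    moreover have "(k, g N) \<in> r" if "k \<in> K" for k
      using KN that K(1) \<open>g N \<in> I\<close> by (auto simp: r_def bg[OF N])
    ultimately show "\<exists>u\<in>I. \<forall>k\<in>K. (k, u) \<in> r" by blast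
  qed
  have rI: "i \<in> I" "j \<in> I" if "(i, j) \<in> r" for i j using that by (auto simp: r_def)
  have fct: "is_functor (poset_category I r) Q F F'"
    unfolding is_functor_def
  proof (intro conjI ballI impI)
    fix i assume "i \<in> Ob (poset_category I r)"
    then have i: "i \<in> I" by simp
    then have ii: "(i, i) \<in> r" by (simp add: r_def)
    show "F i \<in> Ob Q" using reps_cart[OF F[OF i]] by (simp add: Q_simps)
    show "F' (ide (poset_category I r) i) = ide Q (F i)"
      using into_eq[OF ei[OF i] e[OF i] F'(1)[OF ii] ide_Hom[OF reps_cart[OF F[OF i]]]] F'(2)[OF ii] comp_ide(1)[OF e[OF i]] by simp
  next
    fix f assume "f \<in> Ar (poset_category I r)"
    then show "F' f \<in> Hom Q (F (src (poset_category I r) f)) (F (tgt (poset_category I r) f))"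
      using F'(1) by (cases f) simp
  next
    fix f h assume "f \<in> Ar (poset_category I r)" "h \<in> Ar (poset_category I r)" "tgt (poset_category I r) f = src (poset_category I r) h"
    then obtain i j k where ijk: "f = (i, j)" "h = (j, k)" "(i, j) \<in> r" "(j, k) \<in> r" by (cases f, cases h) auto
    then have ik: "(i, k) \<in> r" by (auto simp: r_def)
    have "e k \<bullet>\<^bsub>Q\<^esub> F' (i, k) = e k \<bullet>\<^bsub>Q\<^esub> (F' (j, k) \<bullet>\<^bsub>Q\<^esub> F' (i, j))"
      using comp_assoc[OF F'(1)[OF ijk(3)] F'(1)[OF ijk(4)] e[OF rI(2)[OF ijk(4)]]] F'(2)[OF ik] F'(2)[OF ijk(3)] F'(2)[OF ijk(4)] by simp
    then have "F' (i, k) = F' (j, k) \<bullet>\<^bsub>Q\<^esub> F' (i, j)"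
      using rI(2)[OF ik] by (intro into_eq[OF ei e F'(1)[OF ik] comp_Hom[OF F'(1)[OF ijk(3)] F'(1)[OF ijk(4)]]])
    then show "F' (h \<bullet>\<^bsub>poset_category I r\<^esub> f) = F' h \<bullet>\<^bsub>Q\<^esub> F' f" by (simp add: ijk)
  qed
  have coc: "cocone (poset_category I r) Q F F' M e"
    unfolding cocone_def using M e F'(2) by (auto simp: Q_simps)
  have "is_colimit (poset_category I r) Q F F' M e"
  proof (rule directed_union_colimit[OF fct card_directedD(1)[OF cd] smallI coc ei])
    fix x v assume x: "x \<in> Ob C" and v: "v \<in> el M x"
    \<comment> \<open>The submodule generated from the single element \<open>v\<close> shows that
      the bounded submodules cover \<open>M\<close>.\<close>
    have "\<exists>N. csub M N \<and> N \<in> extensional (Ob C) \<and> (\<forall>y\<in>Ob C. (if y = x then {v} else {}) \<subseteq> N y \<and> |N y| \<le>o |Y| )"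
      by (rule bounded_csub[OF M]) (use v infinite_ordLeq_finite[OF inf_Y] in auto)
    then obtain N where N: "csub M N" "N \<in> extensional (Ob C)"
      and Nb: "\<forall>y\<in>Ob C. (if y = x then {v} else {}) \<subseteq> N y \<and> |N y| \<le>o |Y|" by blast
    have "v \<in> N x" using Nb x by force
    moreover have NS: "N \<in> Sub" using N Nb by (simp add: Sub_def)
    ultimately have "g N \<in> I" "v \<in> b (g N) x" by (auto simp: I_def bg)
    then have "v \<in> app (e (g N)) x ` el (F (g N)) x" using eb[of "g N" x] x by simp
    then show "\<exists>i\<in>I. \<exists>w\<in>el (F i) x. app (e i) x w = v" using \<open>g N \<in> I\<close> by blast
  qed
  moreover have "F ` I \<subseteq> reps" using F by blast
  ultimately show ?thesis using smallI cd fct by blast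
qed

text \<open>Each of at most kappa elements dies at some later stage, and kappa^+-directedness bounds
  these stages simultaneously. The elements may sit over different objects of
  \<open>C\<close>.\<close>

lemma vanish_later:
  fixes I :: "'u set"
  assumes sI: "small TYPE('u) I" and cd: "card_directed_poset l I r"
    and fct: "is_functor (poset_category I r) Q F F'" and col: "is_colimit (poset_category I r) Q F F' L \<iota>"
    and i: "i \<in> I" and D: "|D| \<le>o |Y|"
    and van: "\<And>x d. (x, d) \<in> D \<Longrightarrow> x \<in> Ob C \<and> d \<in> el (F i) x \<and> app (\<iota> i) x d = \<zero>\<^bsub>msec L x\<^esub>"
  shows "\<exists>k. (i, k) \<in> r \<and> (\<forall>(x, d)\<in>D. app (F' (i, k)) x d = \<zero>\<^bsub>msec (F k) x\<^esub>)"
proof -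
  note dir = card_directedD(1)[OF cd]
  have "\<exists>j. (i, j) \<in> r \<and> app (F' (i, j)) (fst p) (snd p) = \<zero>\<^bsub>msec (F j) (fst p)\<^esub>" if "p \<in> D" for p
    using colimit_zero[OF fct dir col sI i] van[of "fst p" "snd p"] that by simp
  then obtain j where j: "\<And>p. p \<in> D \<Longrightarrow> (i, j p) \<in> r"
    and jz: "\<And>p. p \<in> D \<Longrightarrow> app (F' (i, j p)) (fst p) (snd p) = \<zero>\<^bsub>msec (F (j p)) (fst p)\<^esub>" by metis
  \<comment> \<open>\<open>i\<close> is included so that the bound lies above it even when D is
    empty.\<close>
  let ?K = "insert i (j ` D)"
  have KI: "?K \<subseteq> I" using i j directedD(1)[OF dir] by blast
  have "|{i} \<union> j ` D| \<le>o |Y|"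
    by (rule ordLeq_Un[OF inf_Y infinite_ordLeq_finite[OF inf_Y] ordLeq_image[OF D]]) simp
  then have Kc: "|?K| \<le>o |Y|" by simp
  obtain k where k: "k \<in> I" "\<And>m. m \<in> ?K \<Longrightarrow> (m, k) \<in> r" using card_directedD(2)[OF cd KI Kc] by blast
  have "app (F' (i, k)) x d = \<zero>\<^bsub>msec (F k) x\<^esub>" if d: "(x, d) \<in> D" for x d
  proof -
    have x: "x \<in> Ob C" "d \<in> el (F i) x" using van[OF d] by auto
    have jk: "(j (x, d), k) \<in> r" using k(2) d by blast
    show ?thesis
      using poset_functor(3)[OF fct dir j[OF d] jk x] jz[OF d] hom_zero[OF poset_functor(2)[OF fct dir jk] x(1)] by simp
  qed
  then show ?thesis using k(2)[of i] by blast
qed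

lemma bounded_elements:
  assumes "bounded M"
  shows "|SIGMA x:Ob C. el M x| \<le>o |Y|"
  using assms by (intro ordLeq_Sigma[OF inf_Y Ob_Y]) (simp add: bounded_def)

text \<open>The elements of M, at most kappa in number, are lifted to one stage without regard to
  the structure. The failures of the lift to be linear and natural are again at most kappa many and
  vanish in the colimit, hence at a common later stage, where the lift becomes a morphism.\<close>

lemma bounded_factor:
  fixes I :: "'u set"
  assumes sI: "small TYPE('u) I" and cd: "card_directed_poset l I r"
    and fct: "is_functor (poset_category I r) Q F F'" and col: "is_colimit (poset_category I r) Q F F' L \<iota>"
    and M: "bounded M" and f: "f \<in> Hom Q M L"
  shows "\<exists>i\<in>I. \<exists>g\<in>Hom Q M (F i). f = \<iota> i \<bullet>\<^bsub>Q\<^esub> g"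
proof -
  note dir = card_directedD(1)[OF cd]
  note coc = colimit_cocone[OF fct dir col sI]
  note \<iota> = poset_cocone(2)[OF fct dir coc] and \<iota>F = poset_cocone(3)[OF fct dir coc]
  note F = poset_functor(1)[OF fct dir] and F' = poset_functor(2)[OF fct dir]
  have cM: "cart M" and cL: "cart L" using M Hom_cart[OF f] by auto
  have rI: "i \<in> I" "j \<in> I" if "(i, j) \<in> r" for i j using directedD(1)[OF dir] that by auto
  let ?E = "SIGMA x:Ob C. el M x"
  have "\<exists>i\<in>I. \<exists>w\<in>el (F i) x. app (\<iota> i) x w = app f x v" if "x \<in> Ob C" "v \<in> el M x" for x v
    using colimit_elem[OF fct dir col sI that(1) hom_closed[OF f that]] .
  then obtain ix where ix: "\<And>x v. x \<in> Ob C \<Longrightarrow> v \<in> el M x \<Longrightarrow> ix x v \<in> I \<and> (\<exists>w\<in>el (F (ix x v)) x. app (\<iota> (ix x v)) x w = app f x v)"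
    by metis
  have "case_prod ix ` ?E \<subseteq> I" using ix by auto
  \<comment> \<open>One stage above all those at which the individual elements were lifted.\<close>
  then obtain i where i: "i \<in> I" and ixi: "\<And>x v. x \<in> Ob C \<Longrightarrow> v \<in> el M x \<Longrightarrow> (ix x v, i) \<in> r"
    using card_directedD(2)[OF cd _ ordLeq_image[OF bounded_elements[OF M]], of "case_prod ix"] by auto
  have "\<exists>w. w \<in> el (F i) x \<and> app (\<iota> i) x w = app f x v" if xv: "x \<in> Ob C" "v \<in> el M x" for x v
  proof -
    obtain w where w: "w \<in> el (F (ix x v)) x" "app (\<iota> (ix x v)) x w = app f x v" using ix[OF xv] by blast
    show ?thesis using \<iota>F[OF ixi[OF xv] xv(1) w(1)] w(2) hom_closed[OF F'[OF ixi[OF xv]] xv(1) w(1)] by auto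
  qed
  then obtain w where w: "\<And>x v. x \<in> Ob C \<Longrightarrow> v \<in> el M x \<Longrightarrow> w x v \<in> el (F i) x"
    and w\<iota>: "\<And>x v. x \<in> Ob C \<Longrightarrow> v \<in> el M x \<Longrightarrow> app (\<iota> i) x (w x v) = app f x v" by metis
  note cF = F[OF i] and \<iota>i = \<iota>[OF i]
  \<comment> \<open>The defects of the lift with respect to addition, scalars and
    restriction.\<close>
  let ?D1 = "(\<lambda>(x, v, v'). (x, w x (v \<oplus>\<^bsub>msec M x\<^esub> v') \<ominus>\<^bsub>msec (F i) x\<^esub> (w x v \<oplus>\<^bsub>msec (F i) x\<^esub> w x v'))) ` (SIGMA x:Ob C. el M x \<times> el M x)"
  let ?D2 = "(\<lambda>(x, a, v). (x, w x (a \<odot>\<^bsub>msec M x\<^esub> v) \<ominus>\<^bsub>msec (F i) x\<^esub> (a \<odot>\<^bsub>msec (F i) x\<^esub> w x v))) ` (SIGMA x:Ob C. carrier (sec A x) \<times> el M x)"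
  let ?D3 = "(\<lambda>(h, v). (src C h, w (src C h) (mres M h v) \<ominus>\<^bsub>msec (F i) (src C h)\<^esub> mres (F i) h (w (tgt C h) v))) ` (SIGMA h:Ar C. el M (tgt C h))"
  have bM: "|el M x| \<le>o |Y|" if "x \<in> Ob C" for x using M that by (simp add: bounded_def)
  have "|?D1| \<le>o |Y|"
    by (intro ordLeq_image ordLeq_Sigma[OF inf_Y] Ob_Y bM)
  moreover have "|?D2| \<le>o |Y|"
    by (intro ordLeq_image ordLeq_Sigma[OF inf_Y] Ob_Y A_Y bM)
  moreover have "|?D3| \<le>o |Y|"
    by (intro ordLeq_image ordLeq_Sigma[OF inf_Y] Ar_Y bM Ar_Ob)
  ultimately have D: "|?D1 \<union> ?D2 \<union> ?D3| \<le>o |Y|" by (intro ordLeq_Un[OF inf_Y])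
  have van: "x \<in> Ob C \<and> u \<ominus>\<^bsub>msec (F i) x\<^esub> u' \<in> el (F i) x \<and> app (\<iota> i) x (u \<ominus>\<^bsub>msec (F i) x\<^esub> u') = \<zero>\<^bsub>msec L x\<^esub>"
    if "x \<in> Ob C" "u \<in> el (F i) x" "u' \<in> el (F i) x" "app (\<iota> i) x u = app (\<iota> i) x u'" for x u u'
    using that el_diff[OF cF that(1-3)] hom_diff[OF \<iota>i that(1-3)] diff_zero[OF cL that(1) hom_closed[OF \<iota>i that(1,3)] hom_closed[OF \<iota>i that(1,3)]] by simp
  have "\<exists>k. (i, k) \<in> r \<and> (\<forall>(x, d)\<in>?D1 \<union> ?D2 \<union> ?D3. app (F' (i, k)) x d = \<zero>\<^bsub>msec (F k) x\<^esub>)"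
  proof (rule vanish_later[OF sI cd fct col i D])
    fix x d assume "(x, d) \<in> ?D1 \<union> ?D2 \<union> ?D3"
    then consider (1) v v' where "x \<in> Ob C" "v \<in> el M x" "v' \<in> el M x"
        "d = w x (v \<oplus>\<^bsub>msec M x\<^esub> v') \<ominus>\<^bsub>msec (F i) x\<^esub> (w x v \<oplus>\<^bsub>msec (F i) x\<^esub> w x v')"
      | (2) a v where "x \<in> Ob C" "a \<in> carrier (sec A x)" "v \<in> el M x"
        "d = w x (a \<odot>\<^bsub>msec M x\<^esub> v) \<ominus>\<^bsub>msec (F i) x\<^esub> (a \<odot>\<^bsub>msec (F i) x\<^esub> w x v)"
      | (3) h v where "h \<in> Ar C" "v \<in> el M (tgt C h)" "x = src C h"
        "d = w (src C h) (mres M h v) \<ominus>\<^bsub>msec (F i) (src C h)\<^esub> mres (F i) h (w (tgt C h) v)"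
      by auto
    then show "x \<in> Ob C \<and> d \<in> el (F i) x \<and> app (\<iota> i) x d = \<zero>\<^bsub>msec L x\<^esub>"
    proof cases
      case 1
      show ?thesis
        unfolding 1(4) using 1(1-3) w
        by (intro van) (simp_all add: el_add[OF cF] el_add[OF cM] w\<iota> hom_add[OF \<iota>i] hom_add[OF f])
    next
      case 2
      show ?thesis
        unfolding 2(4) using 2(1-3) w
        by (intro van) (simp_all add: el_smult[OF cF] el_smult[OF cM] w\<iota> hom_smult[OF \<iota>i] hom_smult[OF f])
    next
      case 3
      show ?thesis
        unfolding 3(3,4) using 3(1,2) w Ar_Ob[OF 3(1)]
        by (intro van) (simp_all add: res_closed[OF cF] res_closed[OF cM] w\<iota> hom_nat[OF \<iota>i] hom_nat[OF f])
    qed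
  qed
  then obtain k where k: "(i, k) \<in> r" and kz: "\<And>x d. (x, d) \<in> ?D1 \<union> ?D2 \<union> ?D3 \<Longrightarrow> app (F' (i, k)) x d = \<zero>\<^bsub>msec (F k) x\<^esub>"
    by blast
  note Fk = F'[OF k] and cFk = F[OF rI(2)[OF k]]
  let ?g = "\<lambda>x v. app (F' (i, k)) x (w x v)"
  \<comment> \<open>Two elements whose difference is one of the listed defects are identified at
    stage k.\<close>
  have kill: "app (F' (i, k)) x u = app (F' (i, k)) x u'"
    if "x \<in> Ob C" "u \<in> el (F i) x" "u' \<in> el (F i) x" "(x, u \<ominus>\<^bsub>msec (F i) x\<^esub> u') \<in> ?D1 \<union> ?D2 \<union> ?D3" for x u u'
    using kz[OF that(4)] hom_diff[OF Fk that(1-3)] diff_zero[OF cFk that(1) hom_closed[OF Fk that(1,2)] hom_closed[OF Fk that(1,3)]] by simp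
  have m: "mor M (F k) ?g"
    unfolding mor_def
  proof (intro conjI ballI linear_mapsI)
    fix x v assume x: "x \<in> Ob C" and v: "v \<in> el M x"
    show "?g x v \<in> el (F k) x" by (rule hom_closed[OF Fk x w[OF x v]])
    show "?g x (v \<oplus>\<^bsub>msec M x\<^esub> v') = ?g x v \<oplus>\<^bsub>msec (F k) x\<^esub> ?g x v'" if v': "v' \<in> el M x" for v'
    proof -
      have "(x, w x (v \<oplus>\<^bsub>msec M x\<^esub> v') \<ominus>\<^bsub>msec (F i) x\<^esub> (w x v \<oplus>\<^bsub>msec (F i) x\<^esub> w x v')) \<in> ?D1"
        using x v v' by (intro image_eqI[of _ _ "(x, v, v')"]) auto
      then have "?g x (v \<oplus>\<^bsub>msec M x\<^esub> v') = app (F' (i, k)) x (w x v \<oplus>\<^bsub>msec (F i) x\<^esub> w x v')"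
        using x v v' w by (intro kill) (auto simp: el_add[OF cF] el_add[OF cM])
      then show ?thesis using hom_add[OF Fk x w[OF x v] w[OF x v']] by simp
    qed
  next
    fix x a v assume x: "x \<in> Ob C" and a: "a \<in> carrier (sec A x)" and v: "v \<in> el M x"
    have "(x, w x (a \<odot>\<^bsub>msec M x\<^esub> v) \<ominus>\<^bsub>msec (F i) x\<^esub> (a \<odot>\<^bsub>msec (F i) x\<^esub> w x v)) \<in> ?D2"
      using x a v by (intro image_eqI[of _ _ "(x, a, v)"]) auto
    then have "?g x (a \<odot>\<^bsub>msec M x\<^esub> v) = app (F' (i, k)) x (a \<odot>\<^bsub>msec (F i) x\<^esub> w x v)"
      using x a v w by (intro kill) (auto simp: el_smult[OF cF] el_smult[OF cM])
    then show "?g x (a \<odot>\<^bsub>msec M x\<^esub> v) = a \<odot>\<^bsub>msec (F k) x\<^esub> ?g x v" using hom_smult[OF Fk x a w[OF x v]] by simp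
  next
    fix h v assume h: "h \<in> Ar C" and v: "v \<in> el M (tgt C h)"
    note x = Ar_Ob(1)[OF h] and y = Ar_Ob(2)[OF h]
    have "(src C h, w (src C h) (mres M h v) \<ominus>\<^bsub>msec (F i) (src C h)\<^esub> mres (F i) h (w (tgt C h) v)) \<in> ?D3"
      using h v by (intro image_eqI[of _ _ "(h, v)"]) auto
    then have "?g (src C h) (mres M h v) = app (F' (i, k)) (src C h) (mres (F i) h (w (tgt C h) v))"
      using x y h v w by (intro kill) (auto simp: res_closed[OF cF] res_closed[OF cM])
    then show "?g (src C h) (mres M h v) = mres (F k) h (?g (tgt C h) v)" using hom_nat[OF Fk h w[OF y v]] by simp
  qed
  note g = arr_Hom[OF cM cFk m]
  note \<iota>k = \<iota>[OF rI(2)[OF k]]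
  have "f = \<iota> k \<bullet>\<^bsub>Q\<^esub> arr M ?g (F k)"
  proof (rule hom_eqI[OF f comp_Hom[OF g \<iota>k]])
    fix x v assume xv: "x \<in> Ob C" "v \<in> el M x"
    show "app f x v = app (\<iota> k \<bullet>\<^bsub>Q\<^esub> arr M ?g (F k)) x v"
      unfolding comp_app[OF g \<iota>k xv] app_arr[OF xv] using \<iota>F[OF k xv(1) w[OF xv]] w\<iota>[OF xv] by simp
  qed
  then show ?thesis using rI(2)[OF k] g by blast
qed

text \<open>Surjectivity is \<open>bounded_factor\<close>. For injectivity, two maps are moved to a
  common stage; their differences on the elements of M vanish in the colimit, hence all at once at a
  later stage.\<close>

lemma bounded_presentable:
  assumes M: "bounded M"
  shows "presentable_object TYPE('u) l Q M"
  unfolding presentable_object_def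
proof (intro conjI allI impI ballI)
  show "M \<in> Ob Q" using M by (simp add: bounded_def Q_simps)
next
  fix I :: "'u set" and r F F' L \<iota> f
  assume a: "small TYPE('u) I \<and> card_directed_poset l I r \<and> is_functor (poset_category I r) Q F F' \<and>
     is_colimit (poset_category I r) Q F F' L \<iota>" and f: "f \<in> Hom Q M L"
  show "\<exists>i\<in>I. \<exists>g\<in>Hom Q M (F i). f = \<iota> i \<bullet>\<^bsub>Q\<^esub> g"
    by (rule bounded_factor[OF _ _ _ _ M f, of I r F F']) (use a in auto)
next
  fix I :: "'u set" and r F F' L \<iota> i g j h
  assume a: "small TYPE('u) I \<and> card_directed_poset l I r \<and> is_functor (poset_category I r) Q F F' \<and>
     is_colimit (poset_category I r) Q F F' L \<iota>"
    and i: "i \<in> I" and g: "g \<in> Hom Q M (F i)" and j: "j \<in> I" and h: "h \<in> Hom Q M (F j)"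
    and eq: "\<iota> i \<bullet>\<^bsub>Q\<^esub> g = \<iota> j \<bullet>\<^bsub>Q\<^esub> h"
  have sI: "small TYPE('u) I" and cd: "card_directed_poset l I r" and fct: "is_functor (poset_category I r) Q F F'"
    and col: "is_colimit (poset_category I r) Q F F' L \<iota>" using a by auto
  note dir = card_directedD(1)[OF cd]
  note coc = colimit_cocone[OF fct dir col sI]
  note \<iota> = poset_cocone(2)[OF fct dir coc] and \<iota>F = poset_cocone(3)[OF fct dir coc]
  note F = poset_functor(1)[OF fct dir] and F' = poset_functor(2)[OF fct dir] and F'' = poset_functor(3)[OF fct dir]
  have cL: "cart L" by (rule poset_cocone(1)[OF fct dir coc])
  have rI: "i \<in> I" "j \<in> I" if "(i, j) \<in> r" for i j using directedD(1)[OF dir] that by auto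
  obtain m where m: "m \<in> I" "(i, m) \<in> r" "(j, m) \<in> r" using directedD(4)[OF dir i j] by blast
  let ?u = "\<lambda>x v. app (F' (i, m)) x (app g x v)" and ?u' = "\<lambda>x v. app (F' (j, m)) x (app h x v)"
  \<comment> \<open>The differences of the two maps at the common stage m, one for each element of
    M.\<close>
  let ?D = "(\<lambda>(x, v). (x, ?u x v \<ominus>\<^bsub>msec (F m) x\<^esub> ?u' x v)) ` (SIGMA x:Ob C. el M x)"
  have u: "?u x v \<in> el (F m) x" "?u' x v \<in> el (F m) x" "app (\<iota> m) x (?u x v) = app (\<iota> m) x (?u' x v)"
    if xv: "x \<in> Ob C" "v \<in> el M x" for x v
  proof -
    note gv = hom_closed[OF g xv] and hv = hom_closed[OF h xv]
    show "?u x v \<in> el (F m) x" "?u' x v \<in> el (F m) x"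
      using hom_closed[OF F'[OF m(2)] xv(1) gv] hom_closed[OF F'[OF m(3)] xv(1) hv] by auto
    show "app (\<iota> m) x (?u x v) = app (\<iota> m) x (?u' x v)"
      using \<iota>F[OF m(2) xv(1) gv] \<iota>F[OF m(3) xv(1) hv] comp_app[OF g \<iota>[OF i] xv] comp_app[OF h \<iota>[OF j] xv] eq by simp
  qed
  have "\<exists>k. (m, k) \<in> r \<and> (\<forall>(x, d)\<in>?D. app (F' (m, k)) x d = \<zero>\<^bsub>msec (F k) x\<^esub>)"
  proof (rule vanish_later[OF sI cd fct col m(1) ordLeq_image[OF bounded_elements[OF M]]])
    fix x d assume "(x, d) \<in> ?D"
    then obtain v where v: "x \<in> Ob C" "v \<in> el M x" "d = ?u x v \<ominus>\<^bsub>msec (F m) x\<^esub> ?u' x v" by auto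
    note uv = u[OF v(1,2)]
    show "x \<in> Ob C \<and> d \<in> el (F m) x \<and> app (\<iota> m) x d = \<zero>\<^bsub>msec L x\<^esub>"
      using v el_diff[OF F[OF m(1)] v(1) uv(1,2)] hom_diff[OF \<iota>[OF m(1)] v(1) uv(1,2)] uv(3)
        diff_zero[OF cL v(1) hom_closed[OF \<iota>[OF m(1)] v(1) uv(2)] hom_closed[OF \<iota>[OF m(1)] v(1) uv(2)]] by simp
  qed
  then obtain k where k: "(m, k) \<in> r" and kz: "\<And>x d. (x, d) \<in> ?D \<Longrightarrow> app (F' (m, k)) x d = \<zero>\<^bsub>msec (F k) x\<^esub>" by blast
  have ik: "(i, k) \<in> r" and jk: "(j, k) \<in> r" using directedD(3)[OF dir] m k by blast+
  have "F' (i, k) \<bullet>\<^bsub>Q\<^esub> g = F' (j, k) \<bullet>\<^bsub>Q\<^esub> h"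
  proof (rule hom_eqI[OF comp_Hom[OF g F'[OF ik]] comp_Hom[OF h F'[OF jk]]])
    fix x v assume xv: "x \<in> Ob C" "v \<in> el M x"
    note uv = u[OF xv] and Fk = F'[OF k]
    have "(x, ?u x v \<ominus>\<^bsub>msec (F m) x\<^esub> ?u' x v) \<in> ?D" using xv by (intro image_eqI[of _ _ "(x, v)"]) auto
    from kz[OF this] have "app (F' (m, k)) x (?u x v) = app (F' (m, k)) x (?u' x v)"
      using hom_diff[OF Fk xv(1) uv(1,2)]
        diff_zero[OF F[OF rI(2)[OF k]] xv(1) hom_closed[OF Fk xv(1) uv(1)] hom_closed[OF Fk xv(1) uv(2)]] by simp
    then show "app (F' (i, k) \<bullet>\<^bsub>Q\<^esub> g) x v = app (F' (j, k) \<bullet>\<^bsub>Q\<^esub> h) x v"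
      using F''[OF m(2) k xv(1) hom_closed[OF g xv]] F''[OF m(3) k xv(1) hom_closed[OF h xv]]
        comp_app[OF g F'[OF ik] xv] comp_app[OF h F'[OF jk] xv] by simp
  qed
  then show "\<exists>k\<in>I. (i, k) \<in> r \<and> (j, k) \<in> r \<and> F' (i, k) \<bullet>\<^bsub>Q\<^esub> g = F' (j, k) \<bullet>\<^bsub>Q\<^esub> h"
    using ik jk rI(2)[OF ik] by blast
qed

lemma locally_presentable_Q: "locally_presentable TYPE('u) Q"
  unfolding locally_presentable_def
proof (intro conjI category_Q locally_small_Q cocomplete_Q exI[of _ l] l_props(2,3) exI[of _ reps] ballI)
  show "cinfinite l" "Card_order l" using l_props(1) by auto
  show "reps \<subseteq> Ob Q" using reps_cart by (auto simp: Q_simps)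
  show "small TYPE('u) reps" by (rule small_reps)
  show "presentable_object TYPE('u) l Q K" if "K \<in> reps" for K by (rule bounded_presentable[OF reps_bounded[OF that]])
  fix M assume "M \<in> Ob Q"
  then show "\<exists>(I :: 'u set) r F F' \<iota>. small TYPE('u) I \<and> card_directed_poset l I r \<and> F ` I \<subseteq> reps \<and>
     is_functor (poset_category I r) Q F F' \<and> is_colimit (poset_category I r) Q F F' M \<iota>"
    by (intro colimit_of_reps) (simp add: Q_simps)
qed

section \<open>Generator and products\<close>

text \<open>Distinct arrows differ at some element, which lies in the image of a representative. A
  map out of the coproduct that is the embedding on this summand reaches the element.\<close>

lemma generator_Q: "generator Q (coprod reps (\<lambda>s. s))"
  unfolding generator_def
proof (intro conjI ballI impI)
  let ?G = "coprod reps (\<lambda>s. s)"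
  have G: "cart ?G" by (rule coprod_cart) (auto intro: small_reps reps_cart)
  then show "?G \<in> Ob Q" by (simp add: Q_simps)
  fix f g assume f': "f \<in> Ar Q" "g \<in> Ar Q" and fg: "src Q f = src Q g \<and> tgt Q f = tgt Q g \<and> f \<noteq> g"
  define M N where "M = src Q f" and "N = tgt Q f"
  have f: "f \<in> Hom Q M N" and g: "g \<in> Hom Q M N" using f' fg by (auto simp: Hom_def M_def N_def)
  note M = Hom_cart(1)[OF f]
  obtain x v where x: "x \<in> Ob C" and v: "v \<in> el M x" and ne: "app f x v \<noteq> app g x v"
    using hom_eqI[OF f g] fg by blast
  have "\<exists>K. csub M K \<and> K \<in> extensional (Ob C) \<and> (\<forall>y\<in>Ob C. (if y = x then {v} else {}) \<subseteq> K y \<and> |K y| \<le>o |Y| )"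
    by (rule bounded_csub[OF M]) (use v infinite_ordLeq_finite[OF inf_Y] in auto)
  then obtain K where K: "csub M K" and Kb: "\<forall>y\<in>Ob C. (if y = x then {v} else {}) \<subseteq> K y \<and> |K y| \<le>o |Y|" by blast
  have vK: "v \<in> K x" using Kb x by force
  obtain s e where s: "s \<in> reps" and e: "e \<in> Hom Q s M" and img: "\<forall>x\<in>Ob C. app e x ` el s x = K x"
    using reps_sub[OF M K] Kb by blast
  have "v \<in> app e x ` el s x" using img x vK by simp
  then obtain w where w: "w \<in> el s x" "app e x w = v" by blast
  \<comment> \<open>Off the summand \<open>s\<close> the map is set to zero.\<close>
  have "\<exists>u\<in>Hom Q ?G M. \<forall>t\<in>reps. u \<bullet>\<^bsub>Q\<^esub> cmor reps (\<lambda>s. s) t = (if t = s then e else zhom t M)"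
    by (rule coprod_desc[where F = "\<lambda>s. s"]) (auto intro: small_reps reps_cart M e zhom_Hom)
  then obtain u where u: "u \<in> Hom Q ?G M" and us: "u \<bullet>\<^bsub>Q\<^esub> cmor reps (\<lambda>s. s) s = e" using s by force
  have c: "cmor reps (\<lambda>s. s) s \<in> Hom Q s ?G" by (rule cmor_Hom[where F = "\<lambda>s. s"]) (auto intro: small_reps reps_cart s)
  define z where "z = app (cmor reps (\<lambda>s. s) s) x w"
  have z: "z \<in> el ?G x" "app u x z = v"
    unfolding z_def using hom_closed[OF c x w(1)] comp_app[OF c u x w(1)] w(2) by (simp_all add: us)
  have "app (f \<bullet>\<^bsub>Q\<^esub> u) x z \<noteq> app (g \<bullet>\<^bsub>Q\<^esub> u) x z"
    using ne z comp_app[OF u f x z(1)] comp_app[OF u g x z(1)] by simp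
  then show "\<exists>h\<in>Hom Q ?G (src Q f). f \<bullet>\<^bsub>Q\<^esub> h \<noteq> g \<bullet>\<^bsub>Q\<^esub> h" using u unfolding M_def[symmetric] by metis
qed

text \<open>
  The product is the coproduct of all representatives with a cone to the family, modulo the largest
  cartesian submodule on which all the projections vanish.
\<close>

lemma products:
  fixes F :: "'i \<Rightarrow> ('o, 'a, 'u) module_presheaf"
  assumes sI: "small TYPE('u) I" and FI: "F ` I \<subseteq> Ob Q"
  shows "\<exists>P \<pi>. is_product Q I F P \<pi>"
proof -
  have F: "cart (F i)" if "i \<in> I" for i using FI that by (auto simp: Q_simps)
  \<comment> \<open>All cones to the family from a representative. The families of legs are
    extensional, so that the collection is small.\<close>
  define Cn where "Cn = (SIGMA s:reps. \<Pi>\<^sub>E i\<in>I. Hom Q s (F i))"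
  have sC: "small TYPE('u) Cn"
    unfolding Cn_def by (intro small_Sigma small_PiE univ small_reps sI small_Hom reps_cart F)
  have fc: "cart (fst c)" if "c \<in> Cn" for c using that reps_cart by (auto simp: Cn_def)
  have sc: "snd c i \<in> Hom Q (fst c) (F i)" if "c \<in> Cn" "i \<in> I" for c i using that by (auto simp: Cn_def)
  let ?W = "coprod Cn fst" and ?\<iota> = "cmor Cn fst"
  have W: "cart ?W" by (rule coprod_cart[OF sC fc])
  have \<iota>: "?\<iota> c \<in> Hom Q (fst c) ?W" if "c \<in> Cn" for c by (rule cmor_Hom) (use sC fc that in auto)
  have "\<exists>p. p \<in> Hom Q ?W (F i) \<and> (\<forall>c\<in>Cn. p \<bullet>\<^bsub>Q\<^esub> ?\<iota> c = snd c i)" if i: "i \<in> I" for i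
    using coprod_desc[where F = fst and \<kappa> = "\<lambda>c. snd c i", OF sC fc F[OF i]] sc[OF _ i] by blast
  then obtain p where p: "\<And>i. i \<in> I \<Longrightarrow> p i \<in> Hom Q ?W (F i)"
    and p\<iota>: "\<And>i c. i \<in> I \<Longrightarrow> c \<in> Cn \<Longrightarrow> p i \<bullet>\<^bsub>Q\<^esub> ?\<iota> c = snd c i" by metis
  \<comment> \<open>Submodules on which every projection vanishes. They form a small set, hence have
    a coproduct.\<close>
  define KK where "KK = {R \<in> extensional (Ob C). csub ?W R \<and> (\<forall>x\<in>Ob C. \<forall>v\<in>R x. \<forall>i\<in>I. app (p i) x v = \<zero>\<^bsub>msec (F i) x\<^esub>)}"
  have "KK \<subseteq> (\<Pi>\<^sub>E x\<in>Ob C. Pow (el ?W x))" using csub_props(1)[OF W] by (auto simp: KK_def PiE_def)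
  then have sK: "small TYPE('u) KK"
    by (rule small_subset[rotated]) (intro small_PiE small_Pow univ small_Ob cartD W)
  have cK: "csub ?W R" if "R \<in> KK" for R using that by (simp add: KK_def)
  have sub: "cart (subm ?W R)" if "R \<in> KK" for R by (rule subm_cart[OF W cK[OF that]])
  have "\<exists>k. k \<in> Hom Q (subm ?W R) ?W \<and> (\<forall>x\<in>Ob C. \<forall>v\<in>R x. app k x v = v)" if "R \<in> KK" for R
    by (rule sub_hom[OF W cK[OF that]]) blast
  then obtain k where k: "\<And>R. R \<in> KK \<Longrightarrow> k R \<in> Hom Q (subm ?W R) ?W"
    and kv: "\<And>R x v. R \<in> KK \<Longrightarrow> x \<in> Ob C \<Longrightarrow> v \<in> R x \<Longrightarrow> app (k R) x v = v" by metis
  let ?V = "coprod KK (subm ?W)" and ?\<epsilon> = "cmor KK (subm ?W)"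
  obtain z where z: "z \<in> Hom Q ?V ?W" and z\<epsilon>: "\<And>R. R \<in> KK \<Longrightarrow> z \<bullet>\<^bsub>Q\<^esub> ?\<epsilon> R = k R"
    using coprod_desc[where F = "subm ?W" and \<kappa> = k, OF sK sub W k] by blast
  have \<epsilon>: "?\<epsilon> R \<in> Hom Q (subm ?W R) ?V" if "R \<in> KK" for R by (rule cmor_Hom) (use sK sub that in auto)
  have V: "cart ?V" by (rule coprod_cart) (use sK sub in auto)
  \<comment> \<open>The sum of all members of \<open>KK\<close>, realised as the image of their
    coproduct. It contains each of them and is still killed by the projections.\<close>
  define Z where "Z x = app z x ` el ?V x" for x
  have cZ: "csub ?W Z" unfolding Z_def by (rule csub_hom_image[OF z])
  have KZ: "v \<in> Z x" if R: "R \<in> KK" and x: "x \<in> Ob C" and v: "v \<in> R x" for R x v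
  proof -
    have vR: "v \<in> el (subm ?W R) x" using v by simp
    have "app z x (app (?\<epsilon> R) x v) = v" using comp_app[OF \<epsilon>[OF R] z x vR] kv[OF R x v] by (simp add: z\<epsilon>[OF R])
    then show ?thesis unfolding Z_def using hom_closed[OF \<epsilon>[OF R] x vR] by force
  qed
  have pZ: "app (p i) x v = \<zero>\<^bsub>msec (F i) x\<^esub>" if i: "i \<in> I" and x: "x \<in> Ob C" and v: "v \<in> Z x" for i x v
  proof -
    have "p i \<bullet>\<^bsub>Q\<^esub> z = zhom ?V (F i)"
    proof (rule coprod_hom_eq[where F = "subm ?W", OF sK sub comp_Hom[OF z p[OF i]] zhom_Hom[OF V F[OF i]]])
      fix R assume R: "R \<in> KK"
      have "p i \<bullet>\<^bsub>Q\<^esub> k R = zhom (subm ?W R) (F i)"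
      proof (rule hom_eqI[OF comp_Hom[OF k[OF R] p[OF i]] zhom_Hom[OF sub[OF R] F[OF i]]])
        fix x v assume x: "x \<in> Ob C" and v: "v \<in> el (subm ?W R) x"
        then have "app (p i) x v = \<zero>\<^bsub>msec (F i) x\<^esub>" using R i by (simp add: KK_def)
        then show "app (p i \<bullet>\<^bsub>Q\<^esub> k R) x v = app (zhom (subm ?W R) (F i)) x v"
          using comp_app[OF k[OF R] p[OF i] x v] kv[OF R x] v zhom_app[OF x v] by simp
      qed
      then show "(p i \<bullet>\<^bsub>Q\<^esub> z) \<bullet>\<^bsub>Q\<^esub> ?\<epsilon> R = zhom ?V (F i) \<bullet>\<^bsub>Q\<^esub> ?\<epsilon> R"
        using comp_assoc[OF \<epsilon>[OF R] z p[OF i]] zhom_comp[OF \<epsilon>[OF R] F[OF i]] by (simp add: z\<epsilon>[OF R])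
    qed
    moreover obtain y where y: "y \<in> el ?V x" "v = app z x y" using v by (auto simp: Z_def)
    ultimately show ?thesis using comp_app[OF z p[OF i] x y(1)] zhom_app[OF x y(1)] by simp
  qed
  let ?E = "quotm ?W Z"
  obtain q where q: "q \<in> Hom Q ?W ?E" "onto ?E q"
    and qZ: "\<And>x v. x \<in> Ob C \<Longrightarrow> v \<in> el ?W x \<Longrightarrow> app q x v = \<zero>\<^bsub>msec ?E x\<^esub> \<longleftrightarrow> v \<in> Z x"
    by (rule quot_hom[OF W cZ]) blast
  note E = Hom_cart(2)[OF q(1)]
  have "\<exists>u\<in>Hom Q ?E (F i). u \<bullet>\<^bsub>Q\<^esub> q = p i" if i: "i \<in> I" for i
    by (rule factor_onto[OF q p[OF i]]) (use qZ pZ i in blast)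
  then obtain \<pi> where \<pi>: "\<And>i. i \<in> I \<Longrightarrow> \<pi> i \<in> Hom Q ?E (F i)" and \<pi>q: "\<And>i. i \<in> I \<Longrightarrow> \<pi> i \<bullet>\<^bsub>Q\<^esub> q = p i" by metis
  \<comment> \<open>Maps into the quotient are determined by their projections; this is what
    dividing by \<open>Z\<close> achieves.\<close>
  have sep: "u = u'" if u: "u \<in> Hom Q K ?E" and u': "u' \<in> Hom Q K ?E"
      and eq: "\<And>i. i \<in> I \<Longrightarrow> \<pi> i \<bullet>\<^bsub>Q\<^esub> u = \<pi> i \<bullet>\<^bsub>Q\<^esub> u'" for u u' K
  proof (rule hom_eqI[OF u u'])
    fix x y assume x: "x \<in> Ob C" and y: "y \<in> el K x"
    note d = hdiff_Hom[OF u u']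
    \<comment> \<open>The preimage in the coproduct of the image of u - u'. It is cartesian and
      killed by all projections, so it belongs to \<open>KK\<close> and lies in \<open>Z\<close>,
      which forces u - u' to vanish.\<close>
    let ?R = "\<lambda>x. {v \<in> el ?W x. app q x v \<in> app (hdiff u u') x ` el K x}"
    have cR: "csub ?W ?R" by (rule csub_preimage[OF q(1) csub_hom_image[OF d(1)]])
    have "app (p i) x v = \<zero>\<^bsub>msec (F i) x\<^esub>" if i: "i \<in> I" and x: "x \<in> Ob C" and v: "v \<in> ?R x" for i x v
    proof -
      obtain y where y: "y \<in> el K x" "app q x v = app (hdiff u u') x y" using v by blast
      note c = hom_closed[OF u x y(1)] and c' = hom_closed[OF u' x y(1)]
      have "app (p i) x v = app (\<pi> i) x (app q x v)"
        using comp_app[OF q(1) \<pi>[OF i] x] v by (simp add: \<pi>q[OF i])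
      also have "\<dots> = app (\<pi> i) x (app u x y) \<ominus>\<^bsub>msec (F i) x\<^esub> app (\<pi> i) x (app u' x y)"
        unfolding y(2) d(2)[OF x y(1)] by (rule hom_diff[OF \<pi>[OF i] x c c'])
      also have "\<dots> = \<zero>\<^bsub>msec (F i) x\<^esub>"
        using eq[OF i] comp_app[OF u \<pi>[OF i] x y(1)] comp_app[OF u' \<pi>[OF i] x y(1)]
          diff_zero[OF F[OF i] x hom_closed[OF \<pi>[OF i] x c] hom_closed[OF \<pi>[OF i] x c']] by simp
      finally show ?thesis .
    qed
    then have RK: "restrict ?R (Ob C) \<in> KK"
      unfolding KK_def using cR by (simp add: csub_restrict)
    have c: "app (hdiff u u') x y \<in> el ?E x" by (rule hom_closed[OF d(1) x y])
    obtain v where v: "v \<in> el ?W x" "app q x v = app (hdiff u u') x y" using ontoD[OF q(2,1) x c] by blast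
    have "v \<in> ?R x" using v y by simp
    then have "v \<in> Z x" using KZ[OF RK x] x by simp
    then have "app (hdiff u u') x y = \<zero>\<^bsub>msec ?E x\<^esub>" using qZ[OF x v(1)] v(2) by simp
    then show "app u x y = app u' x y"
      using d(2)[OF x y] diff_zero[OF E x hom_closed[OF u x y] hom_closed[OF u' x y]] by simp
  qed
  have "is_product Q I F ?E \<pi>"
    unfolding is_product_def
  proof (intro conjI ballI allI impI)
    show "?E \<in> Ob Q" using E by (simp add: Q_simps)
    show "\<pi> i \<in> Hom Q ?E (F i)" if "i \<in> I" for i by (rule \<pi>[OF that])
    fix K \<kappa> assume "K \<in> Ob Q" and \<kappa>': "\<forall>i\<in>I. \<kappa> i \<in> Hom Q K (F i)"
    then have K: "cart K" by (simp add: Q_simps)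
    have \<kappa>: "\<kappa> i \<in> Hom Q K (F i)" if "i \<in> I" for i using \<kappa>' that by blast
    \<comment> \<open>An arbitrary source of a cone is written as a colimit of representatives,
      since only cones from representatives occur in the coproduct.\<close>
    obtain J :: "'u set" and r G G' e where J: "small TYPE('u) J" "card_directed_poset l J r" "G ` J \<subseteq> reps"
      and fct: "is_functor (poset_category J r) Q G G'" and col: "is_colimit (poset_category J r) Q G G' K e"
      using colimit_of_reps[OF K] by blast
    note dir = card_directedD(1)[OF J(2)]
    note coc = colimit_cocone[OF fct dir col J(1)]
    note e = poset_cocone(2)[OF fct dir coc] and G' = poset_functor(2)[OF fct dir]
    have rJ: "a \<in> J" "b \<in> J" if "(a, b) \<in> r" for a b using directedD(1)[OF dir] that by auto
    \<comment> \<open>The cone restricted to the representative at j is one of the summands of the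
      coproduct, and its injection provides the map at stage j.\<close>
    define c where "c j = (G j, \<lambda>i\<in>I. \<kappa> i \<bullet>\<^bsub>Q\<^esub> e j)" for j
    have c: "c j \<in> Cn" if j: "j \<in> J" for j
      using J(3) j comp_Hom[OF e[OF j] \<kappa>] by (auto simp: c_def Cn_def)
    define u where "u j = q \<bullet>\<^bsub>Q\<^esub> ?\<iota> (c j)" for j
    have \<iota>c: "?\<iota> (c j) \<in> Hom Q (G j) ?W" if "j \<in> J" for j using \<iota>[OF c[OF that]] by (simp add: c_def)
    have u: "u j \<in> Hom Q (G j) ?E" if "j \<in> J" for j unfolding u_def by (rule comp_Hom[OF \<iota>c[OF that] q(1)])
    have \<pi>u: "\<pi> i \<bullet>\<^bsub>Q\<^esub> u j = \<kappa> i \<bullet>\<^bsub>Q\<^esub> e j" if i: "i \<in> I" and j: "j \<in> J" for i j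
      using comp_assoc[OF \<iota>c[OF j] q(1) \<pi>[OF i]] p\<iota>[OF i c[OF j]] i by (simp add: \<pi>q[OF i] u_def) (simp add: c_def)
    have "cocone (poset_category J r) Q G G' ?E u"
      unfolding cocone_def
    proof (intro conjI ballI)
      show "?E \<in> Ob Q" using E by (simp add: Q_simps)
      show "u j \<in> Hom Q (G j) ?E" if "j \<in> Ob (poset_category J r)" for j using u that by simp
      fix f assume "f \<in> Ar (poset_category J r)"
      then obtain a b where ab: "f = (a, b)" "(a, b) \<in> r" by (cases f) auto
      note abJ = rJ[OF ab(2)]
      have "e b \<bullet>\<^bsub>Q\<^esub> G' (a, b) = e a" using coc ab(2) by (force simp: cocone_def)
      \<comment> \<open>The summands for a and b are unrelated in the coproduct; compatibility
        arises only after passing to the quotient, where projections separate maps.\<close>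
      then have "u b \<bullet>\<^bsub>Q\<^esub> G' (a, b) = u a"
        using comp_assoc[OF G'[OF ab(2)] u[OF abJ(2)] \<pi>] comp_assoc[OF G'[OF ab(2)] e[OF abJ(2)] \<kappa>] abJ
        by (intro sep[OF comp_Hom[OF G'[OF ab(2)] u[OF abJ(2)]] u[OF abJ(1)]]) (simp add: \<pi>u)
      then show "u (tgt (poset_category J r) f) \<bullet>\<^bsub>Q\<^esub> G' f = u (src (poset_category J r) f)" by (simp add: ab)
    qed
    then obtain v where v: "v \<in> Hom Q K ?E" and ve: "\<And>j. j \<in> J \<Longrightarrow> v \<bullet>\<^bsub>Q\<^esub> e j = u j"
      using col unfolding is_colimit_def by (metis poset_category_simps(1))
    have v\<kappa>: "\<pi> i \<bullet>\<^bsub>Q\<^esub> v = \<kappa> i" if i: "i \<in> I" for i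
    proof (rule colimit_eq[OF fct dir col J(1) comp_Hom[OF v \<pi>[OF i]] \<kappa>[OF i]])
      fix j assume j: "j \<in> J"
      show "(\<pi> i \<bullet>\<^bsub>Q\<^esub> v) \<bullet>\<^bsub>Q\<^esub> e j = \<kappa> i \<bullet>\<^bsub>Q\<^esub> e j"
        using comp_assoc[OF e[OF j] v \<pi>[OF i]] by (simp add: ve[OF j] \<pi>u[OF i j])
    qed
    show "\<exists>!u. u \<in> Hom Q K ?E \<and> (\<forall>i\<in>I. \<pi> i \<bullet>\<^bsub>Q\<^esub> u = \<kappa> i)"
    proof (rule ex1I[of _ v])
      show "v \<in> Hom Q K ?E \<and> (\<forall>i\<in>I. \<pi> i \<bullet>\<^bsub>Q\<^esub> v = \<kappa> i)" using v v\<kappa> by blast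
      fix v' assume "v' \<in> Hom Q K ?E \<and> (\<forall>i\<in>I. \<pi> i \<bullet>\<^bsub>Q\<^esub> v' = \<kappa> i)"
      then show "v' = v" using v\<kappa> by (intro sep[OF _ v]) auto
    qed
  qed
  then show ?thesis by blast
qed

lemma has_products_Q: "has_products TYPE('u) Q"
  unfolding has_products_def using products by blast

lemma abelian_Q: "abelian_category Q"
  unfolding abelian_category_def
proof (intro conjI allI impI ballI category_Q preadditive_Q)
  show "\<exists>z. zero_object Q z" using zero_object_Q by blast
next
  fix F :: "bool \<Rightarrow> _" assume F: "F ` UNIV \<subseteq> Ob Q"
  \<comment> \<open>Binary products and coproducts are the general ones with \<open>bool\<close> as
    index set.\<close>
  have sm: "small TYPE('u) (UNIV :: bool set)" by (rule small_finite[OF univ]) simp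
  show "\<exists>P \<pi>. is_product Q UNIV F P \<pi>" by (rule products[OF sm F])
  show "\<exists>P \<iota>. is_coproduct Q UNIV F P \<iota>" by (rule coproducts[OF sm F])
next
  fix f assume "f \<in> Ar Q"
  then have f: "f \<in> Hom Q (src Q f) (tgt Q f)" by (simp add: Ar_Q)
  show "\<exists>k. is_kernel Q f k"
    by (rule kernel_exists[OF f]) (blast intro: is_kernelI[OF f])
  show "\<exists>c. is_cokernel Q f c"
    by (rule cokernel_exists[OF f]) (blast intro: is_cokernelI[OF f])
next
  fix f assume m: "monic Q f"
  then have f: "f \<in> Hom Q (src Q f) (tgt Q f)" by (simp add: Ar_Q[symmetric] monic_def)
  obtain N c where c: "c \<in> Hom Q (tgt Q f) N"
    "\<And>x. x \<in> Ob C \<Longrightarrow> {v \<in> el (tgt Q f) x. app c x v = \<zero>\<^bsub>msec N x\<^esub>} = app f x ` el (src Q f) x"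
    by (rule cokernel_exists[OF f]) blast
  \<comment> \<open>A monomorphism is the kernel of its cokernel, by comparison on elements.\<close>
  show "\<exists>g. is_kernel Q g f" using is_kernelI[OF c(1) f monic_into[OF f m] c(2)] by blast
next
  fix f assume m: "epic Q f"
  then have f: "f \<in> Hom Q (src Q f) (tgt Q f)" by (simp add: Ar_Q[symmetric] epic_def)
  obtain K k where k: "k \<in> Hom Q K (src Q f)"
    "\<And>x. x \<in> Ob C \<Longrightarrow> {v \<in> el (src Q f) x. app f x v = \<zero>\<^bsub>msec (tgt Q f) x\<^esub>} = app k x ` el K x"
    by (rule kernel_exists[OF f]) blast
  \<comment> \<open>An epimorphism is the cokernel of its kernel.\<close>
  show "\<exists>g. is_cokernel Q g f" using is_cokernelI[OF k(1) f epic_onto[OF f m] k(2)] by blast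
qed

lemma grothendieck_Q: "grothendieck_category TYPE('u) Q"
  unfolding grothendieck_category_def
  using abelian_Q locally_small_Q has_coproducts_Q exact_direct_limits_Q generator_Q by blast

end

text \<open>One infinite small set dominates the objects, the arrows and every ring of sections at
  once; \<open>l\<close> is a copy inside \<open>'u\<close> of the successor of its
  cardinality.\<close>

lemma (in qcoh) exists_bound: "\<exists>Y l. qcoh_bound C A Y l"
proof -
  let ?B = "Sum_Type.Plus (Ob C) (Sum_Type.Plus (Ar C) (\<Union>x\<in>Ob C. carrier (sec A x)))"
  have Pl: "Sum_Type.Plus S T = Inl ` S \<union> Inr ` T" for S :: "'x set" and T :: "'y set" by auto
  have "small TYPE('u) ?B"
    unfolding Pl by (intro small_Un small_image small_UN univ small_Ob small_Ar A_small)
  then obtain Y :: "'u set" where Y: "infinite Y" "small TYPE('u) Y" "|?B| \<le>o |Y|"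
    by (rule small_infinite_bound[OF univ])
  have le: "|S| \<le>o |Y|" if "inj_on f S" "f ` S \<subseteq> ?B" for f :: "_ \<Rightarrow> 'o + 'a + 'u" and S
    by (rule ordLeq_transitive[OF card_of_ordLeqI Y(3)]) (use that in auto)
  let ?c = "cardSuc |Y|"
  have Yc: "Card_order |Y|" "Cinfinite |Y|" using Y(1) by (auto simp: cinfinite_def Field_card_of card_of_Card_order)
  have co: "Card_order ?c" by (rule cardSuc_Card_order[OF Yc(1)])
  \<comment> \<open>The successor is at most the cardinality of the power set, which is small
    because the universe is closed under power sets.\<close>
  have "?c \<le>o |Pow Y|" by (rule cardSuc_least[OF Yc(1) card_of_Card_order card_of_Pow])
  moreover have "|Pow Y| <o |UNIV :: 'u set|" using small_Pow[OF univ Y(2)] by (simp add: small_def)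
  ultimately have cu: "?c <o |UNIV :: 'u set|" by (rule ordLeq_ordLess_trans)
  have fc: "|Field ?c| =o ?c" by (rule card_of_Field_ordIso[OF co])
  then have "|Field ?c| \<le>o |UNIV :: 'u set|" using cu ordIso_ordLess_trans ordLess_imp_ordLeq by blast
  \<comment> \<open>The successor cardinal is a relation on another type; being small, it has a copy
    carried by a set of elements of \<open>'u\<close>.\<close>
  then obtain Z :: "'u set" where "|Field ?c| =o |Z|" using internalize_card_of_ordLeq2[of "Field ?c" "UNIV :: 'u set"] by blast
  then have Z: "?c =o |Z|" using fc ordIso_symmetric ordIso_transitive by blast
  have "qcoh_bound C A Y |Z|"
  proof (unfold_locales)
    show "infinite Y" "small TYPE('u) Y" using Y by auto
    show "|Ob C| \<le>o |Y|" by (rule le[of Inl]) auto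
    show "|Ar C| \<le>o |Y|" by (rule le[of "\<lambda>f. Inr (Inl f)"]) (auto simp: inj_on_def)
    show "|carrier (sec A x)| \<le>o |Y|" if "x \<in> Ob C" for x
      by (rule le[of "\<lambda>f. Inr (Inr f)"]) (use that in \<open>auto simp: inj_on_def\<close>)
    show "|K| <o |Z| \<longleftrightarrow> |K| \<le>o |Y|" for K :: "'u set"
      using cardSuc_ordLeq_ordLess[OF Yc(1) card_of_Card_order[of K]] Z ordLess_ordIso_trans ordIso_symmetric by metis
    show "Cinfinite |Z|" by (rule Cinfinite_cong[OF Z Cinfinite_cardSuc[OF Yc(2)]])
    show "regularCard |Z|"
      by (rule regularCard_ordIso[OF Z Cinfinite_cardSuc[OF Yc(2)] regularCard_cardSuc[OF Yc(2)]])
    show "|Z| <o |UNIV :: 'u set|" by (rule ordIso_ordLess_trans[OF ordIso_symmetric[OF Z] cu])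
  qed
  then show ?thesis by blast
qed

lemma category_full_subcategory: "category D \<Longrightarrow> S \<subseteq> Ob D \<Longrightarrow> category (full_subcategory D S)"
  unfolding category_def full_subcategory_def Hom_def by (auto simp: subset_eq)

theorem corollary4p7:
  fixes \<E> C :: "('o, 'a) category"
    and \<O> A :: "('o, 'a, 'u) presheaf"
  assumes "universe TYPE('u)"
    and "algebraic_stack \<E> \<O>"
    and "small_skeleton TYPE('u) C (smooth_affines \<E> \<O>)"
    and "ring_sheaf C \<O> A"
    and "flat_presheaf C A"
  shows "grothendieck_category TYPE('u) (Qcoh C A) \<and>
         locally_presentable TYPE('u) (Qcoh C A) \<and>
         has_products TYPE('u) (Qcoh C A)"
proof -
  have "category \<E>"
    using assms(2) by (simp add: algebraic_stack_def stack_def fibred_in_groupoids_def)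
  then have "category (smooth_affines \<E> \<O>)"
    unfolding smooth_affines_def by (rule category_full_subcategory) (auto simp: smooth_object_def)
  \<comment> \<open>A skeleton is a full subcategory of the smooth affines, which are in turn a full
    subcategory of the stack.\<close>
  then have "category C"
    using assms(3) category_full_subcategory by (auto simp: small_skeleton_def)
  then have "qcoh C A"
    using assms by unfold_locales (auto simp: small_skeleton_def ring_sheaf_def)
  then obtain Y l where "qcoh_bound C A Y l" using qcoh.exists_bound by blast
  then interpret qcoh_bound C A Y l .
  show ?thesis using grothendieck_Q locally_presentable_Q has_products_Q by blast
qed

end
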